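(* Let $\Gamma$ be a finite group with irreducible characters $\gamma_0,\dots,\gamma_r$ and let $\xi=\gamma_0$ be the trivial character. The operators $X_n^+(\gamma_i)$, $X_n^-(\gamma_i)$ $(n\in\mathbb Z$, $0\le i\le r)$ on $R_\Gamma^-$ generate a generalized Clifford algebra: for all $n,n'\in\mathbb Z$ and $0\le i,j\le r$, $$[X_n^+(\gamma_i),X_{n'}^+(\gamma_j)]=[X_n^-(\gamma_i),X_{n'}^-(\gamma_j)]=[X_n^+(\gamma_i),X_{n'}^-(\gamma_j)]=0\quad(i\ne j),$$ $$\{X_n^+(\gamma_i),X_{n'}^+(\gamma_i)\}=2(-1)^n\delta_{n,-n'},\qquad \{X_n^-(\gamma_i),X_{n'}^-(\gamma_i)\}=2(-1)^n\delta_{n,-n'},$$ $$\{X_n^+(\gamma_i),X_{n'}^-(\gamma_i)\}=2\delta_{n,-n'},$$ where $\{A,B\}=AB+BA$.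
   Context: Groups. $\Gamma_*$ is the set of conjugacy classes of $\Gamma$, $R(\Gamma)$ the complex class functions. For $n\ge0$, $\widetilde S_n$ is the group generated by $z,t_1,\dots,t_{n-1}$ with relations $z^2=1$, $zt_i=t_iz$, $t_i^2=(t_it_{i+1})^3=z$, $t_it_j=zt_jt_i$ for $i>j+1$; it maps onto $S_n$ by $t_i\mapsto(i,i+1)$, $z\mapsto1$. It acts on $\Gamma^n$ through $S_n$ by $s(g_1,\dots,g_n)=(g_{s^{-1}(1)},\dots,g_{s^{-1}(n)})$, and $\widetilde\Gamma_n=\Gamma^n\rtimes\widetilde S_n$ with $(g,t)(h,s)=(g\,t(h),ts)$; $\Gamma_n=\Gamma\wr S_n=\widetilde\Gamma_n/\{1,z\}$. The parity is the homomorphism $d:\widetilde\Gamma_n\to\mathbb Z/2$ with $d(g,t_i)=1$, $d(g,z)=0$. Types. For a partition-valued function $\rho=(\rho(c))_{c\in\Gamma_*}$, $l(\rho)=\sum_cl(\rho(c))$ is the total number of parts. The type of $(g,\sigma)\in\Gamma_n$ is the $\rho$ obtained by letting each cycle $(i_1\cdots i_k)$ of $\sigma$ with $g_{i_k}\cdots g_{i_1}\in c$ contribute a part $k$ to $\rho(c)$. $\mathcal{OP}_n(\Gamma_* )$ is the set of $\rho$ with $\sum_c|\rho(c)|=n$ and all parts odd. Fix an order $c^0=\{1\},\dots,c^r$ of $\Gamma_*$. For $\rho\in\mathcal{OP}_n(\Gamma_* )$ cut $1,\dots,n$ into consecutive intervals whose lengths are the parts of $\rho(c^0)$ (decreasing),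 then of $\rho(c^1)$, etc.; $t^\rho$ is the product in this order of $t_at_{a+1}\cdots t_{b-1}$ over the intervals $\{a,\dots,b\}$ ($1$ if $a=b$). $D_\rho^+$ is the conjugacy class of $(g,t^\rho)$, where the cycle product of $g$ over each interval coming from $\rho(c^i)$ lies in $c^i$. Write $f(\rho)=f(D_\rho^+)$. The space. $R^-(\widetilde\Gamma_n)$ is the space of class functions $f$ on $\widetilde\Gamma_n$ with $f(zx)=-f(x)$ vanishing on odd elements (determined by the $f(\rho)$); $R_\Gamma^-=\bigoplus_{n\ge0}R^-(\widetilde\Gamma_n)$. Let $\widetilde\Gamma_n\hat\times\widetilde\Gamma_m\subset\widetilde\Gamma_{n+m}$ be the preimage of $\Gamma_n\times\Gamma_m$; its elements are products $xy$, $x\in\widetilde\Gamma_n$ (using $t_1,\dots,t_{n-1}$), $y\in\widetilde\Gamma_m$ (using $t_{n+1},\dots,t_{n+m-1}$). Let $\phi(f\otimes g)(xy)=f(x)g(y)$ if $x,y$ are both even and $0$ otherwise, an isomorphism onto the class functions on $\widetilde\Gamma_n\hat\times\widetilde\Gamma_m$ changing sign under $z$ and vanishing on odd elements. The product is $f\cdot g=\mathrm{Ind}\,\phi(f\otimes g)$ and $\Delta=\bigoplus\phi^{-1}\mathrm{Res}$. On $R^-(\widetilde\Gamma_n)$, $\langle f,g\rangle=\frac1{|\widetilde\Gamma_n|}\sum_xf(x)g(x^{-1})$ (the weighted form for $\xi=\gamma_0$). Operators. For $\gamma\in R(\Gamma)$, $\chi_n(\gamma)\in R^-(\widetilde\Gamma_n)$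 has values $\chi_n(\gamma)(\rho)=2^{(l(\rho)-\overline n)/2}\prod_c\gamma(c)^{l(\rho(c))}$, $\overline n\in\{0,1\}$ the parity of $n$. For $n\ge0$, $H_{-n}(\gamma)f=2^{\overline n/2}\chi_n(\gamma)\cdot f$; for $f\in R^-(\widetilde\Gamma_m)$, $H_n(\gamma)f$ is obtained by applying $\langle2^{\overline n/2}\chi_n(\gamma),\cdot\rangle$ to the first factor of the component of $\Delta f$ in $R^-(\widetilde\Gamma_n)\otimes R^-(\widetilde\Gamma_{m-n})$ (zero if $n>m$). $H_+(\gamma,z)=\sum_{n\ge0}H_{-n}(\gamma)z^n$, $H_-(\gamma,z)=\sum_{n\ge0}H_n(\gamma)z^{-n}$, and $X^{\pm}(\gamma,z)=\sum_{n\in\mathbb Z}X_n^\pm(\gamma)z^{-n}=H_+(\pm\gamma,z)H_-(\pm\gamma,-z)$. *)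

theory Defs
  imports
    Complex_Main
    "HOL-Library.Multiset"
    "HOL-Combinatorics.Transposition"
    "HOL-Algebra.Product_Groups"
    "Jordan_Normal_Form.Matrix"
    "Jordan_Normal_Form.VS_Connect"
begin

section \<open>Finite groups: class functions and irreducible characters\<close>

definition conj_class :: "('a, 'b) monoid_scheme \<Rightarrow> 'a \<Rightarrow> 'a set" where
  "conj_class K x = {y \<otimes>\<^bsub>K\<^esub> x \<otimes>\<^bsub>K\<^esub> inv\<^bsub>K\<^esub> y | y. y \<in> carrier K}"

definition conj_classes :: "('a, 'b) monoid_scheme \<Rightarrow> 'a set set" where
  "conj_classes K = conj_class K ` carrier K"

text \<open>Functions on a group are functions on the whole type that vanish outside the carrier.\<close>

definition class_functions :: "('a, 'b) monoid_scheme \<Rightarrow> ('a \<Rightarrow> complex) set" where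
  "class_functions K = {f.
     (\<forall>x\<in>carrier K. \<forall>y\<in>carrier K. f (y \<otimes>\<^bsub>K\<^esub> x \<otimes>\<^bsub>K\<^esub> inv\<^bsub>K\<^esub> y) = f x) \<and>
     (\<forall>x. x \<notin> carrier K \<longrightarrow> f x = 0)}"

text \<open>A \<open>d\<close>-dimensional complex representation is a homomorphism to \<open>GL\<^sub>d\<close>, the group of
  units of the ring of complex \<open>d \<times> d\<close> matrices.\<close>

definition is_rep :: "('a, 'b) monoid_scheme \<Rightarrow> nat \<Rightarrow> ('a \<Rightarrow> complex mat) \<Rightarrow> bool" where
  "is_rep G d \<pi> \<longleftrightarrow> \<pi> \<in> hom G (units_of (ring_mat TYPE(complex) d ()))"

definition irreducible_rep :: "('a, 'b) monoid_scheme \<Rightarrow> nat \<Rightarrow> ('a \<Rightarrow> complex mat) \<Rightarrow> bool" where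
  "irreducible_rep G d \<pi> \<longleftrightarrow> is_rep G d \<pi> \<and> d > 0 \<and>
     (\<forall>W. subspace class_ring W (module_vec TYPE(complex) d) \<and>
          (\<forall>x\<in>carrier G. \<forall>w\<in>W. \<pi> x *\<^sub>v w \<in> W)
        \<longrightarrow> W = {0\<^sub>v d} \<or> W = carrier_vec d)"

definition rep_character ::
  "('a, 'b) monoid_scheme \<Rightarrow> nat \<Rightarrow> ('a \<Rightarrow> complex mat) \<Rightarrow> 'a \<Rightarrow> complex" where
  "rep_character G d \<pi> = (\<lambda>x. if x \<in> carrier G then \<Sum>i<d. \<pi> x $$ (i, i) else 0)"

definition irr_chars :: "('a, 'b) monoid_scheme \<Rightarrow> ('a \<Rightarrow> complex) set" where
  "irr_chars G = {rep_character G d \<pi> | d \<pi>. irreducible_rep G d \<pi>}"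

definition trivial_char :: "('a, 'b) monoid_scheme \<Rightarrow> 'a \<Rightarrow> complex" where
  "trivial_char G = (\<lambda>x. if x \<in> carrier G then 1 else 0)"

definition class_order :: "('a, 'b) monoid_scheme \<Rightarrow> (nat \<Rightarrow> 'a set) \<Rightarrow> nat \<Rightarrow> bool" where
  "class_order G c r \<longleftrightarrow> bij_betw c {0..r} (conj_classes G) \<and> c 0 = {\<one>\<^bsub>G\<^esub>}"

definition induce :: "('a, 'b) monoid_scheme \<Rightarrow> 'a set \<Rightarrow> ('a \<Rightarrow> complex) \<Rightarrow> 'a \<Rightarrow> complex" where
  "induce K H f = (\<lambda>x. if x \<in> carrier K then
     (\<Sum>u\<in>carrier K. if inv\<^bsub>K\<^esub> u \<otimes>\<^bsub>K\<^esub> x \<otimes>\<^bsub>K\<^esub> u \<in> H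
        then f (inv\<^bsub>K\<^esub> u \<otimes>\<^bsub>K\<^esub> x \<otimes>\<^bsub>K\<^esub> u) else 0) / of_nat (card H) else 0)"

definition restrict_to :: "'a set \<Rightarrow> ('a \<Rightarrow> complex) \<Rightarrow> 'a \<Rightarrow> complex" where
  "restrict_to H f = (\<lambda>x. if x \<in> H then f x else 0)"


section \<open>Groups given by generators and relations\<close>

text \<open>A letter \<open>(x, False)\<close> stands for the generator \<open>x\<close> and \<open>(x, True)\<close> for its inverse.\<close>

type_synonym 'x gword = "('x \<times> bool) list"

definition gwords :: "'x set \<Rightarrow> 'x gword set" where
  "gwords X = lists (X \<times> UNIV)"

inductive word_cong :: "'x set \<Rightarrow> ('x gword \<times> 'x gword) set \<Rightarrow> 'x gword \<Rightarrow> 'x gword \<Rightarrow> bool"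
  for X R where
  refl: "u \<in> gwords X \<Longrightarrow> word_cong X R u u"
| sym: "word_cong X R u v \<Longrightarrow> word_cong X R v u"
| trans: "word_cong X R u v \<Longrightarrow> word_cong X R v w \<Longrightarrow> word_cong X R u w"
| cancel: "u \<in> gwords X \<Longrightarrow> v \<in> gwords X \<Longrightarrow> x \<in> X \<Longrightarrow>
    word_cong X R (u @ [(x, b), (x, \<not> b)] @ v) (u @ v)"
| rel: "u \<in> gwords X \<Longrightarrow> v \<in> gwords X \<Longrightarrow> (l, m) \<in> R \<Longrightarrow> l \<in> gwords X \<Longrightarrow> m \<in> gwords X \<Longrightarrow>
    word_cong X R (u @ l @ v) (u @ m @ v)"

definition word_class :: "'x set \<Rightarrow> ('x gword \<times> 'x gword) set \<Rightarrow> 'x gword \<Rightarrow> 'x gword set" where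
  "word_class X R u = {v. word_cong X R u v}"

definition presented_group :: "'x set \<Rightarrow> ('x gword \<times> 'x gword) set \<Rightarrow> 'x gword set monoid" where
  "presented_group X R = \<lparr>
     carrier = word_class X R ` gwords X,
     mult = (\<lambda>A B. \<Union>a\<in>A. \<Union>b\<in>B. word_class X R (a @ b)),
     one = word_class X R [] \<rparr>"


section \<open>The groups \<open>\<widetilde>S\<^sub>n\<close> and \<open>\<widetilde>\<Gamma>\<^sub>n\<close>\<close>

datatype spin_gen = Z | T nat

abbreviation lz :: "spin_gen \<times> bool" where "lz \<equiv> (Z, False)"
abbreviation lt :: "nat \<Rightarrow> spin_gen \<times> bool" where "lt i \<equiv> (T i, False)"

definition spin_gens :: "nat \<Rightarrow> spin_gen set" where
  "spin_gens n = insert Z (T ` {1..<n})"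

definition spin_rels :: "nat \<Rightarrow> (spin_gen gword \<times> spin_gen gword) set" where
  "spin_rels n =
     {([lz, lz], [])} \<union>
     {([lz, lt i], [lt i, lz]) | i. i \<in> {1..<n}} \<union>
     {([lt i, lt i], [lz]) | i. i \<in> {1..<n}} \<union>
     {([lt i, lt (i + 1), lt i, lt (i + 1), lt i, lt (i + 1)], [lz]) | i.
        i \<in> {1..<n} \<and> i + 1 \<in> {1..<n}} \<union>
     {([lt i, lt j], [lz, lt j, lt i]) | i j. i \<in> {1..<n} \<and> j \<in> {1..<n} \<and> i > j + 1}"

definition spin_class :: "nat \<Rightarrow> spin_gen gword \<Rightarrow> spin_gen gword set" where
  "spin_class n = word_class (spin_gens n) (spin_rels n)"

definition spin_group :: "nat \<Rightarrow> spin_gen gword set monoid" where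
  "spin_group n = presented_group (spin_gens n) (spin_rels n)"

text \<open>The map to the symmetric group. Permutations are functions, composed from right to left, so
  \<open>t\<^sub>a t\<^sub>a\<^sub>+\<^sub>1 \<dots> t\<^sub>b\<^sub>-\<^sub>1\<close> goes to the cycle \<open>a \<mapsto> a + 1 \<mapsto> \<dots> \<mapsto> b \<mapsto> a\<close>, and the action on \<open>\<Gamma>\<^sup>n\<close> below
  is a left action. Both this map and the parity are constant on the elements of the group, which
  are classes of words.\<close>

fun gen_perm :: "spin_gen \<Rightarrow> nat \<Rightarrow> nat" where
  "gen_perm Z = id"
| "gen_perm (T i) = Transposition.transpose i (i + 1)"

definition word_perm :: "spin_gen gword \<Rightarrow> nat \<Rightarrow> nat" where
  "word_perm w = foldr (\<lambda>(x, _) p. gen_perm x \<circ> p) w id"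

definition spin_perm :: "spin_gen gword set \<Rightarrow> nat \<Rightarrow> nat" where
  "spin_perm t = the_elem (word_perm ` t)"

definition word_parity :: "spin_gen gword \<Rightarrow> nat" where
  "word_parity w = length (filter (\<lambda>(x, _). x \<noteq> Z) w) mod 2"

definition spin_parity :: "spin_gen gword set \<Rightarrow> nat" where
  "spin_parity t = the_elem (word_parity ` t)"

type_synonym 'a welt = "(nat \<Rightarrow> 'a) \<times> spin_gen gword set"

definition base_group :: "('a, 'b) monoid_scheme \<Rightarrow> nat \<Rightarrow> (nat \<Rightarrow> 'a) monoid" where
  "base_group G n = product_group {1..n} (\<lambda>_. G)"

definition perm_act :: "nat \<Rightarrow> (nat \<Rightarrow> nat) \<Rightarrow> (nat \<Rightarrow> 'a) \<Rightarrow> nat \<Rightarrow> 'a" where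
  "perm_act n s g = (\<lambda>i\<in>{1..n}. g (inv_into UNIV s i))"

definition wreath :: "('a, 'b) monoid_scheme \<Rightarrow> nat \<Rightarrow> 'a welt monoid" where
  "wreath G n = \<lparr>
     carrier = carrier (base_group G n) \<times> carrier (spin_group n),
     mult = (\<lambda>(g, t) (h, s).
       (g \<otimes>\<^bsub>base_group G n\<^esub> perm_act n (spin_perm t) h, t \<otimes>\<^bsub>spin_group n\<^esub> s)),
     one = (\<one>\<^bsub>base_group G n\<^esub>, \<one>\<^bsub>spin_group n\<^esub>) \<rparr>"

definition zelt :: "('a, 'b) monoid_scheme \<Rightarrow> nat \<Rightarrow> 'a welt" where
  "zelt G n = (\<one>\<^bsub>base_group G n\<^esub>, spin_class n [lz])"

definition even_elts :: "('a, 'b) monoid_scheme \<Rightarrow> nat \<Rightarrow> 'a welt set" where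
  "even_elts G n = {x \<in> carrier (wreath G n). spin_parity (snd x) = 0}"


section \<open>The classes \<open>D\<^sub>\<rho>\<^sup>+\<close>\<close>

text \<open>A partition is the multiset of its parts. Oddness of the parts implies that they are
  positive.\<close>

definition odd_partitions :: "('a, 'b) monoid_scheme \<Rightarrow> nat \<Rightarrow> ('a set \<Rightarrow> nat multiset) set" where
  "odd_partitions G n = {\<rho>.
     (\<forall>C. C \<notin> conj_classes G \<longrightarrow> \<rho> C = {#}) \<and>
     (\<forall>C\<in>conj_classes G. \<forall>k\<in>#\<rho> C. odd k) \<and>
     (\<Sum>C\<in>conj_classes G. \<Sum>\<^sub># (\<rho> C)) = n}"

definition total_length :: "('a, 'b) monoid_scheme \<Rightarrow> ('a set \<Rightarrow> nat multiset) \<Rightarrow> nat" where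
  "total_length G \<rho> = (\<Sum>C\<in>conj_classes G. size (\<rho> C))"

definition type_parts ::
  "(nat \<Rightarrow> 'a set) \<Rightarrow> nat \<Rightarrow> ('a set \<Rightarrow> nat multiset) \<Rightarrow> ('a set \<times> nat) list" where
  "type_parts c r \<rho> =
     concat (map (\<lambda>i. map (Pair (c i)) (rev (sorted_list_of_multiset (\<rho> (c i))))) [0..<r + 1])"

text \<open>The consecutive intervals, from \<open>a\<close> on, with lengths the given parts: a triple \<open>(C, a, k)\<close>
  stands for the interval \<open>{a, \<dots>, a + k - 1}\<close>, coming from the class \<open>C\<close>.\<close>

fun intervals_from :: "nat \<Rightarrow> ('a set \<times> nat) list \<Rightarrow> ('a set \<times> nat \<times> nat) list" where
  "intervals_from a [] = []"
| "intervals_from a ((C, k) # ps) = (C, a, k) # intervals_from (a + k) ps"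

definition type_intervals ::
  "(nat \<Rightarrow> 'a set) \<Rightarrow> nat \<Rightarrow> ('a set \<Rightarrow> nat multiset) \<Rightarrow> ('a set \<times> nat \<times> nat) list" where
  "type_intervals c r \<rho> = intervals_from 1 (type_parts c r \<rho>)"

definition t_word ::
  "(nat \<Rightarrow> 'a set) \<Rightarrow> nat \<Rightarrow> ('a set \<Rightarrow> nat multiset) \<Rightarrow> spin_gen gword" where
  "t_word c r \<rho> = concat (map (\<lambda>(C, a, k). map lt [a..<a + k - 1]) (type_intervals c r \<rho>))"

text \<open>\<open>cycle_prod G g a k\<close> is \<open>g (a + k - 1) \<cdots> g (a + 1) g a\<close>, the cycle product over the cycle
  \<open>(a, a + 1, \<dots>, a + k - 1)\<close>.\<close>

primrec cycle_prod :: "('a, 'b) monoid_scheme \<Rightarrow> (nat \<Rightarrow> 'a) \<Rightarrow> nat \<Rightarrow> nat \<Rightarrow> 'a" where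
  "cycle_prod G g a 0 = \<one>\<^bsub>G\<^esub>"
| "cycle_prod G g a (Suc k) = g (a + k) \<otimes>\<^bsub>G\<^esub> cycle_prod G g a k"

text \<open>All \<open>(g, t\<^sup>\<rho>)\<close> with cycle products in the prescribed classes are conjugate, so the following
  union over \<open>g\<close> is a single conjugacy class.\<close>

definition D_plus ::
  "('a, 'b) monoid_scheme \<Rightarrow> (nat \<Rightarrow> 'a set) \<Rightarrow> nat \<Rightarrow> nat \<Rightarrow> ('a set \<Rightarrow> nat multiset) \<Rightarrow> 'a welt set"
where
  "D_plus G c r n \<rho> =
     (\<Union>g\<in>{g \<in> carrier (base_group G n).
              \<forall>(C, a, k)\<in>set (type_intervals c r \<rho>). cycle_prod G g a k \<in> C}.
        conj_class (wreath G n) (g, spin_class n (t_word c r \<rho>)))"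


section \<open>The space \<open>R\<^sub>\<Gamma>\<^sup>-\<close>\<close>

definition R_minus :: "('a, 'b) monoid_scheme \<Rightarrow> nat \<Rightarrow> ('a welt \<Rightarrow> complex) set" where
  "R_minus G n = {f \<in> class_functions (wreath G n).
     (\<forall>x\<in>carrier (wreath G n). f (zelt G n \<otimes>\<^bsub>wreath G n\<^esub> x) = - f x) \<and>
     (\<forall>x\<in>carrier (wreath G n). x \<notin> even_elts G n \<longrightarrow> f x = 0)}"

text \<open>An element of the direct sum is the family of its components.\<close>

type_synonym 'a wfam = "nat \<Rightarrow> 'a welt \<Rightarrow> complex"

definition R_Gamma :: "('a, 'b) monoid_scheme \<Rightarrow> 'a wfam set" where
  "R_Gamma G = {F. (\<forall>n. F n \<in> R_minus G n) \<and> finite {n. F n \<noteq> (\<lambda>_. 0)}}"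

definition pairing ::
  "('a, 'b) monoid_scheme \<Rightarrow> nat \<Rightarrow> ('a welt \<Rightarrow> complex) \<Rightarrow> ('a welt \<Rightarrow> complex) \<Rightarrow> complex" where
  "pairing G n f g =
     (\<Sum>x\<in>carrier (wreath G n). f x * g (inv\<^bsub>wreath G n\<^esub> x)) / of_nat (card (carrier (wreath G n)))"

text \<open>The preimage of \<open>\<Gamma>\<^sub>n \<times> \<Gamma>\<^sub>m\<close> in \<open>\<widetilde>\<Gamma>\<^sub>n\<^sub>+\<^sub>m\<close>, and the maps of \<open>\<widetilde>\<Gamma>\<^sub>n\<close> and \<open>\<widetilde>\<Gamma>\<^sub>m\<close> into it, which
  send \<open>t\<^sub>i\<close> to \<open>t\<^sub>i\<close> and to \<open>t\<^sub>n\<^sub>+\<^sub>i\<close>, respectively.\<close>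

definition young :: "('a, 'b) monoid_scheme \<Rightarrow> nat \<Rightarrow> nat \<Rightarrow> 'a welt set" where
  "young G n m = {x \<in> carrier (wreath G (n + m)). spin_perm (snd x) ` {1..n} = {1..n}}"

fun shift_gen :: "nat \<Rightarrow> spin_gen \<Rightarrow> spin_gen" where
  "shift_gen n Z = Z"
| "shift_gen n (T i) = T (n + i)"

definition emb_left :: "('a, 'b) monoid_scheme \<Rightarrow> nat \<Rightarrow> nat \<Rightarrow> 'a welt \<Rightarrow> 'a welt" where
  "emb_left G n m = (\<lambda>(g, t).
     (\<lambda>i\<in>{1..n + m}. if i \<le> n then g i else \<one>\<^bsub>G\<^esub>, \<Union>w\<in>t. spin_class (n + m) w))"

definition emb_right :: "('a, 'b) monoid_scheme \<Rightarrow> nat \<Rightarrow> nat \<Rightarrow> 'a welt \<Rightarrow> 'a welt" where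
  "emb_right G n m = (\<lambda>(g, t).
     (\<lambda>i\<in>{1..n + m}. if i \<le> n then \<one>\<^bsub>G\<^esub> else g (i - n),
      \<Union>w\<in>t. spin_class (n + m) (map (map_prod (shift_gen n) id) w)))"

definition young_mult ::
  "('a, 'b) monoid_scheme \<Rightarrow> nat \<Rightarrow> nat \<Rightarrow> 'a welt \<Rightarrow> 'a welt \<Rightarrow> 'a welt" where
  "young_mult G n m x y = emb_left G n m x \<otimes>\<^bsub>wreath G (n + m)\<^esub> emb_right G n m y"

text \<open>The tensor product \<open>R\<^sup>-(\<widetilde>\<Gamma>\<^sub>n) \<otimes> R\<^sup>-(\<widetilde>\<Gamma>\<^sub>m)\<close>, with \<open>f \<otimes> g\<close> realised as the function
  \<open>(x, y) \<mapsto> f x * g y\<close>.\<close>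

definition tensor ::
  "('a, 'b) monoid_scheme \<Rightarrow> nat \<Rightarrow> nat \<Rightarrow> ('a welt \<Rightarrow> 'a welt \<Rightarrow> complex) set" where
  "tensor G n m = {\<lambda>x y. \<Sum>i<k. f i x * g i y | (k::nat) f g.
     (\<forall>i<k. f i \<in> R_minus G n \<and> g i \<in> R_minus G m)}"

text \<open>An element of the subgroup is a product \<open>xy\<close> in two ways, the other one being \<open>(zx)(zy)\<close>;
  an element of the tensor product has the same value at both.\<close>

definition phi ::
  "('a, 'b) monoid_scheme \<Rightarrow> nat \<Rightarrow> nat \<Rightarrow> ('a welt \<Rightarrow> 'a welt \<Rightarrow> complex) \<Rightarrow> 'a welt \<Rightarrow> complex"
where
  "phi G n m F = (\<lambda>u.
     if \<exists>x\<in>even_elts G n. \<exists>y\<in>even_elts G m. u = young_mult G n m x y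
     then THE v. \<exists>x\<in>even_elts G n. \<exists>y\<in>even_elts G m. u = young_mult G n m x y \<and> v = F x y
     else 0)"

text \<open>The product \<open>R\<^sup>-(\<widetilde>\<Gamma>\<^sub>n) \<times> R\<^sup>-(\<widetilde>\<Gamma>\<^sub>m) \<rightarrow> R\<^sup>-(\<widetilde>\<Gamma>\<^sub>n\<^sub>+\<^sub>m)\<close> and the component
  \<open>R\<^sup>-(\<widetilde>\<Gamma>\<^sub>n\<^sub>+\<^sub>m) \<rightarrow> R\<^sup>-(\<widetilde>\<Gamma>\<^sub>n) \<otimes> R\<^sup>-(\<widetilde>\<Gamma>\<^sub>m)\<close> of the coproduct.\<close>

definition R_mult ::
  "('a, 'b) monoid_scheme \<Rightarrow> nat \<Rightarrow> nat \<Rightarrow> ('a welt \<Rightarrow> complex) \<Rightarrow> ('a welt \<Rightarrow> complex)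
    \<Rightarrow> 'a welt \<Rightarrow> complex" where
  "R_mult G n m f g = induce (wreath G (n + m)) (young G n m) (phi G n m (\<lambda>x y. f x * g y))"

definition R_comult ::
  "('a, 'b) monoid_scheme \<Rightarrow> nat \<Rightarrow> nat \<Rightarrow> ('a welt \<Rightarrow> complex) \<Rightarrow> 'a welt \<Rightarrow> 'a welt \<Rightarrow> complex"
where
  "R_comult G n m f = inv_into (tensor G n m) (phi G n m) (restrict_to (young G n m) f)"


section \<open>The operators\<close>

definition class_value :: "('a \<Rightarrow> complex) \<Rightarrow> 'a set \<Rightarrow> complex" where
  "class_value \<gamma> C = the_elem (\<gamma> ` C)"

definition chi ::
  "('a, 'b) monoid_scheme \<Rightarrow> (nat \<Rightarrow> 'a set) \<Rightarrow> nat \<Rightarrow> nat \<Rightarrow> ('a \<Rightarrow> complex) \<Rightarrow> 'a welt \<Rightarrow> complex"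
where
  "chi G c r n \<gamma> = (THE f. f \<in> R_minus G n \<and>
     (\<forall>\<rho>\<in>odd_partitions G n. \<forall>x\<in>D_plus G c r n \<rho>.
        f x = of_real (2 powr ((real (total_length G \<rho>) - real (n mod 2)) / 2)) *
              (\<Prod>C\<in>conj_classes G. class_value \<gamma> C ^ size (\<rho> C))))"

definition scaled_chi ::
  "('a, 'b) monoid_scheme \<Rightarrow> (nat \<Rightarrow> 'a set) \<Rightarrow> nat \<Rightarrow> nat \<Rightarrow> ('a \<Rightarrow> complex) \<Rightarrow> 'a welt \<Rightarrow> complex"
where
  "scaled_chi G c r n \<gamma> = (\<lambda>x. of_real (2 powr (real (n mod 2) / 2)) * chi G c r n \<gamma> x)"

text \<open>\<open>H_create\<close> is \<open>H\<^sub>-\<^sub>n(\<gamma>)\<close> and \<open>H_annih\<close> is \<open>H\<^sub>n(\<gamma>)\<close>, for \<open>n \<ge> 0\<close>.\<close>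

definition H_create ::
  "('a, 'b) monoid_scheme \<Rightarrow> (nat \<Rightarrow> 'a set) \<Rightarrow> nat \<Rightarrow> ('a \<Rightarrow> complex) \<Rightarrow> nat \<Rightarrow> 'a wfam \<Rightarrow> 'a wfam"
where
  "H_create G c r \<gamma> n F = (\<lambda>p.
     if n \<le> p then R_mult G n (p - n) (scaled_chi G c r n \<gamma>) (F (p - n)) else (\<lambda>_. 0))"

definition H_annih ::
  "('a, 'b) monoid_scheme \<Rightarrow> (nat \<Rightarrow> 'a set) \<Rightarrow> nat \<Rightarrow> ('a \<Rightarrow> complex) \<Rightarrow> nat \<Rightarrow> 'a wfam \<Rightarrow> 'a wfam"
where
  "H_annih G c r \<gamma> n F = (\<lambda>p y.
     pairing G n (scaled_chi G c r n \<gamma>) (\<lambda>x. R_comult G n p (F (n + p)) x y))"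

text \<open>The coefficient of \<open>z\<^sup>-\<^sup>n\<close> in \<open>H\<^sub>+(\<gamma>, z) H\<^sub>-(\<gamma>, -z)\<close> is the sum of
  \<open>(-1)\<^sup>k H\<^sub>-\<^sub>(\<^sub>k\<^sub>-\<^sub>n\<^sub>)(\<gamma>) H\<^sub>k(\<gamma>)\<close> over all \<open>k \<ge> 0\<close> with \<open>k - n \<ge> 0\<close>. On a given element of \<open>R\<^sub>\<Gamma>\<^sup>-\<close>
  only finitely many of the \<open>H\<^sub>k(\<gamma>)\<close> are nonzero.\<close>

definition X_coeff ::
  "('a, 'b) monoid_scheme \<Rightarrow> (nat \<Rightarrow> 'a set) \<Rightarrow> nat \<Rightarrow> ('a \<Rightarrow> complex) \<Rightarrow> int \<Rightarrow> 'a wfam \<Rightarrow> 'a wfam"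
where
  "X_coeff G c r \<gamma> n F = (\<lambda>p x.
     \<Sum>k | n \<le> int k \<and> H_annih G c r \<gamma> k F \<noteq> (\<lambda>_ _. 0).
       (-1) ^ k * H_create G c r \<gamma> (nat (int k - n)) (H_annih G c r \<gamma> k F) p x)"

definition X_plus ::
  "('a, 'b) monoid_scheme \<Rightarrow> (nat \<Rightarrow> 'a set) \<Rightarrow> nat \<Rightarrow> ('a \<Rightarrow> complex) \<Rightarrow> int \<Rightarrow> 'a wfam \<Rightarrow> 'a wfam"
where
  "X_plus G c r \<gamma> n = X_coeff G c r \<gamma> n"

definition X_minus ::
  "('a, 'b) monoid_scheme \<Rightarrow> (nat \<Rightarrow> 'a set) \<Rightarrow> nat \<Rightarrow> ('a \<Rightarrow> complex) \<Rightarrow> int \<Rightarrow> 'a wfam \<Rightarrow> 'a wfam"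
where
  "X_minus G c r \<gamma> n = X_coeff G c r (\<lambda>x. - \<gamma> x) n"

definition linear_operator :: "('a, 'b) monoid_scheme \<Rightarrow> ('a wfam \<Rightarrow> 'a wfam) \<Rightarrow> bool" where
  "linear_operator G A \<longleftrightarrow> A \<in> R_Gamma G \<rightarrow> R_Gamma G \<and>
     (\<forall>F\<in>R_Gamma G. \<forall>E\<in>R_Gamma G. \<forall>a b.
        A (\<lambda>p x. a * F p x + b * E p x) = (\<lambda>p x. a * A F p x + b * A E p x))"

definition commutator :: "('a wfam \<Rightarrow> 'a wfam) \<Rightarrow> ('a wfam \<Rightarrow> 'a wfam) \<Rightarrow> 'a wfam \<Rightarrow> 'a wfam" where
  "commutator A B F = (\<lambda>p x. A (B F) p x - B (A F) p x)"

definition anticommutator :: "('a wfam \<Rightarrow> 'a wfam) \<Rightarrow> ('a wfam \<Rightarrow> 'a wfam) \<Rightarrow> 'a wfam \<Rightarrow> 'a wfam" where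
  "anticommutator A B F = (\<lambda>p x. A (B F) p x + B (A F) p x)"

definition is_scalar_on :: "('a, 'b) monoid_scheme \<Rightarrow> ('a wfam \<Rightarrow> 'a wfam) \<Rightarrow> complex \<Rightarrow> bool" where
  "is_scalar_on G A s \<longleftrightarrow> (\<forall>F\<in>R_Gamma G. A F = (\<lambda>p x. s * F p x))"

end

theory Submission
 imports Defs "HOL-Combinatorics.Cycles" "HOL-Library.Function_Algebras" "Jordan_Normal_Form.Spectral_Radius"
begin

text \<open>
 A function in \<open>R\<^sup>-\<close> is determined by its values on the elements of odd order of the spin cover: an
 even element whose permutation has a cycle of even length is conjugate to its product with the
 central element. An element of \<open>\<Gamma>\<^sub>n\<close> whose permutation has odd order has exactly one lift whose
 spin part has odd order, so \<open>R\<^sub>\<Gamma>\<^sup>-\<close> becomes a space of isomorphism-invariant functions of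
 permutations of finite sets decorated by elements of \<open>\<Gamma>\<close>. There \<open>H\<^sub>-\<^sub>n(\<gamma>)\<close> sums over the invariant
 subsets of size \<open>n\<close> and \<open>H\<^sub>n(\<gamma>)\<close> averages over \<open>n\<close> fresh points, both weighted by a function that
 is multiplicative over cycles and vanishes in the presence of even ones. Averaging over the
 permutations of a set is governed by averages over single cycles, where the orthogonality of
 characters enters; this gives \<open>H\<^sub>n(\<gamma>) H\<^sub>-\<^sub>m(\<gamma>) = \<Sum>\<^sub>a c\<^sub>a H\<^sub>a\<^sub>-\<^sub>m(\<gamma>) H\<^sub>n\<^sub>-\<^sub>a(\<gamma>)\<close> with \<open>c\<^sub>0 = 1\<close> and
  \<open>c\<^sub>a = 2\<close> for \<open>a > 0\<close>, the expansion of \<open>(1 + t) / (1 - t)\<close>. Together with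
  \<open>H\<^sub>\<plusminus>(\<gamma>, z) H\<^sub>\<plusminus>(\<gamma>, -z) = 1\<close> these relations formally imply those of the Clifford algebra.
\<close>

text \<open>Lifts of odd order are preferred to the elements given by \<open>t_word\<close> because
  they need no bookkeeping of signs: conjugates, inverses and Young products of such lifts are again
  such lifts, and no permutation has two of them. Uniqueness needs z to be nontrivial in the
  presented group, which cannot be read off from the relations; hence the Clifford representation.
  The price is that \<open>chi\<close> is prescribed on \<open>t_word\<close>, which differs from
  the odd-order lift by an unknown sign for every cycle length. Both weights in a pairing carry the
  same sign, so only its square survives. The extra factor in \<open>scaled_chi\<close> cancels the
  part of \<open>chi\<close> that is not multiplicative and leaves sqrt 2 per cycle. A permutation
  of a points is a cycle with probability 1/a, so an odd cycle contributes 2/a times an inner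
  product of characters, and the exponential of 2(t + t^3/3 + t^5/5 + ...) is (1 + t)/(1 - t).
  Replacing gamma by -gamma multiplies the weight on n points by (-1)^n, all cycles being odd; so
  the operators X^- are those of X^+ up to sign.\<close>

abbreviation Sp :: "nat => spin_gen gword set monoid" where
 "Sp \<equiv> spin_group"

section \<open>Words and the Clifford representation of the spin group\<close>

lemma gwords_append [simp]: "u @ v \<in> gwords X \<longleftrightarrow> u \<in> gwords X \<and> v \<in> gwords X"
 by (auto simp: gwords_def)

lemma gwords_Nil [simp]: "[] \<in> gwords X"
 by (simp add: gwords_def)

lemma gwords_Cons [simp]: "(x, b) # u \<in> gwords X \<longleftrightarrow> x \<in> X \<and> u \<in> gwords X"
 by (auto simp: gwords_def)

declare word_cong.trans [trans]

lemma word_cong_gwords: "word_cong X R u v ==> u \<in> gwords X \<and> v \<in> gwords X"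
 by (induction rule: word_cong.induct) auto

lemma word_cong_context:
 "word_cong X R u v ==> a \<in> gwords X ==> b \<in> gwords X ==> word_cong X R (a @ u @ b) (a @ v @ b)"
proof (induction rule: word_cong.induct)
 case (cancel u v x c)
 then show ?case using word_cong.cancel[of "a @ u" X "v @ b" x R c] by simp
next
 case (rel u v l m)
 then show ?case using word_cong.rel[of "a @ u" X "v @ b" l m R] by simp
qed (auto intro: word_cong.intros)

lemma word_cong_append:
 assumes "word_cong X R u u'" "word_cong X R v v'"
 shows "word_cong X R (u @ v) (u' @ v')"
proof -
 note g = word_cong_gwords[OF assms(1)] word_cong_gwords[OF assms(2)]
 have "word_cong X R (u @ v) (u' @ v)"
  using word_cong_context[OF assms(1), of "[]" v] g by simp
 also have "word_cong X R (u' @ v) (u' @ v')"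
  using word_cong_context[OF assms(2), of u' "[]"] g by simp
 finally show ?thesis .
qed

lemma word_class_self: "u \<in> gwords X ==> u \<in> word_class X R u"
 by (simp add: word_class_def word_cong.refl)

lemma word_class_eq_iff:
 assumes "v \<in> gwords X"
 shows "word_class X R u = word_class X R v \<longleftrightarrow> word_cong X R u v"
proof
 assume "word_class X R u = word_class X R v"
 then show "word_cong X R u v"
  using word_class_self[OF assms, of R] by (auto simp: word_class_def)
next
 assume "word_cong X R u v"
 then show "word_class X R u = word_class X R v"
  by (auto simp: word_class_def intro: word_cong.trans word_cong.sym)
qed

text \<open>Multiplication is a union over all pairs of representatives. Congruence is compatible
  with concatenation, so all classes in that union coincide.\<close>

lemma presented_mult:
 assumes "u \<in> gwords X" "v \<in> gwords X"
 shows "word_class X R u \<otimes>\<^bsub>presented_group X R\<^esub> word_class X R v = word_class X R (u @ v)"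
proof -
 have "word_class X R (a @ b) = word_class X R (u @ v)"
  if "a \<in> word_class X R u" "b \<in> word_class X R v" for a b
  using that assms by (subst word_class_eq_iff)
   (auto simp: word_class_def intro!: word_cong_append intro: word_cong.sym)
 then have "(\<Union>a\<in>word_class X R u. \<Union>b\<in>word_class X R v. word_class X R (a @ b)) =
   word_class X R (u @ v)"
  using word_class_self[OF assms(1), of R] word_class_self[OF assms(2), of R] by blast
 then show ?thesis by (simp add: presented_group_def)
qed

lemma word_cong_inverse:
 "w \<in> gwords X ==> word_cong X R (rev (map (\<lambda>(x, b). (x, \<not> b)) w) @ w) []"
proof (induction w)
 case Nil
 then show ?case by (simp add: word_cong.refl)
next
 case (Cons a w)
 obtain x b where a: "a = (x, b)" by force
 have g: "rev (map (\<lambda>(x, b). (x, \<not> b)) w) \<in> gwords X"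
  using Cons.prems by (force simp: gwords_def lists_def a in_lists_conv_set)
 have "word_cong X R (rev (map (\<lambda>(x, b). (x, \<not> b)) w) @ [(x, \<not> b), (x, \<not> \<not> b)] @ w)
  (rev (map (\<lambda>(x, b). (x, \<not> b)) w) @ w)"
  using Cons.prems g a by (intro word_cong.cancel) auto
 also have "word_cong X R \<dots> []" using Cons.IH Cons.prems a by simp
 finally show ?case by (simp add: a)
qed

lemma presented_group_group: "group (presented_group X R)"
proof (rule groupI)
 let ?K = "presented_group X R"
 have car: "carrier ?K = word_class X R ` gwords X" and one: "\<one>\<^bsub>?K\<^esub> = word_class X R []"
  by (simp_all add: presented_group_def)
 show "\<one>\<^bsub>?K\<^esub> \<in> carrier ?K" by (auto simp: car one)
 fix x y z
 assume x: "x \<in> carrier ?K"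
 then obtain u where u: "u \<in> gwords X" "x = word_class X R u" by (auto simp: car)
 show "\<one>\<^bsub>?K\<^esub> \<otimes>\<^bsub>?K\<^esub> x = x" using u by (simp add: one presented_mult)
 have "rev (map (\<lambda>(x, b). (x, \<not> b)) u) \<in> gwords X"
  using u(1) by (force simp: gwords_def in_lists_conv_set)
 then show "\<exists>y\<in>carrier ?K. y \<otimes>\<^bsub>?K\<^esub> x = \<one>\<^bsub>?K\<^esub>"
  using u word_cong_inverse[OF u(1), of R]
  by (intro bexI[of _ "word_class X R (rev (map (\<lambda>(x, b). (x, \<not> b)) u))"])
   (auto simp: car one presented_mult word_class_eq_iff)
 assume y: "y \<in> carrier ?K"
 then obtain v where v: "v \<in> gwords X" "y = word_class X R v" by (auto simp: car)
 show "x \<otimes>\<^bsub>?K\<^esub> y \<in> carrier ?K" using u v by (auto simp: presented_mult car)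
 assume "z \<in> carrier ?K"
 then obtain w where w: "w \<in> gwords X" "z = word_class X R w" by (auto simp: car)
 show "x \<otimes>\<^bsub>?K\<^esub> y \<otimes>\<^bsub>?K\<^esub> z = x \<otimes>\<^bsub>?K\<^esub> (y \<otimes>\<^bsub>?K\<^esub> z)" using u v w by (simp add: presented_mult)
qed

section \<open>Consequences of the spin relations\<close>

abbreviation swords :: "nat => spin_gen gword set" where "swords n \<equiv> gwords (spin_gens n)"
abbreviation scong :: "nat => spin_gen gword => spin_gen gword => bool" where
 "scong n \<equiv> word_cong (spin_gens n) (spin_rels n)"

lemma spin_gens_simps [simp]:
 "Z \<in> spin_gens n" "T i \<in> spin_gens n \<longleftrightarrow> 1 \<le> i \<and> i < n"
 by (auto simp: spin_gens_def)

lemma scong_rel: "(l, m) \<in> spin_rels n ==> l \<in> swords n ==> m \<in> swords n ==> scong n l m"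
 using word_cong.rel[of "[]" "spin_gens n" "[]" l m "spin_rels n"] by simp

lemma scong_lz2: "scong n [lz, lz] []"
 by (rule scong_rel) (auto simp: spin_rels_def)

lemma scong_lz_lt: "1 \<le> i ==> i < n ==> scong n [lz, lt i] [lt i, lz]"
 by (rule scong_rel) (auto simp: spin_rels_def)

lemma scong_lt2: "1 \<le> i ==> i < n ==> scong n [lt i, lt i] [lz]"
 by (rule scong_rel) (auto simp: spin_rels_def)

lemma scong_braid: "1 \<le> i ==> i + 1 < n ==>
  scong n [lt i, lt (i + 1), lt i, lt (i + 1), lt i, lt (i + 1)] [lz]"
 by (rule scong_rel) (auto simp: spin_rels_def)

lemma scong_far: "1 \<le> j ==> i < n ==> i > j + 1 ==> scong n [lt i, lt j] [lz, lt j, lt i]"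
 by (rule scong_rel) (auto simp: spin_rels_def)

lemma scong_inverse_Z: "scong n [(Z, True)] [lz]"
proof -
 have "scong n ([(Z, True)] @ [lz, lz]) ([(Z, True)] @ [])"
  by (rule word_cong_append) (auto intro: scong_lz2 word_cong.refl)
 moreover have "scong n ([] @ [(Z, True), (Z, \<not> True)] @ [lz]) ([] @ [lz])"
  by (rule word_cong.cancel) auto
 ultimately show ?thesis by (auto intro: word_cong.trans word_cong.sym)
qed

text \<open>Insert z^2 = 1 in front, trade the second z for t_i^2, and cancel t_i against its
  inverse.\<close>

lemma scong_inverse_T:
 assumes "1 \<le> i" "i < n" shows "scong n [(T i, True)] [lz, lt i]"
proof -
 have i: "[(T i, True)] \<in> swords n" "[lt i] \<in> swords n" using assms by auto
 have "scong n ([] @ [(T i, True)]) ([lz, lz] @ [(T i, True)])"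
  by (intro word_cong_append word_cong.sym[OF scong_lz2] word_cong.refl i)
 then have "scong n [(T i, True)] [lz, lz, (T i, True)]" by simp
 also have "scong n ([lz] @ [lz] @ [(T i, True)]) ([lz] @ [lt i, lt i] @ [(T i, True)])"
  by (intro word_cong_append word_cong.refl i word_cong.sym[OF scong_lt2[OF assms]]) simp
 then have "scong n [lz, lz, (T i, True)] [lz, lt i, lt i, (T i, True)]" by simp
 also have "scong n [lz, lt i, lt i, (T i, True)] [lz, lt i]"
  using word_cong.cancel[of "[lz, lt i]" "spin_gens n" "[]" "T i" "spin_rels n" False] assms by simp
 finally show ?thesis .
qed

text \<open>Inverse letters can be eliminated, since z is its own inverse and the inverse of t_i is
  z t_i. Later inductions over the group therefore only have to treat multiplication by a
  generator.\<close>

lemma scong_positive: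
 "w \<in> swords n ==> \<exists>w'\<in>swords n. scong n w w' \<and> (\<forall>l\<in>set w'. \<not> snd l)"
proof (induction w)
 case Nil
 then show ?case by (intro bexI[of _ "[]"]) (auto intro: word_cong.refl)
next
 case (Cons a w)
 obtain x b where a: "a = (x, b)" by force
 obtain w' where w': "w' \<in> swords n" "scong n w w'" "\<forall>l\<in>set w'. \<not> snd l" using Cons a by auto
 have x: "x \<in> spin_gens n" using Cons.prems a by simp
 obtain u where u: "u \<in> swords n" "scong n [(x, b)] u" "\<forall>l\<in>set u. \<not> snd l"
 proof (cases b)
  case False
  then show ?thesis using that[of "[(x, False)]"] x word_cong.refl[of "[(x, False)]"] by simp
 next
  case True
  show ?thesis
  proof (cases x)
   case Z
   then show ?thesis using that[of "[lz]"] scong_inverse_Z True by auto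
  next
   case (T i)
   then show ?thesis using that[of "[lz, lt i]"] scong_inverse_T[of i n] True x by auto
  qed
 qed
 show ?case
  using word_cong_append[OF u(2) w'(2)] u w' by (intro bexI[of _ "u @ w'"]) (auto simp: a)
qed

text \<open>The relations move z only past the generators themselves; words with inverse letters are
  first replaced by positive ones.\<close>

lemma scong_lz_central: "w \<in> swords n ==> scong n (lz # w) (w @ [lz])"
proof -
 assume w: "w \<in> swords n"
 have pos: "v \<in> swords n ==> \<forall>l\<in>set v. \<not> snd l ==> scong n (lz # v) (v @ [lz])" for v
 proof (induction v)
  case Nil
  then show ?case by (auto intro: word_cong.refl)
 next
  case (Cons a v)
  obtain x where a: "a = (x, False)" using Cons.prems by (cases a) auto
  have x: "x \<in> spin_gens n" using Cons.prems a by simp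
  have "scong n [lz, a] [a, lz]"
   using x by (cases x) (auto simp: a intro: word_cong.refl scong_lz_lt)
  then have "scong n ([lz, a] @ v) ([a, lz] @ v)"
   using Cons.prems by (intro word_cong_append word_cong.refl) (auto simp: a)
  then have "scong n (lz # a # v) (a # lz # v)" by simp
  also have "scong n ([a] @ (lz # v)) ([a] @ (v @ [lz]))"
   using Cons a by (intro word_cong_append word_cong.refl) auto
  then have "scong n (a # lz # v) (a # v @ [lz])" by simp
  finally show ?case by simp
 qed
 obtain v where v: "v \<in> swords n" "scong n w v" "\<forall>l\<in>set v. \<not> snd l"
  using scong_positive[OF w] by blast
 have "scong n (lz # w) (lz # v)"
  using word_cong_append[OF word_cong.refl[of "[lz]"] v(2)] by simp
 also have "scong n (lz # v) (v @ [lz])" by (rule pos) (use v in auto)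
 also have "scong n (v @ [lz]) (w @ [lz])"
  using word_cong_append[OF word_cong.sym[OF v(2)] word_cong.refl[of "[lz]"]] by simp
 finally show ?thesis .
qed

section \<open>Projection to the symmetric group, and parity\<close>

lemma word_perm_Nil [simp]: "word_perm [] = id" by (simp add: word_perm_def)
lemma word_perm_Cons [simp]: "word_perm ((x, b) # w) = gen_perm x \<circ> word_perm w"
 by (simp add: word_perm_def)
lemma word_perm_append [simp]: "word_perm (u @ v) = word_perm u \<circ> word_perm v"
 by (induction u) (auto simp: comp_assoc)

lemma gen_perm_involution: "gen_perm x \<circ> gen_perm x = id"
 by (cases x) auto

lemma word_perm_scong: "scong n u v ==> word_perm u = word_perm v"
proof (induction rule: word_cong.induct)
 case (cancel u v x b)
 then show ?case using gen_perm_involution[of x] by (simp add: comp_assoc[symmetric])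
next
 case (rel u v l m)
 then have "word_perm l = word_perm m"
  by (auto simp: spin_rels_def fun_eq_iff Transposition.transpose_def)
 then show ?case by simp
qed auto

lemma word_perm_permutes: "w \<in> swords n ==> word_perm w permutes {1..n}"
proof (induction w)
 case (Cons a w)
 obtain x b where a: "a = (x, b)" by force
 have "gen_perm x permutes {1..n}" using Cons.prems a
  by (cases x) (auto simp: permutes_id intro!: permutes_swap_id)
 moreover have "word_perm w permutes {1..n}" using Cons a by simp
 ultimately show ?case unfolding a word_perm_Cons by (intro permutes_compose)
qed (simp add: permutes_id)

lemma word_parity_append: "word_parity (u @ v) = (word_parity u + word_parity v) mod 2"
 by (simp add: word_parity_def mod_simps)

lemma word_parity_scong: "scong n u v ==> word_parity u = word_parity v"
proof (induction rule: word_cong.induct)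
 case (cancel u v x b)
 then show ?case by (simp add: word_parity_def)
next
 case (rel u v l m)
 then have "word_parity l = word_parity m" by (auto simp: spin_rels_def word_parity_def)
 then show ?case by (simp add: word_parity_append)
qed auto

text \<open>The operators \<open>cliff_op i\<close> square to the identity and anticommute, so they generate a Clifford
 algebra; \<open>t\<^sub>i\<close> acts by \<open>\<i> (cliff_op i - cliff_op (i + 1)) / \<surd>2\<close>, and \<open>z\<close> by \<open>-1\<close>.\<close>

definition toggle :: "nat => nat set => nat set" where
 "toggle i A = (if i \<in> A then A - {i} else insert i A)"

definition cliff_op :: "nat => (nat set => complex) => nat set => complex" where
 "cliff_op i f A = (-1) ^ card (A \<inter> {..<i}) * f (toggle i A)"

lemma cliff_op_square: "cliff_op i (cliff_op i f) = f"
proof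
 fix A
 have "toggle i A \<inter> {..<i} = A \<inter> {..<i}" "toggle i (toggle i A) = A" by (auto simp: toggle_def)
 then show "cliff_op i (cliff_op i f) A = f A"
  by (simp add: cliff_op_def flip: power_add mult.assoc)
qed

text \<open>The prefactor of \<open>cliff_op\<close> is the Jordan-Wigner sign. For i < j, toggling
  i changes the number of points below j by one, whereas toggling j leaves the points below i alone;
  so exactly one sign appears when the two operators are exchanged.\<close>

lemma cliff_op_anticommute:
 assumes "i \<noteq> j" shows "cliff_op i (cliff_op j f) A = - cliff_op j (cliff_op i f) A"
proof -
 have *: "cliff_op i (cliff_op j f) A = - cliff_op j (cliff_op i f) A" if "i < j" for i j
 proof -
  have c: "toggle i A \<inter> {..<j} = toggle i (A \<inter> {..<j})" "toggle j A \<inter> {..<i} = A \<inter> {..<i}"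
   "toggle i (toggle j A) = toggle j (toggle i A)"
   using that by (auto simp: toggle_def)
  have "(-1::complex) ^ card (toggle i (A \<inter> {..<j})) = - ((-1) ^ card (A \<inter> {..<j}))"
  proof (cases "i \<in> A")
   case True
   then have "card (A \<inter> {..<j}) = Suc (card (A \<inter> {..<j} - {i}))"
    using that by (intro card.remove) auto
   moreover have "toggle i (A \<inter> {..<j}) = A \<inter> {..<j} - {i}"
    using True that by (simp add: toggle_def)
   ultimately show ?thesis by (simp only: power_Suc) simp
  next
   case False
   then show ?thesis by (simp add: toggle_def)
  qed
  then show ?thesis by (simp add: cliff_op_def c mult_ac)
 qed
 show ?thesis using *[of i j] *[of j i] assms by (cases "i < j") auto
qed

text \<open>For anticommuting e and e' with square 1, (e - e')^2 = 2. The scale must therefore have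
  square -1/2 for t_i^2 to act as z, that is, by -1.\<close>

definition cliff_scale :: complex where "cliff_scale = \<i> / of_real (sqrt 2)"

lemma cliff_scale_square: "cliff_scale * (cliff_scale * x) = - x / 2"
 by (simp add: cliff_scale_def field_simps flip: of_real_mult mult.assoc)

definition cliff_t :: "nat => (nat set => complex) => nat set => complex" where
 "cliff_t i f = (\<lambda>A. cliff_scale * (cliff_op i f A - cliff_op (i + 1) f A))"

text \<open>The inverse letter of t_i receives an extra sign because t_i^2 acts by -1. The two
  letters of z need no distinction.\<close>

definition cliff_letter :: "spin_gen \<times> bool => (nat set => complex) => nat set => complex" where
 "cliff_letter l f = (case fst l of Z => (\<lambda>A. - f A)
  | T i => (\<lambda>A. (if snd l then - 1 else 1) * cliff_t i f A))"

definition cliff_word :: "spin_gen gword => (nat set => complex) => nat set => complex" where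
 "cliff_word w = foldr cliff_letter w"

lemma cliff_t_linear:
 "cliff_t i (\<lambda>A. a * f A + b * g A) = (\<lambda>A. a * cliff_t i f A + b * cliff_t i g A)"
 by (simp add: cliff_t_def cliff_op_def algebra_simps)

lemma cliff_t_minus: "cliff_t i (\<lambda>A. - f A) = (\<lambda>A. - cliff_t i f A)"
 using cliff_t_linear[of i "-1" f 0 f] by simp

lemma cliff_t_add: "cliff_t i (\<lambda>A. f A + g A) = (\<lambda>A. cliff_t i f A + cliff_t i g A)"
 using cliff_t_linear[of i 1 f 1 g] by simp

lemma cliff_t_diff: "cliff_t i (\<lambda>A. f A - g A) = (\<lambda>A. cliff_t i f A - cliff_t i g A)"
 using cliff_t_linear[of i 1 f "-1" g] by simp

lemma cliff_t_comp:
 "cliff_t i (cliff_t j f) A = - (cliff_op i (cliff_op j f) A - cliff_op i (cliff_op (j + 1) f) A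
  - cliff_op (i + 1) (cliff_op j f) A + cliff_op (i + 1) (cliff_op (j + 1) f) A) / 2"
proof -
 have lin: "cliff_op i (\<lambda>A. k * (f A - g A)) A = k * (cliff_op i f A - cliff_op i g A)" for i k f g
  by (simp add: cliff_op_def algebra_simps)
 show ?thesis unfolding cliff_t_def lin
  by (subst cliff_scale_square[symmetric]) (simp add: algebra_simps)
qed

lemma cliff_t_square: "cliff_t i (cliff_t i f) = (\<lambda>A. - f A)"
 using cliff_op_anticommute[of i "i + 1" f] by (auto simp: cliff_t_comp cliff_op_square)

text \<open>Of the four anticommutators of the e's only the one with the shared e_(i+1) survives,
  and the scale turns it into 1: t_i t_(i+1) + t_(i+1) t_i = 1.\<close>

lemma cliff_t_adjacent: "cliff_t (i + 1) (cliff_t i f) = (\<lambda>A. f A - cliff_t i (cliff_t (i + 1) f) A)"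
 using cliff_op_anticommute[of i "i + 1" f] cliff_op_anticommute[of i "i + 2" f]
  cliff_op_anticommute[of "i + 1" "i + 2" f]
 by (auto simp: cliff_t_comp cliff_op_square field_simps)

lemma cliff_t_far:
 assumes "i > j + 1" shows "cliff_t i (cliff_t j f) A = - cliff_t j (cliff_t i f) A"
 using assms cliff_op_anticommute[of i j f A] cliff_op_anticommute[of i "j + 1" f A]
  cliff_op_anticommute[of "i + 1" j f A] cliff_op_anticommute[of "i + 1" "j + 1" f A]
 by (simp add: cliff_t_comp field_simps)

text \<open>For u = t_i t_(i+1), \<open>cliff_t_adjacent\<close> gives u^2 = u - 1. Hence u^3 = u^2
  - u = -1.\<close>

lemma cliff_t_braid:
 "cliff_t i (cliff_t (i + 1) (cliff_t i (cliff_t (i + 1) (cliff_t i (cliff_t (i + 1) f))))) = (\<lambda>A. - f A)"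
proof -
 have sq: "cliff_t i (cliff_t (i + 1) (cliff_t i (cliff_t (i + 1) g))) =
   (\<lambda>A. cliff_t i (cliff_t (i + 1) g) A - g A)" for g
  by (subst cliff_t_adjacent[of i "cliff_t (i + 1) g"])
   (simp add: cliff_t_diff cliff_t_add cliff_t_square cliff_t_minus)
 show ?thesis by (simp only: sq cliff_t_diff) simp
qed

lemma cliff_word_append: "cliff_word (u @ v) f = cliff_word u (cliff_word v f)"
 by (simp add: cliff_word_def)

lemma cliff_word_scong: "scong n u v ==> cliff_word u = cliff_word v"
proof (induction rule: word_cong.induct)
 case (cancel u v x b)
 have "cliff_letter (x, b) (cliff_letter (x, \<not> b) f) = f" for f
  by (cases x) (auto simp: cliff_letter_def cliff_t_minus cliff_t_square)
 then show ?case by (intro ext) (simp add: cliff_word_def)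
next
 case (rel u v l m)
 then have "cliff_word l f = cliff_word m f" for f
  using cliff_t_braid[simplified] cliff_t_far
  by (auto simp: spin_rels_def cliff_word_def cliff_letter_def cliff_t_minus cliff_t_square fun_eq_iff)
 then show ?case by (intro ext) (simp add: cliff_word_append)
qed auto

text \<open>This is what the Clifford representation is for: z acts by -1 there, so the relations do
  not make z trivial and the two lifts of a permutation are distinct.\<close>

lemma not_scong_lz: "\<not> scong n [lz] []"
proof
 assume "scong n [lz] []"
 from cliff_word_scong[OF this] have "cliff_word [lz] (\<lambda>_. 1) {} = cliff_word [] (\<lambda>_. 1) {}" by simp
 then show False by (simp add: cliff_word_def cliff_letter_def)
qed

section \<open>The spin group, its central element and its structure maps\<close>

lemma spin_group_group: "group (Sp n)"
 by (simp add: spin_group_def presented_group_group)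

lemma spin_one: "\<one>\<^bsub>Sp n\<^esub> = spin_class n []"
 by (simp add: spin_group_def presented_group_def spin_class_def)

lemma spin_carrier: "carrier (Sp n) = spin_class n ` swords n"
 by (simp add: spin_group_def presented_group_def spin_class_def)

lemma spin_mult:
 "u \<in> swords n ==> v \<in> swords n ==>
  spin_class n u \<otimes>\<^bsub>Sp n\<^esub> spin_class n v = spin_class n (u @ v)"
 by (simp add: spin_group_def spin_class_def presented_mult)

lemma spin_class_eq: "v \<in> swords n ==> spin_class n u = spin_class n v \<longleftrightarrow> scong n u v"
 by (simp add: spin_class_def word_class_eq_iff)

lemma spin_class_mem: "v \<in> spin_class n u \<longleftrightarrow> scong n u v"
 by (simp add: spin_class_def word_class_def)

lemma spin_class_self: "u \<in> swords n ==> u \<in> spin_class n u"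
 by (simp add: spin_class_mem word_cong.refl)

lemma spin_class_closed [simp]: "w \<in> swords n ==> spin_class n w \<in> carrier (Sp n)"
 by (simp add: spin_carrier)

lemma spin_perm_class:
 assumes "w \<in> swords n" shows "spin_perm (spin_class n w) = word_perm w"
proof -
 have "word_perm ` spin_class n w = {word_perm w}"
 proof (intro equalityI subsetI)
  fix p assume "p \<in> word_perm ` spin_class n w"
  then obtain v where "scong n w v" "p = word_perm v" by (auto simp: spin_class_mem)
  then show "p \<in> {word_perm w}" using word_perm_scong[of n w v] by simp
 qed (use spin_class_self[OF assms] in blast)
 then show ?thesis by (simp add: spin_perm_def)
qed

lemma spin_parity_class:
 assumes "w \<in> swords n" shows "spin_parity (spin_class n w) = word_parity w"
proof -
 have "word_parity ` spin_class n w = {word_parity w}"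
 proof (intro equalityI subsetI)
  fix p assume "p \<in> word_parity ` spin_class n w"
  then obtain v where "scong n w v" "p = word_parity v" by (auto simp: spin_class_mem)
  then show "p \<in> {word_parity w}" using word_parity_scong[of n w v] by simp
 qed (use spin_class_self[OF assms] in blast)
 then show ?thesis by (simp add: spin_parity_def)
qed

lemma spin_perm_mult:
 "s \<in> carrier (Sp n) ==> t \<in> carrier (Sp n) ==>
  spin_perm (s \<otimes>\<^bsub>Sp n\<^esub> t) = spin_perm s \<circ> spin_perm t"
 by (auto simp: spin_carrier spin_mult spin_perm_class)

lemma spin_parity_mult:
 "s \<in> carrier (Sp n) ==> t \<in> carrier (Sp n) ==>
  spin_parity (s \<otimes>\<^bsub>Sp n\<^esub> t) = (spin_parity s + spin_parity t) mod 2"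
 by (auto simp: spin_carrier spin_mult spin_parity_class word_parity_append)

lemma spin_perm_one: "spin_perm \<one>\<^bsub>Sp n\<^esub> = id"
 by (simp add: spin_one spin_perm_class)

lemma spin_parity_one: "spin_parity \<one>\<^bsub>Sp n\<^esub> = 0"
 by (simp add: spin_one spin_parity_class word_parity_def)

lemma spin_parity_less: "t \<in> carrier (Sp n) ==> spin_parity t < 2"
 by (auto simp: spin_carrier spin_parity_class word_parity_def)

lemma spin_perm_permutes: "t \<in> carrier (Sp n) ==> spin_perm t permutes {1..n}"
 by (clarsimp simp: spin_carrier spin_perm_class simp del: One_nat_def) (rule word_perm_permutes)

lemma spin_perm_inv:
 assumes "t \<in> carrier (Sp n)"
 shows "spin_perm (inv\<^bsub>Sp n\<^esub> t) = inv_into UNIV (spin_perm t)"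
proof -
 interpret group "Sp n" by (rule spin_group_group)
 have "spin_perm (inv\<^bsub>Sp n\<^esub> t) \<circ> spin_perm t = id"
  using assms spin_perm_mult[of "inv\<^bsub>Sp n\<^esub> t" n t] by (simp add: spin_perm_one)
 then show ?thesis
  using permutes_inv_o(1)[OF spin_perm_permutes[OF assms]]
  by (metis comp_assoc comp_id id_comp)
qed

lemma spin_parity_inv:
 assumes "t \<in> carrier (Sp n)"
 shows "spin_parity (inv\<^bsub>Sp n\<^esub> t) = spin_parity t"
proof -
 interpret group "Sp n" by (rule spin_group_group)
 have "(spin_parity (inv\<^bsub>Sp n\<^esub> t) + spin_parity t) mod 2 = 0"
  using assms spin_parity_mult[of "inv\<^bsub>Sp n\<^esub> t" n t] by (simp add: spin_parity_one)
 then show ?thesis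
  using spin_parity_less[OF assms] spin_parity_less[OF inv_closed[OF assms]] by presburger
qed

definition spin_z :: "nat => spin_gen gword set" where "spin_z n = spin_class n [lz]"

lemma spin_z_closed [simp]: "spin_z n \<in> carrier (Sp n)"
 by (simp add: spin_z_def)

lemma spin_z_square: "spin_z n \<otimes>\<^bsub>Sp n\<^esub> spin_z n = \<one>\<^bsub>Sp n\<^esub>"
 by (simp add: spin_z_def spin_mult spin_one spin_class_eq scong_lz2)

lemma spin_z_central:
 "t \<in> carrier (Sp n) ==>
  spin_z n \<otimes>\<^bsub>Sp n\<^esub> t = t \<otimes>\<^bsub>Sp n\<^esub> spin_z n"
 by (clarsimp simp: spin_z_def spin_carrier spin_mult)
  (simp add: spin_class_eq scong_lz_central)

lemma spin_z_neq_one: "spin_z n \<noteq> \<one>\<^bsub>Sp n\<^esub>"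
 by (simp add: spin_z_def spin_one spin_class_eq not_scong_lz)

lemma spin_perm_z: "spin_perm (spin_z n) = id"
 by (simp add: spin_z_def spin_perm_class)

lemma spin_parity_z: "spin_parity (spin_z n) = 0"
 by (simp add: spin_z_def spin_parity_class word_parity_def)

section \<open>The kernel of the projection to the symmetric group, by words modulo z\<close>

definition zcong :: "nat => spin_gen gword => spin_gen gword => bool" where
 "zcong n u v \<longleftrightarrow> scong n u v \<or> scong n u (lz # v)"

lemma scong_lz_cancel: "v \<in> swords n ==> scong n (lz # lz # v) v"
 using word_cong_append[OF scong_lz2 word_cong.refl, of v n] by simp

lemma scong_lz_Cons: "scong n u v ==> scong n (lz # u) (lz # v)"
 using word_cong_append[OF word_cong.refl, of "[lz]"] by simp

lemma zcong_swords: "zcong n u v ==> u \<in> swords n \<and> v \<in> swords n"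
 using word_cong_gwords by (force simp: zcong_def)

lemma zcong_scong: "scong n u v ==> zcong n u v"
 by (simp add: zcong_def)

lemma zcong_refl: "u \<in> swords n ==> zcong n u u"
 by (simp add: zcong_scong word_cong.refl)

lemma zcong_sym: assumes "zcong n u v" shows "zcong n v u"
proof (cases "scong n u v")
 case False
 then have *: "scong n u (lz # v)" using assms by (simp add: zcong_def)
 have "scong n v (lz # lz # v)"
  using zcong_swords[OF assms] by (simp add: scong_lz_cancel word_cong.sym)
 also have "scong n (lz # lz # v) (lz # u)"
  using * by (simp add: scong_lz_Cons word_cong.sym)
 finally show ?thesis by (simp add: zcong_def)
qed (simp add: zcong_def word_cong.sym)

lemma zcong_trans [trans]: assumes "zcong n u v" "zcong n v w" shows "zcong n u w"
proof -
 have w: "w \<in> swords n" using zcong_swords[OF assms(2)] by simp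
 have *: "scong n (lz # v) w" if "scong n v (lz # w)"
  by (rule word_cong.trans[OF scong_lz_Cons[OF that] scong_lz_cancel[OF w]])
 consider "scong n u v" "scong n v w" | "scong n u v" "scong n v (lz # w)"
  | "scong n u (lz # v)" "scong n v w" | "scong n u (lz # v)" "scong n v (lz # w)"
  using assms by (auto simp: zcong_def)
 then show ?thesis
 proof cases
  case 1
  then show ?thesis using word_cong.trans unfolding zcong_def by blast
 next
  case 2
  then show ?thesis using word_cong.trans unfolding zcong_def by blast
 next
  case 3
  then show ?thesis using word_cong.trans[OF _ scong_lz_Cons] unfolding zcong_def by blast
 next
  case 4
  then show ?thesis using word_cong.trans[OF _ *] unfolding zcong_def by blast
 qed
qed

lemma zcong_append: assumes "zcong n u u'" "zcong n v v'" shows "zcong n (u @ v) (u' @ v')"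
proof -
 have g: "u \<in> swords n" "v \<in> swords n" "u' \<in> swords n" "v' \<in> swords n"
  using zcong_swords assms by auto
 have "scong n (a @ v) (b @ v)" if "scong n a b" for a b
  by (intro word_cong_append word_cong.refl g that)
 from this[of u u'] this[of u "lz # u'"] have 1: "zcong n (u @ v) (u' @ v)"
  using assms(1) by (auto simp: zcong_def)
 have "zcong n (u' @ v) (u' @ v')"
 proof (cases "scong n v v'")
  case True
  then show ?thesis using word_cong_append[OF word_cong.refl[OF g(3)]] by (simp add: zcong_def)
 next
  case False
  then have "scong n v (lz # v')" using assms by (simp add: zcong_def)
  then have "scong n (u' @ v) (u' @ lz # v')"
   using word_cong_append[OF word_cong.refl[OF g(3)]] by simp
  also have "scong n ((u' @ [lz]) @ v') ((lz # u') @ v')"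
   by (intro word_cong_append word_cong.sym[OF scong_lz_central] g word_cong.refl)
  then have "scong n (u' @ lz # v') (lz # u' @ v')" by simp
  finally show ?thesis by (simp add: zcong_def)
 qed
 with 1 show ?thesis by (rule zcong_trans)
qed

lemma zcong_context:
 "zcong n u v ==> a \<in> swords n ==> b \<in> swords n ==> zcong n (a @ u @ b) (a @ v @ b)"
 by (intro zcong_append zcong_refl)

lemma zcong_lz: "zcong n [lz] []"
 by (simp add: zcong_def word_cong.refl)

lemma zcong_letter:
 assumes "(x, b) # [] \<in> swords n"
 shows "zcong n [(x, b)] (case x of Z => [] | T i => [lt i])"
proof (cases x)
 case Z
 then show ?thesis using zcong_lz zcong_trans[OF zcong_scong[OF scong_inverse_Z] zcong_lz]
  by (cases b) auto
next
 case (T i)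
 have "zcong n [(T i, True)] ([lz] @ [lt i])"
  using scong_inverse_T[of i n] assms T by (simp add: zcong_scong)
 also have "zcong n ([lz] @ [lt i]) ([] @ [lt i])"
  using assms T by (intro zcong_append zcong_lz zcong_refl) auto
 finally show ?thesis using assms T by (cases b) (auto intro: zcong_refl)
qed

lemma zcong_far:
 assumes "1 \<le> i" "i < n" "1 \<le> k" "k < n" "i + 1 < k \<or> k + 1 < i"
 shows "zcong n [lt i, lt k] [lt k, lt i]"
proof -
 have *: "zcong n [lt i, lt k] [lt k, lt i]" if "1 \<le> k" "i < n" "k + 1 < i" for i k
  using scong_far[of k i n] that by (simp add: zcong_def)
 show ?thesis using assms *[of k i] *[of i k] zcong_sym by blast
qed

lemma zcong_square: "1 \<le> i ==> i < n ==> zcong n [lt i, lt i] []"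
 using scong_lt2[of i n] by (simp add: zcong_def)

text \<open>Modulo z the generators a, b are involutions with (ab)^3 = 1. Appending bab to ababab
  and cancelling bb, aa, bb from the junction leaves aba.\<close>

lemma zcong_braid:
 assumes "1 \<le> i" "i + 1 < n"
 shows "zcong n [lt (i + 1), lt i, lt (i + 1)] [lt i, lt (i + 1), lt i]"
proof -
 let ?a = "lt i" and ?b = "lt (i + 1)"
 have g: "i < n" "1 \<le> i + 1" using assms by auto
 have [simp]: "[?a] \<in> swords n" "[?b] \<in> swords n" using assms by auto
 note sq = zcong_square[OF assms(1) g(1)] zcong_square[OF g(2) assms(2)]
 have "zcong n ([?a, ?b, ?a, ?b, ?a, ?b] @ [?b, ?a, ?b]) ([] @ [?b, ?a, ?b])"
  using scong_braid[OF assms] assms by (intro zcong_append zcong_refl) (auto simp: zcong_def)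
 from zcong_sym[OF this]
 have "zcong n [?b, ?a, ?b] ([?a, ?b, ?a, ?b, ?a] @ [?b, ?b] @ [?a, ?b])" by simp
 also have "zcong n ([?a, ?b, ?a, ?b, ?a] @ [?b, ?b] @ [?a, ?b]) ([?a, ?b, ?a, ?b, ?a] @ [] @ [?a, ?b])"
  by (rule zcong_context[OF sq(2)]) (use assms in auto)
 also have "[?a, ?b, ?a, ?b, ?a] @ [] @ [?a, ?b] = [?a, ?b, ?a, ?b] @ [?a, ?a] @ [?b]" by simp
 also have "zcong n ([?a, ?b, ?a, ?b] @ [?a, ?a] @ [?b]) ([?a, ?b, ?a, ?b] @ [] @ [?b])"
  by (rule zcong_context[OF sq(1)]) (use assms in auto)
 also have "[?a, ?b, ?a, ?b] @ [] @ [?b] = [?a, ?b, ?a] @ [?b, ?b] @ []" by simp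
 also have "zcong n ([?a, ?b, ?a] @ [?b, ?b] @ []) ([?a, ?b, ?a] @ [] @ [])"
  by (rule zcong_context[OF sq(2)]) (use assms in auto)
 finally show ?thesis by simp
qed

lemma zcong_block:
 assumes "1 \<le> k" "k < n" "\<And>i. i \<in> set is ==> 1 \<le> i \<and> i < n \<and> (i + 1 < k \<or> k + 1 < i)"
 shows "zcong n (map lt is @ [lt k]) ([lt k] @ map lt is)"
 using assms(3)
proof (induction "is")
 case Nil
 then show ?case using assms by (auto intro: zcong_refl)
next
 case (Cons i "is")
 have w: "map lt is \<in> swords n" using Cons.prems by (auto simp: gwords_def in_lists_conv_set)
 have "zcong n ([lt i] @ map lt is @ [lt k]) ([lt i] @ [lt k] @ map lt is)"
  using Cons by (intro zcong_append zcong_refl Cons.IH) auto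
 also have "[lt i] @ [lt k] @ map lt is = [] @ [lt i, lt k] @ map lt is" by simp
 also have "zcong n ([] @ [lt i, lt k] @ map lt is) ([] @ [lt k, lt i] @ map lt is)"
  using Cons.prems[of i] assms(1,2) w by (intro zcong_context zcong_far) auto
 finally show ?case by simp
qed

text \<open>These are the words t_n t_(n-1) ... t_j, representatives of the cosets of S_n in
  S_(n+1): the j-th one sends j to n + 1. It is empty for j = n + 1.\<close>

definition coset_word :: "nat => nat => spin_gen gword" where
 "coset_word n j = map lt (rev [j..<Suc n])"

text \<open>A generator t_k multiplied on the right passes through the word when k + 1 < j,
  lengthens it when k + 1 = j, and cancels the last letter when k = j. For k > j it moves up to the
  letters t_k t_(k-1), is turned by the braid relation into a t_(k-1) in front of them, and leaves
  on the left.\<close>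

lemma coset_word_step:
 assumes "1 \<le> j" "j \<le> Suc n" "1 \<le> k" "k \<le> n"
 shows "(\<exists>s\<in>swords n. \<exists>i\<in>{1..Suc n}.
  zcong (Suc n) (coset_word n j @ [lt k]) (s @ coset_word n i))"
proof -
 have m: "map lt is \<in> swords (Suc n)" if "set is \<subseteq> {1..n}" for "is"
  using that by (force simp: gwords_def in_lists_conv_set)
 consider "k + 1 < j" | "k + 1 = j" | "k = j" | "k > j" by linarith
 then show ?thesis
 proof cases
  case 1
  have "zcong (Suc n) (coset_word n j @ [lt k]) ([lt k] @ coset_word n j)"
   unfolding coset_word_def by (rule zcong_block) (use 1 assms in auto)
  then show ?thesis using 1 assms by (intro bexI[of _ "[lt k]"] bexI[of _ j]) auto
 next
  case 2
  have "coset_word n j @ [lt k] = coset_word n k"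
   using 2 assms by (auto simp: coset_word_def upt_conv_Cons)
  moreover have "coset_word n k \<in> swords (Suc n)" 
   unfolding coset_word_def using assms by (intro m) auto
  ultimately show ?thesis using assms
   by (intro bexI[of _ "[]"] bexI[of _ k]) (auto intro: zcong_refl)
 next
  case 3
  have "coset_word n j @ [lt k] = coset_word n (Suc j) @ [lt k, lt k] @ []"
   using 3 assms by (auto simp: coset_word_def upt_conv_Cons)
  also have "zcong (Suc n) \<dots> (coset_word n (Suc j) @ [] @ [])"
   unfolding coset_word_def using assms by (intro zcong_context zcong_square m) auto
  finally show ?thesis using 3 assms by (intro bexI[of _ "[]"] bexI[of _ "Suc j"]) auto
 next
  case 4
  obtain k' where k': "k = Suc k'" using 4 by (cases k) auto
  let ?A = "map lt (rev [Suc k..<Suc n])" and ?B = "map lt (rev [j..<k'])"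
  have "[j..<Suc n] = [j..<k'] @ [k', k] @ [Suc k..<Suc n]"
  proof -
   have "[j..<Suc n] = [j..<k'] @ [k'..<Suc n]"
    using 4 k' assms upt_add_eq_append[of j k' "Suc n - k'"] by simp
   moreover have "[k'..<Suc n] = k' # k # [Suc k..<Suc n]"
    using k' assms upt_conv_Cons[of k' "Suc n"] upt_conv_Cons[of k "Suc n"] by simp
   ultimately show ?thesis by simp
  qed
  then have c: "coset_word n j = ?A @ [lt k, lt k'] @ ?B" by (simp add: coset_word_def)
  have A: "?A \<in> swords (Suc n)" and B: "?B \<in> swords (Suc n)" using assms 4 k' by (auto intro!: m)
  have K: "[lt k] \<in> swords (Suc n)" "[lt k'] \<in> swords (Suc n)" using assms 4 k' by auto
  have "zcong (Suc n) ((?A @ [lt k, lt k']) @ (?B @ [lt k])) ((?A @ [lt k, lt k']) @ ([lt k] @ ?B))"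
   by (rule zcong_append, rule zcong_refl)
    (use A K in simp, rule zcong_block, use 4 k' assms in auto)
  also have "(?A @ [lt k, lt k']) @ ([lt k] @ ?B) = ?A @ [lt (k' + 1), lt k', lt (k' + 1)] @ ?B"
   using k' by simp
  also have "zcong (Suc n) \<dots> (?A @ [lt k', lt (k' + 1), lt k'] @ ?B)"
   using 4 k' assms by (intro zcong_context zcong_braid A B) auto
  also have "?A @ [lt k', lt (k' + 1), lt k'] @ ?B = (?A @ [lt k']) @ ([lt k, lt k'] @ ?B)"
   using k' by simp
  also have "zcong (Suc n) \<dots> (([lt k'] @ ?A) @ ([lt k, lt k'] @ ?B))"
  proof (rule zcong_append)
   show "zcong (Suc n) (?A @ [lt k']) ([lt k'] @ ?A)"
    by (rule zcong_block) (use 4 k' assms in auto)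
   show "zcong (Suc n) ([lt k, lt k'] @ ?B) ([lt k, lt k'] @ ?B)" 
    using B K by (intro zcong_refl) simp
  qed
  finally have "zcong (Suc n) (coset_word n j @ [lt k]) ([lt k'] @ coset_word n j)"
   by (simp add: c)
  then show ?thesis using 4 k' assms by (intro bexI[of _ "[lt k']"] bexI[of _ j]) auto
 qed
qed

lemma swords_mono: "w \<in> swords n ==> n \<le> N ==> w \<in> swords N"
 unfolding gwords_def by (erule lists_mono[THEN subsetD, rotated]) (auto simp: spin_gens_def)

lemma scong_mono: "scong n u v ==> n \<le> N ==> scong N u v"
proof (induction rule: word_cong.induct)
 case (rel u v l m)
 have "spin_rels n \<subseteq> spin_rels N" using rel.prems by (force simp: spin_rels_def)
 then show ?case using rel by (intro word_cong.rel) (auto intro: swords_mono)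
next
 case (cancel u v x b)
 have "x \<in> spin_gens N" using cancel by (auto simp: spin_gens_def)
 then show ?case using cancel by (intro word_cong.cancel) (auto intro: swords_mono)
qed (auto intro: word_cong.intros swords_mono)

lemma zcong_mono: "zcong n u v ==> n \<le> N ==> zcong N u v"
 by (auto simp: zcong_def intro: scong_mono)

text \<open>Coset enumeration: words of the shape s c_j are closed under right multiplication by
  generators, by \<open>coset_word_step\<close>. This bounds the presented group from above.\<close>

lemma coset_normal_form:
 "w \<in> swords (Suc n) ==>
  \<exists>s\<in>swords n. \<exists>j\<in>{1..Suc n}. zcong (Suc n) w (s @ coset_word n j)"
proof (induction w rule: rev_induct)
 case Nil
 show ?case by (intro bexI[of _ "[]"] bexI[of _ "Suc n"]) (auto simp: coset_word_def zcong_refl)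
next
 case (snoc a w)
 obtain x b where a: "a = (x, b)" by force
 obtain s j where s: "s \<in> swords n" "j \<in> {1..Suc n}" "zcong (Suc n) w (s @ coset_word n j)"
  using snoc by auto
 have sN: "s \<in> swords (Suc n)" using s swords_mono by auto
 have l: "zcong (Suc n) [(x, b)] (case x of Z => [] | T i => [lt i])"
  using snoc.prems a by (intro zcong_letter) auto
 note * = zcong_append[OF s(3) l]
 show ?case
 proof (cases x)
  case Z
  then show ?thesis using * s a by (intro bexI[of _ s] bexI[of _ j]) auto
 next
  case (T k)
  then have k: "1 \<le> k" "k \<le> n" using snoc.prems a by auto
  obtain s' i where s': "s' \<in> swords n" "i \<in> {1..Suc n}"
   "zcong (Suc n) (coset_word n j @ [lt k]) (s' @ coset_word n i)"
   using coset_word_step[of j n k] k s by auto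
  have "zcong (Suc n) (w @ [a]) (s @ (coset_word n j @ [lt k]))" using * T a by simp
  also have "zcong (Suc n) (s @ (coset_word n j @ [lt k])) (s @ (s' @ coset_word n i))"
   by (intro zcong_append zcong_refl s' sN)
  finally show ?thesis using s s' by (intro bexI[of _ "s @ s'"] bexI[of _ i]) auto
 qed
qed

lemma word_perm_coset_word:
 "j \<le> Suc n ==> word_perm (coset_word n j) j = Suc n"
proof (induction "Suc n - j" arbitrary: j)
 case 0
 then have "j = Suc n" by simp
 then show ?case by (simp add: coset_word_def)
next
 case (Suc d)
 then have "coset_word n j = coset_word n (Suc j) @ [lt j]"
  by (auto simp: coset_word_def upt_conv_Cons)
 then show ?case using Suc by simp
qed

lemma word_perm_zcong: "zcong n u v ==> word_perm u = word_perm v"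
 using word_perm_scong by (force simp: zcong_def)

text \<open>Induction on n. Write w as s c_j; since c_j sends j to n + 1 and s fixes n + 1, a
  trivial permutation forces j = n + 1. Then c_j is empty and the word s, on fewer generators, lies
  in the kernel as well.\<close>

lemma word_perm_kernel: "w \<in> swords n ==> word_perm w = id ==> zcong n w []"
proof (induction n arbitrary: w)
 case 0
 show ?case using 0(1)
 proof (induction w)
  case (Cons a w)
  obtain b where a: "a = (Z, b)" using Cons.prems by (cases a; cases "fst a") auto
  have "zcong 0 ([(Z, b)] @ w) ([] @ [])"
   using zcong_letter[of Z b 0] Cons by (intro zcong_append) (auto simp: a)
  then show ?case by (simp add: a)
 qed (simp add: zcong_refl)
next
 case (Suc n)
 obtain s j where s: "s \<in> swords n" "j \<in> {1..Suc n}" "zcong (Suc n) w (s @ coset_word n j)"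
  using coset_normal_form[OF Suc.prems(1)] by blast
 have "word_perm s (word_perm (coset_word n j) j) = j"
  using word_perm_zcong[OF s(3)] Suc.prems(2) by (simp add: fun_eq_iff)
 then have "j = Suc n"
  using s(2) word_perm_permutes[OF s(1)] by (simp add: word_perm_coset_word permutes_not_in)
 then have w: "zcong (Suc n) w s" using s(3) by (simp add: coset_word_def)
 then have "word_perm s = id" using word_perm_zcong Suc.prems by auto
 then have "zcong n s []" using Suc.IH s by blast
 then show ?case using w zcong_mono zcong_trans by (meson le_SucI order_refl)
qed

lemma spin_kernel:
 assumes "s \<in> carrier (Sp n)" "t \<in> carrier (Sp n)" "spin_perm s = spin_perm t"
 shows "s = t \<or> s = spin_z n \<otimes>\<^bsub>Sp n\<^esub> t"
proof -
 interpret group "Sp n" by (rule spin_group_group)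
 let ?r = "s \<otimes>\<^bsub>Sp n\<^esub> inv\<^bsub>Sp n\<^esub> t"
 have r: "?r \<in> carrier (Sp n)" using assms by simp
 have "spin_perm ?r = id"
  using assms permutes_inv_o(1)[OF spin_perm_permutes[OF assms(2)]]
  by (simp add: spin_perm_mult spin_perm_inv)
 moreover obtain w where w: "w \<in> swords n" "?r = spin_class n w" using r by (auto simp: spin_carrier)
 ultimately have "zcong n w []" by (intro word_perm_kernel) (auto simp: spin_perm_class)
 then have "?r = \<one>\<^bsub>Sp n\<^esub> \<or> ?r = spin_z n"
  using w by (auto simp: zcong_def spin_z_def spin_one spin_class_eq)
 moreover have "s = ?r \<otimes>\<^bsub>Sp n\<^esub> t" using assms by (simp add: m_assoc)
 ultimately show ?thesis using assms by (metis l_one)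
qed

text \<open>Dividing p by the coset word that sends the preimage of n + 1 to n + 1 leaves a
  permutation fixing n + 1.\<close>

lemma word_perm_surj: "p permutes {1..n} ==> \<exists>w\<in>swords n. word_perm w = p"
proof (induction n arbitrary: p)
 case 0
 then have "p = id" by simp
 then show ?case by (intro bexI[of _ "[]"]) auto
next
 case (Suc n)
 obtain j where j: "j \<in> {1..Suc n}" "p j = Suc n"
 proof -
  have "Suc n \<in> p ` {1..Suc n}" using permutes_image[OF Suc.prems] by simp
  then show ?thesis using that by force
 qed
 let ?c = "word_perm (coset_word n j)"
 have cw: "coset_word n j \<in> swords (Suc n)"
  using j by (auto simp: coset_word_def gwords_def in_lists_conv_set)
 have c: "?c permutes {1..Suc n}" "?c j = Suc n"
  using word_perm_permutes[OF cw] word_perm_coset_word j by auto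
 let ?q = "p \<circ> inv_into UNIV ?c"
 have q: "?q permutes {1..Suc n}" using c Suc.prems by (intro permutes_compose permutes_inv)
 have "?q (Suc n) = Suc n" using c(2) j(2) permutes_inverses(2)[OF c(1), of j] by simp
 then have "?q permutes {1..n}"
  by (intro permutes_superset[OF q]) (auto simp: le_Suc_eq)
 then obtain w where w: "w \<in> swords n" "word_perm w = ?q" using Suc.IH by blast
 have "word_perm (w @ coset_word n j) = p"
  using w(2) permutes_inv_o(2)[OF c(1)] by (simp add: comp_assoc)
 then show ?case using w cw swords_mono[of w n "Suc n"]
  by (intro bexI[of _ "w @ coset_word n j"]) auto
qed

lemma spin_perm_surj: "p permutes {1..n} ==> \<exists>t\<in>carrier (Sp n). spin_perm t = p"
 using word_perm_surj[of p n] spin_perm_class by (force simp: spin_carrier)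

lemma finite_spin: "finite (carrier (Sp n))"
proof -
 let ?P = "{p. p permutes {1..n}}"
 have "\<forall>p\<in>?P. \<exists>t. t \<in> carrier (Sp n) \<and> spin_perm t = p"
  using spin_perm_surj by auto
 from bchoice[OF this] obtain l
  where l: "\<And>p. p \<in> ?P ==> l p \<in> carrier (Sp n) \<and> spin_perm (l p) = p"
  by blast
 have "t \<in> l ` ?P \<union> (\<lambda>p. spin_z n \<otimes>\<^bsub>Sp n\<^esub> l p) ` ?P"
  if t: "t \<in> carrier (Sp n)" for t
 proof -
  have p: "spin_perm t \<in> ?P" using spin_perm_permutes[OF t] by simp
  have "t = l (spin_perm t) \<or> t = spin_z n \<otimes>\<^bsub>Sp n\<^esub> l (spin_perm t)"
   by (rule spin_kernel) (use l[OF p] t in auto)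
  then show ?thesis using imageI[OF p, of l] imageI[OF p, of "\<lambda>p. spin_z n \<otimes>\<^bsub>Sp n\<^esub> l p"]
   by auto
 qed
 then have "carrier (Sp n) \<subseteq> l ` ?P \<union> (\<lambda>p. spin_z n \<otimes>\<^bsub>Sp n\<^esub> l p) ` ?P"
  by blast
 then show ?thesis by (rule finite_subset) (simp add: finite_permutations)
qed

text \<open>This connects the parity of the spin group with cycle lengths: a lift of a single cycle
  of even length is odd.\<close>

lemma sign_spin_perm:
 "t \<in> carrier (Sp n) ==> sign (spin_perm t) = (-1) ^ spin_parity t"
proof -
 have "w \<in> swords n ==> sign (word_perm w) = (-1) ^ word_parity w" for w
 proof (induction w)
  case (Cons a w)
  obtain x b where a: "a = (x, b)" by force
  have "permutation (word_perm w)"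
   using word_perm_permutes[of w n] Cons.prems a by (auto simp: permutation_permutes)
  moreover have "permutation (gen_perm x)" by (cases x) (auto simp: permutation_swap_id)
  moreover have "sign (gen_perm x) = (-1) ^ word_parity [(x, b)]"
   by (cases x) (auto simp: word_parity_def sign_swap_id)
  moreover have "word_parity (a # w) = (word_parity [(x, b)] + word_parity w) mod 2"
   using word_parity_append[of "[a]" w] a by simp
  ultimately show ?case
   using Cons unfolding a word_perm_Cons by (simp add: sign_compose minus_one_power_iff del: o_apply)
 qed (simp add: word_parity_def)
 then show "t \<in> carrier (Sp n) ==> ?thesis"
  by (auto simp: spin_carrier spin_perm_class spin_parity_class)
qed

section \<open>Embeddings of smaller spin groups and their commutation\<close>

definition shift_word :: "nat => spin_gen gword => spin_gen gword" where
 "shift_word k = map (map_prod (shift_gen k) id)"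

text \<open>One map for both factors of a Young subgroup: k = 0 keeps the indices of the left
  factor, and k = n moves the right factor past it.\<close>

definition spin_shift :: "nat => nat => spin_gen gword set => spin_gen gword set" where
 "spin_shift k N t = (\<Union>w\<in>t. spin_class N (shift_word k w))"

lemma shift_word_simps [simp]:
 "shift_word k [] = []" "shift_word k ((x, b) # w) = (shift_gen k x, b) # shift_word k w"
 "shift_word k (u @ v) = shift_word k u @ shift_word k v"
 by (simp_all add: shift_word_def)

lemma shift_word_0 [simp]: "shift_word 0 w = w"
proof -
 have "shift_gen 0 x = x" for x by (cases x) auto
 then show ?thesis by (induction w) (auto simp: shift_word_def)
qed

lemma shift_word_closed: "w \<in> swords m ==> k + m \<le> N ==> shift_word k w \<in> swords N"
proof (induction w)
 case (Cons a w)
 obtain x b where a: "a = (x, b)" by force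
 show ?case using Cons a by (cases x) auto
qed simp

lemma spin_rels_shift:
 assumes "(l, w) \<in> spin_rels m" "k + m \<le> N"
 shows "(shift_word k l, shift_word k w) \<in> spin_rels N"
proof -
 have "l = [lz, lz] \<and> w = [] \<or> (\<exists>i\<in>{1..<m}. l = [lz, lt i] \<and> w = [lt i, lz]) \<or>
  (\<exists>i\<in>{1..<m}. l = [lt i, lt i] \<and> w = [lz]) \<or>
  (\<exists>i\<in>{1..<m}. i + 1 < m \<and> l = [lt i, lt (i + 1), lt i, lt (i + 1), lt i, lt (i + 1)] \<and> w = [lz]) \<or>
  (\<exists>i\<in>{1..<m}. \<exists>j\<in>{1..<m}. i > j + 1 \<and> l = [lt i, lt j] \<and> w = [lz, lt j, lt i])"
  using assms(1) unfolding spin_rels_def by fastforce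
 then show ?thesis using assms(2) by (elim disjE bexE conjE) (auto simp: spin_rels_def)
qed

lemma scong_shift: "scong m u v ==> k + m \<le> N ==> scong N (shift_word k u) (shift_word k v)"
proof (induction rule: word_cong.induct)
 case (cancel u v x b)
 have "shift_gen k x \<in> spin_gens N" using cancel by (cases x) auto
 then show ?case using cancel word_cong.cancel[of "shift_word k u" "spin_gens N" "shift_word k v"
   "shift_gen k x" "spin_rels N" b] by (simp add: shift_word_closed)
next
 case (rel u v l w)
 have "(shift_word k l, shift_word k w) \<in> spin_rels N"
  using rel by (intro spin_rels_shift)
 then show ?case using rel by (auto intro!: word_cong.rel shift_word_closed)
qed (auto intro: word_cong.intros shift_word_closed)

lemma spin_shift_class:
 assumes "w \<in> swords m" "k + m \<le> N"
 shows "spin_shift k N (spin_class m w) = spin_class N (shift_word k w)"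
proof -
 have *: "spin_class N (shift_word k v) = spin_class N (shift_word k w)" if "v \<in> spin_class m w" for v
 proof (subst spin_class_eq)
  show "shift_word k w \<in> swords N" using assms by (rule shift_word_closed)
  show "scong N (shift_word k v) (shift_word k w)"
   using that by (intro word_cong.sym[OF scong_shift[OF _ assms(2)]]) (simp add: spin_class_mem)
 qed
 have "spin_shift k N (spin_class m w) = (\<Union>v\<in>spin_class m w. spin_class N (shift_word k w))"
  unfolding spin_shift_def by (rule SUP_cong[OF HOL.refl *])
 also have "\<dots> = spin_class N (shift_word k w)" using spin_class_self[OF assms(1)] by blast
 finally show ?thesis .
qed

lemma shift_gen_0 [simp]: "shift_gen 0 x = x"
 by (cases x) auto

lemma spin_shift_closed:
 "t \<in> carrier (Sp m) ==> k + m \<le> N ==> spin_shift k N t \<in> carrier (Sp N)"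
 by (auto simp: spin_carrier spin_shift_class shift_word_closed)

lemma spin_shift_mult:
 "s \<in> carrier (Sp m) ==> t \<in> carrier (Sp m) ==> k + m \<le> N ==>
  spin_shift k N (s \<otimes>\<^bsub>Sp m\<^esub> t) = spin_shift k N s \<otimes>\<^bsub>Sp N\<^esub> spin_shift k N t"
 by (auto simp: spin_carrier spin_shift_class spin_mult shift_word_closed)

lemma spin_shift_one: "k + m \<le> N ==> spin_shift k N \<one>\<^bsub>Sp m\<^esub> = \<one>\<^bsub>Sp N\<^esub>"
 by (simp add: spin_one spin_shift_class)

lemma spin_shift_z: "k + m \<le> N ==> spin_shift k N (spin_z m) = spin_z N"
 by (simp add: spin_z_def spin_shift_class)

lemma word_perm_shift:
 "w \<in> swords m ==> word_perm (shift_word k w) = (\<lambda>i. if i \<le> k then i else k + word_perm w (i - k))"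
proof (induction w)
 case Nil
 then show ?case by auto
next
 case (Cons a w)
 obtain x b where a: "a = (x, b)" by force
 have *: "gen_perm (shift_gen k x) = (\<lambda>i. if i \<le> k then i else k + gen_perm x (i - k))"
  using Cons.prems a by (cases x) (auto simp: Transposition.transpose_def fun_eq_iff)
 have pos: "word_perm w (i - k) > 0" if "i > k" for i
  using permutes_in_image[OF word_perm_permutes, of w m "i - k"] Cons.prems a that
   permutes_not_in[OF word_perm_permutes, of w m "i - k"]
  by (cases "i - k \<in> {1..m}") auto
 show ?case
 proof
  fix i show "word_perm (shift_word k (a # w)) i = (if i \<le> k then i else k + word_perm (a # w) (i - k))"
   using Cons a pos[of i] by (cases "i \<le> k") (auto simp: *)
 qed
qed

lemma spin_perm_shift:
 "t \<in> carrier (Sp m) ==> k + m \<le> N ==>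
  spin_perm (spin_shift k N t) = (\<lambda>i. if i \<le> k then i else k + spin_perm t (i - k))"
 by (auto simp: spin_carrier spin_shift_class spin_perm_class word_perm_shift shift_word_closed)

lemma spin_parity_shift:
 "t \<in> carrier (Sp m) ==> k + m \<le> N ==> spin_parity (spin_shift k N t) = spin_parity t"
proof -
 have "word_parity (shift_word k w) = word_parity w" for w
 proof (induction w)
  case (Cons a w)
  obtain x b where "a = (x, b)" by force
  then show ?case using Cons by (cases x) (auto simp: word_parity_def mod_Suc)
 qed simp
 then show "t \<in> carrier (Sp m) ==> k + m \<le> N ==> ?thesis"
  by (auto simp: spin_carrier spin_shift_class spin_parity_class shift_word_closed)
qed

lemma spin_induct [consumes 1, case_names one mult]:
 assumes "t \<in> carrier (Sp n)" and "P \<one>\<^bsub>Sp n\<^esub>"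
  and step: "\<And>x t. x \<in> spin_gens n ==> t \<in> carrier (Sp n) ==> P t ==>
   P (spin_class n [(x, False)] \<otimes>\<^bsub>Sp n\<^esub> t)"
 shows "P t"
proof -
 obtain w where w: "w \<in> swords n" "t = spin_class n w" using assms(1) by (auto simp: spin_carrier)
 obtain w' where w': "w' \<in> swords n" "scong n w w'" "\<forall>l\<in>set w'. \<not> snd l"
  using scong_positive[OF w(1)] by blast
 have "P (spin_class n w')" using w'(1,3)
 proof (induction w')
  case Nil
  then show ?case using assms(2) by (simp add: spin_one)
 next
  case (Cons a w)
  obtain x where a: "a = (x, False)" using Cons.prems by (cases a) auto
  show ?case using step[of x "spin_class n w"] Cons by (simp add: spin_mult a)
 qed
 then show ?thesis using w w' by (simp add: spin_class_eq[THEN iffD2])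
qed

text \<open>The relation xy = z^p yx. With a natural number as exponent, exponents simply add along
  products and only their parity is compared at the end.\<close>

definition zcommute :: "nat => nat => spin_gen gword set => spin_gen gword set => bool" where
 "zcommute N p x y \<longleftrightarrow> x \<otimes>\<^bsub>Sp N\<^esub> y =
  (if even p then y \<otimes>\<^bsub>Sp N\<^esub> x else spin_z N \<otimes>\<^bsub>Sp N\<^esub> (y \<otimes>\<^bsub>Sp N\<^esub> x))"

lemma zcommute_mult_right:
 assumes "zcommute N p x y" "zcommute N q x y'"
  and "x \<in> carrier (Sp N)" "y \<in> carrier (Sp N)" "y' \<in> carrier (Sp N)"
 shows "zcommute N (p + q) x (y \<otimes>\<^bsub>Sp N\<^esub> y')"
proof -
 interpret group "Sp N" by (rule spin_group_group)
 let ?m = "(\<otimes>\<^bsub>Sp N\<^esub>)" and ?z = "spin_z N"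
 \<comment> \<open>\<open>zp p\<close> is z^p; it merges the two cases of \<open>zcommute\<close>
   into one equation.\<close>
 define zp where "zp p = (if even p then \<one>\<^bsub>Sp N\<^esub> else ?z)" for p :: nat
 have c: "zp p \<in> carrier (Sp N)" for p by (simp add: zp_def)
 have zc: "?m (zp p) x = ?m x (zp p)" if "x \<in> carrier (Sp N)" for p x
  using spin_z_central[OF that] that by (simp add: zp_def)
 have zz: "?m (zp p) (zp q) = zp (p + q)" for p q by (auto simp: zp_def spin_z_square)
 have eq: "zcommute N p x y \<longleftrightarrow> ?m x y = ?m (zp p) (?m y x)"
  if "x \<in> carrier (Sp N)" "y \<in> carrier (Sp N)" for p x y
  using that by (simp add: zcommute_def zp_def)
 have "?m x (?m y y') = ?m (?m (zp p) (?m y x)) y'" using assms eq by (simp flip: m_assoc)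
 also have "\<dots> = ?m (zp p) (?m y (?m x y'))" using assms c by (simp add: m_assoc)
 also have "?m x y' = ?m (zp q) (?m y' x)" using assms eq by simp
 also have "?m y (?m (zp q) (?m y' x)) = ?m (?m y (zp q)) (?m y' x)" using assms c by (simp add: m_assoc)
 also have "?m y (zp q) = ?m (zp q) y" by (rule zc[OF assms(4), symmetric])
 also have "?m (zp p) (?m (?m (zp q) y) (?m y' x)) = ?m (?m (zp p) (zp q)) (?m (?m y y') x)"
  using assms c by (simp add: m_assoc)
 finally show ?thesis using assms zz by (simp add: eq)
qed

lemma zcommute_cong: "zcommute N p x y ==> even p = even q ==> zcommute N q x y"
 by (simp add: zcommute_def)

lemma zcommute_sym:
 assumes "zcommute N p x y" "x \<in> carrier (Sp N)" "y \<in> carrier (Sp N)"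
 shows "zcommute N p y x"
proof -
 interpret group "Sp N" by (rule spin_group_group)
 have "y \<otimes>\<^bsub>Sp N\<^esub> x =
   spin_z N \<otimes>\<^bsub>Sp N\<^esub> (spin_z N \<otimes>\<^bsub>Sp N\<^esub> (y \<otimes>\<^bsub>Sp N\<^esub> x))"
  using assms m_assoc[of "spin_z N" "spin_z N" "y \<otimes>\<^bsub>Sp N\<^esub> x"] by (simp add: spin_z_square)
 then show ?thesis using assms(1) by (cases "even p") (simp_all add: zcommute_def)
qed

lemma zcommute_one: "x \<in> carrier (Sp N) ==> zcommute N 0 x \<one>\<^bsub>Sp N\<^esub>"
proof -
 interpret group "Sp N" by (rule spin_group_group)
 show "x \<in> carrier (Sp N) ==> ?thesis" by (simp add: zcommute_def)
qed

text \<open>Generators t of the two blocks anticommute up to z, and z commutes with everything.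
  Induction over each factor then accumulates one z for every pair of t's, whose number has the
  parity d(s) d(t).\<close>

lemma zcommute_shift:
 assumes "s \<in> carrier (Sp n)" "t \<in> carrier (Sp m)" "n + m \<le> N"
 shows "zcommute N (spin_parity s * spin_parity t) (spin_shift 0 N s) (spin_shift n N t)"
proof -
 interpret group "Sp N" by (rule spin_group_group)
 have zcz: "zcommute N 0 x (spin_z N)" if "x \<in> carrier (Sp N)" for x
  using spin_z_central[OF that] by (simp add: zcommute_def)
 have gen: "zcommute N (word_parity [(x, False)] * word_parity [(y, False)])
   (spin_class N [(x, False)]) (spin_class N [(shift_gen n y, False)])"
  if x: "x \<in> spin_gens n" and y: "y \<in> spin_gens m" for x y
 proof (cases "x = Z \<or> y = Z")
  case True
  have "spin_class N [(x, False)] \<in> carrier (Sp N)"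
   "spin_class N [(shift_gen n y, False)] \<in> carrier (Sp N)"
   using x y assms(3) by (cases x; cases y; auto)+
  then show ?thesis using True zcz zcommute_sym[OF zcz]
   by (auto simp: word_parity_def spin_z_def)
 next
  case False
  then obtain i j where ij: "x = T i" "y = T j" by (cases x; cases y) auto
  \<comment> \<open>The gap left between the blocks (t_n belongs to neither) makes the indices
    differ by at least two: i < n and j \<ge> 1.\<close>
  then have "scong N [lt (n + j), lt i] [lz, lt i, lt (n + j)]"
   using x y assms(3) by (intro scong_far) auto
  then have *: "spin_class N [lt (n + j), lt i] = spin_class N [lz, lt i, lt (n + j)]"
   using word_cong_gwords by (subst spin_class_eq) blast+
  have w: "[lt (n + j)] \<in> swords N" "[lt i] \<in> swords N" "[lz] \<in> swords N" "[lt i, lt (n + j)] \<in> swords N"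
   using x y ij assms(3) by auto
  have "zcommute N 1 (spin_class N [lt (n + j)]) (spin_class N [lt i])"
   using * spin_mult[OF w(1,2)] spin_mult[OF w(2,1)] spin_mult[OF w(3,4)]
   by (simp add: zcommute_def spin_z_def)
  then have "zcommute N 1 (spin_class N [lt i]) (spin_class N [lt (n + j)])"
   by (rule zcommute_sym) (use w in auto)
  then show ?thesis by (simp add: ij word_parity_def)
 qed
 have cl: "spin_class N [(x, False)] \<in> carrier (Sp N)" if "x \<in> spin_gens n" for x
  using that assms(3) by (cases x) (auto intro!: spin_class_closed)
 have cr: "spin_class N [(shift_gen n y, False)] \<in> carrier (Sp N)" if "y \<in> spin_gens m" for y
  using that assms(3) by (cases y) (auto intro!: spin_class_closed)
 have right: "zcommute N (word_parity [(x, False)] * spin_parity t)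
   (spin_class N [(x, False)]) (spin_shift n N t)" if x: "x \<in> spin_gens n" for x
  using assms(2)
 proof (induction rule: spin_induct)
  case one
  then show ?case using zcommute_one[of "spin_class N [(x, False)]" N] x assms(3)
   by (cases x) (auto simp: spin_parity_one spin_shift_one)
 next
  case (mult y t)
  have ct: "spin_shift n N t \<in> carrier (Sp N)"
   using mult(2) assms(3) by (rule spin_shift_closed)
  have "zcommute N (word_parity [(x, False)] * word_parity [(y, False)] +
   word_parity [(x, False)] * spin_parity t)
   (spin_class N [(x, False)]) (spin_class N [(shift_gen n y, False)] \<otimes>\<^bsub>Sp N\<^esub> spin_shift n N t)"
   by (rule zcommute_mult_right[OF gen[OF x mult(1)] mult(3) cl[OF x] cr[OF mult(1)] ct])
  moreover have "spin_shift n N (spin_class m [(y, False)] \<otimes>\<^bsub>Sp m\<^esub> t) =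
    spin_class N [(shift_gen n y, False)] \<otimes>\<^bsub>Sp N\<^esub> spin_shift n N t"
   using mult assms(3) by (simp add: spin_shift_mult spin_shift_class)
  moreover have "spin_parity (spin_class m [(y, False)] \<otimes>\<^bsub>Sp m\<^esub> t) =
    (word_parity [(y, False)] + spin_parity t) mod 2"
   using mult by (simp add: spin_parity_mult spin_parity_class)
  ultimately show ?case by (simp only:) (erule zcommute_cong, auto)
 qed
 show ?thesis using assms(1)
 proof (induction rule: spin_induct)
  case one
  then show ?case using zcommute_one[of "spin_shift n N t" N] assms
   by (auto simp: spin_parity_one spin_shift_one spin_shift_closed intro: zcommute_sym)
 next
  case (mult x s)
  have cs: "spin_shift 0 N s \<in> carrier (Sp N)" "spin_shift n N t \<in> carrier (Sp N)"
   using mult(2) assms by (auto intro!: spin_shift_closed)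
  have "zcommute N (word_parity [(x, False)] * spin_parity t + spin_parity s * spin_parity t)
   (spin_shift n N t) (spin_class N [(x, False)] \<otimes>\<^bsub>Sp N\<^esub> spin_shift 0 N s)"
   by (rule zcommute_mult_right[OF zcommute_sym[OF right[OF mult(1)] cl[OF mult(1)] cs(2)]
      zcommute_sym[OF mult(3) cs] cs(2) cl[OF mult(1)] cs(1)])
  then have "zcommute N (word_parity [(x, False)] * spin_parity t + spin_parity s * spin_parity t)
   (spin_class N [(x, False)] \<otimes>\<^bsub>Sp N\<^esub> spin_shift 0 N s) (spin_shift n N t)"
   by (rule zcommute_sym[OF _ cs(2) m_closed[OF cl[OF mult(1)] cs(1)]])
  moreover have "spin_shift 0 N (spin_class n [(x, False)] \<otimes>\<^bsub>Sp n\<^esub> s) =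
    spin_class N [(x, False)] \<otimes>\<^bsub>Sp N\<^esub> spin_shift 0 N s"
   using mult assms(3) by (simp add: spin_shift_mult spin_shift_class)
  moreover have "spin_parity (spin_class n [(x, False)] \<otimes>\<^bsub>Sp n\<^esub> s) =
    (word_parity [(x, False)] + spin_parity s) mod 2"
   using mult by (simp add: spin_parity_mult spin_parity_class)
  ultimately show ?case by (simp only:) (erule zcommute_cong, auto)
 qed
qed

section \<open>Decorated permutations\<close>

type_synonym 'a dp = "(nat => 'a) \<times> (nat => nat)"

text \<open>Elements of the wreath product without spin part, but on an arbitrary set of points, so
  that restriction to a union of cycles needs no renumbering. The extensional function space makes
  equality decidable on I alone.\<close>

definition dperm :: "('a, 'b) monoid_scheme => nat set => 'a dp set" where
 "dperm G I = (I \<rightarrow>\<^sub>E carrier G) \<times> {p. p permutes I}"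

definition dres :: "nat set => 'a dp => 'a dp" where
 "dres A x = (restrict (fst x) A, \<lambda>i. if i \<in> A then snd x i else i)"

definition djoin :: "nat set => 'a dp => 'a dp => 'a dp" where
 "djoin A x y = (\<lambda>i. if i \<in> A then fst x i else fst y i, \<lambda>i. if i \<in> A then snd x i else snd y i)"

text \<open>Inversion in the wreath product: the image of \<open>inv\<close> under the projection
  forgetting spin (\<open>pr_inv\<close>).\<close>

definition dinv :: "('a, 'b) monoid_scheme => nat set => 'a dp => 'a dp" where
 "dinv G I x = (\<lambda>i\<in>I. inv\<^bsub>G\<^esub> (fst x (snd x i)), inv_into UNIV (snd x))"

text \<open>On a finite set these are exactly the unions of cycles, the subsets along which an
  element splits as a product in a Young subgroup.\<close>

definition invs :: "nat set => 'a dp => nat set set" where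
 "invs I x = {A. A \<subseteq> I \<and> snd x ` A = A}"

text \<open>For I = J this is conjugation by the element with decoration h and permutation s
  (\<open>conj_diso\<close>), written so that it also makes sense between different sets of points.
  The equation is stated at the point \<open>snd x i\<close> to avoid inverse permutations.\<close>

definition diso_via :: "('a, 'b) monoid_scheme => (nat => nat) => (nat => 'a) =>
  nat set => 'a dp => nat set => 'a dp => bool" where
 "diso_via G s h I x J y \<longleftrightarrow> bij_betw s I J \<and> (\<forall>j\<in>J. h j \<in> carrier G) \<and>
  (\<forall>i\<in>I. snd y (s i) = s (snd x i) \<and>
    fst y (s (snd x i)) = h (s (snd x i)) \<otimes>\<^bsub>G\<^esub> fst x (snd x i) \<otimes>\<^bsub>G\<^esub> inv\<^bsub>G\<^esub> (h (s i)))"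

lemma dperm_iff: "x \<in> dperm G I \<longleftrightarrow> fst x \<in> I \<rightarrow>\<^sub>E carrier G \<and> snd x permutes I"
 by (cases x) (simp add: dperm_def)

lemma dperm_fst: "x \<in> dperm G I ==> i \<in> I ==> fst x i \<in> carrier G"
 by (auto simp: dperm_iff)

lemma dperm_fst_outside: "x \<in> dperm G I ==> i \<notin> I ==> fst x i = undefined"
 by (auto simp: dperm_iff)

lemma dperm_snd: "x \<in> dperm G I ==> snd x permutes I"
 by (simp add: dperm_iff)

lemma dperm_snd_mem: "x \<in> dperm G I ==> snd x i \<in> I \<longleftrightarrow> i \<in> I"
 by (simp add: dperm_iff permutes_in_image)

lemma dperm_snd_outside: "x \<in> dperm G I ==> i \<notin> I ==> snd x i = i"
 using permutes_not_in[of "snd x" I i] by (simp add: dperm_iff)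

lemma dperm_inj: "x \<in> dperm G I ==> inj (snd x)"
 using permutes_inj[of "snd x" I] by (simp add: dperm_iff)

lemma dperm_image: "x \<in> dperm G I ==> snd x ` I = I"
 by (simp add: dperm_iff permutes_image)

lemma dperm_eqI:
 assumes "x \<in> dperm G I" "y \<in> dperm G I"
  and "\<And>i. i \<in> I ==> fst x i = fst y i" "\<And>i. i \<in> I ==> snd x i = snd y i"
 shows "x = y"
proof (intro prod_eqI ext)
 fix i show "fst x i = fst y i" "snd x i = snd y i"
  using assms dperm_fst_outside[OF assms(1), of i] dperm_fst_outside[OF assms(2), of i]
   dperm_snd_outside[OF assms(1), of i] dperm_snd_outside[OF assms(2), of i]
  by (cases "i \<in> I"; simp)+
qed

lemma permutes_restrict:
 assumes "p ` A = A" "inj p"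
 shows "(\<lambda>i. if i \<in> A then p i else i) permutes A"
proof (rule bij_imp_permutes)
 have "bij_betw p A A" using assms by (auto simp: bij_betw_def intro: inj_on_subset)
 then show "bij_betw (\<lambda>i. if i \<in> A then p i else i) A A"
  by (rule bij_betw_cong[THEN iffD1, rotated]) simp
qed simp

lemma invsD: "A \<in> invs I x ==> A \<subseteq> I" "A \<in> invs I x ==> i \<in> A ==> snd x i \<in> A"
 by (auto simp: invs_def)

lemma finite_invs: "finite I ==> finite (invs I x)"
 by (rule finite_subset[of _ "Pow I"]) (auto simp: invs_def)

lemma empty_invs: "{} \<in> invs I x"
 by (simp add: invs_def)

lemma invs_full: "x \<in> dperm G I ==> I \<in> invs I x"
 by (simp add: invs_def dperm_image)

lemma invs_diff:
 assumes "x \<in> dperm G I" "A \<in> invs I x" "B \<in> invs I x" shows "A - B \<in> invs I x"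
 using assms image_set_diff[OF dperm_inj[OF assms(1)], of A B] by (auto simp: invs_def)

lemma invs_compl: "x \<in> dperm G I ==> A \<in> invs I x ==> I - A \<in> invs I x"
 by (rule invs_diff[OF _ invs_full])

lemma invs_Int:
 assumes "x \<in> dperm G I" "A \<in> invs I x" "B \<in> invs I x" shows "A \<inter> B \<in> invs I x"
 using invs_diff[OF assms(1,2) invs_diff[OF assms]] by (simp add: Diff_Diff_Int)

lemma invs_Un: "A \<in> invs I x ==> B \<in> invs I x ==> A \<union> B \<in> invs I x"
 by (auto simp: invs_def image_Un)

lemma dres_closed: "x \<in> dperm G I ==> A \<in> invs I x ==> dres A x \<in> dperm G A"
 using invsD(1)[of A I x] permutes_restrict[OF _ dperm_inj, of x A G I]
 by (auto simp: dperm_iff dres_def invs_def)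

lemma dres_dres: "B \<subseteq> A ==> dres B (dres A x) = dres B x"
 by (auto simp: dres_def restrict_def fun_eq_iff)

lemma dres_self: "x \<in> dperm G I ==> dres I x = x"
 by (auto simp: dres_def dperm_fst_outside dperm_snd_outside fun_eq_iff intro!: prod_eqI)

lemma invs_dres: "A \<in> invs I x ==> invs A (dres A x) = {B \<in> invs I x. B \<subseteq> A}"
proof -
 have "snd (dres A x) ` B = snd x ` B" if "B \<subseteq> A" for B
  using that by (auto simp: dres_def image_iff)
 then have "invs A (dres A x) = {B. B \<subseteq> A \<and> snd x ` B = B}"
  by (simp add: invs_def cong: conj_cong)
 then show "A \<in> invs I x ==> ?thesis" by (auto simp: invs_def)
qed

lemma djoin_closed:
 assumes "x \<in> dperm G A" "y \<in> dperm G B" "A \<inter> B = {}"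
 shows "djoin A x y \<in> dperm G (A \<union> B)"
proof -
 have "bij_betw (snd x) A A" "bij_betw (snd y) B B"
  using assms by (auto simp: dperm_iff intro: permutes_imp_bij)
 then have "bij_betw (snd (djoin A x y)) A A" "bij_betw (snd (djoin A x y)) B B"
  using assms(3) by (auto simp: djoin_def elim!: bij_betw_cong[THEN iffD1, rotated])
 then have "bij_betw (snd (djoin A x y)) (A \<union> B) (A \<union> B)"
  using assms(3) by (rule bij_betw_combine)
 moreover have "snd (djoin A x y) i = i" if "i \<notin> A \<union> B" for i
  using that assms by (simp add: djoin_def dperm_snd_outside)
 ultimately have "snd (djoin A x y) permutes (A \<union> B)" by (rule bij_imp_permutes)
 moreover have "fst (djoin A x y) \<in> A \<union> B \<rightarrow>\<^sub>E carrier G"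
  using assms by (auto simp: djoin_def dperm_iff PiE_iff extensional_def)
 ultimately show ?thesis by (simp add: dperm_iff)
qed

lemma djoin_invs_iff:
 assumes "x \<in> dperm G A" "y \<in> dperm G B" "A \<inter> B = {}"
 shows "C \<in> invs (A \<union> B) (djoin A x y) \<longleftrightarrow> C \<subseteq> A \<union> B \<and> C \<inter> A \<in> invs A x \<and> C \<inter> B \<in> invs B y"
proof -
 have x: "snd x ` D \<subseteq> A" if "D \<subseteq> A" for D using that dperm_snd_mem[OF assms(1)] by auto
 have y: "snd y ` D \<subseteq> B" if "D \<subseteq> B" for D using that dperm_snd_mem[OF assms(2)] by auto
 have im: "snd (djoin A x y) ` C = snd x ` (C \<inter> A) \<union> snd y ` (C \<inter> B)" if "C \<subseteq> A \<union> B"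
 proof -
  have "C = (C \<inter> A) \<union> (C \<inter> B)" using that by blast
  then have "snd (djoin A x y) ` C = snd (djoin A x y) ` (C \<inter> A) \<union> snd (djoin A x y) ` (C \<inter> B)"
   by (metis image_Un)
  moreover have "snd (djoin A x y) ` (C \<inter> A) = snd x ` (C \<inter> A)"
   by (rule image_cong) (auto simp: djoin_def)
  moreover have "snd (djoin A x y) ` (C \<inter> B) = snd y ` (C \<inter> B)"
   by (rule image_cong) (use assms(3) in \<open>auto simp: djoin_def\<close>)
  ultimately show ?thesis by simp
 qed
 have eq: "U \<union> V = C \<longleftrightarrow> U = C \<inter> A \<and> V = C \<inter> B"
  if "U \<subseteq> A" "V \<subseteq> B" "C \<subseteq> A \<union> B" for U V :: "nat set"
  using that assms(3) by blast
 show ?thesis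
 proof (cases "C \<subseteq> A \<union> B")
  case True
  then show ?thesis using eq[OF x[of "C \<inter> A"] y[of "C \<inter> B"] True] im[OF True]
   by (simp add: invs_def)
 qed (simp add: invs_def)
qed

lemma djoin_invs:
 assumes "x \<in> dperm G A" "y \<in> dperm G B" "A \<inter> B = {}"
 shows "A \<in> invs (A \<union> B) (djoin A x y)" "B \<in> invs (A \<union> B) (djoin A x y)"
 using assms invs_full[OF assms(1)] invs_full[OF assms(2)] empty_invs[of A x] empty_invs[of B y]
 by (simp_all add: djoin_invs_iff Int_commute)

lemma dres_djoin:
 assumes "x \<in> dperm G A" "y \<in> dperm G B" "A \<inter> B = {}" "C \<in> invs (A \<union> B) (djoin A x y)"
 shows "dres C (djoin A x y) = djoin (C \<inter> A) (dres (C \<inter> A) x) (dres (C \<inter> B) y)"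
proof -
 have "C \<subseteq> A \<union> B" using invsD(1)[OF assms(4)] .
 then show ?thesis using assms(3)
  by (auto simp: dres_def djoin_def restrict_def fun_eq_iff)
qed

lemma dres_djoin_left:
 assumes "x \<in> dperm G A" shows "dres A (djoin A x y) = x"
 using assms by (auto simp: dres_def djoin_def restrict_def fun_eq_iff dperm_fst_outside
   dperm_snd_outside intro!: prod_eqI)

lemma dres_djoin_right:
 assumes "y \<in> dperm G B" "A \<inter> B = {}" shows "dres B (djoin A x y) = y"
 using assms by (auto simp: dres_def djoin_def restrict_def fun_eq_iff dperm_fst_outside
   dperm_snd_outside intro!: prod_eqI)

lemma djoin_dres:
 assumes "x \<in> dperm G I" "A \<subseteq> I" shows "djoin A (dres A x) (dres (I - A) x) = x"
 using assms by (auto simp: dres_def djoin_def restrict_def fun_eq_iff dperm_fst_outside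
   dperm_snd_outside intro!: prod_eqI)

lemma djoin_assoc:
 "djoin (A \<union> B) (djoin A x y) z = djoin A x (djoin B y z)"
 by (auto simp: djoin_def fun_eq_iff)

text \<open>Lets a sum over decorated permutations preserving A be written as a double sum over the
  two pieces.\<close>

lemma djoin_bij:
 assumes "A \<inter> B = {}"
 shows "bij_betw (\<lambda>(x, y). djoin A x y) (dperm G A \<times> dperm G B)
  {x \<in> dperm G (A \<union> B). A \<in> invs (A \<union> B) x}"
proof (rule bij_betw_byWitness[where f' = "\<lambda>x. (dres A x, dres B x)"])
 show "\<forall>a\<in>dperm G A \<times> dperm G B.
   (dres A (case a of (x, y) => djoin A x y), dres B (case a of (x, y) => djoin A x y)) = a"
  using assms by (auto simp: dres_djoin_left dres_djoin_right)
 have B: "A \<union> B - A = B" using assms by auto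
 show "\<forall>x\<in>{x \<in> dperm G (A \<union> B). A \<in> invs (A \<union> B) x}.
   (case (dres A x, dres B x) of (x, y) => djoin A x y) = x"
  using djoin_dres[of _ G "A \<union> B" A] by (auto simp: B)
 show "(\<lambda>(x, y). djoin A x y) ` (dperm G A \<times> dperm G B) \<subseteq> {x \<in> dperm G (A \<union> B). A \<in> invs (A \<union> B) x}"
  using assms djoin_closed djoin_invs(1) by fastforce
 show "(\<lambda>x. (dres A x, dres B x)) ` {x \<in> dperm G (A \<union> B). A \<in> invs (A \<union> B) x} \<subseteq> dperm G A \<times> dperm G B"
  using dres_closed[of _ G "A \<union> B"] invs_compl[of _ G "A \<union> B" A] by (auto simp: B)
qed

section \<open>Cycles as minimal invariant subsets\<close>

definition cyc :: "nat set => 'a dp => bool" where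
 "cyc A x \<longleftrightarrow> A \<noteq> {} \<and> (\<forall>B\<in>invs A x. B = {} \<or> B = A)"

definition atoms :: "nat set => 'a dp => nat set set" where
 "atoms I x = {A \<in> invs I x. cyc A (dres A x)}"

lemma atoms_iff:
 "A \<in> atoms I x \<longleftrightarrow> A \<in> invs I x \<and> A \<noteq> {} \<and> (\<forall>B\<in>invs I x. B \<subseteq> A \<longrightarrow> B = {} \<or> B = A)"
 by (cases "A \<in> invs I x") (simp_all add: atoms_def cyc_def invs_dres Ball_def imp_conjL)

lemma finite_atoms: "finite I ==> finite (atoms I x)"
 by (rule finite_subset[OF _ finite_invs]) (auto simp: atoms_def)

lemma atom_subset_or_disjoint:
 assumes "x \<in> dperm G I" "A \<in> atoms I x" "B \<in> invs I x"
 shows "A \<subseteq> B \<or> A \<inter> B = {}"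
proof -
 have A: "A \<in> invs I x" and min: "\<forall>B\<in>invs I x. B \<subseteq> A \<longrightarrow> B = {} \<or> B = A"
  using assms(2) unfolding atoms_iff by simp_all
 have "A \<inter> B = {} \<or> A \<inter> B = A"
  using min invs_Int[OF assms(1) A assms(3)] by simp
 then show ?thesis by (simp add: le_iff_inf disj_commute)
qed

lemma atoms_disjoint:
 assumes "x \<in> dperm G I" "A \<in> atoms I x" "B \<in> atoms I x" "A \<noteq> B"
 shows "A \<inter> B = {}"
 using atom_subset_or_disjoint[OF assms(1,2), of B] atom_subset_or_disjoint[OF assms(1,3), of A] assms
 by (auto simp: atoms_def)

text \<open>Take a minimal invariant set A containing i. An invariant subset of A that misses i has
  an invariant complement in A, which contains i and so must be all of A.\<close>

lemma ex_atom:
 assumes x: "x \<in> dperm G I" and I: "finite I" "i \<in> I"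
 shows "\<exists>A\<in>atoms I x. i \<in> A"
proof -
 define S where "S = {A \<in> invs I x. i \<in> A}"
 have "finite S" "S \<noteq> {}" using finite_invs[OF I(1), of x] invs_full[OF x] I by (auto simp: S_def)
 then obtain A where A: "A \<in> S" "\<And>B. B \<in> S ==> \<not> B \<subset> A"
  using finite_has_minimal[of S] by (metis psubset_eq)
 have "B = {} \<or> B = A" if B: "B \<in> invs I x" "B \<subseteq> A" for B
 proof (cases "i \<in> B")
  case True
  then show ?thesis using A(2)[of B] B by (auto simp: S_def)
 next
  case False
  then have "A - B \<in> S" using invs_diff[OF x _ B(1), of A] A(1) by (auto simp: S_def)
  then show ?thesis using A(2)[of "A - B"] B(2) by auto
 qed
 then show ?thesis using A(1) by (intro bexI[of _ A]) (auto simp: atoms_iff S_def)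
qed

lemma Union_atoms: "x \<in> dperm G I ==> finite I ==> \<Union> (atoms I x) = I"
proof (intro equalityI subsetI)
 fix i assume "i \<in> \<Union> (atoms I x)"
 then obtain A where "A \<in> invs I x" "i \<in> A" by (auto simp: atoms_def)
 then show "i \<in> I" using invsD(1) by blast
next
 fix i assume "x \<in> dperm G I" "finite I" "i \<in> I"
 then show "i \<in> \<Union> (atoms I x)" using ex_atom by blast
qed

lemma sum_card_atoms:
 assumes "x \<in> dperm G I" "finite I" shows "(\<Sum>A\<in>atoms I x. card A) = card I"
proof -
 have "card (\<Union> (atoms I x)) = (\<Sum>A\<in>atoms I x. card A)"
 proof (rule card_Union_disjoint)
  show "pairwise disjnt (atoms I x)"
   using atoms_disjoint[OF assms(1)] by (simp add: pairwise_def disjnt_def)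
  fix A assume "A \<in> atoms I x"
  then have "A \<in> invs I x" by (simp add: atoms_def)
  then show "finite A" by (intro finite_subset[OF invsD(1) assms(2)])
 qed
 then show ?thesis using Union_atoms[OF assms] by simp
qed

lemma atoms_djoin:
 assumes "x \<in> dperm G A" "y \<in> dperm G B" "A \<inter> B = {}"
 shows "atoms (A \<union> B) (djoin A x y) = atoms A x \<union> atoms B y"
proof -
 let ?z = "djoin A x y"
 have z: "?z \<in> dperm G (A \<union> B)" using assms by (rule djoin_closed)
 have ex: "invs A x = {C \<in> invs (A \<union> B) ?z. C \<subseteq> A}" "invs B y = {C \<in> invs (A \<union> B) ?z. C \<subseteq> B}"
  using invs_dres[OF djoin_invs(1)[OF assms]] invs_dres[OF djoin_invs(2)[OF assms]]
   dres_djoin_left[OF assms(1)] dres_djoin_right[OF assms(2,3)] by simp_all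
 show ?thesis
 proof (intro equalityI subsetI)
  fix C assume C: "C \<in> atoms (A \<union> B) ?z"
  then have "C \<in> invs (A \<union> B) ?z" by (simp add: atoms_def)
  then have "C \<subseteq> A \<union> B" by (rule invsD(1))
  then have "C \<subseteq> A \<or> C \<subseteq> B"
   using atom_subset_or_disjoint[OF z C djoin_invs(1)[OF assms]] by auto
  then show "C \<in> atoms A x \<union> atoms B y" using C by (auto simp: atoms_iff ex)
 next
  fix C assume "C \<in> atoms A x \<union> atoms B y"
  then show "C \<in> atoms (A \<union> B) ?z" by (auto simp: atoms_iff ex)
 qed
qed

section \<open>Isomorphisms of decorated permutations\<close>

lemma diso_via_inj: "diso_via G s h I x J y ==> inj_on s I"
 by (simp add: diso_via_def bij_betw_def)

lemma diso_via_image: "diso_via G s h I x J y ==> s ` I = J"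
 by (simp add: diso_via_def bij_betw_def)

lemma diso_image_invs:
 assumes "x \<in> dperm G I" "diso_via G s h I x J y" "A \<subseteq> I"
 shows "s ` A \<in> invs J y \<longleftrightarrow> A \<in> invs I x"
proof -
 have sub: "snd x ` A \<subseteq> I" using assms(3) dperm_snd_mem[OF assms(1)] by auto
 have "snd y (s i) = s (snd x i)" if "i \<in> A" for i
  using assms(2,3) that by (auto simp: diso_via_def)
 then have "snd y ` s ` A = s ` snd x ` A"
  by (simp add: image_image cong: image_cong)
 then have "snd y ` s ` A = s ` A \<longleftrightarrow> snd x ` A = A"
  using inj_on_image_eq_iff[OF diso_via_inj[OF assms(2)] sub assms(3)] by simp
 then show ?thesis using assms diso_via_image[OF assms(2)] by (auto simp: invs_def)
qed

lemma invs_diso: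
 assumes "x \<in> dperm G I" "diso_via G s h I x J y"
 shows "bij_betw (image s) (invs I x) (invs J y)"
proof (rule bij_betw_imageI)
 show "inj_on (image s) (invs I x)"
 proof (rule inj_onI)
  fix A B assume AB: "A \<in> invs I x" "B \<in> invs I x" and eq: "s ` A = s ` B"
  show "A = B"
   using inj_on_image_eq_iff[OF diso_via_inj[OF assms(2)] invsD(1)[OF AB(1)] invsD(1)[OF AB(2)]] eq
   by simp
 qed
 show "image s ` invs I x = invs J y"
 proof (intro equalityI subsetI)
  fix B assume B: "B \<in> invs J y"
  then have "B \<subseteq> s ` I" using invsD(1)[OF B] diso_via_image[OF assms(2)] by simp
  then obtain A where A: "A \<subseteq> I" "B = s ` A" unfolding subset_image_iff by auto
  then show "B \<in> image s ` invs I x" using diso_image_invs[OF assms A(1)] B by auto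
 next
  fix B assume "B \<in> image s ` invs I x"
  then obtain A where A: "A \<in> invs I x" "B = s ` A" by auto
  then show "B \<in> invs J y" using diso_image_invs[OF assms invsD(1)[OF A(1)]] by simp
 qed
qed

lemma diso_dres:
 assumes "x \<in> dperm G I" "diso_via G s h I x J y" "A \<in> invs I x"
 shows "diso_via G s h A (dres A x) (s ` A) (dres (s ` A) y)"
proof -
 have A: "A \<subseteq> I" using invsD(1)[OF assms(3)] .
 have "snd x i \<in> A" if "i \<in> A" for i using that invsD(2)[OF assms(3)] by simp
 then show ?thesis using assms(2) A
  by (auto simp: diso_via_def dres_def bij_betw_def intro: inj_on_subset)
qed

lemma atoms_diso:
 assumes "x \<in> dperm G I" "diso_via G s h I x J y"
 shows "bij_betw (image s) (atoms I x) (atoms J y)"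
proof -
 have *: "s ` A \<in> atoms J y \<longleftrightarrow> A \<in> atoms I x" if A: "A \<in> invs I x" for A
 proof -
  have inj: "s ` B \<subseteq> s ` A \<longleftrightarrow> B \<subseteq> A" "s ` B = s ` A \<longleftrightarrow> B = A" if "B \<in> invs I x" for B
  proof -
   note i = diso_via_inj[OF assms(2)]
   have AB: "A \<subseteq> I" "B \<subseteq> I" using invsD(1)[OF A] invsD(1)[OF that] .
   show "s ` B = s ` A \<longleftrightarrow> B = A" by (rule inj_on_image_eq_iff[OF i AB(2,1)])
   show "s ` B \<subseteq> s ` A \<longleftrightarrow> B \<subseteq> A"
    using inj_on_image_mem_iff[OF i _ AB(1)] AB(2) by blast
  qed
  have "invs J y = image s ` invs I x" using invs_diso[OF assms] by (simp add: bij_betw_def)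
  then show ?thesis using A inj diso_image_invs[OF assms invsD(1)[OF A]] by (simp add: atoms_iff)
 qed
 show ?thesis
 proof (rule bij_betw_subset[OF invs_diso[OF assms]])
  show "atoms I x \<subseteq> invs I x" by (auto simp: atoms_def)
  show "image s ` atoms I x = atoms J y"
  proof (intro equalityI subsetI)
   fix B assume B: "B \<in> atoms J y"
   then have "B \<in> image s ` invs I x"
    using invs_diso[OF assms] by (simp add: bij_betw_def atoms_def)
   then obtain A where "A \<in> invs I x" "B = s ` A" by blast
   then show "B \<in> image s ` atoms I x" using * B by simp
  next
   fix B assume "B \<in> image s ` atoms I x"
   then obtain A where "A \<in> atoms I x" "B = s ` A" by blast
   then show "B \<in> atoms J y" using *[of A] by (simp add: atoms_def)
  qed
 qed
qed

lemma diso_djoin: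
 assumes "diso_via G s h A x A' x'" "diso_via G t k B y B' y'"
  and "x \<in> dperm G A" "y \<in> dperm G B" "A \<inter> B = {}" "A' \<inter> B' = {}"
 shows "diso_via G (\<lambda>i. if i \<in> A then s i else t i) (\<lambda>j. if j \<in> A' then h j else k j)
  (A \<union> B) (djoin A x y) (A' \<union> B') (djoin A' x' y')"
proof -
 have "bij_betw (\<lambda>i. if i \<in> A then s i else t i) (A \<union> B) (A' \<union> B')"
  using assms(1,2,5,6) unfolding diso_via_def
  by (intro bij_betw_disjoint_Un) auto
 moreover have "s i \<in> A'" if "i \<in> A" for i using that diso_via_image[OF assms(1)] by auto
 moreover have "t i \<in> B'" if "i \<in> B" for i using that diso_via_image[OF assms(2)] by auto
 moreover have "snd x i \<in> A \<longleftrightarrow> i \<in> A" "snd y i \<in> B \<longleftrightarrow> i \<in> B" for i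
  using dperm_snd_mem[OF assms(3)] dperm_snd_mem[OF assms(4)] by simp_all
 ultimately show ?thesis using assms(1,2,5,6)
  by (auto simp: diso_via_def djoin_def disjoint_iff)
qed

context group begin

lemma diso_refl:
 assumes "x \<in> dperm G I" shows "diso_via G id (\<lambda>_. \<one>) I x I x"
 using assms by (auto simp: diso_via_def dperm_snd_mem dperm_fst)

lemma diso_sym:
 assumes "x \<in> dperm G I" "y \<in> dperm G J" "diso_via G s h I x J y"
 shows "\<exists>t k. diso_via G t k J y I x"
proof -
 let ?t = "inv_into I s" and ?k = "\<lambda>i. inv (h (s i))"
 have s: "bij_betw s I J" and h: "h j \<in> carrier G" if "j \<in> J" for j
  using assms(3) that by (auto simp: diso_via_def)
 have "bij_betw ?t J I" using bij_betw_inv_into assms(3) by (auto simp: diso_via_def)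
 moreover have "\<forall>i\<in>I. ?k i \<in> carrier G" using assms(3) by (auto simp: diso_via_def bij_betw_def)
 moreover have "snd x (?t j) = ?t (snd y j) \<and>
   fst x (?t (snd y j)) = ?k (?t (snd y j)) \<otimes> fst y (snd y j) \<otimes> inv (?k (?t j))" if j: "j \<in> J" for j
 proof -
  obtain i where i: "i \<in> I" "j = s i" using j diso_via_image[OF assms(3)] by auto
  have si: "snd x i \<in> I" using i dperm_snd_mem[OF assms(1)] by simp
  have t: "?t (s i) = i" "?t (s (snd x i)) = snd x i"
   using i si diso_via_inj[OF assms(3)] by simp_all
  have y: "snd y (s i) = s (snd x i)"
   "fst y (s (snd x i)) = h (s (snd x i)) \<otimes> fst x (snd x i) \<otimes> inv (h (s i))"
   using assms(3) i by (auto simp: diso_via_def)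
  have c: "h (s i) \<in> carrier G" "h (s (snd x i)) \<in> carrier G" "fst x (snd x i) \<in> carrier G"
   using h i si diso_via_image[OF assms(3)] dperm_fst[OF assms(1)] by auto
  show ?thesis using c by (simp add: i(2) y t m_assoc inv_solve_left)
 qed
 ultimately have "diso_via G ?t ?k J y I x" by (simp add: diso_via_def)
 then show ?thesis by blast
qed

definition drel :: "(nat => nat) => nat set => nat set => 'a dp => 'a dp" where
 "drel s I J x = (\<lambda>j\<in>J. fst x (inv_into I s j), \<lambda>j. if j \<in> J then s (snd x (inv_into I s j)) else j)"

lemma drel_closed:
 assumes "bij_betw s I J" "x \<in> dperm G I" shows "drel s I J x \<in> dperm G J"
proof -
 have t: "bij_betw (inv_into I s) J I" using assms(1) by (rule bij_betw_inv_into)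
 have "bij_betw (s \<circ> (snd x \<circ> inv_into I s)) J J"
  using assms dperm_snd[OF assms(2)] by (intro bij_betw_trans[OF bij_betw_trans[OF t permutes_imp_bij]])
 then have "bij_betw (snd (drel s I J x)) J J"
  by (rule bij_betw_cong[THEN iffD1, rotated]) (simp add: drel_def)
 then have "snd (drel s I J x) permutes J"
  by (rule bij_imp_permutes) (simp add: drel_def)
 moreover have "fst (drel s I J x) \<in> J \<rightarrow>\<^sub>E carrier G"
  using assms(2) bij_betwE[OF t] by (auto simp: drel_def dperm_fst)
 ultimately show ?thesis by (simp add: dperm_iff)
qed

lemma drel_diso:
 assumes "bij_betw s I J" "x \<in> dperm G I"
 shows "diso_via G s (\<lambda>_. \<one>) I x J (drel s I J x)"
proof -
 have "inv_into I s (s i) = i" "s i \<in> J" if "i \<in> I" for i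
  using assms(1) that by (auto simp: bij_betw_def)
 then show ?thesis using assms(1) dperm_snd_mem[OF assms(2)] dperm_fst[OF assms(2)]
  by (simp add: diso_via_def drel_def)
qed

lemma drel_bij:
 assumes "bij_betw s I J" shows "bij_betw (drel s I J) (dperm G I) (dperm G J)"
proof (rule bij_betw_byWitness[where f' = "drel (inv_into I s) J I"])
 have t: "bij_betw (inv_into I s) J I" using assms by (rule bij_betw_inv_into)
 show "drel s I J ` dperm G I \<subseteq> dperm G J" "drel (inv_into I s) J I ` dperm G J \<subseteq> dperm G I"
  using drel_closed[OF assms] drel_closed[OF t] by auto
 have 1: "inv_into I s (s i) = i" "s i \<in> J" "inv_into J (inv_into I s) i = s i" if "i \<in> I" for i
  using assms that inv_into_inv_into_eq[OF assms] by (auto simp: bij_betw_def)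
 have 2: "s (inv_into I s j) = j" "inv_into I s j \<in> I" if "j \<in> J" for j
  using that assms bij_betwE[OF t] by (auto simp: bij_betw_inv_into_right)
 show "\<forall>x\<in>dperm G I. drel (inv_into I s) J I (drel s I J x) = x"
 proof
  fix x assume x: "x \<in> dperm G I"
  show "drel (inv_into I s) J I (drel s I J x) = x"
   by (rule dperm_eqI[OF drel_closed[OF t drel_closed[OF assms x]] x])
    (auto simp: drel_def 1 dperm_snd_mem[OF x])
 qed
 show "\<forall>y\<in>dperm G J. drel s I J (drel (inv_into I s) J I y) = y"
 proof
  fix y assume y: "y \<in> dperm G J"
  show "drel s I J (drel (inv_into I s) J I y) = y"
   by (rule dperm_eqI[OF drel_closed[OF assms drel_closed[OF t y]] y])
    (auto simp: drel_def 1 2 dperm_snd_mem[OF y])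
 qed
qed

lemma dinv_closed:
 assumes "x \<in> dperm G I" shows "dinv G I x \<in> dperm G I"
 using assms dperm_fst[OF assms] dperm_snd_mem[OF assms]
 by (auto simp: dperm_iff dinv_def permutes_inv)

lemma invs_dinv: "x \<in> dperm G I ==> invs I (dinv G I x) = invs I x"
proof -
 assume x: "x \<in> dperm G I"
 have "inv_into UNIV (snd x) ` A = A \<longleftrightarrow> snd x ` A = A" for A
 proof -
  have 1: "snd x ` inv_into UNIV (snd x) ` A = A" "inv_into UNIV (snd x) ` snd x ` A = A"
   by (simp_all add: image_comp permutes_inv_o[OF dperm_snd[OF x]])
  show ?thesis
  proof
   assume "inv_into UNIV (snd x) ` A = A"
   then show "snd x ` A = A" using 1(1) by simp
  next
   assume "snd x ` A = A"
   then show "inv_into UNIV (snd x) ` A = A" using 1(2) by simp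
  qed
 qed
 then show ?thesis by (simp add: invs_def dinv_def)
qed

lemma atoms_dinv: "x \<in> dperm G I ==> atoms I (dinv G I x) = atoms I x"
 using invs_dinv[of x I] by (auto simp: atoms_iff)

lemma inv_permutes_restrict:
 assumes "p permutes I" "p ` A = A" "i \<in> A"
 shows "inv_into UNIV (\<lambda>i. if i \<in> A then p i else i) i = inv_into UNIV p i"
proof -
 have r: "(\<lambda>i. if i \<in> A then p i else i) permutes A"
  by (rule permutes_restrict[OF assms(2) permutes_inj[OF assms(1)]])
 have "i \<in> p ` A" using assms(2,3) by simp
 then obtain j where j: "j \<in> A" "p j = i" by blast
 have "inv_into UNIV p i = j" using permutes_inverses(2)[OF assms(1), of j] j by simp
 moreover have "inv_into UNIV (\<lambda>i. if i \<in> A then p i else i) i = j"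
  using permutes_inverses(2)[OF r, of j] j by simp
 ultimately show ?thesis by simp
qed

lemma dinv_dres:
 assumes "x \<in> dperm G I" "A \<in> invs I x"
 shows "dres A (dinv G I x) = dinv G A (dres A x)"
proof -
 have A: "A \<in> invs I (dinv G I x)" using invs_dinv assms by simp
 show ?thesis
 proof (rule dperm_eqI[OF dres_closed[OF dinv_closed[OF assms(1)] A] dinv_closed[OF dres_closed[OF assms]]])
  fix i assume i: "i \<in> A"
  then have "i \<in> I" "snd x i \<in> A" using invsD[OF assms(2)] by auto
  then show "fst (dres A (dinv G I x)) i = fst (dinv G A (dres A x)) i"
   using i by (simp add: dres_def dinv_def)
  show "snd (dres A (dinv G I x)) i = snd (dinv G A (dres A x)) i"
   using i inv_permutes_restrict[OF dperm_snd[OF assms(1)], of A i] assms(2)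
   by (simp add: dres_def dinv_def invs_def)
 qed
qed

end

section \<open>Creation and annihilation on species\<close>

type_synonym 'a species = "nat set => 'a dp => complex"

definition iso_inv :: "('a, 'b) monoid_scheme => 'a species => bool" where
 "iso_inv G F \<longleftrightarrow> (\<forall>I J x y s h. finite I \<longrightarrow> x \<in> dperm G I \<longrightarrow> y \<in> dperm G J \<longrightarrow>
  diso_via G s h I x J y \<longrightarrow> F I x = F J y)"

text \<open>One species encodes all the functions \<open>chi\<close> for a fixed gamma at once:
  multiplicativity over disjoint unions is the property of the whole sequence that the commutation
  relations use.\<close>

definition mult_weight :: "('a, 'b) monoid_scheme => 'a species => bool" where
 "mult_weight G w \<longleftrightarrow> iso_inv G w \<and> (\<forall>x\<in>dperm G {}. w {} x = 1) \<and>
  (\<forall>A B x y. finite A \<longrightarrow> finite B \<longrightarrow> A \<inter> B = {} \<longrightarrow> x \<in> dperm G A \<longrightarrow> y \<in> dperm G B \<longrightarrow>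
    w (A \<union> B) (djoin A x y) = w A x * w B y)"

text \<open>The combinatorial source of H(z) H(-z) = 1. The condition is imposed only where the
  weight does not vanish, because permutations with a cycle of even length have to be
  excluded.\<close>

definition alternating :: "('a, 'b) monoid_scheme => 'a species => bool" where
 "alternating G w \<longleftrightarrow> (\<forall>I x. finite I \<longrightarrow> I \<noteq> {} \<longrightarrow> x \<in> dperm G I \<longrightarrow> w I x \<noteq> 0 \<longrightarrow>
  (\<Sum>A\<in>invs I x. (-1) ^ card A) = (0::complex))"

definition avg :: "('a, 'b) monoid_scheme => nat set => ('a dp => complex) => complex" where
 "avg G I f = (\<Sum>x\<in>dperm G I. f x) / of_nat (card (dperm G I))"

text \<open>The induced character formula with the cosets of the Young subgroup replaced by subsets:
  only invariant subsets contribute (\<open>R_mult_pos\<close>).\<close>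

definition Pop :: "'a species => nat => 'a species => 'a species" where
 "Pop w n F I x = (\<Sum>A | A \<in> invs I x \<and> card A = n. w A (dres A x) * F (I - A) (dres (I - A) x))"

text \<open>The points directly beyond the largest element of J; inserting 0 gives
  \<open>Max\<close> a value for empty J.\<close>

definition fresh :: "nat => nat set => nat set" where
 "fresh n J = (\<lambda>i. i + Max (insert 0 J)) ` {1..n}"

text \<open>Restriction to a Young subgroup followed by a pairing in the first factor. The weight
  \<open>v\<close> already incorporates the inversion in \<open>pairing\<close>.\<close>

definition Qop :: "('a, 'b) monoid_scheme => 'a species => nat => 'a species => 'a species" where
 "Qop G v n F J y = avg G (fresh n J) (\<lambda>x. v (fresh n J) x * F (fresh n J \<union> J) (djoin (fresh n J) x y))"

lemma iso_invD:
 "iso_inv G F ==> diso_via G s h I x J y ==> finite I ==> x \<in> dperm G I ==> y \<in> dperm G J ==> F I x = F J y"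
 unfolding iso_inv_def by blast

lemma mult_weight_mult:
 "mult_weight G w ==> finite A ==> finite B ==> A \<inter> B = {} ==> x \<in> dperm G A ==> y \<in> dperm G B ==>
  w (A \<union> B) (djoin A x y) = w A x * w B y"
 unfolding mult_weight_def by blast

lemma mult_weight_iso_inv: "mult_weight G w ==> iso_inv G w"
 by (simp add: mult_weight_def)

lemma mult_weight_split:
 assumes "mult_weight G w" "finite I" "x \<in> dperm G I" "A \<in> invs I x"
 shows "w I x = w A (dres A x) * w (I - A) (dres (I - A) x)"
proof -
 have A: "A \<subseteq> I" using invsD(1)[OF assms(4)] .
 then have "A \<union> (I - A) = I" by auto
 moreover have "finite A" "finite (I - A)" using A assms(2) finite_subset by auto
 then have "w (A \<union> (I - A)) (djoin A (dres A x) (dres (I - A) x)) = w A (dres A x) * w (I - A) (dres (I - A) x)"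
  using dres_closed[OF assms(3,4)] dres_closed[OF assms(3) invs_compl[OF assms(3,4)]]
  by (intro mult_weight_mult[OF assms(1)]) auto
 ultimately show ?thesis using djoin_dres[OF assms(3) A] by simp
qed

lemma alternatingD:
 "alternating G w ==> finite I ==> I \<noteq> {} ==> x \<in> dperm G I ==> w I x \<noteq> 0 ==>
  (\<Sum>A\<in>invs I x. (-1) ^ card A) = (0::complex)"
 unfolding alternating_def by blast

lemma finite_fresh [simp]: "finite (fresh n J)"
 by (simp add: fresh_def)

lemma card_fresh [simp]: "card (fresh n J) = n"
 by (simp add: fresh_def card_image)

lemma fresh_disjoint: "finite J ==> fresh n J \<inter> J = {}"
proof -
 assume J: "finite J"
 have "j < i + Max (insert 0 J)" if "j \<in> J" "1 \<le> i" for i j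
 proof -
  have "j \<le> Max (insert 0 J)" using J that by (intro Max_ge) auto
  then show ?thesis using that(2) by linarith
 qed
 then show ?thesis by (force simp: fresh_def)
qed

lemma avg_cmult: "avg G I (\<lambda>x. c * f x) = c * avg G I f"
 by (simp add: avg_def sum_distrib_left)

lemma avg_cong: "(\<And>x. x \<in> dperm G I ==> f x = g x) ==> avg G I f = avg G I g"
 by (simp add: avg_def)

lemma avg_sum: "avg G I (\<lambda>x. \<Sum>k\<in>S. f k x) = (\<Sum>k\<in>S. avg G I (f k))"
 by (simp add: avg_def sum.swap[of _ S] sum_divide_distrib)

lemma avg_swap: "avg G I (\<lambda>x. avg G J (\<lambda>y. f x y)) = avg G J (\<lambda>y. avg G I (\<lambda>x. f x y))"
 unfolding avg_def sum_divide_distrib[symmetric]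
 by (subst sum.swap) (simp add: field_simps)

locale fin_group = group G for G (structure) +
 assumes finite_carrier: "finite (carrier G)"
begin

lemma finite_dperm: "finite I ==> finite (dperm G I)"
 by (simp add: dperm_def finite_PiE finite_carrier finite_permutations)

lemma card_dperm: "finite I ==> card (dperm G I) = card (carrier G) ^ card I * fact (card I)"
 by (simp add: dperm_def card_cartesian_product card_PiE card_permutations)

lemma card_dperm_pos: "finite I ==> card (dperm G I) > 0"
 using one_closed finite_carrier by (auto simp: card_dperm card_gt_0_iff)

lemma avg_relabel:
 assumes "bij_betw s I J" shows "avg G J f = avg G I (\<lambda>x. f (drel s I J x))"
 using sum.reindex_bij_betw[OF drel_bij[OF assms], of f] bij_betw_same_card[OF drel_bij[OF assms]]
 by (simp add: avg_def)

lemma avg_iso_inv: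
 assumes "iso_inv G F" "finite I" "finite J" "card I = card J"
 shows "avg G I (F I) = avg G J (F J)"
proof -
 obtain s where s: "bij_betw s I J" using finite_same_card_bij[OF assms(2-4)] by blast
 show ?thesis
  unfolding avg_relabel[OF s]
  by (rule avg_cong) (rule iso_invD[OF assms(1) drel_diso[OF s] assms(2) _ drel_closed[OF s]])
qed

lemma avg_empty: "x \<in> dperm G {} ==> avg G {} f = f x"
 by (simp add: avg_def dperm_def)

section \<open>Averages over decorated permutations that split along an invariant subset\<close>

lemma sum_split:
 assumes "finite N"
 shows "(\<Sum>x\<in>dperm G N. \<Sum>A\<in>invs N x. H A (dres A x) (dres (N - A) x)) =
  (\<Sum>A\<in>Pow N. \<Sum>x\<in>dperm G A. \<Sum>y\<in>dperm G (N - A). H A x y :: complex)"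
proof -
 have "(\<Sum>x\<in>dperm G N. \<Sum>A\<in>invs N x. H A (dres A x) (dres (N - A) x)) =
   (\<Sum>x\<in>dperm G N. \<Sum>A | A \<in> Pow N \<and> A \<in> invs N x. H A (dres A x) (dres (N - A) x))"
  by (intro sum.cong) (auto simp: invs_def)
 also have "\<dots> = (\<Sum>A\<in>Pow N. \<Sum>x | x \<in> dperm G N \<and> A \<in> invs N x. H A (dres A x) (dres (N - A) x))"
  by (rule sum.swap_restrict) (use assms finite_dperm in auto)
 also have "\<dots> = (\<Sum>A\<in>Pow N. \<Sum>x\<in>dperm G A. \<Sum>y\<in>dperm G (N - A). H A x y)"
 proof (rule sum.cong)
  fix A assume "A \<in> Pow N"
  then have A: "A \<union> (N - A) = N" by auto
  have "(\<Sum>x | x \<in> dperm G N \<and> A \<in> invs N x. H A (dres A x) (dres (N - A) x)) =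
    (\<Sum>(x, y)\<in>dperm G A \<times> dperm G (N - A).
     H A (dres A (djoin A x y)) (dres (N - A) (djoin A x y)))"
   using sum.reindex_bij_betw[OF djoin_bij[of A "N - A" G], of "\<lambda>x. H A (dres A x) (dres (N - A) x)"]
   unfolding A by (simp add: case_prod_unfold)
  also have "\<dots> = (\<Sum>(x, y)\<in>dperm G A \<times> dperm G (N - A). H A x y)"
   by (intro sum.cong) (auto simp: dres_djoin_left dres_djoin_right)
  finally show "(\<Sum>x | x \<in> dperm G N \<and> A \<in> invs N x. H A (dres A x) (dres (N - A) x)) =
    (\<Sum>x\<in>dperm G A. \<Sum>y\<in>dperm G (N - A). H A x y)"
   by (simp add: sum.cartesian_product)
 qed simp
 finally show ?thesis .
qed

text \<open>|\<open>dperm G N\<close>| is the product of the two smaller cardinalities times a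
  binomial coefficient, and this coefficient is the number of subsets of the given size. So each
  size contributes its iterated average exactly once, and averages convolve like coefficients of
  ordinary power series.\<close>

lemma avg_split:
 assumes "finite N"
  and h: "\<And>A. A \<subseteq> N ==> avg G A (\<lambda>x. avg G (N - A) (\<lambda>y. H A x y)) = h (card A)"
 shows "avg G N (\<lambda>x. \<Sum>A\<in>invs N x. H A (dres A x) (dres (N - A) x)) = (\<Sum>a\<le>card N. h a)"
proof -
 let ?d = "\<lambda>A. complex_of_nat (card (dperm G A))"
 have d0: "?d A \<noteq> 0" if "finite A" for A
  using card_dperm_pos[OF that] by simp
 have trm: "(\<Sum>x\<in>dperm G A. \<Sum>y\<in>dperm G (N - A). H A x y) / ?d N =
   h (card A) / of_nat (card N choose card A)" if A: "A \<in> Pow N" for A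
 proof -
  have fin: "finite A" "finite (N - A)" using A assms(1) finite_subset by auto
  have cA: "card A \<le> card N" "card (N - A) = card N - card A"
   using A assms(1) by (auto simp: card_mono card_Diff_subset fin)
  have pw: "card (carrier G) ^ card N = card (carrier G) ^ card A * card (carrier G) ^ (card N - card A)"
   using cA by (simp flip: power_add)
  have "card (dperm G N) = (card N choose card A) * (card (dperm G A) * card (dperm G (N - A)))"
   unfolding card_dperm[OF assms(1)] card_dperm[OF fin(1)] card_dperm[OF fin(2)] cA(2) pw
    binomial_fact_lemma[OF cA(1), symmetric]
   by (simp only: mult_ac)
  then have "?d N = of_nat (card N choose card A) * (?d A * ?d (N - A))"
   by (simp only: of_nat_mult)
  moreover have "(\<Sum>x\<in>dperm G A. \<Sum>y\<in>dperm G (N - A). H A x y) = h (card A) * (?d A * ?d (N - A))"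
   using h[of A] A d0[OF fin(1)] d0[OF fin(2)]
   by (simp add: avg_def sum_divide_distrib[symmetric] field_simps)
  ultimately show ?thesis using d0[OF fin(1)] d0[OF fin(2)] by simp
 qed
 have "avg G N (\<lambda>x. \<Sum>A\<in>invs N x. H A (dres A x) (dres (N - A) x)) =
   (\<Sum>A\<in>Pow N. (\<Sum>x\<in>dperm G A. \<Sum>y\<in>dperm G (N - A). H A x y) / ?d N)"
  by (simp add: avg_def sum_split[OF assms(1)] sum_divide_distrib)
 also have "\<dots> = (\<Sum>A\<in>Pow N. h (card A) / of_nat (card N choose card A))"
  by (intro sum.cong trm) simp_all
 also have "\<dots> = (\<Sum>a\<le>card N. \<Sum>A | A \<in> Pow N \<and> card A = a. h (card A) / of_nat (card N choose card A))"
  by (rule sum.group[symmetric]) (use assms(1) card_mono in auto)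
 also have "\<dots> = (\<Sum>a\<le>card N. h a)"
 proof (rule sum.cong)
  fix a assume a: "a \<in> {..card N}"
  have "(\<Sum>A | A \<in> Pow N \<and> card A = a. h (card A) / of_nat (card N choose card A)) =
    (\<Sum>A | A \<subseteq> N \<and> card A = a. h a / of_nat (card N choose a))"
   by (intro sum.cong) auto
  also have "\<dots> = h a" using a n_subsets[OF assms(1), of a] by simp
  finally show "(\<Sum>A | A \<in> Pow N \<and> card A = a. h (card A) / of_nat (card N choose card A)) = h a" .
 qed simp
 finally show ?thesis .
qed

text \<open>By isomorphism invariance the choice of the additional points is immaterial; every later
  computation picks the set that suits it.\<close>

lemma Qop_eq:
 assumes "iso_inv G v" "iso_inv G F" "finite J" "y \<in> dperm G J"
  and "finite N" "card N = n" "N \<inter> J = {}"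
 shows "Qop G v n F J y = avg G N (\<lambda>x. v N x * F (N \<union> J) (djoin N x y))"
proof -
 let ?M = "fresh n J"
 have MJ: "?M \<inter> J = {}" by (rule fresh_disjoint[OF assms(3)])
 obtain s where s: "bij_betw s ?M N"
  using finite_same_card_bij[of ?M N] assms by auto
 show ?thesis unfolding Qop_def avg_relabel[OF s]
 proof (rule avg_cong)
  fix x assume x: "x \<in> dperm G ?M"
  let ?x = "drel s ?M N x"
  have x': "?x \<in> dperm G N" by (rule drel_closed[OF s x])
  have "v ?M x = v N ?x"
   by (rule iso_invD[OF assms(1) drel_diso[OF s x] finite_fresh x x'])
  moreover have "F (?M \<union> J) (djoin ?M x y) = F (N \<union> J) (djoin N ?x y)"
   by (rule iso_invD[OF assms(2) diso_djoin[OF drel_diso[OF s x] diso_refl[OF assms(4)] x assms(4) MJ assms(7)]])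
    (use assms djoin_closed[OF x assms(4) MJ] djoin_closed[OF x' assms(4,7)] in auto)
  ultimately show "v ?M x * F (?M \<union> J) (djoin ?M x y) = v N ?x * F (N \<union> J) (djoin N ?x y)" by simp
 qed
qed

lemma iso_inv_Qop:
 assumes "iso_inv G v" "iso_inv G F" shows "iso_inv G (Qop G v n F)"
 unfolding iso_inv_def
proof (intro allI impI)
 fix I J x y s h
 assume I: "finite I" and x: "x \<in> dperm G I" and y: "y \<in> dperm G J" and iso: "diso_via G s h I x J y"
 have J: "finite J" using I diso_via_image[OF iso] by auto
 let ?N = "fresh n (I \<union> J)"
 have NI: "?N \<inter> I = {}" "?N \<inter> J = {}" using fresh_disjoint[of "I \<union> J" n] I J by auto
 have "F (?N \<union> I) (djoin ?N z x) = F (?N \<union> J) (djoin ?N z y)" if z: "z \<in> dperm G ?N" for z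
  by (rule iso_invD[OF assms(2) diso_djoin[OF diso_refl[OF z] iso z x NI]])
   (use I djoin_closed[OF z x NI(1)] djoin_closed[OF z y NI(2)] in auto)
 then show "Qop G v n F I x = Qop G v n F J y"
  using Qop_eq[OF assms I x _ _ NI(1)] Qop_eq[OF assms J y _ _ NI(2)]
  by (simp add: cong: avg_cong)
qed

lemma iso_inv_Pop:
 assumes "iso_inv G w" "iso_inv G F" shows "iso_inv G (Pop w n F)"
 unfolding iso_inv_def
proof (intro allI impI)
 fix I J x y s h
 assume I: "finite I" and x: "x \<in> dperm G I" and y: "y \<in> dperm G J" and iso: "diso_via G s h I x J y"
 have c: "card (s ` A) = card A" if "A \<in> invs I x" for A
  by (rule card_image[OF inj_on_subset[OF diso_via_inj[OF iso] invsD(1)[OF that]]])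
 have bij: "bij_betw (image s) {A. A \<in> invs I x \<and> card A = n} {B. B \<in> invs J y \<and> card B = n}"
 proof (rule bij_betw_subset[OF invs_diso[OF x iso]])
  have im: "invs J y = image s ` invs I x" using invs_diso[OF x iso] by (simp add: bij_betw_def)
  show "image s ` {A. A \<in> invs I x \<and> card A = n} = {B. B \<in> invs J y \<and> card B = n}"
  proof (intro equalityI subsetI)
   fix B assume "B \<in> {B. B \<in> invs J y \<and> card B = n}"
   then have "B \<in> image s ` invs I x" "card B = n" using im by auto
   then obtain A where "A \<in> invs I x" "B = s ` A" "card B = n" by auto
   then show "B \<in> image s ` {A. A \<in> invs I x \<and> card A = n}" using c by auto
  next
   fix B assume "B \<in> image s ` {A. A \<in> invs I x \<and> card A = n}"
   then obtain A where "A \<in> invs I x" "B = s ` A" "card A = n" by auto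
   then show "B \<in> {B. B \<in> invs J y \<and> card B = n}" using im c by auto
  qed
 qed auto
 have "w A (dres A x) * F (I - A) (dres (I - A) x) =
   w (s ` A) (dres (s ` A) y) * F (J - s ` A) (dres (J - s ` A) y)" if A: "A \<in> invs I x" for A
 proof -
  have sub: "A \<subseteq> I" using invsD(1)[OF A] .
  have sA: "s ` A \<in> invs J y" using diso_image_invs[OF x iso sub] A by simp
  have cA: "I - A \<in> invs I x" "J - s ` A \<in> invs J y" by (rule invs_compl[OF x A], rule invs_compl[OF y sA])
  have "s ` (I - A) = J - s ` A"
   using diso_via_image[OF iso] inj_on_image_set_diff[OF diso_via_inj[OF iso], of I A] sub by simp
  then have iso2: "diso_via G s h (I - A) (dres (I - A) x) (J - s ` A) (dres (J - s ` A) y)"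
   using diso_dres[OF x iso cA(1)] by simp
  have "w A (dres A x) = w (s ` A) (dres (s ` A) y)"
   using iso_invD[OF assms(1) diso_dres[OF x iso A]] dres_closed[OF x A] dres_closed[OF y sA]
    finite_subset[OF sub I] by simp
  moreover have "F (I - A) (dres (I - A) x) = F (J - s ` A) (dres (J - s ` A) y)"
   using iso_invD[OF assms(2) iso2] dres_closed[OF x cA(1)] dres_closed[OF y cA(2)] I by simp
  ultimately show ?thesis by simp
 qed
 then have "Pop w n F I x = (\<Sum>A | A \<in> invs I x \<and> card A = n.
   w (s ` A) (dres (s ` A) y) * F (J - s ` A) (dres (J - s ` A) y))"
  unfolding Pop_def by (intro sum.cong) auto
 also have "\<dots> = Pop w n F J y"
  unfolding Pop_def by (rule sum.reindex_bij_betw[OF bij])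
 finally show "Pop w n F I x = Pop w n F J y" .
qed

section \<open>Relations among creation operators\<close>

text \<open>The sum runs over ordered pairs of disjoint invariant sets, a form in which
  commutativity is the exchange of A and B.\<close>

lemma Pop_Pop:
 assumes "x \<in> dperm G I" "finite I"
 shows "Pop w m (Pop w' n F) I x =
  (\<Sum>(A, B) | A \<in> invs I x \<and> B \<in> invs I x \<and> A \<inter> B = {} \<and> card A = m \<and> card B = n.
   w A (dres A x) * w' B (dres B x) * F (I - A - B) (dres (I - A - B) x))"
proof -
 have inner: "Pop w' n F (I - A) (dres (I - A) x) =
   (\<Sum>B | B \<in> invs I x \<and> A \<inter> B = {} \<and> card B = n. w' B (dres B x) * F (I - A - B) (dres (I - A - B) x))"
  if A: "A \<in> invs I x" for A
 proof -
  have "B \<subseteq> I - A \<longleftrightarrow> A \<inter> B = {}" if "B \<in> invs I x" for B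
   using invsD(1)[OF that] by auto
  then have "{B. B \<in> invs (I - A) (dres (I - A) x) \<and> card B = n} =
    {B. B \<in> invs I x \<and> A \<inter> B = {} \<and> card B = n}"
   using invs_dres[OF invs_compl[OF assms(1) A]] by auto
  moreover have "dres B (dres (I - A) x) = dres B x" if "B \<in> invs I x" "A \<inter> B = {}" for B
   using that invsD(1)[OF that(1)] by (intro dres_dres) auto
  moreover have "dres (I - A - B) (dres (I - A) x) = dres (I - A - B) x" for B
   by (intro dres_dres) auto
  ultimately show ?thesis unfolding Pop_def by (intro sum.cong) auto
 qed
 have "Pop w m (Pop w' n F) I x = (\<Sum>A | A \<in> invs I x \<and> card A = m.
   \<Sum>B | B \<in> invs I x \<and> A \<inter> B = {} \<and> card B = n.
    w A (dres A x) * w' B (dres B x) * F (I - A - B) (dres (I - A - B) x))"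
  unfolding Pop_def[of w m] by (intro sum.cong) (auto simp: inner sum_distrib_left mult_ac)
 also have "\<dots> = (\<Sum>(A, B)\<in>(SIGMA A : {A. A \<in> invs I x \<and> card A = m}.
   {B. B \<in> invs I x \<and> A \<inter> B = {} \<and> card B = n}).
    w A (dres A x) * w' B (dres B x) * F (I - A - B) (dres (I - A - B) x))"
  by (rule sum.Sigma) (use finite_invs[OF assms(2), of x] in auto)
 also have "\<dots> = (\<Sum>(A, B) | A \<in> invs I x \<and> B \<in> invs I x \<and> A \<inter> B = {} \<and> card A = m \<and> card B = n.
   w A (dres A x) * w' B (dres B x) * F (I - A - B) (dres (I - A - B) x))"
  by (intro sum.cong) auto
 finally show ?thesis .
qed

lemma Pop_commute:
 assumes "x \<in> dperm G I" "finite I"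
 shows "Pop w m (Pop w' n F) I x = Pop w' n (Pop w m F) I x"
proof -
 have "I - A - B = I - B - A" for A B by auto
 then show ?thesis unfolding Pop_Pop[OF assms]
  by (intro sum.reindex_bij_witness[where i = prod.swap and j = prod.swap]) auto
qed

text \<open>Collect the pairs (A, B) by their union C. Multiplicativity makes the product of weights
  depend on C only, which leaves the alternating sum over the invariant subsets A of C; it vanishes
  unless C is empty.\<close>

lemma Pop_alternating:
 assumes w: "mult_weight G w" "alternating G w" and x: "x \<in> dperm G I" and I: "finite I"
 shows "(\<Sum>a\<le>n. (-1) ^ a * Pop w a (Pop w (n - a) F) I x) = (if n = 0 then F I x else 0)"
proof -
 let ?f = "\<lambda>A C. (-1) ^ card A * (w A (dres A x) * w (C - A) (dres (C - A) x) * F (I - C) (dres (I - C) x))"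
 let ?S = "\<lambda>a. {(A, B). A \<in> invs I x \<and> B \<in> invs I x \<and> A \<inter> B = {} \<and> card A = a \<and> card B = n - a}"
 have fin: "finite A" if "A \<in> invs I x" for A using invsD(1)[OF that] I finite_subset by blast
 have eq: "(\<Sum>(A, B)\<in>?S a. w A (dres A x) * w B (dres B x) * F (I - A - B) (dres (I - A - B) x)) * (-1) ^ a
  = (\<Sum>(C, A) | C \<in> invs I x \<and> card C = n \<and> A \<in> invs I x \<and> A \<subseteq> C \<and> card A = a. ?f A C)"
  if "a \<le> n" for a
  unfolding sum_distrib_right
 proof (rule sum.reindex_bij_witness[where i = "\<lambda>(C, A). (A, C - A)" and j = "\<lambda>(A, B). (A \<union> B, A)"], goal_cases)
  case (1 p) then show ?case by auto
 next
  case (2 p)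
  then obtain A B where p: "p = (A, B)" "A \<in> invs I x" "B \<in> invs I x" "A \<inter> B = {}" "card A = a" "card B = n - a"
   by auto
  have "card (A \<union> B) = n" using p that fin by (simp add: card_Un_disjoint)
  then show ?case using p invs_Un[OF p(2,3)] by auto
 next
  case (3 p) then show ?case by auto
 next
  case (4 p)
  then obtain C A where p: "p = (C, A)" "C \<in> invs I x" "A \<in> invs I x" "A \<subseteq> C" "card A = a" "card C = n"
   by auto
  have "card (C - A) = n - a" using p fin[OF p(3)] by (simp add: card_Diff_subset)
  then show ?case using p invs_diff[OF x p(2,3)] by auto
 next
  case (5 p)
  then obtain A B where p: "p = (A, B)" "A \<inter> B = {}" "card A = a" by auto
  then have "A \<union> B - A = B" "I - (A \<union> B) = I - A - B" by auto
  then show ?case using p by (simp add: mult_ac)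
 qed
 have "(\<Sum>a\<le>n. (-1) ^ a * Pop w a (Pop w (n - a) F) I x) =
   (\<Sum>a\<le>n. \<Sum>(C, A) | C \<in> invs I x \<and> card C = n \<and> A \<in> invs I x \<and> A \<subseteq> C \<and> card A = a. ?f A C)"
  by (intro sum.cong) (auto simp: Pop_Pop[OF x I] eq[symmetric])
 also have "\<dots> = (\<Sum>(C, A) | C \<in> invs I x \<and> card C = n \<and> A \<in> invs I x \<and> A \<subseteq> C. ?f A C)"
 proof -
  let ?T = "{(C, A). C \<in> invs I x \<and> card C = n \<and> A \<in> invs I x \<and> A \<subseteq> C}"
  have "finite ?T" by (rule finite_subset[of _ "invs I x \<times> invs I x"]) (use finite_invs[OF I, of x] in auto)
  moreover have "(\<lambda>p. card (snd p)) ` ?T \<subseteq> {..n}" using card_mono[OF fin] by force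
  ultimately have "(\<Sum>p\<in>?T. case p of (C, A) => ?f A C) =
    (\<Sum>a\<le>n. \<Sum>p | p \<in> ?T \<and> card (snd p) = a. case p of (C, A) => ?f A C)"
   by (intro sum.group[symmetric]) auto
  also have "\<dots> = (\<Sum>a\<le>n. \<Sum>(C, A) | C \<in> invs I x \<and> card C = n \<and> A \<in> invs I x \<and> A \<subseteq> C \<and> card A = a. ?f A C)"
   by (intro sum.cong) auto
  finally show ?thesis by simp
 qed
 also have "\<dots> = (\<Sum>(C, A)\<in>(SIGMA C : {C. C \<in> invs I x \<and> card C = n}. {A. A \<in> invs I x \<and> A \<subseteq> C}). ?f A C)"
  by (intro sum.cong) auto
 also have "\<dots> = (\<Sum>C | C \<in> invs I x \<and> card C = n. \<Sum>A | A \<in> invs I x \<and> A \<subseteq> C. ?f A C)"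
  by (rule sum.Sigma[symmetric]) (use finite_invs[OF I, of x] in auto)
 also have "\<dots> = (\<Sum>C | C \<in> invs I x \<and> card C = n. if n = 0 then F I x else 0)"
 proof (rule sum.cong)
  fix C assume "C \<in> {C. C \<in> invs I x \<and> card C = n}"
  then have C: "C \<in> invs I x" "card C = n" by auto
  have xC: "dres C x \<in> dperm G C" by (rule dres_closed[OF x C(1)])
  have inv: "invs C (dres C x) = {A. A \<in> invs I x \<and> A \<subseteq> C}" using invs_dres[OF C(1)] by auto
  have "w A (dres A x) * w (C - A) (dres (C - A) x) = w C (dres C x)" if "A \<in> invs C (dres C x)" for A
   using mult_weight_split[OF w(1) fin[OF C(1)] xC that] that
   by (auto simp: dres_dres inv)
  then have "(\<Sum>A | A \<in> invs I x \<and> A \<subseteq> C. ?f A C) =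
    (\<Sum>A\<in>invs C (dres C x). (-1) ^ card A) * (w C (dres C x) * F (I - C) (dres (I - C) x))"
   unfolding inv[symmetric] sum_distrib_right by (intro sum.cong) (auto simp: mult_ac)
  also have "\<dots> = (if n = 0 then F I x else 0)"
  proof (cases "n = 0")
   case True
   then have "C = {}" using C fin by auto
   moreover have "dres {} x \<in> dperm G {}" using dres_closed[OF x empty_invs] .
   moreover have "invs {} (dres {} x) = {{}}" by (auto simp: invs_def)
   ultimately show ?thesis using w(1) True dres_self[OF x] by (simp add: mult_weight_def)
  next
   case False
   then have "C \<noteq> {}" using C by auto
   \<comment> \<open>Where the weight of C is zero, \<open>alternating\<close> says nothing, but the
     factor kills the term.\<close>
   then show ?thesis using alternatingD[OF w(2) fin[OF C(1)] _ xC] False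
    by (cases "w C (dres C x) = 0") simp_all
  qed
  finally show "(\<Sum>A | A \<in> invs I x \<and> A \<subseteq> C. ?f A C) = (if n = 0 then F I x else 0)" .
 qed simp
 also have "\<dots> = (if n = 0 then F I x else 0)"
 proof -
  have "C = {}" if "C \<in> invs I x" "card C = 0" for C
   using fin[OF that(1)] that(2) by simp
  then have "{C. C \<in> invs I x \<and> card C = 0} = {{}}" using empty_invs[of I x] by auto
  then show ?thesis by (cases "n = 0") simp_all
 qed
 finally show ?thesis .
qed

end

lemma avg_multc: "avg G I (\<lambda>x. f x * c) = c * avg G I f"
 using avg_cmult[of G I c f] by (simp add: mult.commute)

context fin_group begin

section \<open>Relations involving annihilation operators\<close>

lemma Qop_Qop:
 assumes "iso_inv G v" "iso_inv G v'" "iso_inv G F" "finite J" "y \<in> dperm G J"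
  and "finite N" "finite N'" "N \<inter> J = {}" "N' \<inter> J = {}" "N \<inter> N' = {}"
 shows "Qop G v (card N) (Qop G v' (card N') F) J y =
  avg G N (\<lambda>x. avg G N' (\<lambda>x'. v N x * v' N' x' * F (N' \<union> (N \<union> J)) (djoin N' x' (djoin N x y))))"
proof -
 have "Qop G v (card N) (Qop G v' (card N') F) J y =
   avg G N (\<lambda>x. v N x * Qop G v' (card N') F (N \<union> J) (djoin N x y))"
  using assms by (intro Qop_eq iso_inv_Qop) auto
 also have "\<dots> = avg G N (\<lambda>x. avg G N' (\<lambda>x'. v N x * v' N' x' * F (N' \<union> (N \<union> J)) (djoin N' x' (djoin N x y))))"
 proof (rule avg_cong)
  fix x assume x: "x \<in> dperm G N"
  have "Qop G v' (card N') F (N \<union> J) (djoin N x y) =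
    avg G N' (\<lambda>x'. v' N' x' * F (N' \<union> (N \<union> J)) (djoin N' x' (djoin N x y)))"
   using assms djoin_closed[OF x assms(5,8)] by (intro Qop_eq) auto
  then show "v N x * Qop G v' (card N') F (N \<union> J) (djoin N x y) =
    avg G N' (\<lambda>x'. v N x * v' N' x' * F (N' \<union> (N \<union> J)) (djoin N' x' (djoin N x y)))"
   by (simp add: avg_cmult[symmetric] mult.assoc)
 qed
 finally show ?thesis .
qed

lemma Qop_commute:
 assumes "iso_inv G v" "iso_inv G v'" "iso_inv G F" "finite J" "y \<in> dperm G J"
 shows "Qop G v m (Qop G v' n F) J y = Qop G v' n (Qop G v m F) J y"
proof -
 let ?N = "fresh m J" let ?N' = "fresh n (?N \<union> J)"
 have d: "?N \<inter> J = {}" "?N' \<inter> J = {}" "?N \<inter> ?N' = {}"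
  using fresh_disjoint[OF assms(4), of m] fresh_disjoint[of "?N \<union> J" n] assms(4) by auto
 have d': "?N' \<inter> ?N = {}" using d(3) by (simp add: Int_commute)
 have swap: "djoin ?N' x' (djoin ?N x y) = djoin ?N x (djoin ?N' x' y)" for x x'
  using d(3) by (auto simp: djoin_def fun_eq_iff)
 have "Qop G v (card ?N) (Qop G v' (card ?N') F) J y = Qop G v' (card ?N') (Qop G v (card ?N) F) J y"
  unfolding Qop_Qop[OF assms finite_fresh finite_fresh d]
   Qop_Qop[OF assms(2,1,3-5) finite_fresh finite_fresh d(2,1) d']
  by (subst avg_swap) (simp add: swap Un_left_commute mult_ac)
 then show ?thesis by simp
qed

lemma card_Pow_split: "finite N ==> A \<subseteq> N ==> finite A \<and> finite (N - A) \<and> card (N - A) = card N - card A"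
 using finite_subset[of A N] by (simp add: card_Diff_subset)

text \<open>Read \<open>avg_split\<close> backwards: choosing a fresh points and then n - a more
  amounts to choosing n fresh points together with an invariant subset of size a. The alternating
  sum over those subsets then appears under a single average.\<close>

lemma Qop_alternating:
 assumes v: "mult_weight G v" "alternating G v" and F: "iso_inv G F"
  and J: "finite J" and y: "y \<in> dperm G J"
 shows "(\<Sum>a\<le>n. (-1) ^ a * Qop G v a (Qop G v (n - a) F) J y) = (if n = 0 then F J y else 0)"
proof -
 let ?N = "fresh n J"
 have NJ: "?N \<inter> J = {}" by (rule fresh_disjoint[OF J])
 note iv = mult_weight_iso_inv[OF v(1)]
 define H where "H A x x' = (-1) ^ card A * (v A x * v (?N - A) x' *
  F ((?N - A) \<union> (A \<union> J)) (djoin (?N - A) x' (djoin A x y)))" for A x x'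
 have "(\<Sum>a\<le>card ?N. (-1) ^ a * Qop G v a (Qop G v (n - a) F) J y) =
   avg G ?N (\<lambda>x. \<Sum>A\<in>invs ?N x. H A (dres A x) (dres (?N - A) x))"
 proof (rule avg_split[OF finite_fresh, symmetric])
  fix A assume A: "A \<subseteq> ?N"
  note fin = card_Pow_split[OF finite_fresh A]
  have d: "A \<inter> J = {}" "(?N - A) \<inter> J = {}" "A \<inter> (?N - A) = {}" using A NJ by auto
  show "avg G A (\<lambda>x. avg G (?N - A) (\<lambda>y. H A x y)) =
    (-1) ^ card A * Qop G v (card A) (Qop G v (n - card A) F) J y"
   using Qop_Qop[OF iv iv F J y _ _ d] fin by (simp add: H_def avg_cmult)
 qed
 also have "\<dots> = avg G ?N (\<lambda>x. if n = 0 then F J y else 0)"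
 proof (rule avg_cong)
  fix x assume x: "x \<in> dperm G ?N"
  have "H A (dres A x) (dres (?N - A) x) = (-1) ^ card A * (v ?N x * F (?N \<union> J) (djoin ?N x y))"
   if A: "A \<in> invs ?N x" for A
  proof -
   have sub: "A \<subseteq> ?N" using invsD(1)[OF A] .
   then have U: "(?N - A) \<union> (A \<union> J) = ?N \<union> J" by auto
   have "djoin (?N - A) (dres (?N - A) x) (djoin A (dres A x) y) =
     djoin ((?N - A) \<union> A) (djoin (?N - A) (dres (?N - A) x) (dres A x)) y"
    by (rule djoin_assoc[symmetric])
   also have "(?N - A) \<union> A = ?N" using sub by auto
   also have "djoin (?N - A) (dres (?N - A) x) (dres A x) = x"
    using djoin_dres[OF x, of "?N - A"] sub by (simp add: double_diff)
   finally have j: "djoin (?N - A) (dres (?N - A) x) (djoin A (dres A x) y) = djoin ?N x y" .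
   show ?thesis unfolding H_def U j mult_weight_split[OF v(1) finite_fresh x A] by simp
  qed
  then have "(\<Sum>A\<in>invs ?N x. H A (dres A x) (dres (?N - A) x)) =
    (\<Sum>A\<in>invs ?N x. (-1) ^ card A) * (v ?N x * F (?N \<union> J) (djoin ?N x y))"
   by (simp add: sum_distrib_right)
  also have "\<dots> = (if n = 0 then F J y else 0)"
  proof (cases "n = 0")
   case True
   have N: "fresh 0 J = {}" by (simp add: fresh_def)
   have "invs {} x = {{}}" by (auto simp: invs_def)
   moreover have "djoin {} x y = y" by (simp add: djoin_def)
   moreover have "v {} x = 1" using v(1) x True by (simp add: N mult_weight_def)
   ultimately show ?thesis using True by (simp add: N)
  next
   case False
   then have "?N \<noteq> {}" by (metis card.empty card_fresh)
   then show ?thesis using alternatingD[OF v(2) finite_fresh _ x] False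
    by (cases "v ?N x = 0") simp_all
  qed
  finally show "(\<Sum>A\<in>invs ?N x. H A (dres A x) (dres (?N - A) x)) = (if n = 0 then F J y else 0)" .
 qed
 also have "\<dots> = (if n = 0 then F J y else 0)"
  using card_dperm_pos[OF finite_fresh, of n J] by (simp add: avg_def)
 finally show ?thesis by simp
qed

definition wpair :: "'a species => 'a species => nat => complex" where
 "wpair v w n = avg G {1..n} (\<lambda>x. v {1..n} x * w {1..n} x)"

lemma iso_inv_mult: "iso_inv G v ==> iso_inv G w ==> iso_inv G (\<lambda>I x. v I x * w I x)"
 unfolding iso_inv_def by metis

lemma wpair_eq:
 assumes "iso_inv G v" "iso_inv G w" "finite A"
 shows "avg G A (\<lambda>x. v A x * w A x) = wpair v w (card A)"
 unfolding wpair_def using avg_iso_inv[OF iso_inv_mult[OF assms(1,2)] assms(3), of "{1..card A}"] by simp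

text \<open>An invariant subset of the enlarged set is a union of some A among the fresh points and
  some B among the old ones. The part A carries both weights and averages to the scalar
  \<open>wpair\<close>; the other fresh points remain for the annihilation and B for the
  creation.\<close>

lemma Qop_Pop:
 assumes v: "mult_weight G v" and w: "mult_weight G w" and F: "iso_inv G F"
  and J: "finite J" and y: "y \<in> dperm G J"
 shows "Qop G v n (Pop w m F) J y =
  (\<Sum>a\<le>n. if a \<le> m then wpair v w a * Pop w (m - a) (Qop G v (n - a) F) J y else 0)"
proof -
 let ?N = "fresh n J"
 have NJ: "?N \<inter> J = {}" by (rule fresh_disjoint[OF J])
 note iv = mult_weight_iso_inv[OF v] and iw = mult_weight_iso_inv[OF w]
 define S where "S a = {B. B \<in> invs J y \<and> a + card B = m}" for a
 define H where "H A x x' = v A x * w A x * (\<Sum>B\<in>S (card A). w B (dres B y) *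
  (v (?N - A) x' * F ((?N - A) \<union> (J - B)) (djoin (?N - A) x' (dres (J - B) y))))" for A x x'
 have "avg G ?N (\<lambda>x. \<Sum>A\<in>invs ?N x. H A (dres A x) (dres (?N - A) x)) =
  (\<Sum>a\<le>card ?N. if a \<le> m then wpair v w a * Pop w (m - a) (Qop G v (n - a) F) J y else 0)"
 proof (rule avg_split[OF finite_fresh])
  fix A assume A: "A \<subseteq> ?N"
  note fin = card_Pow_split[OF finite_fresh A]
  have Q: "avg G (?N - A) (\<lambda>x'. v (?N - A) x' * F ((?N - A) \<union> (J - B)) (djoin (?N - A) x' (dres (J - B) y))) =
    Qop G v (n - card A) F (J - B) (dres (J - B) y)" if B: "B \<in> invs J y" for B
   using fin NJ J A dres_closed[OF y invs_compl[OF y B]]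
   by (intro Qop_eq[OF iv F, symmetric]) auto
  have "avg G A (\<lambda>x. avg G (?N - A) (\<lambda>x'. H A x x')) =
    avg G A (\<lambda>x. v A x * w A x * (\<Sum>B\<in>S (card A). w B (dres B y) * Qop G v (n - card A) F (J - B) (dres (J - B) y)))"
   unfolding H_def avg_cmult avg_sum by (intro avg_cong arg_cong2[where f = "(*)"] sum.cong) (auto simp: S_def Q)
  also have "\<dots> = (\<Sum>B\<in>S (card A). w B (dres B y) * Qop G v (n - card A) F (J - B) (dres (J - B) y)) *
    wpair v w (card A)"
   using wpair_eq[OF iv iw, of A] fin by (simp add: avg_multc)
  also have "\<dots> = (if card A \<le> m then wpair v w (card A) * Pop w (m - card A) (Qop G v (n - card A) F) J y else 0)"
  proof (cases "card A \<le> m")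
   case True
   then have "S (card A) = {B. B \<in> invs J y \<and> card B = m - card A}" by (auto simp: S_def)
   then show ?thesis using True by (simp add: Pop_def)
  qed (simp add: S_def)
  finally show "avg G A (\<lambda>x. avg G (?N - A) (\<lambda>x'. H A x x')) =
   (if card A \<le> m then wpair v w (card A) * Pop w (m - card A) (Qop G v (n - card A) F) J y else 0)" .
 qed
 moreover have "avg G ?N (\<lambda>x. \<Sum>A\<in>invs ?N x. H A (dres A x) (dres (?N - A) x)) = Qop G v n (Pop w m F) J y"
  unfolding Qop_def
 proof (rule avg_cong)
  fix x assume x: "x \<in> dperm G ?N"
  let ?z = "djoin ?N x y"
  have z: "?z \<in> dperm G (?N \<union> J)" by (rule djoin_closed[OF x y NJ])
  have "v ?N x * Pop w m F (?N \<union> J) ?z = (\<Sum>C | C \<in> invs (?N \<union> J) ?z \<and> card C = m.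
    v ?N x * (w C (dres C ?z) * F (?N \<union> J - C) (dres (?N \<union> J - C) ?z)))"
   by (simp add: Pop_def sum_distrib_left)
  also have "\<dots> = (\<Sum>(A, B)\<in>(SIGMA A : invs ?N x. S (card A)).
    v A (dres A x) * w A (dres A x) * (w B (dres B y) *
     (v (?N - A) (dres (?N - A) x) * F ((?N - A) \<union> (J - B)) (djoin (?N - A) (dres (?N - A) x) (dres (J - B) y)))))"
  proof (rule sum.reindex_bij_witness[where i = "\<lambda>(A, B). A \<union> B" and j = "\<lambda>C. (C \<inter> ?N, C \<inter> J)"], goal_cases)
   case (1 C)
   then have "C \<subseteq> ?N \<union> J" using djoin_invs_iff[OF x y NJ] by simp
   then show ?case by auto
  next
   case (2 C)
   then have C: "C \<subseteq> ?N \<union> J" "C \<inter> ?N \<in> invs ?N x" "C \<inter> J \<in> invs J y" "card C = m"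
    using djoin_invs_iff[OF x y NJ] by simp_all
   have "card C = card (C \<inter> ?N \<union> C \<inter> J)" using C(1) by (intro arg_cong[of _ _ card]) auto
   also have "\<dots> = card (C \<inter> ?N) + card (C \<inter> J)"
    using NJ J by (intro card_Un_disjoint) auto
   finally show ?case using C by (simp add: S_def)
  next
   case (3 p)
   then obtain A B where p: "p = (A, B)" "A \<in> invs ?N x" "B \<in> invs J y" by (auto simp: S_def)
   then show ?case using NJ invsD(1)[OF p(2)] invsD(1)[OF p(3)] by auto
  next
   case (4 p)
   then obtain A B where p: "p = (A, B)" "A \<in> invs ?N x" "B \<in> invs J y" "card A + card B = m"
    by (auto simp: S_def)
   note sub = invsD(1)[OF p(2)] invsD(1)[OF p(3)]
   have "(A \<union> B) \<inter> ?N = A" "(A \<union> B) \<inter> J = B" using NJ sub by auto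
   moreover have "card (A \<union> B) = m"
    using p(4) sub NJ J finite_subset[OF sub(1)] finite_subset[OF sub(2)]
    by (subst card_Un_disjoint) auto
   ultimately show ?case using p sub by (auto simp: djoin_invs_iff[OF x y NJ])
  next
   case (5 C)
   then have C: "C \<in> invs (?N \<union> J) ?z" by simp
   let ?A = "C \<inter> ?N" and ?B = "C \<inter> J"
   have AB: "C \<subseteq> ?N \<union> J" "?A \<in> invs ?N x" "?B \<in> invs J y"
    using C djoin_invs_iff[OF x y NJ] by simp_all
   have d: "?A \<inter> ?B = {}" "finite ?A" "finite ?B" using NJ J by auto
   have "dres C ?z = djoin ?A (dres ?A x) (dres ?B y)" by (rule dres_djoin[OF x y NJ C])
   moreover have CAB: "?A \<union> ?B = C" using AB(1) by auto
   ultimately have wC: "w C (dres C ?z) = w ?A (dres ?A x) * w ?B (dres ?B y)"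
    using mult_weight_mult[OF w d(2,3,1) dres_closed[OF x AB(2)] dres_closed[OF y AB(3)]] by simp
   have C': "?N \<union> J - C \<in> invs (?N \<union> J) ?z" by (rule invs_compl[OF z C])
   have e: "(?N \<union> J - C) \<inter> ?N = ?N - ?A" "(?N \<union> J - C) \<inter> J = J - ?B"
    "?N \<union> J - C = (?N - ?A) \<union> (J - ?B)" using NJ by auto
   have "dres (?N \<union> J - C) ?z = djoin (?N - ?A) (dres (?N - ?A) x) (dres (J - ?B) y)"
    using dres_djoin[OF x y NJ C'] unfolding e(1,2) .
   moreover have "v ?N x = v ?A (dres ?A x) * v (?N - ?A) (dres (?N - ?A) x)"
    by (rule mult_weight_split[OF v finite_fresh x AB(2)])
   ultimately show ?case by (simp add: wC e(3) mult_ac)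
  qed
  also have "\<dots> = (\<Sum>A\<in>invs ?N x. \<Sum>B\<in>S (card A).
    v A (dres A x) * w A (dres A x) * (w B (dres B y) *
     (v (?N - A) (dres (?N - A) x) * F ((?N - A) \<union> (J - B)) (djoin (?N - A) (dres (?N - A) x) (dres (J - B) y)))))"
   by (rule sum.Sigma[symmetric]) (use finite_invs[of ?N x] finite_invs[OF J, of y] in \<open>auto simp: S_def\<close>)
  finally show "(\<Sum>A\<in>invs ?N x. H A (dres A x) (dres (?N - A) x)) = v ?N x * Pop w m F (?N \<union> J) ?z"
   by (simp add: H_def sum_distrib_left)
 qed
 ultimately show ?thesis by simp
qed

section \<open>Reduction of averages to single cycles\<close>

text \<open>The normalisation is by all decorated permutations, not only by the cyclic ones.\<close>

definition cyc_avg :: "'a species => nat => complex" where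
 "cyc_avg u a = avg G {1..a} (\<lambda>x. if cyc {1..a} x then u {1..a} x else 0)"

lemma cyc_diso:
 assumes "x \<in> dperm G I" "y \<in> dperm G J" "diso_via G s h I x J y"
 shows "cyc I x \<longleftrightarrow> cyc J y"
proof -
 have c: "cyc I x \<longleftrightarrow> I \<in> atoms I x" "cyc J y \<longleftrightarrow> J \<in> atoms J y"
  using assms(1,2) by (simp_all add: atoms_def invs_full dres_self)
 have im: "atoms J y = image s ` atoms I x" "s ` I = J"
  using atoms_diso[OF assms(1,3)] diso_via_image[OF assms(3)] by (simp_all add: bij_betw_def)
 have "A = I" if "A \<in> atoms I x" "s ` A = s ` I" for A
 proof -
  have "A \<subseteq> I" using that(1) invsD(1)[of A I x] by (simp add: atoms_def)
  then show ?thesis using inj_on_image_eq_iff[OF diso_via_inj[OF assms(3)], of A I] that(2) by simp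
 qed
 note AI = this
 have "s ` I \<in> image s ` atoms I x \<longleftrightarrow> I \<in> atoms I x"
 proof
  assume "s ` I \<in> image s ` atoms I x"
  then obtain A where "A \<in> atoms I x" "s ` I = s ` A" by blast
  then show "I \<in> atoms I x" using AI[of A] by simp
 qed (rule imageI)
 then show ?thesis using im unfolding c by simp
qed

text \<open>Counting, for every decorated permutation of \<open>n\<close> points, the points by the cycle that
 contains them.\<close>

lemma avg_recurrence:
 assumes u: "mult_weight G u"
 shows "of_nat n * avg G {1..n} (u {1..n}) =
  (\<Sum>a\<le>n. of_nat a * cyc_avg u a * avg G {1..n - a} (u {1..n - a}))"
proof -
 let ?N = "{1..n}"
 note iu = mult_weight_iso_inv[OF u]
 define H where "H A x x' = of_nat (card A) * (if cyc A x then u A x else 0) * u (?N - A) x'" for A x x'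
 have ic: "iso_inv G (\<lambda>I x. if cyc I x then u I x else 0)"
  unfolding iso_inv_def
 proof (intro allI impI)
  fix I J x y s h
  assume a: "finite I" "x \<in> dperm G I" "y \<in> dperm G J" "diso_via G s h I x J y"
  show "(if cyc I x then u I x else 0) = (if cyc J y then u J y else 0)"
   using cyc_diso[OF a(2-4)] iso_invD[OF iu a(4,1,2,3)] by simp
 qed
 have "avg G ?N (\<lambda>x. \<Sum>A\<in>invs ?N x. H A (dres A x) (dres (?N - A) x)) =
   (\<Sum>a\<le>card ?N. of_nat a * cyc_avg u a * avg G {1..n - a} (u {1..n - a}))"
 proof (rule avg_split)
  fix A assume A: "A \<subseteq> ?N"
  note fin = card_Pow_split[OF finite_atLeastAtMost A]
  have 1: "avg G (?N - A) (u (?N - A)) = avg G {1..n - card A} (u {1..n - card A})"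
   using fin by (intro avg_iso_inv[OF iu]) auto
  have 2: "avg G A (\<lambda>x. if cyc A x then u A x else 0) = cyc_avg u (card A)"
   unfolding cyc_avg_def using fin avg_iso_inv[OF ic, of A "{1..card A}"] by simp
  have "avg G A (\<lambda>x. avg G (?N - A) (\<lambda>x'. H A x x')) =
    of_nat (card A) * (avg G (?N - A) (u (?N - A)) * avg G A (\<lambda>x. if cyc A x then u A x else 0))"
   unfolding H_def mult.assoc avg_cmult avg_multc ..
  also have "\<dots> = of_nat (card A) * cyc_avg u (card A) * avg G {1..n - card A} (u {1..n - card A})"
   by (simp only: 1 2 mult_ac)
  finally show "avg G A (\<lambda>x. avg G (?N - A) (\<lambda>x'. H A x x')) =
   of_nat (card A) * cyc_avg u (card A) * avg G {1..n - card A} (u {1..n - card A})" .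
 qed simp
 moreover have "avg G ?N (\<lambda>x. \<Sum>A\<in>invs ?N x. H A (dres A x) (dres (?N - A) x)) =
   avg G ?N (\<lambda>x. of_nat n * u ?N x)"
 proof (rule avg_cong)
  fix x assume x: "x \<in> dperm G ?N"
  have "(\<Sum>A\<in>invs ?N x. H A (dres A x) (dres (?N - A) x)) =
    (\<Sum>A\<in>invs ?N x. if cyc A (dres A x) then of_nat (card A) * u ?N x else 0)"
  proof (rule sum.cong)
   fix A assume A: "A \<in> invs ?N x"
   show "H A (dres A x) (dres (?N - A) x) = (if cyc A (dres A x) then of_nat (card A) * u ?N x else 0)"
    using mult_weight_split[OF u _ x A] by (simp add: H_def)
  qed simp
  also have "\<dots> = (\<Sum>A\<in>atoms ?N x. of_nat (card A) * u ?N x)"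
   unfolding atoms_def by (rule sum.inter_filter[OF finite_invs[OF finite_atLeastAtMost], symmetric])
  also have "\<dots> = of_nat (\<Sum>A\<in>atoms ?N x. card A) * u ?N x"
   by (simp add: sum_distrib_right)
  finally show "(\<Sum>A\<in>invs ?N x. H A (dres A x) (dres (?N - A) x)) = of_nat n * u ?N x"
   using sum_card_atoms[OF x] by (simp del: of_nat_sum)
 qed
 ultimately show ?thesis by (simp add: avg_cmult)
qed

lemma avg_const_one: "finite I ==> avg G I (\<lambda>_. 1) = 1"
 using card_dperm_pos[of I] by (simp add: avg_def)

text \<open>For the constant weight the recurrence says that the numbers a c_a, where c_a is the
  proportion of cycles, sum to n over a \<le> n, for every n. Hence each of them is 1.\<close>

lemma cyc_avg_one: "a > 0 ==> of_nat a * cyc_avg (\<lambda>_ _. 1) a = 1"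
proof (induction a rule: less_induct)
 case (less n)
 let ?q = "\<lambda>a. of_nat a * cyc_avg (\<lambda>_ _. 1) a"
 have "mult_weight G (\<lambda>_ _. 1)" by (simp add: mult_weight_def iso_inv_def)
 from avg_recurrence[OF this, of n] have "of_nat n = (\<Sum>a\<le>n. ?q a)"
  by (simp add: avg_const_one)
 also have "{..n} = insert n (insert 0 {1..<n})" using less.prems by auto
 also have "(\<Sum>a\<in>\<dots>. ?q a) = ?q n + (\<Sum>a\<in>{1..<n}. ?q a)" using less.prems by simp
 also have "(\<Sum>a\<in>{1..<n}. ?q a) = (\<Sum>a\<in>{1..<n}. 1)" using less.IH by (intro sum.cong) auto
 finally have "of_nat n = ?q n + of_nat (n - 1)" by simp
 moreover have "(of_nat n :: complex) = 1 + of_nat (n - 1)"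
  using less.prems by (cases n) auto
 ultimately show ?case by simp
qed

lemma avg_mult_weight_zero:
 assumes "mult_weight G u" "avg G {} (u {}) = 1" "\<And>a. a > 0 ==> cyc_avg u a = 0" "n > 0"
 shows "avg G {1..n} (u {1..n}) = 0"
proof -
 have "of_nat a * cyc_avg u a * b = 0" for a b using assms(3)[of a] by (cases "a = 0") auto
 then show ?thesis using avg_recurrence[OF assms(1), of n] assms(4) by simp
qed

text \<open>The recurrence is t A' = 2 (t + t^3 + t^5 + ...) A for the generating function A of the
  averages. The solution with A(0) = 1 is (1 + t)/(1 - t) = 1 + 2t + 2t^2 + ...\<close>

lemma avg_mult_weight_two:
 assumes "mult_weight G u" "avg G {} (u {}) = 1"
  and "\<And>a. a > 0 ==> of_nat a * cyc_avg u a = (if odd a then 2 else 0)" "n > 0"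
 shows "avg G {1..n} (u {1..n}) = 2"
 using assms(4)
proof (induction n rule: less_induct)
 case (less n)
 have "of_nat n * avg G {1..n} (u {1..n}) =
   (\<Sum>a\<le>n. of_nat a * cyc_avg u a * avg G {1..n - a} (u {1..n - a}))"
  by (rule avg_recurrence[OF assms(1)])
 \<comment> \<open>By induction the remaining average is 2, giving 2 times 2, except for a = n,
   where it is the average 1 over the empty set.\<close>
 also have "\<dots> = (\<Sum>a\<le>n. if odd a then (if a = n then 2 else 4) else 0)"
 proof (rule sum.cong)
  fix a assume a: "a \<in> {..n}"
  show "of_nat a * cyc_avg u a * avg G {1..n - a} (u {1..n - a}) =
    (if odd a then (if a = n then 2 else 4) else 0)"
  proof (cases "a = 0")
   case False
   then show ?thesis using assms(2) assms(3)[of a] less.IH[of "n - a"] a by (cases "a = n") auto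
  qed simp
 qed simp
 also have "\<dots> = of_nat n * 2"
  using less.prems
 proof -
  have "(\<Sum>a\<le>n. if odd a then (4::complex) else 0) = (if odd n then of_nat n * 2 + 2 else of_nat n * 2)" for n
   by (induction n) (auto simp: algebra_simps)
  moreover have "(\<Sum>a\<le>n. if odd a then (if a = n then 2 else 4) else 0) =
    (\<Sum>a\<le>n. if odd a then (4::complex) else 0) - (if odd n then 2 else 0)"
  proof -
   have "(\<Sum>a\<le>n. if odd a then (if a = n then 2 else 4) else 0) =
     (\<Sum>a\<le>n. (if odd a then (4::complex) else 0) - (if a = n then (if odd n then 2 else 0) else 0))"
    by (intro sum.cong) auto
   then show ?thesis by (simp add: sum_subtractf)
  qed
  ultimately show ?thesis by (cases "odd n") auto
 qed
 finally show ?case using less.prems by simp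
qed

end

section \<open>Weights of cycles\<close>

text \<open>The counterpart of \<open>cycle_prod\<close> for an arbitrary permutation: the
  decorations along the orbit of i, later ones on the left.\<close>

primrec cprod :: "('a, 'b) monoid_scheme => 'a dp => nat => nat => 'a" where
 "cprod G x i 0 = \<one>\<^bsub>G\<^esub>"
| "cprod G x i (Suc k) = fst x ((snd x ^^ k) i) \<otimes>\<^bsub>G\<^esub> cprod G x i k"

definition class_fun :: "('a, 'b) monoid_scheme => ('a => complex) => bool" where
 "class_fun G f \<longleftrightarrow> (\<forall>x\<in>carrier G. \<forall>y\<in>carrier G. f (y \<otimes>\<^bsub>G\<^esub> x \<otimes>\<^bsub>G\<^esub> inv\<^bsub>G\<^esub> y) = f x)"

text \<open>The minimum is an arbitrary starting point; for a class function every other one gives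
  the same value (\<open>cyc_val_eq\<close>).\<close>

definition cyc_val :: "('a, 'b) monoid_scheme => ('a => complex) => 'a species" where
 "cyc_val G f A x = f (cprod G x (Min A) (card A))"

text \<open>The factor \<open>e\<close>, depending on the length of a cycle only, stays free here.
  It will be sqrt 2 times a sign that is never computed.\<close>

definition wt :: "('a, 'b) monoid_scheme => (nat => complex) => ('a => complex) => 'a species" where
 "wt G e f I x = (\<Prod>A\<in>atoms I x. if odd (card A) then e (card A) * cyc_val G f A (dres A x) else 0)"

lemma funpow_mem: "x \<in> dperm G I ==> i \<in> I ==> (snd x ^^ k) i \<in> I"
 by (induction k) (simp_all add: dperm_snd_mem)

text \<open>The orbit of i, listed by \<open>support\<close>, is an invariant set and so all of
  I.\<close>

lemma cyc_orbit:
 assumes x: "x \<in> dperm G I" and I: "finite I" "cyc I x" "i \<in> I"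
 shows "(snd x ^^ card I) i = i" "inj_on (\<lambda>k. (snd x ^^ k) i) {..<card I}"
  "(\<lambda>k. (snd x ^^ k) i) ` {..<card I} = I" "least_power (snd x) i = card I"
proof -
 let ?p = "snd x" and ?l = "least_power (snd x) i"
 have p: "permutation ?p" using dperm_snd[OF x] I(1) by (auto simp: permutation_permutes)
 define S where "S = set (support ?p i)"
 have S: "S = range (\<lambda>k. (?p ^^ k) i)" unfolding S_def by (rule support_set[OF p])
 have sub: "?p ` S \<subseteq> S"
 proof
  fix j assume "j \<in> ?p ` S"
  then obtain k where "j = ?p ((?p ^^ k) i)" unfolding S by blast
  then have "j = (?p ^^ Suc k) i" by simp
  then show "j \<in> S" unfolding S by (rule range_eqI)
 qed
 have "finite S" by (simp add: S_def)
 moreover have "inj_on ?p S" using dperm_inj[OF x] by (rule inj_on_subset) simp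
 ultimately have eq: "?p ` S = S" using sub by (intro endo_inj_surj)
 have "S \<subseteq> I" using funpow_mem[OF x I(3)] by (auto simp: S)
 then have "S \<in> invs I x" using eq by (simp add: invs_def)
 moreover have "i \<in> S" unfolding S by (rule range_eqI[of _ _ 0]) simp
 ultimately have SI: "S = I" using I(2) unfolding cyc_def by blast
 have d: "distinct (support ?p i)" by (rule cycle_of_permutation[OF p])
 have l: "?l = card I" using distinct_card[OF d] SI by (simp add: S_def)
 then show "least_power (snd x) i = card I" .
 show "(?p ^^ card I) i = i" using least_power_of_permutation(1)[OF p, of i] l by simp
 show "(\<lambda>k. (?p ^^ k) i) ` {..<card I} = I"
  using SI l by (simp add: S_def lessThan_atLeast0)
 show "inj_on (\<lambda>k. (?p ^^ k) i) {..<card I}"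
  using d l by (simp add: distinct_map lessThan_atLeast0)
qed

context fin_group begin

lemma cprod_closed: "x \<in> dperm G I ==> i \<in> I ==> cprod G x i k \<in> carrier G"
 by (induction k) (auto intro!: m_closed dperm_fst funpow_mem)

lemma cprod_head:
 assumes "x \<in> dperm G I" "i \<in> I"
 shows "cprod G x i (Suc k) = cprod G x (snd x i) k \<otimes> fst x i"
proof (induction k)
 case 0
 then show ?case using dperm_fst[OF assms] by simp
next
 case (Suc k)
 have "snd x i \<in> I" using assms dperm_snd_mem[OF assms(1)] by simp
 then have c: "cprod G x (snd x i) k \<in> carrier G" "fst x ((snd x ^^ k) (snd x i)) \<in> carrier G"
  using assms cprod_closed dperm_fst funpow_mem by metis+
 show ?case using Suc c dperm_fst[OF assms] by (simp add: m_assoc funpow_swap1)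
qed

text \<open>Starting one step later conjugates the product around the cycle by the decoration of the
  first point.\<close>

lemma cyc_val_step:
 assumes f: "class_fun G f" and x: "x \<in> dperm G I" and I: "finite I" "cyc I x" "i \<in> I"
 shows "f (cprod G x (snd x i) (card I)) = f (cprod G x i (card I))"
proof -
 let ?n = "card I"
 have si: "snd x i \<in> I" using I dperm_snd_mem[OF x] by simp
 have c: "cprod G x i ?n \<in> carrier G" "cprod G x (snd x i) ?n \<in> carrier G" "fst x i \<in> carrier G"
  using cprod_closed[OF x] I si dperm_fst[OF x] by auto
 have "fst x i \<otimes> cprod G x i ?n = cprod G x (snd x i) ?n \<otimes> fst x i"
  using cprod_head[OF x I(3), of ?n] cyc_orbit(1)[OF x I] by simp
 then have "cprod G x (snd x i) ?n = fst x i \<otimes> cprod G x i ?n \<otimes> inv (fst x i)"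
  using c by (simp add: m_assoc)
 then show ?thesis using f c by (simp add: class_fun_def)
qed

lemma cyc_val_eq:
 assumes f: "class_fun G f" and x: "x \<in> dperm G I" and I: "finite I" "cyc I x" "i \<in> I"
 shows "f (cprod G x i (card I)) = cyc_val G f I x"
proof -
 have m: "Min I \<in> I" using I by (auto intro: Min_in)
 have "f (cprod G x ((snd x ^^ k) (Min I)) (card I)) = cyc_val G f I x" for k
 proof (induction k)
  case (Suc k)
  then show ?case using cyc_val_step[OF f x I(1,2) funpow_mem[OF x m, of k]] by simp
 qed (simp add: cyc_val_def)
 moreover obtain k where "i = (snd x ^^ k) (Min I)"
  using cyc_orbit(3)[OF x I(1,2) m] I(3) by blast
 ultimately show ?thesis by simp
qed

text \<open>The factors h cancel between neighbouring points, so only those at the two ends remain.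
  Starting at the image of i matches the form of the equation in \<open>diso_via\<close>.\<close>

lemma cprod_diso:
 assumes x: "x \<in> dperm G I" and y: "y \<in> dperm G J" and iso: "diso_via G s h I x J y" and i: "i \<in> I"
 shows "cprod G y (s (snd x i)) k =
  h (s ((snd x ^^ k) i)) \<otimes> cprod G x (snd x i) k \<otimes> inv (h (s i))"
proof -
 have h: "h (s j) \<in> carrier G" if "j \<in> I" for j
  using iso that diso_via_image[OF iso] by (auto simp: diso_via_def)
 have si: "snd x i \<in> I" using i dperm_snd_mem[OF x] by simp
 have pw: "(snd y ^^ k) (s j) = s ((snd x ^^ k) j)" if "j \<in> I" for j k
 proof (induction k)
  case (Suc k)
  then show ?case using iso funpow_mem[OF x that] by (simp add: diso_via_def)
 qed simp
 show ?thesis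
 proof (induction k)
  case 0
  then show ?case using h i by simp
 next
  case (Suc k)
  let ?j = "(snd x ^^ k) i"
  have j: "?j \<in> I" "(snd x ^^ k) (snd x i) = snd x ?j" "snd x ?j \<in> I"
   using funpow_mem[OF x i, of k] funpow_swap1[of "snd x" k i] funpow_mem[OF x i, of "Suc k"] by simp_all
  have "fst y (s (snd x ?j)) = h (s (snd x ?j)) \<otimes> fst x (snd x ?j) \<otimes> inv (h (s ?j))"
   using iso j(1) by (simp add: diso_via_def)
  moreover have "inv (h (s ?j)) \<otimes> (h (s ?j) \<otimes> z) = z" if "z \<in> carrier G" for z
   using that h[OF j(1)] by (simp flip: m_assoc)
  ultimately show ?case using Suc h j i cprod_closed[OF x si, of k] dperm_fst[OF x j(3)]
   by (simp add: pw[OF si] m_assoc)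
 qed
qed

lemma cyc_val_diso:
 assumes f: "class_fun G f" and x: "x \<in> dperm G I" and y: "y \<in> dperm G J"
  and iso: "diso_via G s h I x J y" and I: "finite I" "cyc I x"
 shows "cyc_val G f I x = cyc_val G f J y"
proof -
 obtain i where i: "i \<in> I" using I(2) by (auto simp: cyc_def)
 have J: "finite J" "cyc J y" "card J = card I"
  using I cyc_diso[OF x y iso] diso_via_image[OF iso] card_image[OF diso_via_inj[OF iso]] by auto
 have si: "snd x i \<in> I" "s (snd x i) \<in> J"
  using i dperm_snd_mem[OF x] diso_via_image[OF iso] by auto
 have h: "h (s i) \<in> carrier G" using iso i diso_via_image[OF iso] by (auto simp: diso_via_def)
 have "cprod G y (s (snd x i)) (card I) = h (s i) \<otimes> cprod G x (snd x i) (card I) \<otimes> inv (h (s i))"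
  using cprod_diso[OF x y iso i, of "card I"] cyc_orbit(1)[OF x I i] by simp
 then have "f (cprod G y (s (snd x i)) (card I)) = f (cprod G x (snd x i) (card I))"
  using f h cprod_closed[OF x si(1)] by (simp add: class_fun_def)
 then show ?thesis
  using cyc_val_eq[OF f x I si(1)] cyc_val_eq[OF f y J(1,2) si(2)] J(3) by simp
qed

text \<open>Walking backwards from the k-th iterate of j, the inverse meets the inverted decorations
  of the iterates k + 1, ..., 2, since \<open>dinv\<close> takes its decoration from the next point.
  This accounts for the second iterate on the right.\<close>

lemma cprod_dinv:
 assumes x: "x \<in> dperm G I" and j: "j \<in> I"
 shows "cprod G (dinv G I x) ((snd x ^^ k) j) k = inv (cprod G x (snd x (snd x j)) k)"
proof (induction k)
 case (Suc k)
 let ?y = "dinv G I x"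
 have y: "?y \<in> dperm G I" by (rule dinv_closed[OF x])
 have m: "(snd x ^^ k) j \<in> I" "(snd x ^^ Suc k) j \<in> I" "snd x (snd x j) \<in> I"
  using funpow_mem[OF x j, of k] funpow_mem[OF x j, of "Suc k"] j dperm_snd_mem[OF x] by auto
 have bk: "snd ?y ((snd x ^^ Suc k) j) = (snd x ^^ k) j"
  using permutes_inverses(2)[OF dperm_snd[OF x]] by (simp add: dinv_def)
 have "fst ?y ((snd x ^^ Suc k) j) = inv (fst x ((snd x ^^ k) (snd x (snd x j))))"
  using m(2) by (simp add: dinv_def funpow_swap1)
 moreover have "fst x ((snd x ^^ k) (snd x (snd x j))) \<in> carrier G"
  using funpow_mem[OF x m(3)] dperm_fst[OF x] by simp
 ultimately show ?case
  using cprod_head[OF y m(2), of k] Suc cprod_closed[OF x m(3), of k] bk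
  by (simp add: inv_mult_group)
qed simp

lemma class_fun_inv: "class_fun G f ==> class_fun G (\<lambda>g. f (inv g))"
proof -
 have "inv (y \<otimes> x \<otimes> inv y) = y \<otimes> inv x \<otimes> inv y" if "x \<in> carrier G" "y \<in> carrier G" for x y
  using that by (simp add: inv_mult_group m_assoc)
 then show "class_fun G f ==> ?thesis" by (simp add: class_fun_def)
qed

lemma cyc_dinv: "x \<in> dperm G I ==> cyc I (dinv G I x) \<longleftrightarrow> cyc I x"
 by (simp add: cyc_def invs_dinv)

lemma cyc_val_dinv:
 assumes f: "class_fun G f" and x: "x \<in> dperm G I" and I: "finite I" "cyc I x"
 shows "cyc_val G f I (dinv G I x) = cyc_val G (\<lambda>g. f (inv g)) I x"
proof -
 obtain j where j: "j \<in> I" using I(2) by (auto simp: cyc_def)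
 have ssj: "snd x (snd x j) \<in> I" using j dperm_snd_mem[OF x] by simp
 have "cyc_val G f I (dinv G I x) = f (cprod G (dinv G I x) j (card I))"
  using cyc_val_eq[OF f dinv_closed[OF x] I(1) _ j] I(2) cyc_dinv[OF x] by simp
 also have "\<dots> = f (inv (cprod G x (snd x (snd x j)) (card I)))"
  using cprod_dinv[OF x j, of "card I"] cyc_orbit(1)[OF x I j] by simp
 also have "\<dots> = cyc_val G (\<lambda>g. f (inv g)) I x"
  by (rule cyc_val_eq[OF class_fun_inv[OF f] x I ssj])
 finally show ?thesis .
qed

lemma atomsD: "A \<in> atoms I x ==> A \<in> invs I x" "A \<in> atoms I x ==> cyc A (dres A x)"
 by (simp_all add: atoms_def)

lemma wt_dinv:
 assumes f: "class_fun G f" and x: "x \<in> dperm G I" and I: "finite I"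
 shows "wt G e f I (dinv G I x) = wt G e (\<lambda>g. f (inv g)) I x"
 unfolding wt_def atoms_dinv[OF x]
proof (rule prod.cong)
 fix A assume A: "A \<in> atoms I x"
 have "finite A" using finite_subset[OF invsD(1)[OF atomsD(1)[OF A]] I] .
 then have "cyc_val G f A (dres A (dinv G I x)) = cyc_val G (\<lambda>g. f (inv g)) A (dres A x)"
  using cyc_val_dinv[OF f dres_closed[OF x atomsD(1)[OF A]] _ atomsD(2)[OF A]]
   dinv_dres[OF x atomsD(1)[OF A]] by simp
 then show "(if odd (card A) then e (card A) * cyc_val G f A (dres A (dinv G I x)) else 0) =
   (if odd (card A) then e (card A) * cyc_val G (\<lambda>g. f (inv g)) A (dres A x) else 0)" by simp
qed simp

lemma mult_weight_wt:
 assumes f: "class_fun G f" shows "mult_weight G (wt G e f)"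
 unfolding mult_weight_def iso_inv_def
proof (intro conjI allI impI ballI)
 fix I J x y s h
 assume I: "finite I" and x: "x \<in> dperm G I" and y: "y \<in> dperm G J" and iso: "diso_via G s h I x J y"
 let ?v = "\<lambda>A x. if odd (card A) then e (card A) * cyc_val G f A (dres A x) else 0"
 have "?v A x = ?v (s ` A) y" if A: "A \<in> atoms I x" for A
 proof -
  have sub: "A \<subseteq> I" and inv: "A \<in> invs I x" using invsD(1)[OF atomsD(1)[OF A]] atomsD(1)[OF A] .
  have "card (s ` A) = card A" by (rule card_image[OF inj_on_subset[OF diso_via_inj[OF iso] sub]])
  moreover have "s ` A \<in> invs J y" using diso_image_invs[OF x iso sub] inv by simp
  then have "cyc_val G f A (dres A x) = cyc_val G f (s ` A) (dres (s ` A) y)"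
   using diso_dres[OF x iso inv] finite_subset[OF sub I] atomsD(2)[OF A]
   by (intro cyc_val_diso[OF f dres_closed[OF x inv] dres_closed[OF y]]) auto
  ultimately show ?thesis by simp
 qed
 then show "wt G e f I x = wt G e f J y"
  unfolding wt_def prod.reindex_bij_betw[OF atoms_diso[OF x iso], of "\<lambda>A. ?v A y", symmetric]
  by (intro prod.cong) simp_all
next
 fix x :: "'a dp" assume "x \<in> dperm G {}"
 have "atoms {} x = {}" by (auto simp: atoms_iff invs_def)
 then show "wt G e f {} x = 1" by (simp add: wt_def)
next
 fix A B x y
 assume fin: "finite A" "finite B" and d: "A \<inter> B = {}" and x: "x \<in> dperm G A" and y: "y \<in> dperm G B"
 have sub: "C \<subseteq> A" if "C \<in> atoms A x" for C using invsD(1)[OF atomsD(1)[OF that]] .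
 have sub': "C \<subseteq> B" if "C \<in> atoms B y" for C using invsD(1)[OF atomsD(1)[OF that]] .
 have ne: "{} \<notin> atoms A x" by (simp add: atoms_iff)
 have disj: "atoms A x \<inter> atoms B y = {}"
 proof -
  have "C = {}" if "C \<in> atoms A x" "C \<in> atoms B y" for C
   using sub[OF that(1)] sub'[OF that(2)] d by blast
  then show ?thesis using ne by blast
 qed
 have 1: "dres C (djoin A x y) = dres C x" if "C \<in> atoms A x" for C
  using sub[OF that] by (auto simp: dres_def djoin_def restrict_def fun_eq_iff)
 have 2: "dres C (djoin A x y) = dres C y" if "C \<in> atoms B y" for C
  using sub'[OF that] d by (auto simp: dres_def djoin_def restrict_def fun_eq_iff)
 show "wt G e f (A \<union> B) (djoin A x y) = wt G e f A x * wt G e f B y"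
  unfolding wt_def atoms_djoin[OF x y d]
  by (subst prod.union_disjoint[OF finite_atoms[OF fin(1)] finite_atoms[OF fin(2)] disj])
   (intro arg_cong2[where f = "(*)"] prod.cong; simp add: 1 2)
qed

text \<open>A nonzero weight forces all cycles to be odd. Adding or removing one fixed cycle C is
  then a sign-reversing involution on the invariant subsets.\<close>

lemma alternating_wt: "alternating G (wt G e f)"
 unfolding alternating_def
proof (intro allI impI)
 fix I x assume I: "finite I" "I \<noteq> {}" and x: "x \<in> dperm G I" and nz: "wt G e f I x \<noteq> 0"
 obtain i where i: "i \<in> I" using I(2) by auto
 obtain C where C: "C \<in> atoms I x" using ex_atom[OF x I(1) i] by auto
 have odd: "odd (card C)" 
 proof (rule ccontr)
  assume "\<not> odd (card C)"
  then have "wt G e f I x = 0" unfolding wt_def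
   using finite_atoms[OF I(1), of x] C by (intro prod_zero) auto
  then show False using nz by simp
 qed
 \<comment> \<open>Every invariant set contains C or is disjoint from it, so these two cases are
   inverse to each other.\<close>
 define t where "t A = (if C \<subseteq> A then A - C else A \<union> C)" for A
 have Cinv: "C \<in> invs I x" "C \<noteq> {}" using C by (auto simp: atoms_iff)
 have dich: "C \<subseteq> A \<or> C \<inter> A = {}" if "A \<in> invs I x" for A
  using atom_subset_or_disjoint[OF x C that] .
 have t: "t A \<in> invs I x \<and> t (t A) = A \<and> (-1::complex) ^ card (t A) = - ((-1) ^ card A)"
  if A: "A \<in> invs I x" for A
 proof -
  have fin: "finite A" "finite C" using invsD(1)[OF A] invsD(1)[OF Cinv(1)] I(1) finite_subset by auto
  show ?thesis
  proof (cases "C \<subseteq> A")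
   case True
   have "card A = card (A - C) + card C" using True fin card_mono[OF fin(1) True] by (simp add: card_Diff_subset)
   then have "(-1::complex) ^ card A = - ((-1) ^ card (A - C))" using odd by (simp add: power_add)
   moreover have "\<not> C \<subseteq> A - C" "A - C \<union> C = A" using True Cinv(2) by auto
   ultimately show ?thesis using True invs_diff[OF x A Cinv(1)] by (simp add: t_def)
  next
   case False
   then have d: "C \<inter> A = {}" using dich[OF A] by simp
   then have "card (A \<union> C) = card A + card C" using fin by (intro card_Un_disjoint) auto
   then have "(-1::complex) ^ card (A \<union> C) = - ((-1) ^ card A)" using odd by (simp add: power_add)
   moreover have "A \<union> C - C = A" using d by auto
   ultimately show ?thesis using False invs_Un[OF A Cinv(1)] by (simp add: t_def)
  qed
 qed
 have "(\<Sum>A\<in>invs I x. (-1) ^ card A) = (\<Sum>A\<in>invs I x. - ((-1::complex) ^ card A))"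
  by (rule sum.reindex_bij_witness[where i = t and j = t]) (use t in auto)
 then show "(\<Sum>A\<in>invs I x. (-1) ^ card A) = (0::complex)" by (simp add: sum_negf)
qed

lemma mult_weight_mult_weight:
 assumes "mult_weight G v" "mult_weight G w" shows "mult_weight G (\<lambda>I x. v I x * w I x)"
 unfolding mult_weight_def
proof (intro conjI allI impI ballI)
 show "iso_inv G (\<lambda>I x. v I x * w I x)"
  unfolding iso_inv_def
 proof (intro allI impI)
  fix I J x y s h assume a: "finite I" "x \<in> dperm G I" "y \<in> dperm G J" "diso_via G s h I x J y"
  show "v I x * w I x = v J y * w J y"
   using iso_invD[OF mult_weight_iso_inv[OF assms(1)] a(4,1-3)]
    iso_invD[OF mult_weight_iso_inv[OF assms(2)] a(4,1-3)] by simp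
 qed
 fix x assume "x \<in> dperm G {}"
 then show "v {} x * w {} x = 1" using assms unfolding mult_weight_def by simp
next
 fix A B x y
 assume a: "finite A" "finite B" "A \<inter> B = {}" "x \<in> dperm G A" "y \<in> dperm G B"
 show "v (A \<union> B) (djoin A x y) * w (A \<union> B) (djoin A x y) = v A x * w A x * (v B y * w B y)"
  using mult_weight_mult[OF assms(1) a] mult_weight_mult[OF assms(2) a] by simp
qed

lemma wt_cyc:
 assumes "x \<in> dperm G I" "cyc I x"
 shows "wt G e f I x = (if odd (card I) then e (card I) * cyc_val G f I x else 0)"
proof -
 have "atoms I x = {I}"
  using assms invs_full[OF assms(1)] unfolding atoms_iff cyc_def set_eq_iff by (auto simp: atoms_iff)
 then show ?thesis using dres_self[OF assms(1)] by (simp add: wt_def)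
qed

end

section \<open>Averages of products of two weights\<close>

context fin_group begin

text \<open>For a fixed cyclic permutation the product around the cycle is equidistributed in the
  group: multiplying the decoration of i by y on the right multiplies the cycle product by y on the
  right.\<close>

lemma sum_cycle_product:
 assumes p: "p permutes I" and I: "finite I" "cyc I (g0, p)" "i \<in> I"
 shows "of_nat (card (carrier G)) * (\<Sum>g\<in>I \<rightarrow>\<^sub>E carrier G. \<phi> (cprod G (g, p) i (card I))) =
  of_nat (card (I \<rightarrow>\<^sub>E carrier G)) * (\<Sum>y\<in>carrier G. \<phi> y :: complex)"
proof -
 have cyc: "cyc I (g, p)" for g using I(2) by (simp add: cyc_def invs_def)
 have dp: "(g, p) \<in> dperm G I" if "g \<in> I \<rightarrow>\<^sub>E carrier G" for g
  using that p by (simp add: dperm_iff)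
 let ?P = "\<lambda>g. cprod G (g, p) i (card I)"
 obtain m where m: "card I = Suc m" using I by (cases "card I") auto
 have upd: "?P (g(i := g i \<otimes> y)) = ?P g \<otimes> y" if g: "g \<in> I \<rightarrow>\<^sub>E carrier G" and y: "y \<in> carrier G" for g y
 proof -
  let ?g = "g(i := g i \<otimes> y)"
  have g': "?g \<in> I \<rightarrow>\<^sub>E carrier G" using g y I(3) by (auto simp: PiE_iff extensional_def)
  have pi: "p i \<in> I" using p I(3) by (simp add: permutes_in_image)
  \<comment> \<open>The point i occurs only at the start of the walk, so the other factors of the
    cycle product do not notice the change.\<close>
  have "k \<le> m ==> cprod G (?g, p) (p i) k = cprod G (g, p) (p i) k" for k
  proof (induction k)
   case (Suc k)
   have "(p ^^ Suc k) i \<noteq> (p ^^ 0) i"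
    using inj_onD[OF cyc_orbit(2)[OF dp[OF g] I(1) cyc I(3)], of "Suc k" 0] Suc.prems m by auto
   then have "(p ^^ k) (p i) \<noteq> i" by (simp add: funpow_swap1)
   then show ?case using Suc by simp
  qed simp
  then have "?P ?g = cprod G (g, p) (p i) m \<otimes> (g i \<otimes> y)"
   using cprod_head[OF dp[OF g'] I(3), of m] m by simp
  moreover have "?P g = cprod G (g, p) (p i) m \<otimes> g i"
   using cprod_head[OF dp[OF g] I(3), of m] m by simp
  moreover have "g i \<in> carrier G" using g I(3) by auto
  ultimately show ?thesis
   using cprod_closed[OF dp[OF g] pi, of m] y by (simp add: m_assoc)
 qed
 have shift: "(\<Sum>g\<in>I \<rightarrow>\<^sub>E carrier G. \<phi> (?P g \<otimes> y)) = (\<Sum>g\<in>I \<rightarrow>\<^sub>E carrier G. \<phi> (?P g))"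
  if y: "y \<in> carrier G" for y
 proof (rule sum.reindex_bij_witness[where i = "\<lambda>g. g(i := g i \<otimes> inv y)" and j = "\<lambda>g. g(i := g i \<otimes> y)"])
  fix g assume g: "g \<in> I \<rightarrow>\<^sub>E carrier G"
  then have gi: "g i \<in> carrier G" using I(3) by auto
  show "(g(i := g i \<otimes> y))(i := (g(i := g i \<otimes> y)) i \<otimes> inv y) = g"
   using gi y by (simp add: m_assoc)
  show "(g(i := g i \<otimes> inv y))(i := (g(i := g i \<otimes> inv y)) i \<otimes> y) = g"
   using gi y by (simp add: m_assoc)
  show "g(i := g i \<otimes> y) \<in> I \<rightarrow>\<^sub>E carrier G" "g(i := g i \<otimes> inv y) \<in> I \<rightarrow>\<^sub>E carrier G"
   using g gi y I(3) by (auto simp: PiE_iff extensional_def)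
  show "\<phi> (?P (g(i := g i \<otimes> y))) = \<phi> (?P g \<otimes> y)" using upd[OF g y] by simp
 qed
 have "of_nat (card (carrier G)) * (\<Sum>g\<in>I \<rightarrow>\<^sub>E carrier G. \<phi> (?P g)) =
   (\<Sum>y\<in>carrier G. \<Sum>g\<in>I \<rightarrow>\<^sub>E carrier G. \<phi> (?P g \<otimes> y))"
  by (simp add: shift)
 also have "\<dots> = (\<Sum>g\<in>I \<rightarrow>\<^sub>E carrier G. \<Sum>y\<in>carrier G. \<phi> (?P g \<otimes> y))" by (rule sum.swap)
 also have "\<dots> = (\<Sum>g\<in>I \<rightarrow>\<^sub>E carrier G. \<Sum>y\<in>carrier G. \<phi> y)"
 proof (rule sum.cong)
  fix g assume g: "g \<in> I \<rightarrow>\<^sub>E carrier G"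
  have c: "?P g \<in> carrier G" by (rule cprod_closed[OF dp[OF g] I(3)])
  show "(\<Sum>y\<in>carrier G. \<phi> (?P g \<otimes> y)) = (\<Sum>y\<in>carrier G. \<phi> y)"
   by (rule sum.reindex_bij_witness[where i = "\<lambda>y. inv (?P g) \<otimes> y" and j = "\<lambda>y. ?P g \<otimes> y"])
    (use c in \<open>auto simp flip: m_assoc\<close>)
 qed simp
 finally show ?thesis by simp
qed

text \<open>Bilinear, with no inverse in the second argument: the inverse required by orthogonality
  will come from \<open>dual\<close>, that is, from the one in \<open>pairing\<close>.\<close>

definition inner :: "('a => complex) => ('a => complex) => complex" where
 "inner f f' = (\<Sum>y\<in>carrier G. f y * f' y) / of_nat (card (carrier G))"

text \<open>Equidistribution of the cycle product turns the average into an inner product; the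
  remaining factor 1/a is the proportion of cycles. Both weights carry \<open>e a\<close>, so its
  sign disappears.\<close>

lemma cyc_avg_wt:
 assumes f: "class_fun G f" "class_fun G f'" and a: "a > 0"
 shows "of_nat a * cyc_avg (\<lambda>I x. wt G e f I x * wt G e f' I x) a =
  (if odd a then e a ^ 2 * inner f f' else 0)"
proof -
 let ?I = "{1..a}" and ?N = "of_nat (card (carrier G)) :: complex"
 have i: "1 \<in> ?I" using a by simp
 have N: "?N \<noteq> 0" using finite_carrier one_closed by (auto simp: card_eq_0_iff)
 let ?\<phi> = "\<lambda>y. f y * f' y"
 let ?k = "if odd a then e a ^ 2 else 0"
 have val: "wt G e f ?I x * wt G e f' ?I x = ?k * ?\<phi> (cprod G x 1 a)"
  if "x \<in> dperm G ?I" "cyc ?I x" for x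
  using wt_cyc[OF that, of e] cyc_val_eq[OF f(1) that(1) _ that(2) i] cyc_val_eq[OF f(2) that(1) _ that(2) i]
  by (simp add: power2_eq_square)
 have "?N * (\<Sum>x\<in>dperm G ?I. if cyc ?I x then ?\<phi> (cprod G x 1 a) else 0) =
   (\<Sum>y\<in>carrier G. ?\<phi> y) * (\<Sum>x\<in>dperm G ?I. if cyc ?I x then 1 else 0)"
 proof -
  have cg: "cyc ?I (g, p) \<longleftrightarrow> cyc ?I (undefined, p)" for g :: "nat => 'a" and p by (simp add: cyc_def invs_def)
  have "?N * (\<Sum>g\<in>?I \<rightarrow>\<^sub>E carrier G. if cyc ?I (g, p) then ?\<phi> (cprod G (g, p) 1 a) else 0) =
    (\<Sum>y\<in>carrier G. ?\<phi> y) * (\<Sum>g\<in>?I \<rightarrow>\<^sub>E carrier G. if cyc ?I (g, p) then 1 else 0)"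
   if p: "p permutes ?I" for p
  proof (cases "cyc ?I (undefined :: nat => 'a, p)")
   case True
   then have c: "cyc ?I (g, p)" for g :: "nat => 'a" using cg[of g p] by blast
   show ?thesis
    using sum_cycle_product[OF p _ True i, of ?\<phi>] by (simp add: c mult.commute del: One_nat_def)
  next
   case False
   then have "\<not> cyc ?I (g, p)" for g :: "nat => 'a" using cg[of g p] by blast
   then show ?thesis by (simp del: One_nat_def)
  qed
  then have "(\<Sum>p | p permutes ?I. ?N * (\<Sum>g\<in>?I \<rightarrow>\<^sub>E carrier G. if cyc ?I (g, p) then ?\<phi> (cprod G (g, p) 1 a) else 0)) =
    (\<Sum>p | p permutes ?I. (\<Sum>y\<in>carrier G. ?\<phi> y) * (\<Sum>g\<in>?I \<rightarrow>\<^sub>E carrier G. if cyc ?I (g, p) then 1 else 0))"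
   by (intro sum.cong) (simp_all del: One_nat_def)
  moreover have "(\<Sum>x\<in>dperm G ?I. \<psi> x) = (\<Sum>p | p permutes ?I. \<Sum>g\<in>?I \<rightarrow>\<^sub>E carrier G. \<psi> (g, p))"
   for \<psi> :: "'a dp => complex"
   unfolding dperm_def sum.cartesian_product' by (rule sum.swap)
  ultimately show ?thesis
   by (simp only: sum_distrib_left)
 qed
 then have "?N * cyc_avg (\<lambda>I x. wt G e f I x * wt G e f' I x) a =
   ?k * (\<Sum>y\<in>carrier G. ?\<phi> y) * cyc_avg (\<lambda>_ _. 1) a"
 proof -
  assume eq: "?N * (\<Sum>x\<in>dperm G ?I. if cyc ?I x then ?\<phi> (cprod G x 1 a) else 0) =
   (\<Sum>y\<in>carrier G. ?\<phi> y) * (\<Sum>x\<in>dperm G ?I. if cyc ?I x then 1 else 0)"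
  have "cyc_avg (\<lambda>I x. wt G e f I x * wt G e f' I x) a =
    avg G ?I (\<lambda>x. ?k * (if cyc ?I x then ?\<phi> (cprod G x 1 a) else 0))"
   unfolding cyc_avg_def by (rule avg_cong) (use val in auto)
  also have "\<dots> = ?k * (\<Sum>x\<in>dperm G ?I. if cyc ?I x then ?\<phi> (cprod G x 1 a) else 0) / of_nat (card (dperm G ?I))"
   by (simp only: avg_cmult) (simp add: avg_def)
  finally have E: "?N * cyc_avg (\<lambda>I x. wt G e f I x * wt G e f' I x) a =
   ?k * (?N * (\<Sum>x\<in>dperm G ?I. if cyc ?I x then ?\<phi> (cprod G x 1 a) else 0)) / of_nat (card (dperm G ?I))"
   by simp
  show ?thesis unfolding E eq unfolding cyc_avg_def avg_def
   by (simp only: mult.assoc times_divide_eq_right)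
 qed
 then have "cyc_avg (\<lambda>I x. wt G e f I x * wt G e f' I x) a = ?k * inner f f' * cyc_avg (\<lambda>_ _. 1) a"
  using N by (simp add: inner_def field_simps)
 then show ?thesis using cyc_avg_one[OF a] by (simp add: mult.left_commute)
qed

text \<open>Inner product 0 makes all single-cycle averages vanish, so only the empty set
  contributes; inner product 1 gives the coefficients of (1 + t)/(1 - t).\<close>

lemma wpair_wt:
 assumes f: "class_fun G f" "class_fun G f'" and e: "\<And>a. e a ^ 2 = 2"
 shows "inner f f' = 0 ==> wpair (wt G e f) (wt G e f') n = (if n = 0 then 1 else 0)"
  and "inner f f' = 1 ==> wpair (wt G e f) (wt G e f') n = (if n = 0 then 1 else 2)"
proof -
 let ?u = "\<lambda>I x. wt G e f I x * wt G e f' I x"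
 have u: "mult_weight G ?u" by (intro mult_weight_mult_weight mult_weight_wt f)
 have "dperm G {} \<noteq> {}" using card_dperm_pos[of "{}"] by auto
 then obtain x where x: "x \<in> dperm G {}" by blast
 have 0: "avg G {} (?u {}) = 1" using u x avg_empty[OF x, of "?u {}"] unfolding mult_weight_def by simp
 note c = cyc_avg_wt[OF f, of _ e, unfolded e]
 { assume z: "inner f f' = 0"
  have "cyc_avg ?u a = 0" if "a > 0" for a
  proof -
   have "of_nat a * cyc_avg ?u a = 0" using c[OF that] z by simp
   then show ?thesis using that by simp
  qed
  from avg_mult_weight_zero[OF u 0 this, of n] 0
  show "wpair (wt G e f) (wt G e f') n = (if n = 0 then 1 else 0)"
   by (cases "n = 0") (simp_all add: wpair_def) }
 { assume z: "inner f f' = 1"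
  have "of_nat a * cyc_avg ?u a = (if odd a then 2 else 0)" if "a > 0" for a using c[OF that] z by simp
  from avg_mult_weight_two[OF u 0 this, of n] 0
  show "wpair (wt G e f) (wt G e f') n = (if n = 0 then 1 else 2)"
   by (cases "n = 0") (simp_all add: wpair_def) }
qed

end

section \<open>Lifts of odd order\<close>

lemma diso_via_unique:
 assumes "diso_via G s h I x J y" "diso_via G s h I x J y'" "x \<in> dperm G I" "y \<in> dperm G J" "y' \<in> dperm G J"
 shows "y = y'"
proof (rule dperm_eqI[OF assms(4,5)])
 fix j assume j: "j \<in> J"
 then obtain i where i: "i \<in> I" "j = s i" using diso_via_image[OF assms(1)] by auto
 show "snd y j = snd y' j" using assms(1,2) i by (simp add: diso_via_def)
 have "i \<in> snd x ` I" using dperm_image[OF assms(3)] i by simp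
 then obtain k where k: "k \<in> I" "i = snd x k" by auto
 then show "fst y j = fst y' j" using assms(1,2) i(2) by (simp add: diso_via_def)
qed

lemma diso_via_cong:
 assumes "diso_via G s h I x J y" "\<And>i. i \<in> I ==> s i = s' i" "\<And>j. j \<in> J ==> h j = h' j" "x \<in> dperm G I"
 shows "diso_via G s' h' I x J y"
proof -
 have "bij_betw s' I J" using assms(1,2) bij_betw_cong[of I s s' J] by (simp add: diso_via_def)
 moreover have "s' i \<in> J" if "i \<in> I" for i
  using assms(2)[OF that] imageI[OF that, of s] diso_via_image[OF assms(1)] by simp
 ultimately show ?thesis using assms(1) dperm_snd_mem[OF assms(4)]
  unfolding diso_via_def by (simp add: assms(2,3))
qed

lemma (in group) diso_trans:
 assumes x: "x \<in> dperm G I" and y: "y \<in> dperm G J"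
  and "diso_via G s h I x J y" "diso_via G t k J y K z"
 shows "\<exists>u l. diso_via G u l I x K z"
proof -
 let ?l = "\<lambda>j. k j \<otimes> h (inv_into J t j)"
 have sI: "s i \<in> J" if "i \<in> I" for i using that diso_via_image[OF assms(3)] by auto
 have tJ: "t j \<in> K" if "j \<in> J" for j using that diso_via_image[OF assms(4)] by auto
 have inv: "inv_into J t (t j) = j" if "j \<in> J" for j using that diso_via_inj[OF assms(4)] by simp
 have hk: "h j \<in> carrier G" "k (t j) \<in> carrier G" if "j \<in> J" for j
  using that assms(3,4) tJ by (auto simp: diso_via_def)
 have "bij_betw (t \<circ> s) I K" using assms(3,4) by (auto simp: diso_via_def intro: bij_betw_trans)
 moreover have "?l j \<in> carrier G" if "j \<in> K" for j
 proof -
  obtain i where "i \<in> J" "j = t i" using \<open>j \<in> K\<close> diso_via_image[OF assms(4)] by auto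
  then show ?thesis using hk by (simp add: inv)
 qed
 moreover have "snd z (t (s i)) = t (s (snd x i)) \<and> fst z (t (s (snd x i))) =
   ?l (t (s (snd x i))) \<otimes> fst x (snd x i) \<otimes> inv (?l (t (s i)))" if i: "i \<in> I" for i
 proof -
  have m: "snd x i \<in> I" "s i \<in> J" "s (snd x i) \<in> J" using i sI dperm_snd_mem[OF x] by auto
  have 1: "snd y (s i) = s (snd x i)"
   "fst y (s (snd x i)) = h (s (snd x i)) \<otimes> fst x (snd x i) \<otimes> inv (h (s i))"
   using assms(3) i by (auto simp: diso_via_def)
  have 2: "snd z (t (s i)) = t (snd y (s i))"
   "fst z (t (snd y (s i))) = k (t (snd y (s i))) \<otimes> fst y (snd y (s i)) \<otimes> inv (k (t (s i)))"
   using assms(4) m(2) by (auto simp: diso_via_def)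
  show ?thesis using 2 hk[OF m(2)] hk[OF m(3)] dperm_fst[OF x m(1)]
   by (simp add: 1 inv m inv_mult_group m_assoc)
 qed
 ultimately have "diso_via G (t \<circ> s) ?l I x K z" by (simp add: diso_via_def)
 then show ?thesis by blast
qed

definition pr :: "'a welt => 'a dp" where
 "pr x = (fst x, spin_perm (snd x))"

definition odd_order :: "(nat => nat) => bool" where
 "odd_order p \<longleftrightarrow> (\<exists>N. odd N \<and> p ^^ N = id)"

text \<open>Only the spin component is required to have odd order. The decoration is left free,
  since the group may have elements of even order.\<close>

definition pos :: "nat => 'a welt => bool" where
 "pos n x \<longleftrightarrow> (\<exists>N::nat. odd N \<and> snd x [^]\<^bsub>Sp n\<^esub> N = \<one>\<^bsub>Sp n\<^esub>)"

lemma odd_order_diso: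
 assumes x: "x \<in> dperm G I" and y: "y \<in> dperm G J" and iso: "diso_via G s h I x J y" and o: "odd_order (snd x)"
 shows "odd_order (snd y)"
proof -
 obtain N where N: "odd N" "snd x ^^ N = id" using o by (auto simp: odd_order_def)
 have pw: "(snd y ^^ k) (s i) = s ((snd x ^^ k) i)" if "i \<in> I" for i k
 proof (induction k)
  case (Suc k)
  then show ?case using iso funpow_mem[OF x that] by (simp add: diso_via_def)
 qed simp
 have "(snd y ^^ N) j = j" for j
 proof (cases "j \<in> J")
  case True
  then obtain i where "i \<in> I" "j = s i" using diso_via_image[OF iso] by auto
  then show ?thesis using pw[of i N] N(2) by simp
 next
  case False
  have "(snd y ^^ k) j = j" for k using dperm_snd_outside[OF y False] by (induction k) auto
  then show ?thesis .
 qed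
 then show ?thesis using N(1) by (auto simp: odd_order_def fun_eq_iff)
qed

lemma spin_perm_pow:
 "t \<in> carrier (Sp n) ==> spin_perm (t [^]\<^bsub>Sp n\<^esub> (k::nat)) = spin_perm t ^^ k"
proof (induction k)
 case 0
 then show ?case by (simp add: spin_perm_one)
next
 case (Suc k)
 interpret S: group "Sp n" by (rule spin_group_group)
 show ?case using Suc by (simp add: spin_perm_mult funpow_swap1 fun_eq_iff)
qed

lemma spin_parity_pow:
 "t \<in> carrier (Sp n) ==> spin_parity (t [^]\<^bsub>Sp n\<^esub> (k::nat)) = (k * spin_parity t) mod 2"
proof (induction k)
 case 0
 then show ?case by (simp add: spin_parity_one)
next
 case (Suc k)
 interpret S: group "Sp n" by (rule spin_group_group)
 show ?case using Suc by (simp add: spin_parity_mult mod_simps add.commute)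
qed

lemma spin_z_pow: "spin_z n [^]\<^bsub>Sp n\<^esub> (k::nat) = (if even k then \<one>\<^bsub>Sp n\<^esub> else spin_z n)"
proof (induction k)
 case (Suc k)
 interpret S: group "Sp n" by (rule spin_group_group)
 show ?case using Suc by (simp add: spin_z_square)
qed simp

lemma spin_z_mult_pow:
 assumes "t \<in> carrier (Sp n)"
 shows "(spin_z n \<otimes>\<^bsub>Sp n\<^esub> t) [^]\<^bsub>Sp n\<^esub> (k::nat) =
  (if even k then t [^]\<^bsub>Sp n\<^esub> k else spin_z n \<otimes>\<^bsub>Sp n\<^esub> t [^]\<^bsub>Sp n\<^esub> k)"
proof -
 interpret S: group "Sp n" by (rule spin_group_group)
 show ?thesis using S.pow_mult_distrib[OF spin_z_central[OF assms] spin_z_closed assms, of k] assms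
  by (simp add: spin_z_pow)
qed

section \<open>The spin wreath product over the decorated permutations\<close>

context fin_group begin

abbreviation W :: "nat => 'a welt monoid" where
 "W \<equiv> wreath G"

abbreviation CW :: "nat => 'a welt set" where
 "CW n \<equiv> carrier (W n)"

lemma carrier_wreath:
 "x \<in> CW n \<longleftrightarrow> fst x \<in> {1..n} \<rightarrow>\<^sub>E carrier G \<and> snd x \<in> carrier (Sp n)"
 by (cases x) (simp add: wreath_def base_group_def)

lemma wreath_fst: "x \<in> CW n ==> i \<in> {1..n} ==> fst x i \<in> carrier G"
 by (auto simp: carrier_wreath)

lemma wreath_snd: "x \<in> CW n ==> snd x \<in> carrier (Sp n)"
 by (simp add: carrier_wreath)

lemma mult_wreath:
 "x \<otimes>\<^bsub>W n\<^esub> y = (\<lambda>i\<in>{1..n}. fst x i \<otimes> fst y (inv_into UNIV (spin_perm (snd x)) i),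
  snd x \<otimes>\<^bsub>Sp n\<^esub> snd y)"
 by (cases x; cases y) (auto simp: wreath_def base_group_def perm_act_def restrict_def fun_eq_iff)

lemma one_wreath: "\<one>\<^bsub>W n\<^esub> = (\<lambda>i\<in>{1..n}. \<one>, \<one>\<^bsub>Sp n\<^esub>)"
 by (simp add: wreath_def base_group_def)

lemma zelt_eq: "zelt G n = (\<lambda>i\<in>{1..n}. \<one>, spin_z n)"
 by (simp add: zelt_def base_group_def spin_z_def)

lemma pr_closed: "x \<in> CW n ==> pr x \<in> dperm G {1..n}"
 by (simp add: pr_def dperm_iff carrier_wreath spin_perm_permutes del: One_nat_def)

lemma perm_mem: "x \<in> CW n ==> spin_perm (snd x) i \<in> {1..n} \<longleftrightarrow> i \<in> {1..n}"
 using dperm_snd_mem[OF pr_closed] by (simp add: pr_def)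

lemma perm_inv_mem:
 assumes "x \<in> CW n"
 shows "inv_into UNIV (spin_perm (snd x)) i \<in> {1..n} \<longleftrightarrow> i \<in> {1..n}"
 using permutes_in_image[OF permutes_inv[OF spin_perm_permutes[OF wreath_snd[OF assms]]]] by simp

lemma wreath_closed:
 assumes "x \<in> CW n" "y \<in> CW n"
 shows "x \<otimes>\<^bsub>W n\<^esub> y \<in> CW n"
proof -
 interpret S: group "Sp n" by (rule spin_group_group)
 show ?thesis using assms perm_inv_mem[OF assms(1)]
  by (auto simp: carrier_wreath mult_wreath simp del: One_nat_def intro!: m_closed)
qed

lemma wreath_eqI:
 assumes "x \<in> CW n" "y \<in> CW n"
  and "\<And>i. i \<in> {1..n} ==> fst x i = fst y i" "snd x = snd y"
 shows "x = y"
proof (rule prod_eqI)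
 show "fst x = fst y"
  using assms(1,2) assms(3) unfolding carrier_wreath by (intro PiE_ext[of "fst x" "{1..n}" "\<lambda>_. carrier G"]) auto
qed (rule assms(4))

lemma wreath_inverse_closed:
 assumes "x \<in> CW n"
 shows "(\<lambda>i\<in>{1..n}. inv (fst x (spin_perm (snd x) i)), inv\<^bsub>Sp n\<^esub> (snd x)) \<in> CW n"
proof -
 interpret S: group "Sp n" by (rule spin_group_group)
 show ?thesis using assms perm_mem[OF assms]
  by (auto simp: carrier_wreath simp del: One_nat_def)
qed

lemma wreath_group: "group (W n)"
proof (rule groupI)
 interpret S: group "Sp n" by (rule spin_group_group)
 let ?W = "W n"
 show one: "\<one>\<^bsub>?W\<^esub> \<in> carrier ?W" by (auto simp: carrier_wreath one_wreath)
 fix x y z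
 assume x: "x \<in> carrier ?W"
 show "\<one>\<^bsub>?W\<^esub> \<otimes>\<^bsub>?W\<^esub> x = x"
  by (rule wreath_eqI[OF wreath_closed[OF one x] x])
   (use wreath_fst[OF x] wreath_snd[OF x] in \<open>auto simp: mult_wreath one_wreath spin_perm_one\<close>)
 let ?y = "(\<lambda>i\<in>{1..n}. inv (fst x (spin_perm (snd x) i)), inv\<^bsub>Sp n\<^esub> (snd x))"
 have y': "?y \<in> carrier ?W" by (rule wreath_inverse_closed[OF x])
 have "?y \<otimes>\<^bsub>?W\<^esub> x = \<one>\<^bsub>?W\<^esub>"
 proof (rule wreath_eqI[OF wreath_closed[OF y' x] one])
  fix i assume i: "i \<in> {1..n}"
  have "inv_into UNIV (inv_into UNIV (spin_perm (snd x))) = spin_perm (snd x)"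
   by (rule permutes_inv_inv[OF spin_perm_permutes[OF wreath_snd[OF x]]])
  then show "fst (?y \<otimes>\<^bsub>?W\<^esub> x) i = fst \<one>\<^bsub>?W\<^esub> i"
   using i wreath_fst[OF x, of "spin_perm (snd x) i"] perm_mem[OF x, of i]
   by (simp add: mult_wreath one_wreath spin_perm_inv[OF wreath_snd[OF x]])
 qed (use wreath_snd[OF x] in \<open>simp add: mult_wreath one_wreath\<close>)
 then show "\<exists>y\<in>carrier ?W. y \<otimes>\<^bsub>?W\<^esub> x = \<one>\<^bsub>?W\<^esub>" using y' by blast
 assume y: "y \<in> carrier ?W"
 show xy: "x \<otimes>\<^bsub>?W\<^esub> y \<in> carrier ?W" by (rule wreath_closed[OF x y])
 assume z: "z \<in> carrier ?W"
 show "x \<otimes>\<^bsub>?W\<^esub> y \<otimes>\<^bsub>?W\<^esub> z = x \<otimes>\<^bsub>?W\<^esub> (y \<otimes>\<^bsub>?W\<^esub> z)"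
 proof (rule wreath_eqI[OF wreath_closed[OF xy z] wreath_closed[OF x wreath_closed[OF y z]]])
  fix i assume i: "i \<in> {1..n}"
  let ?p = "inv_into UNIV (spin_perm (snd x))" and ?q = "inv_into UNIV (spin_perm (snd y))"
  have m: "?p i \<in> {1..n}" "?q (?p i) \<in> {1..n}" using i perm_inv_mem[OF x] perm_inv_mem[OF y] by auto
  have "bij (spin_perm (snd x))" "bij (spin_perm (snd y))"
   using x y wreath_snd spin_perm_permutes permutes_bij by blast+
  then have "inv_into UNIV (spin_perm (snd x \<otimes>\<^bsub>Sp n\<^esub> snd y)) = ?q \<circ> ?p"
   using wreath_snd[OF x] wreath_snd[OF y] by (simp add: spin_perm_mult o_inv_distrib)
  then show "fst (x \<otimes>\<^bsub>?W\<^esub> y \<otimes>\<^bsub>?W\<^esub> z) i = fst (x \<otimes>\<^bsub>?W\<^esub> (y \<otimes>\<^bsub>?W\<^esub> z)) i"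
   using i m wreath_fst[OF x i] wreath_fst[OF y m(1)] wreath_fst[OF z m(2)]
   by (simp add: mult_wreath m_assoc)
 qed (use wreath_snd[OF x] wreath_snd[OF y] wreath_snd[OF z] in \<open>simp add: mult_wreath S.m_assoc\<close>)
qed

lemma inv_wreath:
 assumes "x \<in> CW n"
 shows "inv\<^bsub>W n\<^esub> x = (\<lambda>i\<in>{1..n}. inv (fst x (spin_perm (snd x) i)), inv\<^bsub>Sp n\<^esub> (snd x))"
proof -
 interpret S: group "Sp n" by (rule spin_group_group)
 interpret W: group "W n" by (rule wreath_group)
 let ?y = "(\<lambda>i\<in>{1..n}. inv (fst x (spin_perm (snd x) i)), inv\<^bsub>Sp n\<^esub> (snd x))"
 have y: "?y \<in> CW n" by (rule wreath_inverse_closed[OF assms])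
 have "?y \<otimes>\<^bsub>W n\<^esub> x = \<one>\<^bsub>W n\<^esub>"
 proof (rule wreath_eqI[OF wreath_closed[OF y assms] W.one_closed])
  fix i assume i: "i \<in> {1..n}"
  have "inv_into UNIV (inv_into UNIV (spin_perm (snd x))) = spin_perm (snd x)"
   by (rule permutes_inv_inv[OF spin_perm_permutes[OF wreath_snd[OF assms]]])
  then show "fst (?y \<otimes>\<^bsub>W n\<^esub> x) i = fst \<one>\<^bsub>W n\<^esub> i"
   using i wreath_fst[OF assms, of "spin_perm (snd x) i"] perm_mem[OF assms, of i]
   by (simp add: mult_wreath one_wreath spin_perm_inv[OF wreath_snd[OF assms]])
 qed (use wreath_snd[OF assms] in \<open>simp add: mult_wreath one_wreath\<close>)
 then show ?thesis by (rule W.inv_equality[OF _ assms y])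
qed

lemma pr_inv: "x \<in> CW n ==> pr (inv\<^bsub>W n\<^esub> x) = dinv G {1..n} (pr x)"
 using spin_perm_inv[OF wreath_snd, of x n] by (simp add: inv_wreath pr_def dinv_def)

lemma finite_wreath: "finite (CW n)"
proof -
 have "CW n = ({1..n} \<rightarrow>\<^sub>E carrier G) \<times> carrier (Sp n)"
  by (simp add: wreath_def base_group_def)
 then show ?thesis using finite_spin[of n] by (simp add: finite_PiE finite_carrier)
qed

lemma pr_surj:
 assumes "\<xi> \<in> dperm G {1..n}" shows "\<exists>x\<in>CW n. pr x = \<xi>"
proof -
 obtain t where "t \<in> carrier (Sp n)" "spin_perm t = snd \<xi>"
  using spin_perm_surj[OF dperm_snd[OF assms]] by blast
 then show ?thesis using assms
  by (intro bexI[of _ "(fst \<xi>, t)"]) (auto simp: pr_def carrier_wreath dperm_iff)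
qed

lemma zelt_closed: "zelt G n \<in> CW n"
 by (auto simp: zelt_eq carrier_wreath)

lemma zelt_mult:
 assumes "x \<in> CW n"
 shows "zelt G n \<otimes>\<^bsub>W n\<^esub> x = (fst x, spin_z n \<otimes>\<^bsub>Sp n\<^esub> snd x)"
proof (rule wreath_eqI[OF wreath_closed[OF zelt_closed assms]])
 interpret S: group "Sp n" by (rule spin_group_group)
 show "(fst x, spin_z n \<otimes>\<^bsub>Sp n\<^esub> snd x) \<in> CW n"
  using assms by (simp add: carrier_wreath)
qed (use wreath_fst[OF assms] in \<open>auto simp: mult_wreath zelt_eq spin_perm_z\<close>)

lemma zelt_central:
 assumes "x \<in> CW n"
 shows "zelt G n \<otimes>\<^bsub>W n\<^esub> x = x \<otimes>\<^bsub>W n\<^esub> zelt G n"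
proof (rule wreath_eqI[OF wreath_closed[OF zelt_closed assms] wreath_closed[OF assms zelt_closed]])
 fix i assume i: "i \<in> {1..n}"
 then show "fst (zelt G n \<otimes>\<^bsub>W n\<^esub> x) i = fst (x \<otimes>\<^bsub>W n\<^esub> zelt G n) i"
  using wreath_fst[OF assms i] perm_inv_mem[OF assms, of i]
  by (simp add: zelt_mult[OF assms]) (simp add: mult_wreath zelt_eq)
qed (use spin_z_central[OF wreath_snd[OF assms]] in \<open>simp add: mult_wreath zelt_eq\<close>)

lemma zelt_zelt:
 assumes "x \<in> CW n"
 shows "zelt G n \<otimes>\<^bsub>W n\<^esub> (zelt G n \<otimes>\<^bsub>W n\<^esub> x) = x"
proof -
 interpret S: group "Sp n" by (rule spin_group_group)
 show ?thesis
  using S.m_assoc[of "spin_z n" "spin_z n" "snd x"] wreath_snd[OF assms]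
   zelt_mult[OF wreath_closed[OF zelt_closed assms]]
  by (simp add: zelt_mult[OF assms] spin_z_square)
qed

lemma pr_zelt: "x \<in> CW n ==> pr (zelt G n \<otimes>\<^bsub>W n\<^esub> x) = pr x"
 using spin_perm_mult[OF spin_z_closed wreath_snd] by (simp add: zelt_mult pr_def spin_perm_z)

lemma parity_zelt:
 "x \<in> CW n ==> spin_parity (snd (zelt G n \<otimes>\<^bsub>W n\<^esub> x)) = spin_parity (snd x)"
 using spin_parity_mult[OF spin_z_closed wreath_snd] spin_parity_less[OF wreath_snd]
 by (simp add: zelt_mult spin_parity_z)

lemma pr_eq:
 assumes "x \<in> CW n" "y \<in> CW n" "pr x = pr y"
 shows "x = y \<or> x = zelt G n \<otimes>\<^bsub>W n\<^esub> y"
 using spin_kernel[OF wreath_snd[OF assms(1)] wreath_snd[OF assms(2)]] assms(3)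
 by (auto simp: pr_def zelt_mult[OF assms(2)] prod_eq_iff)

text \<open>If t^N = 1 and (zt)^M = 1 with M, N odd, then the power MN of zt is both 1 and z. But z
  is not 1.\<close>

lemma pos_zelt:
 assumes x: "x \<in> CW n" "pos n x" shows "\<not> pos n (zelt G n \<otimes>\<^bsub>W n\<^esub> x)"
proof
 interpret S: group "Sp n" by (rule spin_group_group)
 let ?t = "snd x" and ?z = "spin_z n"
 have t: "?t \<in> carrier (Sp n)" by (rule wreath_snd[OF x(1)])
 obtain N :: nat where N: "odd N" "?t [^]\<^bsub>Sp n\<^esub> N = \<one>\<^bsub>Sp n\<^esub>" using x(2) by (auto simp: pos_def)
 assume "pos n (zelt G n \<otimes>\<^bsub>W n\<^esub> x)"
 then obtain M :: nat where M: "odd M" "(?z \<otimes>\<^bsub>Sp n\<^esub> ?t) [^]\<^bsub>Sp n\<^esub> M = \<one>\<^bsub>Sp n\<^esub>"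
  by (auto simp: pos_def zelt_mult[OF x(1)])
 have "(?z \<otimes>\<^bsub>Sp n\<^esub> ?t) [^]\<^bsub>Sp n\<^esub> (M * N) = \<one>\<^bsub>Sp n\<^esub>"
  using M(2) t by (simp flip: S.nat_pow_pow)
 moreover have "?t [^]\<^bsub>Sp n\<^esub> (M * N) = \<one>\<^bsub>Sp n\<^esub>"
  using N(2) t by (simp add: mult.commute[of M] flip: S.nat_pow_pow)
 ultimately have "?z = \<one>\<^bsub>Sp n\<^esub>" using spin_z_mult_pow[OF t, of "M * N"] M(1) N(1) by simp
 then show False using spin_z_neq_one by blast
qed

lemma pos_unique:
 "x \<in> CW n ==> y \<in> CW n ==> pos n x ==> pos n y ==> pr x = pr y ==> x = y"
 using pr_eq[of x n y] pos_zelt[of y n] by blast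

text \<open>An odd power of t lies over the identity, so it is 1 or z; in the second case the same
  power of zt is z z = 1.\<close>

lemma pos_or_zpos:
 assumes x: "x \<in> CW n" and o: "odd_order (snd (pr x))"
 shows "pos n x \<or> pos n (zelt G n \<otimes>\<^bsub>W n\<^esub> x)"
proof -
 interpret S: group "Sp n" by (rule spin_group_group)
 let ?t = "snd x" and ?z = "spin_z n"
 have t: "?t \<in> carrier (Sp n)" by (rule wreath_snd[OF x])
 obtain N where N: "odd N" "spin_perm ?t ^^ N = id" using o by (auto simp: odd_order_def pr_def)
 have "spin_perm (?t [^]\<^bsub>Sp n\<^esub> N) = spin_perm \<one>\<^bsub>Sp n\<^esub>"
  using N(2) t by (simp add: spin_perm_pow spin_perm_one)
 then have "?t [^]\<^bsub>Sp n\<^esub> N = \<one>\<^bsub>Sp n\<^esub> \<or> ?t [^]\<^bsub>Sp n\<^esub> N = ?z"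
  using spin_kernel[OF S.nat_pow_closed[OF t] S.one_closed] by simp
 then show ?thesis
  using N(1) spin_z_mult_pow[OF t, of N] by (auto simp: pos_def zelt_mult[OF x] spin_z_square)
qed

lemma pos_exists:
 assumes "\<xi> \<in> dperm G {1..n}" "odd_order (snd \<xi>)"
 shows "\<exists>x\<in>CW n. pr x = \<xi> \<and> pos n x"
proof -
 obtain x where x: "x \<in> CW n" "pr x = \<xi>" using pr_surj[OF assms(1)] by blast
 then show ?thesis
  using pos_or_zpos[OF x(1)] assms(2) pr_zelt[OF x(1)] wreath_closed[OF zelt_closed x(1)] by auto
qed

lemma pos_odd_order: "x \<in> CW n ==> pos n x ==> odd_order (snd (pr x))"
 using spin_perm_pow[OF wreath_snd, of x n] spin_perm_one[of n]
 by (auto simp: pos_def odd_order_def pr_def) metis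

lemma pos_even:
 assumes "x \<in> CW n" "pos n x" shows "spin_parity (snd x) = 0"
proof -
 obtain N :: nat where N: "odd N" "snd x [^]\<^bsub>Sp n\<^esub> N = \<one>\<^bsub>Sp n\<^esub>"
  using assms(2) by (auto simp: pos_def)
 have "(N * spin_parity (snd x)) mod 2 = 0"
  using spin_parity_pow[OF wreath_snd[OF assms(1)], of N] N(2) by (simp add: spin_parity_one)
 then show ?thesis using N(1) spin_parity_less[OF wreath_snd[OF assms(1)]] by (auto simp: mod_eq_0_iff_dvd)
qed

lemma pos_even_elts: "x \<in> CW n ==> pos n x ==> x \<in> even_elts G n"
 by (simp add: even_elts_def pos_even)

lemma snd_conj:
 "x \<in> CW n ==> u \<in> CW n ==> snd (u \<otimes>\<^bsub>W n\<^esub> x \<otimes>\<^bsub>W n\<^esub> inv\<^bsub>W n\<^esub> u) =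
  snd u \<otimes>\<^bsub>Sp n\<^esub> snd x \<otimes>\<^bsub>Sp n\<^esub> inv\<^bsub>Sp n\<^esub> (snd u)"
 by (simp add: mult_wreath inv_wreath)

lemma pos_conj:
 assumes x: "x \<in> CW n" "pos n x" and u: "u \<in> CW n"
 shows "pos n (u \<otimes>\<^bsub>W n\<^esub> x \<otimes>\<^bsub>W n\<^esub> inv\<^bsub>W n\<^esub> u)"
proof -
 interpret S: group "Sp n" by (rule spin_group_group)
 let ?s = "snd u" and ?t = "snd x"
 have c: "?s \<in> carrier (Sp n)" "?t \<in> carrier (Sp n)" using x u wreath_snd by auto
 obtain N :: nat where N: "odd N" "?t [^]\<^bsub>Sp n\<^esub> N = \<one>\<^bsub>Sp n\<^esub>" using x(2) by (auto simp: pos_def)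
 have "(?s \<otimes>\<^bsub>Sp n\<^esub> ?t \<otimes>\<^bsub>Sp n\<^esub> inv\<^bsub>Sp n\<^esub> ?s) [^]\<^bsub>Sp n\<^esub> k =
   ?s \<otimes>\<^bsub>Sp n\<^esub> ?t [^]\<^bsub>Sp n\<^esub> k \<otimes>\<^bsub>Sp n\<^esub> inv\<^bsub>Sp n\<^esub> ?s" for k :: nat
 proof (induction k)
  case (Suc k)
  have "inv\<^bsub>Sp n\<^esub> ?s \<otimes>\<^bsub>Sp n\<^esub> (?s \<otimes>\<^bsub>Sp n\<^esub> a) = a" if "a \<in> carrier (Sp n)" for a
   using that c by (simp flip: S.m_assoc)
  then show ?case using Suc c by (simp add: S.m_assoc)
 qed (use c in simp)
 then show ?thesis using N c x u by (auto simp: pos_def snd_conj intro!: exI[of _ N])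
qed

lemma pos_inv:
 assumes x: "x \<in> CW n" "pos n x" shows "pos n (inv\<^bsub>W n\<^esub> x)"
proof -
 interpret S: group "Sp n" by (rule spin_group_group)
 obtain N :: nat where N: "odd N" "snd x [^]\<^bsub>Sp n\<^esub> N = \<one>\<^bsub>Sp n\<^esub>"
  using x(2) by (auto simp: pos_def)
 have "snd (inv\<^bsub>W n\<^esub> x) [^]\<^bsub>Sp n\<^esub> N = \<one>\<^bsub>Sp n\<^esub>"
  unfolding inv_wreath[OF x(1)] snd_conv S.nat_pow_inv[OF wreath_snd[OF x(1)]] N(2) by (rule S.inv_one)
 then show ?thesis using N(1) unfolding pos_def by blast
qed

lemma conj_diso:
 assumes x: "x \<in> CW n" and u: "u \<in> CW n"
 shows "diso_via G (spin_perm (snd u)) (fst u) {1..n} (pr x) {1..n}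
  (pr (u \<otimes>\<^bsub>W n\<^esub> x \<otimes>\<^bsub>W n\<^esub> inv\<^bsub>W n\<^esub> u))"
proof -
 interpret S: group "Sp n" by (rule spin_group_group)
 let ?s = "spin_perm (snd u)" and ?p = "spin_perm (snd x)"
 have su: "?s permutes {1..n}" "?p permutes {1..n}" using spin_perm_permutes wreath_snd x u by blast+
 have bs: "bij ?s" "bij ?p" using su permutes_bij by blast+
 have c: "snd u \<in> carrier (Sp n)" "snd x \<in> carrier (Sp n)" using wreath_snd x u by auto
 have P: "spin_perm (snd u \<otimes>\<^bsub>Sp n\<^esub> snd x) = ?s \<circ> ?p" using c by (simp add: spin_perm_mult)
 have snd: "snd (pr (u \<otimes>\<^bsub>W n\<^esub> x \<otimes>\<^bsub>W n\<^esub> inv\<^bsub>W n\<^esub> u)) = ?s \<circ> ?p \<circ> inv_into UNIV ?s"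
  using c x u by (simp add: pr_def snd_conj spin_perm_mult spin_perm_inv)
 have fst: "fst (u \<otimes>\<^bsub>W n\<^esub> x \<otimes>\<^bsub>W n\<^esub> inv\<^bsub>W n\<^esub> u) (?s (?p i)) =
   fst u (?s (?p i)) \<otimes> fst x (?p i) \<otimes> inv (fst u (?s i))" if i: "i \<in> {1..n}" for i
 proof -
  have m: "?p i \<in> {1..n}" "?s (?p i) \<in> {1..n}" "?s i \<in> {1..n}" using i perm_mem[OF x] perm_mem[OF u] by auto
  have "inv_into UNIV (?s \<circ> ?p) (?s (?p i)) = i" using bs by (simp add: o_inv_distrib bij_is_inj)
  then show ?thesis
   using m i bs(1) by (simp add: mult_wreath inv_wreath[OF u] P bij_is_inj)
 qed
 show ?thesis unfolding diso_via_def snd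
  using permutes_imp_bij[OF su(1)] wreath_fst[OF u] fst permutes_inverses(2)[OF su(1)]
  by (auto simp: pr_def)
qed

text \<open>Every isomorphism on {1..n} is induced by a conjugation: extend s by the identity and
  lift it to the spin group.\<close>

lemma diso_conj:
 assumes \<xi>: "\<xi> \<in> dperm G {1..n}" and \<xi>': "\<xi>' \<in> dperm G {1..n}" and iso: "diso_via G s h {1..n} \<xi> {1..n} \<xi>'"
 shows "\<exists>u\<in>CW n. \<forall>x\<in>CW n. pr x = \<xi> \<longrightarrow>
  pr (u \<otimes>\<^bsub>W n\<^esub> x \<otimes>\<^bsub>W n\<^esub> inv\<^bsub>W n\<^esub> u) = \<xi>'"
proof -
 let ?s = "\<lambda>i. if i \<in> {1..n} then s i else i"
 have "bij_betw s {1..n} {1..n}" using iso by (simp add: diso_via_def)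
 then have "bij_betw ?s {1..n} {1..n}"
  by (rule bij_betw_cong[THEN iffD1, rotated]) simp
 then have "?s permutes {1..n}" by (rule bij_imp_permutes) auto
 then obtain t where t: "t \<in> carrier (Sp n)" "spin_perm t = ?s" using spin_perm_surj by blast
 define u where "u = (restrict h {1..n}, t)"
 have u: "u \<in> CW n" using iso t by (auto simp: u_def carrier_wreath diso_via_def)
 have "pr (u \<otimes>\<^bsub>W n\<^esub> x \<otimes>\<^bsub>W n\<^esub> inv\<^bsub>W n\<^esub> u) = \<xi>'"
  if x: "x \<in> CW n" "pr x = \<xi>" for x
 proof (rule diso_via_unique[OF _ iso \<xi> _ \<xi>'])
  interpret W: group "W n" by (rule wreath_group)
  show "pr (u \<otimes>\<^bsub>W n\<^esub> x \<otimes>\<^bsub>W n\<^esub> inv\<^bsub>W n\<^esub> u) \<in> dperm G {1..n}"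
   using x u by (intro pr_closed) auto
  show "diso_via G s h {1..n} \<xi> {1..n} (pr (u \<otimes>\<^bsub>W n\<^esub> x \<otimes>\<^bsub>W n\<^esub> inv\<^bsub>W n\<^esub> u))"
   by (rule diso_via_cong[OF conj_diso[OF x(1) u, unfolded x(2)] _ _ \<xi>]) (simp_all add: u_def t)
 qed
 then show ?thesis using u by blast
qed

section \<open>From functions on the spin cover to species\<close>

text \<open>The value of a class function at any odd-order lift of an isomorphic element; by
  \<open>til_eq\<close> the choice does not matter. The value 0 elsewhere is the right one for
  members of \<open>R_minus\<close>, by \<open>R_minus_not_odd_order\<close>.\<close>

definition til :: "('a welt => complex) => nat => 'a species" where
 "til f n I \<xi> = (if odd_order (snd \<xi>)
  then f (SOME x. x \<in> CW n \<and> pos n x \<and> (\<exists>s h. diso_via G s h {1..n} (pr x) I \<xi>)) else 0)"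

lemma class_functionD:
 assumes "f \<in> class_functions (W n)" "x \<in> CW n" "u \<in> CW n"
 shows "f (u \<otimes>\<^bsub>W n\<^esub> x \<otimes>\<^bsub>W n\<^esub> inv\<^bsub>W n\<^esub> u) = f x"
 using assms by (simp add: class_functions_def)

text \<open>Conjugation realises the isomorphism below. The conjugate of x has odd order and lies
  over the same element as y, so uniqueness gives y itself; no factor z can intervene.\<close>

lemma pos_class_eq:
 assumes f: "f \<in> class_functions (W n)"
  and x: "x \<in> CW n" "pos n x" and y: "y \<in> CW n" "pos n y"
  and iso: "diso_via G s h {1..n} (pr x) {1..n} (pr y)"
 shows "f x = f y"
proof -
 interpret W: group "W n" by (rule wreath_group)
 obtain u where u: "u \<in> CW n"
  "pr (u \<otimes>\<^bsub>W n\<^esub> x \<otimes>\<^bsub>W n\<^esub> inv\<^bsub>W n\<^esub> u) = pr y"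
  using diso_conj[OF pr_closed[OF x(1)] pr_closed[OF y(1)] iso] x(1) by blast
 have "u \<otimes>\<^bsub>W n\<^esub> x \<otimes>\<^bsub>W n\<^esub> inv\<^bsub>W n\<^esub> u = y"
  by (rule pos_unique[OF _ y(1) pos_conj[OF x u(1)] y(2) u(2)]) (use x u in auto)
 then show ?thesis using class_functionD[OF f x(1) u(1)] by simp
qed

lemma til_eq:
 assumes f: "f \<in> class_functions (W n)" and x: "x \<in> CW n" "pos n x"
  and \<xi>: "\<xi> \<in> dperm G I" and iso: "diso_via G s h {1..n} (pr x) I \<xi>"
 shows "til f n I \<xi> = f x"
proof -
 let ?P = "\<lambda>x. x \<in> CW n \<and> pos n x \<and> (\<exists>s h. diso_via G s h {1..n} (pr x) I \<xi>)"
 have "?P x" using x iso by blast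
 then have P: "?P (Eps ?P)" by (rule someI[of ?P])
 let ?y = "Eps ?P"
 obtain t k where y: "?y \<in> CW n" "pos n ?y" "diso_via G t k {1..n} (pr ?y) I \<xi>" using P by blast
 obtain t' k' where "diso_via G t' k' I \<xi> {1..n} (pr x)"
  using diso_sym[OF pr_closed[OF x(1)] \<xi> iso] by blast
 then obtain a b where "diso_via G a b {1..n} (pr ?y) {1..n} (pr x)"
  using diso_trans[OF pr_closed[OF y(1)] \<xi> y(3)] by blast
 then have "f ?y = f x" by (rule pos_class_eq[OF f y(1,2) x])
 moreover have "odd_order (snd \<xi>)"
  using odd_order_diso[OF pr_closed[OF x(1)] \<xi> iso] pos_odd_order[OF x] by blast
 ultimately show ?thesis by (simp add: til_def)
qed

lemma til_self:
 "f \<in> class_functions (W n) ==> x \<in> CW n ==> pos n x ==> til f n {1..n} (pr x) = f x"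
 by (rule til_eq[OF _ _ _ pr_closed diso_refl[OF pr_closed]])

lemma til_zero: "\<not> odd_order (snd \<xi>) ==> til f n I \<xi> = 0"
 by (simp add: til_def)

lemma pos_representative:
 assumes \<xi>: "\<xi> \<in> dperm G I" and I: "finite I" "card I = n" and o: "odd_order (snd \<xi>)"
 shows "\<exists>x\<in>CW n. pos n x \<and> (\<exists>s h. diso_via G s h {1..n} (pr x) I \<xi>)"
proof -
 obtain s where s: "bij_betw s I {1..n}" using finite_same_card_bij[OF I(1), of "{1..n}"] I(2) by auto
 let ?\<eta> = "drel s I {1..n} \<xi>"
 have \<eta>: "?\<eta> \<in> dperm G {1..n}" by (rule drel_closed[OF s \<xi>])
 note iso = drel_diso[OF s \<xi>]
 obtain x where x: "x \<in> CW n" "pr x = ?\<eta>" "pos n x"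
  using pos_exists[OF \<eta> odd_order_diso[OF \<xi> \<eta> iso o]] by blast
 then show ?thesis using diso_sym[OF \<xi> \<eta> iso] by metis
qed

lemma til_diso:
 assumes f: "f \<in> class_functions (W n)" and I: "finite I" "card I = n"
  and \<xi>: "\<xi> \<in> dperm G I" and \<eta>: "\<eta> \<in> dperm G J" and iso: "diso_via G s h I \<xi> J \<eta>"
 shows "til f n I \<xi> = til f n J \<eta>"
proof (cases "odd_order (snd \<xi>)")
 case True
 obtain x t k where x: "x \<in> CW n" "pos n x" "diso_via G t k {1..n} (pr x) I \<xi>"
  using pos_representative[OF \<xi> I True] by blast
 obtain u l where "diso_via G u l {1..n} (pr x) J \<eta>"
  using diso_trans[OF pr_closed[OF x(1)] \<xi> x(3) iso] by blast
 then show ?thesis using til_eq[OF f x(1,2) \<xi> x(3)] til_eq[OF f x(1,2) \<eta>] by simp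
next
 case False
 obtain t k where "diso_via G t k J \<eta> I \<xi>" using diso_sym[OF \<xi> \<eta> iso] by blast
 then have "\<not> odd_order (snd \<eta>)" using odd_order_diso[OF \<eta> \<xi>] False by blast
 then show ?thesis using False by (simp add: til_zero)
qed

end

section \<open>Young subgroups\<close>

context fin_group begin

abbreviation shifted :: "nat => nat => 'a dp => 'a dp" where
 "shifted n m \<equiv> drel (\<lambda>i. i + n) {1..m} {n + 1..n + m}"

lemma shift_bij: "bij_betw (\<lambda>i. i + n) {1..m} {n + 1..n + m :: nat}"
 by (rule bij_betw_byWitness[where f' = "\<lambda>i. i - n"]) auto

lemma inv_shift: "n < j ==> j \<le> n + m ==> inv_into {1..m} (\<lambda>i. i + n) j = j - (n :: nat)"
 by (rule inv_into_f_eq) (auto simp: inj_on_def)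

lemmas inv_shifts = inv_shift inv_shift[unfolded One_nat_def]

lemma young_sets: "{1..n} \<inter> {n + 1..n + m} = {}" "{1..n} \<union> {n + 1..n + m} = {1..n + m}"
 "{1..n + m} - {1..n} = {n + 1..n + m :: nat}"
 by auto

lemma emb_left_eq: "emb_left G n m x =
  (\<lambda>i\<in>{1..n + m}. if i \<le> n then fst x i else \<one>, spin_shift 0 (n + m) (snd x))"
 by (cases x) (simp add: emb_left_def spin_shift_def cong: if_cong)

lemma emb_right_eq: "emb_right G n m x =
  (\<lambda>i\<in>{1..n + m}. if i \<le> n then \<one> else fst x (i - n), spin_shift n (n + m) (snd x))"
 by (cases x) (simp add: emb_right_def spin_shift_def shift_word_def cong: if_cong)

lemma emb_left_closed: "x \<in> CW n ==> emb_left G n m x \<in> CW (n + m)"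
 using spin_shift_closed[OF wreath_snd, of x n 0 "n + m"] wreath_fst[of x n]
 by (auto simp: emb_left_eq carrier_wreath)

lemma emb_right_closed: "x \<in> CW m ==> emb_right G n m x \<in> CW (n + m)"
proof -
 assume x: "x \<in> CW m"
 have "fst x (i - n) \<in> carrier G" if "i \<le> n + m" "\<not> i \<le> n" for i
  by (rule wreath_fst[OF x]) (use that in auto)
 then show ?thesis using spin_shift_closed[OF wreath_snd[OF x], of n "n + m"]
  by (auto simp: emb_right_eq carrier_wreath)
qed

lemma young_mult_closed:
 "x \<in> CW n ==> y \<in> CW m ==> young_mult G n m x y \<in> CW (n + m)"
 unfolding young_mult_def by (intro wreath_closed emb_left_closed emb_right_closed)

lemma perm_left: "x \<in> CW n ==> spin_perm (spin_shift 0 (n + m) (snd x)) = spin_perm (snd x)"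
proof -
 assume x: "x \<in> CW n"
 have "spin_perm (snd x) 0 = 0" using dperm_snd_outside[OF pr_closed[OF x], of 0] by (simp add: pr_def)
 then show ?thesis using spin_perm_shift[OF wreath_snd[OF x], of 0 "n + m"] by (auto simp: fun_eq_iff)
qed

lemma perm_right: "y \<in> CW m ==>
  spin_perm (spin_shift n (n + m) (snd y)) = (\<lambda>i. if i \<le> n then i else n + spin_perm (snd y) (i - n))"
 by (rule spin_perm_shift[OF wreath_snd le_refl])

lemma snd_young_mult:
 "snd (young_mult G n m x y) = spin_shift 0 (n + m) (snd x) \<otimes>\<^bsub>Sp (n + m)\<^esub> spin_shift n (n + m) (snd y)"
 by (simp add: young_mult_def mult_wreath emb_left_eq emb_right_eq)

lemma pr_young_mult:
 assumes x: "x \<in> CW n" and y: "y \<in> CW m"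
 shows "pr (young_mult G n m x y) = djoin {1..n} (pr x) (shifted n m (pr y))"
proof (rule dperm_eqI)
 have s: "shifted n m (pr y) \<in> dperm G {n + 1..n + m}"
  by (rule drel_closed[OF shift_bij pr_closed[OF y]])
 show "pr (young_mult G n m x y) \<in> dperm G {1..n + m}" by (rule pr_closed[OF young_mult_closed[OF x y]])
 show "djoin {1..n} (pr x) (shifted n m (pr y)) \<in> dperm G {1..n + m}"
  using djoin_closed[OF pr_closed[OF x] s young_sets(1)] by (simp only: young_sets(2))
 fix i assume i: "i \<in> {1..n + m}"
 have px: "spin_perm (snd x) permutes {1..n}" by (rule spin_perm_permutes[OF wreath_snd[OF x]])
 have c: "spin_shift 0 (n + m) (snd x) \<in> carrier (Sp (n + m))"
  "spin_shift n (n + m) (snd y) \<in> carrier (Sp (n + m))"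
  using wreath_snd[OF x] wreath_snd[OF y] by (auto intro: spin_shift_closed)
 show "fst (pr (young_mult G n m x y)) i = fst (djoin {1..n} (pr x) (shifted n m (pr y))) i"
 proof (cases "i \<le> n")
  case True
  have "inv_into UNIV (spin_perm (snd x)) i \<in> {1..n}" using perm_inv_mem[OF x, of i] True i by simp
  then show ?thesis using True i wreath_fst[OF x, of i]
   by (simp add: pr_def young_mult_def mult_wreath emb_left_eq emb_right_eq perm_left[OF x] djoin_def)
 next
  case False
  have "inv_into UNIV (spin_perm (snd x)) i = i"
   using permutes_not_in[OF permutes_inv[OF px], of i] False by simp
  moreover have "fst y (i - n) \<in> carrier G" by (rule wreath_fst[OF y]) (use False i in auto)
  ultimately show ?thesis using False i
   by (simp add: pr_def young_mult_def mult_wreath emb_left_eq emb_right_eq perm_left[OF x] djoin_def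
     drel_def inv_shifts)
 qed
 have sp: "snd (pr (young_mult G n m x y)) i = spin_perm (snd x) (if i \<le> n then i else n + spin_perm (snd y) (i - n))"
  using c by (simp add: pr_def snd_young_mult spin_perm_mult perm_left[OF x] perm_right[OF y])
 show "snd (pr (young_mult G n m x y)) i = snd (djoin {1..n} (pr x) (shifted n m (pr y))) i"
 proof (cases "i \<le> n")
  case True
  then show ?thesis using i sp by (simp add: djoin_def pr_def)
 next
  case False
  have "spin_perm (snd y) (i - n) \<in> {1..m}" using perm_mem[OF y, of "i - n"] False i by auto
  then have "spin_perm (snd x) (n + spin_perm (snd y) (i - n)) = n + spin_perm (snd y) (i - n)"
   by (intro permutes_not_in[OF px]) auto
  then show ?thesis using False i sp by (simp add: djoin_def pr_def drel_def inv_shifts)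
 qed
qed

lemma young_iff: "x \<in> young G n m \<longleftrightarrow> x \<in> CW (n + m) \<and> {1..n} \<in> invs {1..n + m} (pr x)"
 by (auto simp: young_def invs_def pr_def)

lemma young_mult_young:
 assumes x: "x \<in> CW n" and y: "y \<in> CW m"
 shows "young_mult G n m x y \<in> young G n m"
 unfolding young_iff pr_young_mult[OF x y]
 using young_mult_closed[OF x y]
  djoin_invs(1)[OF pr_closed[OF x] drel_closed[OF shift_bij pr_closed[OF y]] young_sets(1)]
 by (simp only: young_sets(2))

lemma dres_young_mult:
 assumes x: "x \<in> CW n" and y: "y \<in> CW m"
 shows "dres {1..n} (pr (young_mult G n m x y)) = pr x"
  "dres {n + 1..n + m} (pr (young_mult G n m x y)) = shifted n m (pr y)"
 unfolding pr_young_mult[OF x y]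
 by (rule dres_djoin_left[OF pr_closed[OF x]],
   rule dres_djoin_right[OF drel_closed[OF shift_bij pr_closed[OF y]] young_sets(1)])

lemma shifted_inj: "\<xi> \<in> dperm G {1..m} ==> \<eta> \<in> dperm G {1..m} ==> shifted n m \<xi> = shifted n m \<eta> ==> \<xi> = \<eta>"
 using drel_bij[OF shift_bij, of n m] by (auto simp: bij_betw_def inj_on_def)

lemma young_mult_zelt:
 assumes x: "x \<in> CW n" and y: "y \<in> CW m"
 shows "young_mult G n m (zelt G n \<otimes>\<^bsub>W n\<^esub> x) y = zelt G (n + m) \<otimes>\<^bsub>W (n + m)\<^esub> young_mult G n m x y"
  and "young_mult G n m x (zelt G m \<otimes>\<^bsub>W m\<^esub> y) = zelt G (n + m) \<otimes>\<^bsub>W (n + m)\<^esub> young_mult G n m x y"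
proof -
 interpret W: group "W (n + m)" by (rule wreath_group)
 have "emb_left G n m (zelt G n \<otimes>\<^bsub>W n\<^esub> x) = zelt G (n + m) \<otimes>\<^bsub>W (n + m)\<^esub> emb_left G n m x"
  using spin_shift_mult[OF spin_z_closed wreath_snd[OF x], of 0 "n + m"] spin_shift_z[of 0 n "n + m"]
  by (simp add: zelt_mult[OF x] zelt_mult[OF emb_left_closed[OF x]]) (simp add: emb_left_eq cong: if_cong)
 then show "young_mult G n m (zelt G n \<otimes>\<^bsub>W n\<^esub> x) y = zelt G (n + m) \<otimes>\<^bsub>W (n + m)\<^esub> young_mult G n m x y"
  by (simp add: young_mult_def W.m_assoc zelt_closed emb_left_closed emb_right_closed x y)
 have "emb_right G n m (zelt G m \<otimes>\<^bsub>W m\<^esub> y) = zelt G (n + m) \<otimes>\<^bsub>W (n + m)\<^esub> emb_right G n m y"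
  using spin_shift_mult[OF spin_z_closed wreath_snd[OF y], of n "n + m"] spin_shift_z[of n m "n + m"]
  by (simp add: zelt_mult[OF y] zelt_mult[OF emb_right_closed[OF y]]) (simp add: emb_right_eq cong: if_cong)
 then have "young_mult G n m x (zelt G m \<otimes>\<^bsub>W m\<^esub> y) =
   (emb_left G n m x \<otimes>\<^bsub>W (n + m)\<^esub> zelt G (n + m)) \<otimes>\<^bsub>W (n + m)\<^esub> emb_right G n m y"
  by (simp add: young_mult_def W.m_assoc zelt_closed emb_left_closed emb_right_closed x y)
 also have "emb_left G n m x \<otimes>\<^bsub>W (n + m)\<^esub> zelt G (n + m) = zelt G (n + m) \<otimes>\<^bsub>W (n + m)\<^esub> emb_left G n m x"
  by (rule zelt_central[OF emb_left_closed[OF x], symmetric])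
 finally show "young_mult G n m x (zelt G m \<otimes>\<^bsub>W m\<^esub> y) = zelt G (n + m) \<otimes>\<^bsub>W (n + m)\<^esub> young_mult G n m x y"
  by (simp add: young_mult_def W.m_assoc zelt_closed emb_left_closed emb_right_closed x y)
qed

lemma zelt_neq: "x \<in> CW n ==> zelt G n \<otimes>\<^bsub>W n\<^esub> x \<noteq> x"
proof
 assume x: "x \<in> CW n" and "zelt G n \<otimes>\<^bsub>W n\<^esub> x = x"
 interpret W: group "W n" by (rule wreath_group)
 have "zelt G n = \<one>\<^bsub>W n\<^esub>"
  using W.r_cancel_one[OF x zelt_closed] \<open>zelt G n \<otimes>\<^bsub>W n\<^esub> x = x\<close> by simp
 then show False using spin_z_neq_one[of n] by (simp add: zelt_eq one_wreath)
qed

text \<open>The projection determines each factor up to z. Changing just one of them by z changes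
  the product, so both change or neither does.\<close>

lemma young_mult_eq:
 assumes x: "x \<in> CW n" "x' \<in> CW n"
  and y: "y \<in> CW m" "y' \<in> CW m"
  and eq: "young_mult G n m x y = young_mult G n m x' y'"
 shows "x' = x \<and> y' = y \<or> x' = zelt G n \<otimes>\<^bsub>W n\<^esub> x \<and> y' = zelt G m \<otimes>\<^bsub>W m\<^esub> y"
proof -
 have "pr x' = pr x" using dres_young_mult(1)[OF x(1) y(1)] dres_young_mult(1)[OF x(2) y(2)] eq by simp
 then have 1: "x' = x \<or> x' = zelt G n \<otimes>\<^bsub>W n\<^esub> x" by (rule pr_eq[OF x(2,1)])
 have "pr y' = pr y"
  using dres_young_mult(2)[OF x(1) y(1)] dres_young_mult(2)[OF x(2) y(2)] eq
  by (intro shifted_inj[OF pr_closed[OF y(2)] pr_closed[OF y(1)], of n]) simp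
 then have 2: "y' = y \<or> y' = zelt G m \<otimes>\<^bsub>W m\<^esub> y" by (rule pr_eq[OF y(2,1)])
 have "\<not> (x' = zelt G n \<otimes>\<^bsub>W n\<^esub> x \<and> y' = y)" "\<not> (x' = x \<and> y' = zelt G m \<otimes>\<^bsub>W m\<^esub> y)"
  using zelt_neq[OF young_mult_closed[OF x(1) y(1)]] young_mult_zelt[OF x(1) y(1)] eq by auto
 then show ?thesis using 1 2 by blast
qed

text \<open>Lift the two restrictions separately. Their product is right up to z, which the left
  factor can absorb.\<close>

lemma young_decompose:
 assumes v: "v \<in> young G n m"
 shows "\<exists>x\<in>CW n. \<exists>y\<in>CW m. v = young_mult G n m x y"
proof -
 have vc: "v \<in> CW (n + m)" and inv: "{1..n} \<in> invs {1..n + m} (pr v)"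
  using v by (auto simp: young_iff)
 note pv = pr_closed[OF vc]
 have r: "dres {n + 1..n + m} (pr v) \<in> dperm G {n + 1..n + m}"
  using dres_closed[OF pv invs_compl[OF pv inv]] by (simp only: young_sets(3))
 obtain x where x: "x \<in> CW n" "pr x = dres {1..n} (pr v)"
  using pr_surj[OF dres_closed[OF pv inv]] by blast
 obtain \<eta> where \<eta>: "\<eta> \<in> dperm G {1..m}" "shifted n m \<eta> = dres {n + 1..n + m} (pr v)"
  using drel_bij[OF shift_bij, of n m] r unfolding bij_betw_def by (metis imageE)
 obtain y where y: "y \<in> CW m" "pr y = \<eta>" using pr_surj[OF \<eta>(1)] by blast
 have "pr (young_mult G n m x y) = pr v"
  using djoin_dres[OF pv invsD(1)[OF inv]] unfolding pr_young_mult[OF x(1) y(1)] x(2) y(2) \<eta>(2)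
  by (simp only: young_sets(3))
 then have "v = young_mult G n m x y \<or> v = zelt G (n + m) \<otimes>\<^bsub>W (n + m)\<^esub> young_mult G n m x y"
  by (intro pr_eq vc young_mult_closed x y) simp
 then show ?thesis
  using young_mult_zelt(1)[OF x(1) y(1)] x(1) y(1) wreath_closed[OF zelt_closed x(1)] by metis
qed

lemma zcommute_emb:
 assumes x: "x \<in> CW n" and y: "y \<in> CW m"
 shows "emb_left G n m x \<otimes>\<^bsub>W (n + m)\<^esub> emb_right G n m y =
  (if even (spin_parity (snd x) * spin_parity (snd y))
  then emb_right G n m y \<otimes>\<^bsub>W (n + m)\<^esub> emb_left G n m x
  else zelt G (n + m) \<otimes>\<^bsub>W (n + m)\<^esub> (emb_right G n m y \<otimes>\<^bsub>W (n + m)\<^esub> emb_left G n m x))"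
proof -
 let ?W = "W (n + m)"
 let ?l = "emb_left G n m x" and ?r = "emb_right G n m y"
 have c: "?l \<in> carrier ?W" "?r \<in> carrier ?W" using x y by (auto intro: emb_left_closed emb_right_closed)
 have z: "zcommute (n + m) (spin_parity (snd x) * spin_parity (snd y)) (snd ?l) (snd ?r)"
  using zcommute_shift[OF wreath_snd[OF x] wreath_snd[OF y], of "n + m"]
  by (simp add: emb_left_eq emb_right_eq)
 have "fst (?l \<otimes>\<^bsub>?W\<^esub> ?r) = fst (?r \<otimes>\<^bsub>?W\<^esub> ?l)"
 proof
  fix i
  show "fst (?l \<otimes>\<^bsub>?W\<^esub> ?r) i = fst (?r \<otimes>\<^bsub>?W\<^esub> ?l) i"
  proof (cases "i \<in> {1..n + m}")
   case i: True
   let ?p = "inv_into UNIV (spin_perm (snd ?l))" and ?q = "inv_into UNIV (spin_perm (snd ?r))"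
   have pl: "spin_perm (snd ?l) = spin_perm (snd x)" by (simp add: emb_left_eq perm_left[OF x])
   have px: "spin_perm (snd x) permutes {1..n}" by (rule spin_perm_permutes[OF wreath_snd[OF x]])
   have qr: "spin_perm (snd ?r) permutes {n + 1..n + m}"
    using dperm_snd[OF drel_closed[OF shift_bij pr_closed[OF y], of n]]
   proof (rule back_subst[of "\<lambda>p. p permutes {n + 1..n + m}"])
    have "spin_perm (snd y) 0 = 0" using dperm_snd_outside[OF pr_closed[OF y], of 0] by (simp add: pr_def)
    moreover have "spin_perm (snd y) k = k" if "k > m" for k
     using dperm_snd_outside[OF pr_closed[OF y], of k] that by (simp add: pr_def)
    ultimately show "snd (shifted n m (pr y)) = spin_perm (snd ?r)"
     by (auto simp: emb_right_eq perm_right[OF y] drel_def inv_shifts pr_def fun_eq_iff)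
   qed
   have p: "?p i \<in> {1..n} \<longleftrightarrow> i \<in> {1..n}" "i \<notin> {1..n} ==> ?p i = i"
    using permutes_in_image[OF permutes_inv[OF px], of i] permutes_not_in[OF permutes_inv[OF px], of i]
    by (simp_all add: pl)
   have q: "?q i \<in> {n + 1..n + m} \<longleftrightarrow> i \<in> {n + 1..n + m}" "i \<notin> {n + 1..n + m} ==> ?q i = i"
    using permutes_in_image[OF permutes_inv[OF qr], of i] permutes_not_in[OF permutes_inv[OF qr], of i]
    by simp_all
   show ?thesis
   proof (cases "i \<le> n")
    case True
    then have "?p i \<in> {1..n}" "?q i = i" using p q i by auto
    then show ?thesis using True i wreath_fst[OF c(1) i]
     by (simp add: mult_wreath) (simp add: emb_left_eq emb_right_eq)
   next
    case False
    then have "?p i = i" "?q i \<in> {n + 1..n + m}" using p q i by auto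
    then show ?thesis using False i wreath_fst[OF c(2) i]
     by (simp add: mult_wreath) (simp add: emb_left_eq emb_right_eq)
   qed
  qed (simp add: mult_wreath del: atLeastAtMost_iff)
 qed
 then show ?thesis
  using z c wreath_closed[OF c(2,1)]
  by (auto simp: zcommute_def zelt_mult prod_eq_iff) (simp_all add: mult_wreath)
qed

lemma spin_shift_pow:
 "t \<in> carrier (Sp m) ==> k + m \<le> N ==>
  spin_shift k N (t [^]\<^bsub>Sp m\<^esub> (j::nat)) = spin_shift k N t [^]\<^bsub>Sp N\<^esub> j"
proof (induction j)
 case 0
 then show ?case by (simp add: spin_shift_one)
next
 case (Suc j)
 interpret S: group "Sp m" by (rule spin_group_group)
 show ?case using Suc by (simp add: spin_shift_mult)
qed

text \<open>Elements of odd order are even, so the two embedded factors commute and the product of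
  their odd exponents works for both. This is why no sign enters the formulas for product and
  coproduct.\<close>

lemma pos_young_mult:
 assumes x: "x \<in> CW n" "pos n x" and y: "y \<in> CW m" "pos m y"
 shows "pos (n + m) (young_mult G n m x y)"
proof -
 let ?S = "Sp (n + m)"
 interpret S: group ?S by (rule spin_group_group)
 let ?s = "spin_shift 0 (n + m) (snd x)" and ?t = "spin_shift n (n + m) (snd y)"
 have c: "?s \<in> carrier ?S" "?t \<in> carrier ?S" by (rule spin_shift_closed[OF wreath_snd[OF x(1)]], simp)
   (rule spin_shift_closed[OF wreath_snd[OF y(1)]], simp)
 have "?s \<otimes>\<^bsub>?S\<^esub> ?t = ?t \<otimes>\<^bsub>?S\<^esub> ?s"
  using zcommute_shift[OF wreath_snd[OF x(1)] wreath_snd[OF y(1)], of "n + m"] pos_even[OF x]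
  by (simp add: zcommute_def)
 note pw = S.pow_mult_distrib[OF this c]
 obtain N :: nat where N: "odd N" "snd x [^]\<^bsub>Sp n\<^esub> N = \<one>\<^bsub>Sp n\<^esub>" using x(2) by (auto simp: pos_def)
 obtain M :: nat where M: "odd M" "snd y [^]\<^bsub>Sp m\<^esub> M = \<one>\<^bsub>Sp m\<^esub>" using y(2) by (auto simp: pos_def)
 have s: "?s [^]\<^bsub>?S\<^esub> N = \<one>\<^bsub>?S\<^esub>"
  using spin_shift_pow[OF wreath_snd[OF x(1)], of 0 "n + m" N] N(2) by (simp add: spin_shift_one)
 have t: "?t [^]\<^bsub>?S\<^esub> M = \<one>\<^bsub>?S\<^esub>"
  using spin_shift_pow[OF wreath_snd[OF y(1)], of n "n + m" M] M(2) by (simp add: spin_shift_one)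
 have "?s [^]\<^bsub>?S\<^esub> (N * M) = \<one>\<^bsub>?S\<^esub>" using s c by (simp flip: S.nat_pow_pow)
 moreover have "?t [^]\<^bsub>?S\<^esub> (N * M) = \<one>\<^bsub>?S\<^esub>" using t c by (simp add: mult.commute[of N] flip: S.nat_pow_pow)
 ultimately have "(?s \<otimes>\<^bsub>?S\<^esub> ?t) [^]\<^bsub>?S\<^esub> (N * M) = \<one>\<^bsub>?S\<^esub>" by (simp add: pw)
 then show ?thesis using N(1) M(1) unfolding pos_def snd_young_mult by (intro exI[of _ "N * M"]) simp
qed

lemma odd_order_dres:
 assumes "\<xi> \<in> dperm G I" "A \<in> invs I \<xi>" "odd_order (snd \<xi>)" shows "odd_order (snd (dres A \<xi>))"
proof -
 obtain N where N: "odd N" "snd \<xi> ^^ N = id" using assms(3) by (auto simp: odd_order_def)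
 have "(snd (dres A \<xi>) ^^ k) i = (if i \<in> A then (snd \<xi> ^^ k) i else i)" for k i
 proof (induction k)
  case (Suc k)
  have "(snd \<xi> ^^ k) i \<in> A" if "i \<in> A"
   using that by (induction k) (auto intro: invsD(2)[OF assms(2)])
  then show ?case using Suc by (simp add: dres_def)
 qed simp
 then have "snd (dres A \<xi>) ^^ N = id" using N(2) by (simp add: fun_eq_iff)
 then show ?thesis using N(1) by (auto simp: odd_order_def)
qed

text \<open>Replace the factors of an arbitrary decomposition by the odd-order lifts over the same
  elements. Their product has odd order and the correct projection, so it is v.\<close>

lemma pos_young_decompose:
 assumes v: "v \<in> young G n m" "pos (n + m) v"
 shows "\<exists>x\<in>CW n. \<exists>y\<in>CW m. pos n x \<and> pos m y \<and> v = young_mult G n m x y"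
proof -
 obtain x y where xy: "x \<in> CW n" "y \<in> CW m" "v = young_mult G n m x y"
  using young_decompose[OF v(1)] by blast
 have vc: "v \<in> CW (n + m)" and inv: "{1..n} \<in> invs {1..n + m} (pr v)"
  using v(1) by (auto simp: young_iff)
 note pv = pr_closed[OF vc]
 note o = pos_odd_order[OF vc v(2)]
 have "odd_order (snd (pr x))"
  using odd_order_dres[OF pv inv o] dres_young_mult(1)[OF xy(1,2)] xy(3) by simp
 then obtain x' where x': "x' \<in> CW n" "pos n x'" "pr x' = pr x"
  using pos_exists[OF pr_closed[OF xy(1)]] by blast
 have o2: "odd_order (snd (shifted n m (pr y)))"
  using odd_order_dres[OF pv invs_compl[OF pv inv] o] dres_young_mult(2)[OF xy(1,2)] xy(3)
  by (simp only: young_sets(3))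
 obtain s h where "diso_via G s h {n + 1..n + m} (shifted n m (pr y)) {1..m} (pr y)"
  using diso_sym[OF pr_closed[OF xy(2)] drel_closed[OF shift_bij pr_closed[OF xy(2)]]
    drel_diso[OF shift_bij pr_closed[OF xy(2)]]] by blast
 then have "odd_order (snd (pr y))"
  using odd_order_diso[OF drel_closed[OF shift_bij pr_closed[OF xy(2)]] pr_closed[OF xy(2)]] o2 by blast
 then obtain y' where y': "y' \<in> CW m" "pos m y'" "pr y' = pr y"
  using pos_exists[OF pr_closed[OF xy(2)]] by blast
 have "pr (young_mult G n m x' y') = pr v"
  using pr_young_mult[OF x'(1) y'(1)] pr_young_mult[OF xy(1,2)] x'(3) y'(3) xy(3) by simp
 then have "v = young_mult G n m x' y'"
  using pos_unique[OF vc young_mult_closed[OF x'(1) y'(1)] v(2) pos_young_mult[OF x'(1,2) y'(1,2)]] by simp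
 then show ?thesis using x' y' by blast
qed

lemma even_elts_carrier: "x \<in> even_elts G n ==> x \<in> CW n"
 by (simp add: even_elts_def)

lemma even_zelt: "x \<in> CW n ==> zelt G n \<otimes>\<^bsub>W n\<^esub> x \<in> even_elts G n \<longleftrightarrow> x \<in> even_elts G n"
 using parity_zelt wreath_closed[OF zelt_closed] by (auto simp: even_elts_def)

text \<open>An element of the Young subgroup has two factorisations, differing by z on both sides;
  this condition makes the description in \<open>phi\<close> unambiguous.\<close>

definition z_invariant :: "nat => nat => ('a welt => 'a welt => complex) => bool" where
 "z_invariant n m F \<longleftrightarrow> (\<forall>x\<in>CW n. \<forall>y\<in>CW m.
  F (zelt G n \<otimes>\<^bsub>W n\<^esub> x) (zelt G m \<otimes>\<^bsub>W m\<^esub> y) = F x y)"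

lemma phi_young_mult:
 assumes F: "z_invariant n m F" and x: "x \<in> even_elts G n" and y: "y \<in> even_elts G m"
 shows "phi G n m F (young_mult G n m x y) = F x y"
proof -
 let ?u = "young_mult G n m x y"
 have "(THE v. \<exists>x'\<in>even_elts G n. \<exists>y'\<in>even_elts G m. ?u = young_mult G n m x' y' \<and> v = F x' y') = F x y"
 proof (rule the_equality)
  fix v assume "\<exists>x'\<in>even_elts G n. \<exists>y'\<in>even_elts G m. ?u = young_mult G n m x' y' \<and> v = F x' y'"
  then obtain x' y' where a: "x' \<in> even_elts G n" "y' \<in> even_elts G m" "?u = young_mult G n m x' y'" "v = F x' y'"
   by blast
  have "x' = x \<and> y' = y \<or> x' = zelt G n \<otimes>\<^bsub>W n\<^esub> x \<and> y' = zelt G m \<otimes>\<^bsub>W m\<^esub> y"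
   using young_mult_eq a x y even_elts_carrier by blast
  then show "v = F x y" using a(4) F even_elts_carrier[OF x] even_elts_carrier[OF y] unfolding z_invariant_def by auto
 qed (use x y in blast)
 then show ?thesis using x y unfolding phi_def by auto
qed

lemma phi_outside:
 "\<not> (\<exists>x\<in>even_elts G n. \<exists>y\<in>even_elts G m. u = young_mult G n m x y) ==> phi G n m F u = 0"
 by (simp add: phi_def)

lemma young_mult_parity:
 assumes "x \<in> CW n" "y \<in> CW m"
 shows "spin_parity (snd (young_mult G n m x y)) = (spin_parity (snd x) + spin_parity (snd y)) mod 2"
 using assms wreath_snd[OF assms(1)] wreath_snd[OF assms(2)]
 by (simp add: snd_young_mult spin_parity_mult spin_shift_closed spin_parity_shift)

end

section \<open>The product\<close>

lemma sign_cycle_of_list: "distinct cs ==> cs \<noteq> [] ==> sign (cycle_of_list cs) = (-1) ^ (length cs - 1)"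
proof (induction cs rule: cycle_of_list.induct)
 case (1 i j cs)
 have "permutation (cycle_of_list (j # cs))" by (rule permutation_of_cycle)
 then have "sign (cycle_of_list (i # j # cs)) = sign (transpose i j) * sign (cycle_of_list (j # cs))"
  by (simp add: sign_compose permutation_swap_id del: o_apply)
 also have "sign (transpose i j) = -1" using 1(2) by (simp add: sign_swap_id)
 finally show ?case using 1 by simp
qed (simp_all add: sign_id[unfolded id_def])

lemma sign_cyc:
 assumes x: "\<xi> \<in> dperm G I" and I: "finite I" "cyc I \<xi>" "even (card I)"
 shows "sign (snd \<xi>) = -1"
proof -
 obtain i where i: "i \<in> I" using I(2) by (auto simp: cyc_def)
 let ?L = "support (snd \<xi>) i"
 have p: "permutation (snd \<xi>)" using dperm_snd[OF x] I(1) by (auto simp: permutation_permutes)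
 have l: "least_power (snd \<xi>) i = card I" by (rule cyc_orbit(4)[OF x I(1,2) i])
 have set: "set ?L = I" using cyc_orbit(3)[OF x I(1,2) i] by (simp add: l lessThan_atLeast0)
 have d: "distinct ?L" by (rule cycle_of_permutation[OF p])
 have "snd \<xi> = cycle_of_list ?L"
 proof
  fix j show "snd \<xi> j = cycle_of_list ?L j"
  proof (cases "j \<in> I")
   case True
   then show ?thesis using cycle_restrict[OF p, of j i] set by simp
  next
   case False
   then show ?thesis using id_outside_supp[of j ?L] set dperm_snd_outside[OF x False] by simp
  qed
 qed
 moreover have "card I > 0" using I(1) i by (auto simp: card_gt_0_iff)
 then have "?L \<noteq> []" "odd (length ?L - 1)" using I(3) l by auto
 ultimately show ?thesis using sign_cycle_of_list[OF d] by simp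
qed

lemma odd_order_if_odd_atoms:
 assumes x: "\<xi> \<in> dperm G I" and I: "finite I" and odd: "\<And>A. A \<in> atoms I \<xi> ==> odd (card A)"
 shows "odd_order (snd \<xi>)"
proof -
 define N where "N = (\<Prod>A\<in>atoms I \<xi>. card A)"
 have "odd N" unfolding N_def using odd finite_atoms[OF I, of \<xi>]
  by (induction rule: infinite_finite_induct) (auto simp: even_prod_iff)
 moreover have "(snd \<xi> ^^ N) i = i" for i
 proof (cases "i \<in> I")
  case True
  obtain A where A: "A \<in> atoms I \<xi>" "i \<in> A" using ex_atom[OF x I True] by blast
  have inv: "A \<in> invs I \<xi>" "cyc A (dres A \<xi>)" using A(1) by (auto simp: atoms_def)
  have fA: "finite A" using finite_subset[OF invsD(1)[OF inv(1)] I] .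
  have "(snd (dres A \<xi>) ^^ k) j = (snd \<xi> ^^ k) j \<and> (snd \<xi> ^^ k) j \<in> A" if "j \<in> A" for k j
   using that invsD(2)[OF inv(1)] by (induction k) (auto simp: dres_def)
  then have "(snd \<xi> ^^ card A) i = i"
   using cyc_orbit(1)[OF dres_closed[OF x inv(1)] fA inv(2) A(2)] A(2) by metis
  moreover have "card A dvd N" unfolding N_def by (rule dvd_prodI[OF finite_atoms[OF I] A(1)])
  then obtain q where q: "N = card A * q" by auto
  have "(f ^^ (m * q)) i = i" if "(f ^^ m) i = i" for f :: "nat => nat" and m q
   using that by (induction q) (simp_all add: funpow_add)
  ultimately show ?thesis by (simp add: q)
 next
  case False
  have "(snd \<xi> ^^ k) i = i" for k using dperm_snd_outside[OF x False] by (induction k) auto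
  then show ?thesis .
 qed
 ultimately show ?thesis by (auto simp: odd_order_def fun_eq_iff)
qed

section \<open>Vanishing of functions away from odd order\<close>

context fin_group begin

lemma R_minusD:
 assumes "f \<in> R_minus G n"
 shows "f \<in> class_functions (W n)"
  "x \<in> CW n ==> f (zelt G n \<otimes>\<^bsub>W n\<^esub> x) = - f x"
  "x \<notin> even_elts G n ==> f x = 0"
proof -
 show "f \<in> class_functions (W n)" "x \<in> CW n ==> f (zelt G n \<otimes>\<^bsub>W n\<^esub> x) = - f x"
  using assms by (simp_all add: R_minus_def)
 have "x \<notin> CW n ==> f x = 0" "x \<in> CW n ==> x \<notin> even_elts G n ==> f x = 0"
  using assms by (simp_all add: R_minus_def class_functions_def del: split_paired_All)
 then show "x \<notin> even_elts G n ==> f x = 0" by blast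
qed

lemma R_minusI:
 assumes "\<And>x u. x \<in> CW n ==> u \<in> CW n ==>
   f (u \<otimes>\<^bsub>W n\<^esub> x \<otimes>\<^bsub>W n\<^esub> inv\<^bsub>W n\<^esub> u) = f x"
  "\<And>x. x \<in> CW n ==> f (zelt G n \<otimes>\<^bsub>W n\<^esub> x) = - f x"
  "\<And>x. x \<notin> even_elts G n ==> f x = 0"
 shows "f \<in> R_minus G n"
proof -
 have "f x = 0" if "x \<notin> CW n" for x
  using that even_elts_carrier by (intro assms(3)) blast
 then show ?thesis using assms by (simp add: R_minus_def class_functions_def)
qed

lemma R_minus_sum:
 assumes "\<And>k. k \<in> S ==> f k \<in> R_minus G n"
 shows "(\<lambda>x. \<Sum>k\<in>S. a k * f k x) \<in> R_minus G n"
 using assms class_functionD[OF R_minusD(1)[OF assms]] R_minusD(2)[OF assms] R_minusD(3)[OF assms]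
 by (intro R_minusI) (simp_all add: sum_negf)

lemma even_conj:
 assumes x: "x \<in> CW n" and u: "u \<in> CW n"
 shows "u \<otimes>\<^bsub>W n\<^esub> x \<otimes>\<^bsub>W n\<^esub> inv\<^bsub>W n\<^esub> u \<in> even_elts G n \<longleftrightarrow> x \<in> even_elts G n"
proof -
 interpret S: group "Sp n" by (rule spin_group_group)
 interpret W: group "W n" by (rule wreath_group)
 note c = wreath_snd[OF x] wreath_snd[OF u]
 have "spin_parity (snd (u \<otimes>\<^bsub>W n\<^esub> x \<otimes>\<^bsub>W n\<^esub> inv\<^bsub>W n\<^esub> u)) = spin_parity (snd x)"
  using c spin_parity_less[OF c(1)] spin_parity_less[OF c(2)]
  unfolding snd_conj[OF x u] by (simp add: spin_parity_mult spin_parity_inv) presburger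
 then show ?thesis using x u by (simp add: even_elts_def)
qed

text \<open>Here xy = z yx, and yx is conjugate to xy by x. So the value equals its own
  negative.\<close>

lemma odd_odd_zero:
 assumes f: "f \<in> R_minus G (n + m)" and x: "x \<in> CW n" "spin_parity (snd x) = 1"
  and y: "y \<in> CW m" "spin_parity (snd y) = 1"
 shows "f (young_mult G n m x y) = 0"
proof -
 let ?W = "W (n + m)"
 interpret W: group ?W by (rule wreath_group)
 let ?l = "emb_left G n m x" and ?r = "emb_right G n m y"
 have c: "?l \<in> carrier ?W" "?r \<in> carrier ?W" using emb_left_closed[OF x(1)] emb_right_closed[OF y(1)] by auto
 have "?l \<otimes>\<^bsub>?W\<^esub> ?r = zelt G (n + m) \<otimes>\<^bsub>?W\<^esub> (?r \<otimes>\<^bsub>?W\<^esub> ?l)"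
  using zcommute_emb[OF x(1) y(1)] x(2) y(2) by simp
 then have "f (young_mult G n m x y) = - f (?r \<otimes>\<^bsub>?W\<^esub> ?l)"
  using R_minusD(2)[OF f W.m_closed[OF c(2,1)]] by (simp add: young_mult_def)
 moreover have "?l \<otimes>\<^bsub>?W\<^esub> (?r \<otimes>\<^bsub>?W\<^esub> ?l) \<otimes>\<^bsub>?W\<^esub> inv\<^bsub>?W\<^esub> ?l = ?l \<otimes>\<^bsub>?W\<^esub> ?r"
  using c by (simp add: W.m_assoc)
 then have "f (?r \<otimes>\<^bsub>?W\<^esub> ?l) = f (young_mult G n m x y)"
  using class_functionD[OF R_minusD(1)[OF f] W.m_closed[OF c(2,1)] c(1)] by (simp add: young_mult_def)
 ultimately show ?thesis by simp
qed

lemma R_minus_young_zero: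
 assumes f: "f \<in> R_minus G (n + m)" and x: "x \<in> CW n" and y: "y \<in> CW m"
  and odd: "x \<notin> even_elts G n \<or> y \<notin> even_elts G m"
 shows "f (young_mult G n m x y) = 0"
proof -
 have lt: "spin_parity (snd x) < 2" "spin_parity (snd y) < 2"
  using spin_parity_less wreath_snd x y by blast+
 show ?thesis
 proof (cases "spin_parity (snd x) = 1 \<and> spin_parity (snd y) = 1")
  case True
  then show ?thesis using odd_odd_zero[OF f x _ y] by simp
 next
  case False
  then have "spin_parity (snd (young_mult G n m x y)) = 1"
   using young_mult_parity[OF x y] lt odd x y by (auto simp: even_elts_def less_2_cases_iff)
  then show ?thesis by (intro R_minusD(3)[OF f]) (simp add: even_elts_def)
 qed
qed

lemma ex_perm_onto:
 assumes A: "A \<subseteq> {1..n + m}" "card A = n"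
 shows "\<exists>u\<in>CW (n + m). spin_perm (snd u) ` {1..n} = A"
proof -
 have fA: "finite A" using A(1) finite_subset by blast
 obtain s where s: "bij_betw s {1..n} A" using finite_same_card_bij[of "{1..n}" A] fA A(2) by auto
 have "card ({1..n + m} - A) = m" using A fA by (simp add: card_Diff_subset)
 then obtain t where t: "bij_betw t {n + 1..n + m} ({1..n + m} - A)"
  using finite_same_card_bij[of "{n + 1..n + m}" "{1..n + m} - A"] by auto
 let ?p = "\<lambda>i. if i \<in> {1..n} then s i else if i \<in> {n + 1..n + m} then t i else i"
 have "bij_betw ?p {1..n} A" by (rule bij_betw_cong[THEN iffD1, OF _ s]) simp
 moreover have "bij_betw ?p {n + 1..n + m} ({1..n + m} - A)"
  by (rule bij_betw_cong[THEN iffD1, OF _ t]) simp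
 ultimately have "bij_betw ?p ({1..n} \<union> {n + 1..n + m}) (A \<union> ({1..n + m} - A))"
  by (rule bij_betw_combine) auto
 then have "bij_betw ?p {1..n + m} {1..n + m}"
  using A(1) by (simp only: young_sets(2) Un_Diff_cancel Un_absorb1)
 then have p: "?p permutes {1..n + m}" by (rule bij_imp_permutes) auto
 have "((\<lambda>i\<in>{1..n + m}. \<one>), ?p) \<in> dperm G {1..n + m}" unfolding dperm_iff using p by auto
 from pr_surj[OF this] obtain u where u: "u \<in> CW (n + m)" "pr u = ((\<lambda>i\<in>{1..n + m}. \<one>), ?p)"
  by blast
 have "?p ` {1..n} = A" using \<open>bij_betw ?p {1..n} A\<close> by (simp add: bij_betw_def)
 then show ?thesis using u by (intro bexI[of _ u]) (simp_all add: pr_def)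
qed

lemma conj_inv_diso:
 assumes x: "x \<in> CW n" and u: "u \<in> CW n"
 shows "diso_via G (spin_perm (snd u)) (fst u) {1..n}
  (pr (inv\<^bsub>W n\<^esub> u \<otimes>\<^bsub>W n\<^esub> x \<otimes>\<^bsub>W n\<^esub> u)) {1..n} (pr x)"
proof -
 interpret W: group "W n" by (rule wreath_group)
 let ?y = "inv\<^bsub>W n\<^esub> u \<otimes>\<^bsub>W n\<^esub> x \<otimes>\<^bsub>W n\<^esub> u"
 have y: "?y \<in> CW n" using x u by simp
 have "u \<otimes>\<^bsub>W n\<^esub> ?y \<otimes>\<^bsub>W n\<^esub> inv\<^bsub>W n\<^esub> u = x"
 proof -
  have "u \<otimes>\<^bsub>W n\<^esub> (inv\<^bsub>W n\<^esub> u \<otimes>\<^bsub>W n\<^esub> a) = a" if "a \<in> CW n" for a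
   using that u by (simp flip: W.m_assoc)
  then show ?thesis using x u by (simp add: W.m_assoc)
 qed
 then show ?thesis using conj_diso[OF y u] by simp
qed

lemma pos_conj_inv:
 assumes x: "x \<in> CW n" "pos n x" and u: "u \<in> CW n"
 shows "pos n (inv\<^bsub>W n\<^esub> u \<otimes>\<^bsub>W n\<^esub> x \<otimes>\<^bsub>W n\<^esub> u)"
proof -
 interpret W: group "W n" by (rule wreath_group)
 show ?thesis using pos_conj[OF x W.inv_closed[OF u]] u by simp
qed

lemma class_conj_inv:
 assumes "f \<in> class_functions (W n)" "x \<in> CW n" "u \<in> CW n"
 shows "f (inv\<^bsub>W n\<^esub> u \<otimes>\<^bsub>W n\<^esub> x \<otimes>\<^bsub>W n\<^esub> u) = f x"
proof -
 interpret W: group "W n" by (rule wreath_group)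
 show ?thesis using class_functionD[OF assms(1,2) W.inv_closed[OF assms(3)]] assms(3) by simp
qed

text \<open>An even element whose permutation has a cycle of even length is, up to conjugacy, a product of
 two odd elements with disjoint supports, and these anticommute.\<close>

lemma R_minus_not_odd_order:
 assumes f: "f \<in> R_minus G N" and x: "x \<in> CW N" and no: "\<not> odd_order (snd (pr x))"
 shows "f x = 0"
proof -
 interpret W: group "W N" by (rule wreath_group)
 note px = pr_closed[OF x]
 obtain A where A: "A \<in> atoms {1..N} (pr x)" "even (card A)"
  using odd_order_if_odd_atoms[OF px] no by blast
 have inv: "A \<in> invs {1..N} (pr x)" "cyc A (dres A (pr x))" using A(1) by (auto simp: atoms_def)
 have sub: "A \<subseteq> {1..N}" by (rule invsD(1)[OF inv(1)])
 then have fA: "finite A" using finite_subset by blast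
 define a where "a = card A"
 define b where "b = N - a"
 have "card A \<le> card {1..N}" by (rule card_mono[OF finite_atLeastAtMost sub])
 then have N: "N = a + b" unfolding a_def b_def by simp
 obtain u where u: "u \<in> CW N" "spin_perm (snd u) ` {1..a} = A"
  using ex_perm_onto[OF sub[unfolded N] a_def[symmetric]] unfolding N[symmetric] by blast
 let ?y = "inv\<^bsub>W N\<^esub> u \<otimes>\<^bsub>W N\<^esub> x \<otimes>\<^bsub>W N\<^esub> u"
 have y: "?y \<in> CW N" using x u by simp
 note iso = conj_inv_diso[OF x u(1)]
 have ia: "{1..a} \<in> invs {1..N} (pr ?y)"
  using diso_image_invs[OF pr_closed[OF y] iso, of "{1..a}"] inv(1) u(2) \<open>card A \<le> card {1..N}\<close>
  by (simp add: a_def)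
 then have "?y \<in> young G a b" using y unfolding young_iff N[symmetric] by simp
 then obtain x1 x2 where x12: "x1 \<in> CW a" "x2 \<in> CW b" "?y = young_mult G a b x1 x2"
  using young_decompose by blast
 have "diso_via G (spin_perm (snd u)) (fst u) {1..a} (pr x1) A (dres A (pr x))"
  using diso_dres[OF pr_closed[OF y] iso ia] dres_young_mult(1)[OF x12(1,2)] x12(3) u(2) by simp
 then have "cyc {1..a} (pr x1)"
  using cyc_diso[OF pr_closed[OF x12(1)] dres_closed[OF px inv(1)]] inv(2) by blast
 then have "sign (spin_perm (snd x1)) = -1"
  using sign_cyc[OF pr_closed[OF x12(1)]] A(2) by (simp add: a_def pr_def)
 then have "spin_parity (snd x1) \<noteq> 0" using sign_spin_perm[OF wreath_snd[OF x12(1)]]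
  by (cases "spin_parity (snd x1) = 0") simp_all
 then have "x1 \<notin> even_elts G a" by (simp add: even_elts_def)
 then have "f ?y = 0"
  using R_minus_young_zero[OF f[unfolded N] x12(1,2)] x12(3) by simp
 then show ?thesis using class_conj_inv[OF R_minusD(1)[OF f] x u(1)] by simp
qed

lemma R_minus_eqI:
 assumes f: "f \<in> R_minus G n" and g: "g \<in> R_minus G n"
  and eq: "\<And>x. x \<in> CW n ==> pos n x ==> f x = g x"
 shows "f = g"
proof
 fix x
 show "f x = g x"
 proof (cases "x \<in> CW n")
  case x: True
  show ?thesis
  proof (cases "odd_order (snd (pr x))")
   case True
   then consider "pos n x" | "pos n (zelt G n \<otimes>\<^bsub>W n\<^esub> x)" using pos_or_zpos[OF x] by blast
   then show ?thesis
   proof cases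
    case 2
    then have "f (zelt G n \<otimes>\<^bsub>W n\<^esub> x) = g (zelt G n \<otimes>\<^bsub>W n\<^esub> x)"
     by (rule eq[OF wreath_closed[OF zelt_closed x]])
    then show ?thesis using R_minusD(2)[OF f x] R_minusD(2)[OF g x] by simp
   qed (rule eq[OF x])
  qed (use R_minus_not_odd_order[OF f x] R_minus_not_odd_order[OF g x] in simp)
 next
  case False
  then have "x \<notin> even_elts G n" using even_elts_carrier by blast
  then show ?thesis using R_minusD(3)[OF f] R_minusD(3)[OF g] by simp
 qed
qed

section \<open>The product as a sum over invariant subsets\<close>

lemma phi_pos:
 assumes f: "f \<in> R_minus G n" and g: "g \<in> R_minus G m"
  and v: "v \<in> young G n m" "pos (n + m) v"
 shows "phi G n m (\<lambda>x y. f x * g y) v =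
  til f n {1..n} (dres {1..n} (pr v)) * til g m {n + 1..n + m} (dres {n + 1..n + m} (pr v))"
proof -
 obtain x y where xy: "x \<in> CW n" "y \<in> CW m" "pos n x" "pos m y"
  "v = young_mult G n m x y" using pos_young_decompose[OF v] by blast
 have "z_invariant n m (\<lambda>x y. f x * g y)"
  using R_minusD(2)[OF f] R_minusD(2)[OF g] by (simp add: z_invariant_def)
 then have "phi G n m (\<lambda>x y. f x * g y) v = f x * g y"
  using phi_young_mult[of n m _ x y] xy pos_even_elts by simp
 moreover have "til f n {1..n} (pr x) = f x" by (rule til_self[OF R_minusD(1)[OF f] xy(1,3)])
 moreover have "til g m {n + 1..n + m} (shifted n m (pr y)) = g y"
  by (rule til_eq[OF R_minusD(1)[OF g] xy(2,4) drel_closed[OF shift_bij pr_closed[OF xy(2)]]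
     drel_diso[OF shift_bij pr_closed[OF xy(2)]]])
 ultimately show ?thesis using dres_young_mult[OF xy(1,2)] xy(5) by simp
qed

text \<open>The elements mapping {1..n} onto a given A form a left coset of the Young
  subgroup.\<close>

lemma card_young_coset:
 assumes A: "A \<subseteq> {1..n + m}" "card A = n"
 shows "card {u \<in> CW (n + m). spin_perm (snd u) ` {1..n} = A} = card (young G n m)"
proof -
 let ?W = "W (n + m)"
 interpret W: group ?W by (rule wreath_group)
 obtain w where w: "w \<in> carrier ?W" "spin_perm (snd w) ` {1..n} = A" using ex_perm_onto[OF A] by blast
 have perm: "spin_perm (snd (a \<otimes>\<^bsub>?W\<^esub> b)) = spin_perm (snd a) \<circ> spin_perm (snd b)"
  if "a \<in> carrier ?W" "b \<in> carrier ?W" for a b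
  using that wreath_snd by (simp add: mult_wreath spin_perm_mult)
 have inj: "inj (spin_perm (snd w))" using dperm_inj[OF pr_closed[OF w(1)]] by (simp add: pr_def)
 have "bij_betw (\<lambda>v. w \<otimes>\<^bsub>?W\<^esub> v) (young G n m) {u \<in> carrier ?W. spin_perm (snd u) ` {1..n} = A}"
 proof (rule bij_betw_byWitness[where f' = "\<lambda>u. inv\<^bsub>?W\<^esub> w \<otimes>\<^bsub>?W\<^esub> u"])
  show "\<forall>a\<in>young G n m. inv\<^bsub>?W\<^esub> w \<otimes>\<^bsub>?W\<^esub> (w \<otimes>\<^bsub>?W\<^esub> a) = a"
   using w by (auto simp: young_def simp flip: W.m_assoc)
  show "\<forall>a\<in>{u \<in> carrier ?W. spin_perm (snd u) ` {1..n} = A}. w \<otimes>\<^bsub>?W\<^esub> (inv\<^bsub>?W\<^esub> w \<otimes>\<^bsub>?W\<^esub> a) = a"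
   using w by (auto simp flip: W.m_assoc)
  show "(\<lambda>v. w \<otimes>\<^bsub>?W\<^esub> v) ` young G n m \<subseteq> {u \<in> carrier ?W. spin_perm (snd u) ` {1..n} = A}"
  proof
   fix u assume "u \<in> (\<lambda>v. w \<otimes>\<^bsub>?W\<^esub> v) ` young G n m"
   then obtain v where v: "v \<in> carrier ?W" "spin_perm (snd v) ` {1..n} = {1..n}" "u = w \<otimes>\<^bsub>?W\<^esub> v"
    by (auto simp: young_def)
   then have "spin_perm (snd u) ` {1..n} = A" using perm[OF w(1) v(1)] w(2) by (simp only: image_comp[symmetric])
   then show "u \<in> {u \<in> carrier ?W. spin_perm (snd u) ` {1..n} = A}" using v w by simp
  qed
  show "(\<lambda>u. inv\<^bsub>?W\<^esub> w \<otimes>\<^bsub>?W\<^esub> u) ` {u \<in> carrier ?W. spin_perm (snd u) ` {1..n} = A} \<subseteq> young G n m"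
  proof
   fix v assume "v \<in> (\<lambda>u. inv\<^bsub>?W\<^esub> w \<otimes>\<^bsub>?W\<^esub> u) ` {u \<in> carrier ?W. spin_perm (snd u) ` {1..n} = A}"
   then obtain u where u: "u \<in> carrier ?W" "spin_perm (snd u) ` {1..n} = A" "v = inv\<^bsub>?W\<^esub> w \<otimes>\<^bsub>?W\<^esub> u" by auto
   have v: "v \<in> carrier ?W" using u w by simp
   have "w \<otimes>\<^bsub>?W\<^esub> v = u" using u w by (simp flip: W.m_assoc)
   then have "spin_perm (snd w) ` spin_perm (snd v) ` {1..n} = spin_perm (snd w) ` {1..n}"
    using perm[OF w(1) v] u(2) w(2) by (simp add: image_comp)
   then have "spin_perm (snd v) ` {1..n} = {1..n}" using inj by (simp add: inj_image_eq_iff)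
   then show "v \<in> young G n m" using v by (simp add: young_def)
  qed
 qed
 then show ?thesis by (rule bij_betw_same_card[symmetric])
qed

text \<open>The conjugate of x by the inverse of u lies in the Young subgroup exactly when the image
  A of {1..n} under u is invariant, and then its value depends on A only. Each A arises from one
  coset, whose size cancels the denominator of the induction formula.\<close>

lemma R_mult_pos:
 assumes f: "f \<in> R_minus G n" and g: "g \<in> R_minus G m"
  and x: "x \<in> CW (n + m)" "pos (n + m) x"
 shows "R_mult G n m f g x = (\<Sum>A | A \<in> invs {1..n + m} (pr x) \<and> card A = n.
  til f n A (dres A (pr x)) * til g m ({1..n + m} - A) (dres ({1..n + m} - A) (pr x)))"
proof -
 let ?W = "W (n + m)" and ?I = "{1..n + m}"
 interpret W: group ?W by (rule wreath_group)
 note px = pr_closed[OF x(1)]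
 let ?A = "\<lambda>u. spin_perm (snd u) ` {1..n}"
 let ?y = "\<lambda>u. inv\<^bsub>?W\<^esub> u \<otimes>\<^bsub>?W\<^esub> x \<otimes>\<^bsub>?W\<^esub> u"
 define c where "c A = (if A \<in> invs ?I (pr x) then
   til f n A (dres A (pr x)) * til g m (?I - A) (dres (?I - A) (pr x)) else 0)" for A
 have sub: "{1..n} \<subseteq> ?I" by auto
 have term_eq: "(if ?y u \<in> young G n m then phi G n m (\<lambda>x y. f x * g y) (?y u) else 0) = c (?A u)"
  if u: "u \<in> carrier ?W" for u
 proof -
  have y: "?y u \<in> carrier ?W" using x u by simp
  note iso = conj_inv_diso[OF x(1) u] and py = pr_closed[OF y]
  have iff: "?A u \<in> invs ?I (pr x) \<longleftrightarrow> {1..n} \<in> invs ?I (pr (?y u))" by (rule diso_image_invs[OF py iso sub])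
  show ?thesis
  proof (cases "?y u \<in> young G n m")
   case True
   then have inv: "{1..n} \<in> invs ?I (pr (?y u))" by (simp add: young_iff)
   then have invA: "?A u \<in> invs ?I (pr x)" using iff by simp
   have inv2: "{n + 1..n + m} \<in> invs ?I (pr (?y u))" using invs_compl[OF py inv] by (simp only: young_sets(3))
   have "spin_perm (snd u) ` (?I - {1..n}) = ?I - ?A u"
    using diso_via_image[OF iso] inj_on_image_set_diff[OF diso_via_inj[OF iso], of ?I "{1..n}"] sub by simp
   then have im: "spin_perm (snd u) ` {n + 1..n + m} = ?I - ?A u" by (simp only: young_sets(3))
   have 1: "til f n {1..n} (dres {1..n} (pr (?y u))) = til f n (?A u) (dres (?A u) (pr x))"
    by (rule til_diso[OF R_minusD(1)[OF f] _ _ dres_closed[OF py inv] dres_closed[OF px invA] diso_dres[OF py iso inv]]) simp_all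
   have 2: "til g m {n + 1..n + m} (dres {n + 1..n + m} (pr (?y u))) = til g m (?I - ?A u) (dres (?I - ?A u) (pr x))"
    using til_diso[OF R_minusD(1)[OF g] _ _ dres_closed[OF py inv2] _ diso_dres[OF py iso inv2]]
     dres_closed[OF px invs_compl[OF px invA]] unfolding im by simp
   show ?thesis using True invA phi_pos[OF f g True pos_conj_inv[OF x u]] by (simp only: 1 2 c_def if_True)
  next
   case False
   then show ?thesis using iff y by (simp add: young_iff c_def)
  qed
 qed
 have "(\<Sum>u\<in>carrier ?W. c (?A u)) = (\<Sum>A | A \<subseteq> ?I \<and> card A = n. \<Sum>u | u \<in> carrier ?W \<and> ?A u = A. c (?A u))"
 proof (rule sum.group[symmetric])
  show "?A ` carrier ?W \<subseteq> {A. A \<subseteq> ?I \<and> card A = n}"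
  proof
   fix A assume "A \<in> ?A ` carrier ?W"
   then obtain u where u: "u \<in> carrier ?W" "A = ?A u" by auto
   have "inj_on (spin_perm (snd u)) {1..n}"
    using dperm_inj[OF pr_closed[OF u(1)]] by (auto simp: pr_def intro: inj_on_subset)
   moreover have "?A u \<subseteq> ?I" using perm_mem[OF u(1)] sub by blast
   ultimately show "A \<in> {A. A \<subseteq> ?I \<and> card A = n}" using u(2) by (simp add: card_image)
  qed
 qed (use finite_wreath in auto)
 also have "\<dots> = (\<Sum>A | A \<subseteq> ?I \<and> card A = n. of_nat (card (young G n m)) * c A)"
 proof (rule sum.cong)
  fix A assume "A \<in> {A. A \<subseteq> ?I \<and> card A = n}"
  then have A: "A \<subseteq> ?I" "card A = n" by auto
  have "(\<Sum>u | u \<in> carrier ?W \<and> ?A u = A. c (?A u)) = (\<Sum>u | u \<in> carrier ?W \<and> ?A u = A. c A)"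
   by (rule sum.cong) auto
  then show "(\<Sum>u | u \<in> carrier ?W \<and> ?A u = A. c (?A u)) = of_nat (card (young G n m)) * c A"
   using card_young_coset[OF A] by simp
 qed simp
 finally have S: "(\<Sum>u\<in>carrier ?W. c (?A u)) = of_nat (card (young G n m)) * (\<Sum>A | A \<subseteq> ?I \<and> card A = n. c A)"
  by (simp add: sum_distrib_left)
 have "\<one>\<^bsub>?W\<^esub> \<in> young G n m" by (simp add: young_def one_wreath[symmetric]) (simp add: one_wreath spin_perm_one)
 moreover have "finite (young G n m)" by (rule finite_subset[OF _ finite_wreath]) (auto simp: young_def)
 ultimately have ny: "of_nat (card (young G n m)) \<noteq> (0::complex)" by (auto simp: card_eq_0_iff)
 have "R_mult G n m f g x = (\<Sum>u\<in>carrier ?W. c (?A u)) / of_nat (card (young G n m))"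
  using x(1) by (simp add: R_mult_def induce_def term_eq cong: sum.cong)
 also have "\<dots> = (\<Sum>A | A \<subseteq> ?I \<and> card A = n. c A)" unfolding S using ny by simp
 also have "\<dots> = (\<Sum>A | A \<in> invs ?I (pr x) \<and> card A = n.
  til f n A (dres A (pr x)) * til g m (?I - A) (dres (?I - A) (pr x)))"
  by (rule sum.mono_neutral_cong_right) (auto simp: c_def dest: invsD(1))
 finally show ?thesis .
qed

lemma R_mult_mem:
 assumes f: "f \<in> R_minus G n" and g: "g \<in> R_minus G m"
 shows "R_mult G n m f g \<in> R_minus G (n + m)"
proof -
 let ?W = "W (n + m)" and ?z = "zelt G (n + m)"
 interpret W: group ?W by (rule wreath_group)
 let ?F = "\<lambda>x y. f x * g y"
 \<comment> \<open>This is \<open>phi\<close> extended by zero. It changes sign under z and vanishes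
   on odd elements, and both properties survive the averaging over conjugates.\<close>
 define h where "h v = (if v \<in> young G n m then phi G n m ?F v else 0)" for v
 have R: "R_mult G n m f g x = (\<Sum>u\<in>carrier ?W. h (inv\<^bsub>?W\<^esub> u \<otimes>\<^bsub>?W\<^esub> x \<otimes>\<^bsub>?W\<^esub> u)) / of_nat (card (young G n m))"
  if "x \<in> carrier ?W" for x using that by (simp add: R_mult_def induce_def h_def)
 have zi: "z_invariant n m ?F" using R_minusD(2)[OF f] R_minusD(2)[OF g] by (simp add: z_invariant_def)
 have hz: "h (?z \<otimes>\<^bsub>?W\<^esub> v) = - h v" if v: "v \<in> carrier ?W" for v
 proof -
  have yz: "?z \<otimes>\<^bsub>?W\<^esub> v \<in> young G n m \<longleftrightarrow> v \<in> young G n m"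
   using pr_zelt[OF v] wreath_closed[OF zelt_closed v] v by (simp add: young_iff)
  have mul: "phi G n m ?F (?z \<otimes>\<^bsub>?W\<^esub> w) = - phi G n m ?F w"
   if xy: "x \<in> even_elts G n" "y \<in> even_elts G m" "w = young_mult G n m x y" for w x y
  proof -
   note c = even_elts_carrier[OF xy(1)] even_elts_carrier[OF xy(2)]
   have zx: "zelt G n \<otimes>\<^bsub>W n\<^esub> x \<in> even_elts G n" using even_zelt[OF c(1)] xy(1) by simp
   show ?thesis
    using phi_young_mult[OF zi xy(1,2)] phi_young_mult[OF zi zx xy(2)] young_mult_zelt(1)[OF c]
     R_minusD(2)[OF f c(1)] xy(3) by simp
  qed
  have "phi G n m ?F (?z \<otimes>\<^bsub>?W\<^esub> v) = - phi G n m ?F v"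
  proof (cases "\<exists>x\<in>even_elts G n. \<exists>y\<in>even_elts G m. v = young_mult G n m x y")
   case True
   then obtain x y where "x \<in> even_elts G n" "y \<in> even_elts G m" "v = young_mult G n m x y" by blast
   then show ?thesis by (rule mul)
  next
   case False
   have no: "\<not> (\<exists>x\<in>even_elts G n. \<exists>y\<in>even_elts G m. ?z \<otimes>\<^bsub>?W\<^esub> v = young_mult G n m x y)"
   proof
    assume "\<exists>x\<in>even_elts G n. \<exists>y\<in>even_elts G m. ?z \<otimes>\<^bsub>?W\<^esub> v = young_mult G n m x y"
    then obtain x y where xy: "x \<in> even_elts G n" "y \<in> even_elts G m" "?z \<otimes>\<^bsub>?W\<^esub> v = young_mult G n m x y" by blast
    note c = even_elts_carrier[OF xy(1)] even_elts_carrier[OF xy(2)]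
    have "v = young_mult G n m (zelt G n \<otimes>\<^bsub>W n\<^esub> x) y"
     using zelt_zelt[OF v] xy(3) young_mult_zelt(1)[OF c] by simp
    moreover have "zelt G n \<otimes>\<^bsub>W n\<^esub> x \<in> even_elts G n" using even_zelt[OF c(1)] xy(1) by simp
    ultimately show False using False xy(2) by metis
   qed
   then show ?thesis by (simp only: phi_outside[OF False] phi_outside[OF no] minus_zero)
  qed
  then show ?thesis using yz by (simp add: h_def)
 qed
 have hodd: "h v = 0" if v: "v \<in> carrier ?W" "spin_parity (snd v) \<noteq> 0" for v
 proof -
  have "\<not> (\<exists>x\<in>even_elts G n. \<exists>y\<in>even_elts G m. v = young_mult G n m x y)"
  proof
   assume "\<exists>x\<in>even_elts G n. \<exists>y\<in>even_elts G m. v = young_mult G n m x y"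
   then obtain x y where xy: "x \<in> even_elts G n" "y \<in> even_elts G m" "v = young_mult G n m x y" by blast
   then have "spin_parity (snd v) = 0"
    using young_mult_parity[OF even_elts_carrier[OF xy(1)] even_elts_carrier[OF xy(2)]]
    by (simp add: even_elts_def)
   then show False using v(2) by simp
  qed
  then show ?thesis by (simp add: h_def phi_outside)
 qed
 show ?thesis
 proof (rule R_minusI)
  fix x y assume x: "x \<in> carrier ?W" and y: "y \<in> carrier ?W"
  have can: "inv\<^bsub>?W\<^esub> y \<otimes>\<^bsub>?W\<^esub> (y \<otimes>\<^bsub>?W\<^esub> a) = a" "y \<otimes>\<^bsub>?W\<^esub> (inv\<^bsub>?W\<^esub> y \<otimes>\<^bsub>?W\<^esub> a) = a" if "a \<in> carrier ?W" for a
   using that y by (simp_all flip: W.m_assoc)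
  have "(\<Sum>u\<in>carrier ?W. h (inv\<^bsub>?W\<^esub> u \<otimes>\<^bsub>?W\<^esub> (y \<otimes>\<^bsub>?W\<^esub> x \<otimes>\<^bsub>?W\<^esub> inv\<^bsub>?W\<^esub> y) \<otimes>\<^bsub>?W\<^esub> u)) =
    (\<Sum>u\<in>carrier ?W. h (inv\<^bsub>?W\<^esub> u \<otimes>\<^bsub>?W\<^esub> x \<otimes>\<^bsub>?W\<^esub> u))"
   by (rule sum.reindex_bij_witness[where i = "\<lambda>u. y \<otimes>\<^bsub>?W\<^esub> u" and j = "\<lambda>u. inv\<^bsub>?W\<^esub> y \<otimes>\<^bsub>?W\<^esub> u"])
    (use x y can in \<open>simp_all add: W.inv_mult_group W.m_assoc\<close>)
  then show "R_mult G n m f g (y \<otimes>\<^bsub>?W\<^esub> x \<otimes>\<^bsub>?W\<^esub> inv\<^bsub>?W\<^esub> y) = R_mult G n m f g x"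
   using x y by (simp add: R)
 next
  fix x assume x: "x \<in> carrier ?W"
  have "inv\<^bsub>?W\<^esub> u \<otimes>\<^bsub>?W\<^esub> (?z \<otimes>\<^bsub>?W\<^esub> x) \<otimes>\<^bsub>?W\<^esub> u = ?z \<otimes>\<^bsub>?W\<^esub> (inv\<^bsub>?W\<^esub> u \<otimes>\<^bsub>?W\<^esub> x \<otimes>\<^bsub>?W\<^esub> u)"
   if u: "u \<in> carrier ?W" for u
  proof -
   have "inv\<^bsub>?W\<^esub> u \<otimes>\<^bsub>?W\<^esub> (?z \<otimes>\<^bsub>?W\<^esub> x) \<otimes>\<^bsub>?W\<^esub> u = (inv\<^bsub>?W\<^esub> u \<otimes>\<^bsub>?W\<^esub> ?z) \<otimes>\<^bsub>?W\<^esub> x \<otimes>\<^bsub>?W\<^esub> u"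
    using x u zelt_closed by (simp add: W.m_assoc)
   also have "inv\<^bsub>?W\<^esub> u \<otimes>\<^bsub>?W\<^esub> ?z = ?z \<otimes>\<^bsub>?W\<^esub> inv\<^bsub>?W\<^esub> u" by (rule zelt_central[OF W.inv_closed[OF u], symmetric])
   finally show ?thesis using x u zelt_closed by (simp add: W.m_assoc)
  qed
  then show "R_mult G n m f g (?z \<otimes>\<^bsub>?W\<^esub> x) = - R_mult G n m f g x"
   using x zelt_closed hz by (simp add: R sum_negf)
 next
  fix x assume x: "x \<notin> even_elts G (n + m)"
  show "R_mult G n m f g x = 0"
  proof (cases "x \<in> carrier ?W")
   case True
   have "h (inv\<^bsub>?W\<^esub> u \<otimes>\<^bsub>?W\<^esub> x \<otimes>\<^bsub>?W\<^esub> u) = 0" if u: "u \<in> carrier ?W" for u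
    using hodd[of "inv\<^bsub>?W\<^esub> u \<otimes>\<^bsub>?W\<^esub> x \<otimes>\<^bsub>?W\<^esub> u"] even_conj[OF True W.inv_closed[OF u]] x True u
    by (auto simp: even_elts_def)
   then show ?thesis using True by (simp add: R)
  qed (simp add: R_mult_def induce_def)
 qed
qed

end

section \<open>The coproduct\<close>

context fin_group begin

lemma emb_left_mult:
 assumes x: "x \<in> CW n" and x': "x' \<in> CW n"
 shows "emb_left G n m (x \<otimes>\<^bsub>W n\<^esub> x') = emb_left G n m x \<otimes>\<^bsub>W (n + m)\<^esub> emb_left G n m x'"
proof (rule wreath_eqI)
 show "emb_left G n m (x \<otimes>\<^bsub>W n\<^esub> x') \<in> CW (n + m)"
  by (rule emb_left_closed[OF wreath_closed[OF x x']])
 show "emb_left G n m x \<otimes>\<^bsub>W (n + m)\<^esub> emb_left G n m x' \<in> CW (n + m)"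
  by (rule wreath_closed[OF emb_left_closed[OF x] emb_left_closed[OF x']])
 show "snd (emb_left G n m (x \<otimes>\<^bsub>W n\<^esub> x')) =
   snd (emb_left G n m x \<otimes>\<^bsub>W (n + m)\<^esub> emb_left G n m x')"
  using spin_shift_mult[OF wreath_snd[OF x] wreath_snd[OF x'], of 0 "n + m"] by (simp add: emb_left_eq mult_wreath)
next
 fix i assume i: "i \<in> {1..n + m}"
 let ?p = "inv_into UNIV (spin_perm (snd x))"
 have pm: "spin_perm (snd x) permutes {1..n}" by (rule spin_perm_permutes[OF wreath_snd[OF x]])
 have p: "?p i \<in> {1..n} \<longleftrightarrow> i \<in> {1..n}" "i \<notin> {1..n} ==> ?p i = i"
  using permutes_in_image[OF permutes_inv[OF pm], of i] permutes_not_in[OF permutes_inv[OF pm], of i] by simp_all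
 show "fst (emb_left G n m (x \<otimes>\<^bsub>W n\<^esub> x')) i =
   fst (emb_left G n m x \<otimes>\<^bsub>W (n + m)\<^esub> emb_left G n m x') i"
 proof (cases "i \<le> n")
  case True
  then have "?p i \<in> {1..n}" "i \<in> {1..n}" using p i by auto
  then show ?thesis using i by (simp add: mult_wreath emb_left_eq perm_left[OF x])
 next
  case False
  then have "?p i = i" using p by auto
  then show ?thesis using i False by (simp add: mult_wreath emb_left_eq perm_left[OF x])
 qed
qed

lemma emb_right_mult:
 assumes x: "x \<in> CW m" and x': "x' \<in> CW m"
 shows "emb_right G n m (x \<otimes>\<^bsub>W m\<^esub> x') = emb_right G n m x \<otimes>\<^bsub>W (n + m)\<^esub> emb_right G n m x'"
proof (rule wreath_eqI)
 show "emb_right G n m (x \<otimes>\<^bsub>W m\<^esub> x') \<in> CW (n + m)"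
  by (rule emb_right_closed[OF wreath_closed[OF x x']])
 show c2: "emb_right G n m x \<otimes>\<^bsub>W (n + m)\<^esub> emb_right G n m x' \<in> CW (n + m)"
  by (rule wreath_closed[OF emb_right_closed[OF x] emb_right_closed[OF x']])
 show "snd (emb_right G n m (x \<otimes>\<^bsub>W m\<^esub> x')) =
   snd (emb_right G n m x \<otimes>\<^bsub>W (n + m)\<^esub> emb_right G n m x')"
  using spin_shift_mult[OF wreath_snd[OF x] wreath_snd[OF x'], of n "n + m"] by (simp add: emb_right_eq mult_wreath)
next
 fix i assume i: "i \<in> {1..n + m}"
 let ?p = "inv_into UNIV (spin_perm (snd x))" and ?s = "spin_perm (spin_shift n (n + m) (snd x))"
 have pm: "spin_perm (snd x) permutes {1..m}" by (rule spin_perm_permutes[OF wreath_snd[OF x]])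
 have "?s permutes {1..n + m}" by (rule spin_perm_permutes[OF spin_shift_closed[OF wreath_snd[OF x] le_refl]])
 then have inj: "inj ?s" by (rule permutes_inj)
 show "fst (emb_right G n m (x \<otimes>\<^bsub>W m\<^esub> x')) i =
   fst (emb_right G n m x \<otimes>\<^bsub>W (n + m)\<^esub> emb_right G n m x') i"
 proof (cases "i \<le> n")
  case True
  then have "inv_into UNIV ?s i = i" by (intro inv_f_eq[OF inj]) (simp add: perm_right[OF x])
  then show ?thesis using True i by (simp add: mult_wreath emb_right_eq)
 next
  case False
  then have i': "i - n \<in> {1..m}" using i by auto
  then have "?p (i - n) \<in> {1..m}" using permutes_in_image[OF permutes_inv[OF pm]] by simp
  moreover have "spin_perm (snd x) (?p (i - n)) = i - n" by (rule permutes_inverses(1)[OF pm])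
  ultimately have "inv_into UNIV ?s i = n + ?p (i - n)"
   using False by (intro inv_f_eq[OF inj]) (simp add: perm_right[OF x])
  then show ?thesis using False i i' \<open>?p (i - n) \<in> {1..m}\<close>
   by (simp add: mult_wreath emb_right_eq)
 qed
qed

lemma emb_left_inv_cancel:
 assumes x: "x \<in> CW n" and u: "u \<in> CW n"
 shows "emb_left G n m (u \<otimes>\<^bsub>W n\<^esub> x \<otimes>\<^bsub>W n\<^esub> inv\<^bsub>W n\<^esub> u) \<otimes>\<^bsub>W (n + m)\<^esub> emb_left G n m u =
  emb_left G n m u \<otimes>\<^bsub>W (n + m)\<^esub> emb_left G n m x"
proof -
 interpret W: group "W n" by (rule wreath_group)
 show ?thesis using x u by (simp add: W.m_assoc flip: emb_left_mult)
qed

lemma emb_right_inv_cancel: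
 assumes x: "x \<in> CW m" and u: "u \<in> CW m"
 shows "emb_right G n m (u \<otimes>\<^bsub>W m\<^esub> x \<otimes>\<^bsub>W m\<^esub> inv\<^bsub>W m\<^esub> u) \<otimes>\<^bsub>W (n + m)\<^esub> emb_right G n m u =
  emb_right G n m u \<otimes>\<^bsub>W (n + m)\<^esub> emb_right G n m x"
proof -
 interpret W: group "W m" by (rule wreath_group)
 show ?thesis using x u by (simp add: W.m_assoc flip: emb_right_mult)
qed

lemma class_function_conjugate:
 assumes f: "f \<in> class_functions (W n)" and c: "a \<in> CW n" "b \<in> CW n"
  "u \<in> CW n" and eq: "a \<otimes>\<^bsub>W n\<^esub> u = u \<otimes>\<^bsub>W n\<^esub> b"
 shows "f a = f b"
proof -
 interpret W: group "W n" by (rule wreath_group)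
 have "u \<otimes>\<^bsub>W n\<^esub> b \<otimes>\<^bsub>W n\<^esub> inv\<^bsub>W n\<^esub> u = a"
  using c by (simp add: eq[symmetric] W.m_assoc)
 then show ?thesis using class_functionD[OF f c(2,3)] by simp
qed

text \<open>The explicit form of the coproduct component; \<open>R_comult\<close> is defined only as
  a preimage under \<open>phi\<close> and is identified with it in
  \<open>R_comult_eq\<close>.\<close>

definition young_fun :: "nat => nat => ('a welt => complex) => 'a welt => 'a welt => complex" where
 "young_fun n m f x y = (if x \<in> even_elts G n \<and> y \<in> even_elts G m then f (young_mult G n m x y) else 0)"

lemma even_commute:
 assumes "x \<in> CW n" "y \<in> CW m" "x \<in> even_elts G n \<or> y \<in> even_elts G m"
 shows "emb_left G n m x \<otimes>\<^bsub>W (n + m)\<^esub> emb_right G n m y =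
  emb_right G n m y \<otimes>\<^bsub>W (n + m)\<^esub> emb_left G n m x"
 using zcommute_emb[OF assms(1,2)] assms(3) by (auto simp: even_elts_def)

lemma young_fun_left:
 assumes f: "f \<in> R_minus G (n + m)" shows "(\<lambda>x. young_fun n m f x y) \<in> R_minus G n"
proof (cases "y \<in> even_elts G m")
 case y: True
 note cy = even_elts_carrier[OF y]
 let ?W = "W (n + m)"
 interpret V: group "W n" by (rule wreath_group)
 interpret W: group ?W by (rule wreath_group)
 show ?thesis
 proof (rule R_minusI)
  fix x u assume x: "x \<in> CW n" and u: "u \<in> CW n"
  let ?x = "u \<otimes>\<^bsub>W n\<^esub> x \<otimes>\<^bsub>W n\<^esub> inv\<^bsub>W n\<^esub> u"
  have cx: "?x \<in> CW n" using x u by simp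
  note c = emb_left_closed[OF x] emb_left_closed[OF u] emb_left_closed[OF cx] emb_right_closed[OF cy]
  have "young_mult G n m ?x y \<otimes>\<^bsub>?W\<^esub> emb_left G n m u = emb_left G n m ?x \<otimes>\<^bsub>?W\<^esub> (emb_right G n m y \<otimes>\<^bsub>?W\<^esub> emb_left G n m u)"
   using c by (simp add: young_mult_def W.m_assoc)
  also have "\<dots> = (emb_left G n m ?x \<otimes>\<^bsub>?W\<^esub> emb_left G n m u) \<otimes>\<^bsub>?W\<^esub> emb_right G n m y"
   using c even_commute[OF u cy] y by (simp add: W.m_assoc)
  also have "\<dots> = emb_left G n m u \<otimes>\<^bsub>?W\<^esub> young_mult G n m x y"
   unfolding emb_left_inv_cancel[OF x u] using c by (simp add: young_mult_def W.m_assoc)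
  finally have "f (young_mult G n m ?x y) = f (young_mult G n m x y)"
   using class_function_conjugate[OF R_minusD(1)[OF f]] young_mult_closed[OF x cy] young_mult_closed[OF cx cy] c(2)
   by blast
  then show "young_fun n m f ?x y = young_fun n m f x y" using even_conj[OF x u] by (simp add: young_fun_def)
 next
  fix x assume x: "x \<in> CW n"
  show "young_fun n m f (zelt G n \<otimes>\<^bsub>W n\<^esub> x) y = - young_fun n m f x y"
   using young_mult_zelt(1)[OF x cy] R_minusD(2)[OF f young_mult_closed[OF x cy]]
   by (simp add: young_fun_def even_zelt[OF x])
 qed (simp add: young_fun_def)
qed (rule R_minusI; simp add: young_fun_def)

lemma young_fun_right:
 assumes f: "f \<in> R_minus G (n + m)" shows "(\<lambda>y. young_fun n m f x y) \<in> R_minus G m"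
proof (cases "x \<in> even_elts G n")
 case x: True
 note cx = even_elts_carrier[OF x]
 let ?W = "W (n + m)"
 interpret V: group "W m" by (rule wreath_group)
 interpret W: group ?W by (rule wreath_group)
 show ?thesis
 proof (rule R_minusI)
  fix y u assume y: "y \<in> CW m" and u: "u \<in> CW m"
  let ?y = "u \<otimes>\<^bsub>W m\<^esub> y \<otimes>\<^bsub>W m\<^esub> inv\<^bsub>W m\<^esub> u"
  have cy: "?y \<in> CW m" using y u by simp
  note c = emb_right_closed[OF y] emb_right_closed[OF u] emb_right_closed[OF cy] emb_left_closed[OF cx]
  have "young_mult G n m x ?y \<otimes>\<^bsub>?W\<^esub> emb_right G n m u =
    emb_left G n m x \<otimes>\<^bsub>?W\<^esub> (emb_right G n m ?y \<otimes>\<^bsub>?W\<^esub> emb_right G n m u)"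
   using c by (simp add: young_mult_def W.m_assoc)
  also have "\<dots> = (emb_left G n m x \<otimes>\<^bsub>?W\<^esub> emb_right G n m u) \<otimes>\<^bsub>?W\<^esub> emb_right G n m y"
   unfolding emb_right_inv_cancel[OF y u] using c by (simp add: W.m_assoc)
  also have "\<dots> = emb_right G n m u \<otimes>\<^bsub>?W\<^esub> young_mult G n m x y"
   using c even_commute[OF cx u] x by (simp add: young_mult_def W.m_assoc)
  finally have "f (young_mult G n m x ?y) = f (young_mult G n m x y)"
   using class_function_conjugate[OF R_minusD(1)[OF f]] young_mult_closed[OF cx y] young_mult_closed[OF cx cy] c(2)
   by blast
  then show "young_fun n m f x ?y = young_fun n m f x y" using even_conj[OF y u] by (simp add: young_fun_def)
 next
  fix y assume y: "y \<in> CW m"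
  show "young_fun n m f x (zelt G m \<otimes>\<^bsub>W m\<^esub> y) = - young_fun n m f x y"
   using young_mult_zelt(2)[OF cx y] R_minusD(2)[OF f young_mult_closed[OF cx y]]
   by (simp add: young_fun_def even_zelt[OF y])
 qed (simp add: young_fun_def)
qed (rule R_minusI; simp add: young_fun_def)

text \<open>The projection onto \<open>R_minus\<close>: average over conjugation and antisymmetrise
  under z, hence the additional 2 in the denominator.\<close>

definition R_proj :: "nat => ('a welt => complex) => 'a welt => complex" where
 "R_proj n g x = (if x \<in> even_elts G n then (\<Sum>u\<in>CW n.
   g (u \<otimes>\<^bsub>W n\<^esub> x \<otimes>\<^bsub>W n\<^esub> inv\<^bsub>W n\<^esub> u) -
   g (zelt G n \<otimes>\<^bsub>W n\<^esub> (u \<otimes>\<^bsub>W n\<^esub> x \<otimes>\<^bsub>W n\<^esub> inv\<^bsub>W n\<^esub> u)))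
  / (2 * of_nat (card (CW n))) else 0)"

lemma R_proj_mem: "R_proj n g \<in> R_minus G n"
proof (rule R_minusI)
 let ?W = "W n"
 interpret W: group ?W by (rule wreath_group)
 fix x v assume x: "x \<in> carrier ?W" and v: "v \<in> carrier ?W"
 define h where "h w = g w - g (zelt G n \<otimes>\<^bsub>?W\<^esub> w)" for w
 have "(\<Sum>u\<in>carrier ?W. h (u \<otimes>\<^bsub>?W\<^esub> (v \<otimes>\<^bsub>?W\<^esub> x \<otimes>\<^bsub>?W\<^esub> inv\<^bsub>?W\<^esub> v) \<otimes>\<^bsub>?W\<^esub> inv\<^bsub>?W\<^esub> u)) =
   (\<Sum>u\<in>carrier ?W. h (u \<otimes>\<^bsub>?W\<^esub> x \<otimes>\<^bsub>?W\<^esub> inv\<^bsub>?W\<^esub> u))"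
  by (rule sum.reindex_bij_witness[where i = "\<lambda>u. u \<otimes>\<^bsub>?W\<^esub> inv\<^bsub>?W\<^esub> v" and j = "\<lambda>u. u \<otimes>\<^bsub>?W\<^esub> v"])
   (use x v in \<open>simp_all add: W.inv_mult_group W.m_assoc\<close>)
 then show "R_proj n g (v \<otimes>\<^bsub>?W\<^esub> x \<otimes>\<^bsub>?W\<^esub> inv\<^bsub>?W\<^esub> v) = R_proj n g x"
  by (simp add: R_proj_def even_conj[OF x v] h_def)
next
 let ?W = "W n" and ?z = "zelt G n"
 interpret W: group ?W by (rule wreath_group)
 fix x assume x: "x \<in> carrier ?W"
 have "u \<otimes>\<^bsub>?W\<^esub> (?z \<otimes>\<^bsub>?W\<^esub> x) \<otimes>\<^bsub>?W\<^esub> inv\<^bsub>?W\<^esub> u = ?z \<otimes>\<^bsub>?W\<^esub> (u \<otimes>\<^bsub>?W\<^esub> x \<otimes>\<^bsub>?W\<^esub> inv\<^bsub>?W\<^esub> u)" if u: "u \<in> carrier ?W" for u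
 proof -
  have "u \<otimes>\<^bsub>?W\<^esub> (?z \<otimes>\<^bsub>?W\<^esub> x) \<otimes>\<^bsub>?W\<^esub> inv\<^bsub>?W\<^esub> u = (u \<otimes>\<^bsub>?W\<^esub> ?z) \<otimes>\<^bsub>?W\<^esub> x \<otimes>\<^bsub>?W\<^esub> inv\<^bsub>?W\<^esub> u"
   using x u zelt_closed by (simp add: W.m_assoc)
  also have "u \<otimes>\<^bsub>?W\<^esub> ?z = ?z \<otimes>\<^bsub>?W\<^esub> u" by (rule zelt_central[OF u, symmetric])
  finally show ?thesis using x u zelt_closed by (simp add: W.m_assoc)
 qed
 then have "(\<Sum>u\<in>carrier ?W. g (u \<otimes>\<^bsub>?W\<^esub> (?z \<otimes>\<^bsub>?W\<^esub> x) \<otimes>\<^bsub>?W\<^esub> inv\<^bsub>?W\<^esub> u) -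
   g (?z \<otimes>\<^bsub>?W\<^esub> (u \<otimes>\<^bsub>?W\<^esub> (?z \<otimes>\<^bsub>?W\<^esub> x) \<otimes>\<^bsub>?W\<^esub> inv\<^bsub>?W\<^esub> u))) =
  (\<Sum>u\<in>carrier ?W. - (g (u \<otimes>\<^bsub>?W\<^esub> x \<otimes>\<^bsub>?W\<^esub> inv\<^bsub>?W\<^esub> u) - g (?z \<otimes>\<^bsub>?W\<^esub> (u \<otimes>\<^bsub>?W\<^esub> x \<otimes>\<^bsub>?W\<^esub> inv\<^bsub>?W\<^esub> u))))"
  by (intro sum.cong) (use x in \<open>simp_all add: zelt_zelt\<close>)
 then show "R_proj n g (?z \<otimes>\<^bsub>?W\<^esub> x) = - R_proj n g x"
  by (simp only: R_proj_def even_zelt[OF x] sum_negf minus_divide_left split: if_split) simp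
qed (simp add: R_proj_def)

text \<open>The projection is linear and fixes f, so expanding f into point masses and projecting
  each of them gives a finite expansion inside \<open>R_minus\<close>.\<close>

lemma R_minus_expand:
 assumes f: "f \<in> R_minus G n"
 shows "f x = (\<Sum>a\<in>CW n. f a * R_proj n (\<lambda>b. of_bool (b = a)) x)"
proof (cases "x \<in> even_elts G n")
 case True
 let ?W = "W n" and ?z = "zelt G n"
 interpret W: group ?W by (rule wreath_group)
 note x = even_elts_carrier[OF True]
 let ?c = "\<lambda>u. u \<otimes>\<^bsub>?W\<^esub> x \<otimes>\<^bsub>?W\<^esub> inv\<^bsub>?W\<^esub> u" and ?N = "2 * of_nat (card (carrier ?W)) :: complex"
 have N: "?N \<noteq> 0" using finite_wreath W.one_closed by (auto simp: card_eq_0_iff)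
 have c: "?c u \<in> carrier ?W" "?z \<otimes>\<^bsub>?W\<^esub> ?c u \<in> carrier ?W" if "u \<in> carrier ?W" for u using x that zelt_closed by auto
 have "(\<Sum>a\<in>carrier ?W. f a * R_proj n (\<lambda>b. of_bool (b = a)) x) =
   (\<Sum>a\<in>carrier ?W. \<Sum>u\<in>carrier ?W. f a * (of_bool (?c u = a) - of_bool (?z \<otimes>\<^bsub>?W\<^esub> ?c u = a))) / ?N"
  using True by (simp add: R_proj_def sum_divide_distrib sum_distrib_left)
 also have "\<dots> = (\<Sum>u\<in>carrier ?W. \<Sum>a\<in>carrier ?W. f a * (of_bool (?c u = a) - of_bool (?z \<otimes>\<^bsub>?W\<^esub> ?c u = a))) / ?N"
  by (subst sum.swap) (rule HOL.refl)
 also have "(\<Sum>u\<in>carrier ?W. \<Sum>a\<in>carrier ?W. f a * (of_bool (?c u = a) - of_bool (?z \<otimes>\<^bsub>?W\<^esub> ?c u = a))) =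
   (\<Sum>u\<in>carrier ?W. 2 * f x)"
 proof (rule sum.cong[OF HOL.refl])
  fix u assume u: "u \<in> carrier ?W"
  have "(\<Sum>a\<in>carrier ?W. f a * (of_bool (?c u = a) - of_bool (?z \<otimes>\<^bsub>?W\<^esub> ?c u = a))) =
    (\<Sum>a\<in>carrier ?W. if ?c u = a then f a else 0) - (\<Sum>a\<in>carrier ?W. if ?z \<otimes>\<^bsub>?W\<^esub> ?c u = a then f a else 0)"
   unfolding sum_subtractf[symmetric] by (rule sum.cong[OF HOL.refl]) (simp add: of_bool_def)
  also have "\<dots> = f (?c u) - f (?z \<otimes>\<^bsub>?W\<^esub> ?c u)" using c[OF u] finite_wreath by simp
  also have "\<dots> = 2 * f x"
   using R_minusD(2)[OF f c(1)[OF u]] class_functionD[OF R_minusD(1)[OF f] x u] by simp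
  finally show "(\<Sum>a\<in>carrier ?W. f a * (of_bool (?c u = a) - of_bool (?z \<otimes>\<^bsub>?W\<^esub> ?c u = a))) = 2 * f x" .
 qed
 finally show ?thesis using N by simp
qed (simp add: R_proj_def R_minusD(3)[OF f])

text \<open>Expand in the first variable by \<open>R_minus_expand\<close>: the coefficients are
  values of F at fixed first arguments, hence functions of y in \<open>R_minus\<close>. This
  exhibits F as a finite sum of products without choosing a basis.\<close>

lemma tensorI:
 assumes l: "\<And>y. (\<lambda>x. F x y) \<in> R_minus G n" and r: "\<And>x. F x \<in> R_minus G m"
 shows "F \<in> tensor G n m"
proof -
 let ?C = "CW n"
 obtain h where h: "bij_betw h {..<card ?C} ?C" using ex_bij_betw_nat_finite[OF finite_wreath] by (auto simp: atLeast0LessThan)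
 have "F = (\<lambda>x y. \<Sum>i<card ?C. R_proj n (\<lambda>b. of_bool (b = h i)) x * F (h i) y)"
 proof (intro ext)
  fix x y
  have "F x y = (\<Sum>a\<in>?C. F a y * R_proj n (\<lambda>b. of_bool (b = a)) x)" by (rule R_minus_expand[OF l])
  also have "\<dots> = (\<Sum>i<card ?C. F (h i) y * R_proj n (\<lambda>b. of_bool (b = h i)) x)"
   by (rule sum.reindex_bij_betw[OF h, symmetric])
  finally show "F x y = (\<Sum>i<card ?C. R_proj n (\<lambda>b. of_bool (b = h i)) x * F (h i) y)" by (simp add: mult.commute)
 qed
 then show ?thesis unfolding tensor_def
  by (intro CollectI exI[of _ "card ?C"] exI[of _ "\<lambda>i. R_proj n (\<lambda>b. of_bool (b = h i))"] exI[of _ "\<lambda>i. F (h i)"])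
   (use R_proj_mem r in simp)
qed

lemma tensorD:
 assumes "F \<in> tensor G n m"
 shows "z_invariant n m F" "x \<notin> even_elts G n \<or> y \<notin> even_elts G m ==> F x y = 0"
proof -
 obtain k :: nat and f g where F: "F = (\<lambda>x y. \<Sum>i<k. f i x * g i y)"
  and m: "\<And>i. i < k ==> f i \<in> R_minus G n" "\<And>i. i < k ==> g i \<in> R_minus G m"
  using assms unfolding tensor_def by blast
 show "z_invariant n m F" unfolding z_invariant_def F
  using R_minusD(2)[OF m(1)] R_minusD(2)[OF m(2)] by simp
 show "F x y = 0" if "x \<notin> even_elts G n \<or> y \<notin> even_elts G m"
  unfolding F
 proof (rule sum.neutral, rule ballI)
  fix i assume "i \<in> {..<k}"
  then show "f i x * g i y = 0" using R_minusD(3)[OF m(1), of i x] R_minusD(3)[OF m(2), of i y] that by auto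
 qed
qed

lemma phi_inj: "inj_on (phi G n m) (tensor G n m)"
proof (rule inj_onI, intro ext)
 fix F F' x y
 assume F: "F \<in> tensor G n m" and F': "F' \<in> tensor G n m" and eq: "phi G n m F = phi G n m F'"
 show "F x y = F' x y"
 proof (cases "x \<in> even_elts G n \<and> y \<in> even_elts G m")
  case True
  then show ?thesis
   using phi_young_mult[OF tensorD(1)[OF F], of x y] phi_young_mult[OF tensorD(1)[OF F'], of x y] eq by simp
 next
  case False
  then show ?thesis using tensorD(2)[OF F, of x y] tensorD(2)[OF F', of x y] by simp
 qed
qed

text \<open>Since \<open>phi\<close> is injective on the tensor product, it suffices that
  \<open>young_fun\<close> lies there and has the restriction of f as its image. Outside the
  products of even elements this uses the vanishing \<open>R_minus_young_zero\<close>.\<close>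

lemma R_comult_eq:
 assumes f: "f \<in> R_minus G (n + m)" shows "R_comult G n m f = young_fun n m f"
proof -
 have t: "young_fun n m f \<in> tensor G n m" by (rule tensorI[OF young_fun_left[OF f] young_fun_right[OF f]])
 have "phi G n m (young_fun n m f) v = restrict_to (young G n m) f v" for v
 proof (cases "\<exists>x\<in>even_elts G n. \<exists>y\<in>even_elts G m. v = young_mult G n m x y")
  case True
  then obtain x y where xy: "x \<in> even_elts G n" "y \<in> even_elts G m" "v = young_mult G n m x y" by blast
  show ?thesis using phi_young_mult[OF tensorD(1)[OF t] xy(1,2)] xy
    young_mult_young[OF even_elts_carrier[OF xy(1)] even_elts_carrier[OF xy(2)]]
   by (simp add: young_fun_def restrict_to_def)
 next
  case False
  have "f v = 0" if v: "v \<in> young G n m"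
  proof -
   obtain x y where xy: "x \<in> CW n" "y \<in> CW m" "v = young_mult G n m x y"
    using young_decompose[OF v] by blast
   then show ?thesis using R_minus_young_zero[OF f xy(1,2)] False by blast
  qed
  then show ?thesis using phi_outside[OF False] by (simp add: restrict_to_def)
 qed
 then have "phi G n m (young_fun n m f) = restrict_to (young G n m) f" by blast
 then show ?thesis unfolding R_comult_def using inv_into_f_f[OF phi_inj t] by simp
qed

section \<open>The pairing as an average over decorated permutations\<close>

lemma sum_wreath_pr:
 "(\<Sum>x\<in>CW n. h (pr x)) = 2 * (\<Sum>\<xi>\<in>dperm G {1..n}. h \<xi> :: complex)"
proof -
 have "(\<Sum>x\<in>CW n. h (pr x)) =
   (\<Sum>\<xi>\<in>dperm G {1..n}. \<Sum>x | x \<in> CW n \<and> pr x = \<xi>. h (pr x))"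
  by (rule sum.group[symmetric]) (use finite_wreath finite_dperm pr_closed in auto)
 also have "\<dots> = (\<Sum>\<xi>\<in>dperm G {1..n}. 2 * h \<xi>)"
 proof (rule sum.cong[OF HOL.refl])
  fix \<xi> assume \<xi>: "\<xi> \<in> dperm G {1..n}"
  obtain x where x: "x \<in> CW n" "pr x = \<xi>" using pr_surj[OF \<xi>] by blast
  let ?zx = "zelt G n \<otimes>\<^bsub>W n\<^esub> x"
  have "{w. w \<in> CW n \<and> pr w = \<xi>} = {x, ?zx}"
  proof (intro equalityI subsetI)
   fix w assume "w \<in> {w. w \<in> CW n \<and> pr w = \<xi>}"
   then have "w \<in> CW n" "pr w = pr x" using x(2) by simp_all
   then show "w \<in> {x, ?zx}" using pr_eq[of w n x] x(1) by simp
  next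
   fix w assume "w \<in> {x, ?zx}"
   then consider "w = x" | "w = ?zx" by blast
   then show "w \<in> {w. w \<in> CW n \<and> pr w = \<xi>}"
    using x wreath_closed[OF zelt_closed x(1)] pr_zelt[OF x(1)] by cases simp_all
  qed
  moreover have "x \<noteq> ?zx" using zelt_neq[OF x(1)] by metis
  ultimately show "(\<Sum>x | x \<in> CW n \<and> pr x = \<xi>. h (pr x)) = 2 * h \<xi>"
   using x(2) pr_zelt[OF x(1)] by simp
 qed
 finally show ?thesis by (simp add: sum_distrib_left)
qed

lemma card_wreath: "of_nat (card (CW n)) = 2 * (of_nat (card (dperm G {1..n})) :: complex)"
 using sum_wreath_pr[of "\<lambda>_. 1" n] by simp

lemma avg_wreath:
 "(\<Sum>x\<in>CW n. h (pr x)) / of_nat (card (CW n)) = avg G {1..n} h"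
 by (simp only: sum_wreath_pr card_wreath avg_def) simp

lemma inv_zelt_mult:
 assumes x: "x \<in> CW n"
 shows "inv\<^bsub>W n\<^esub> (zelt G n \<otimes>\<^bsub>W n\<^esub> x) = zelt G n \<otimes>\<^bsub>W n\<^esub> inv\<^bsub>W n\<^esub> x"
proof -
 interpret W: group "W n" by (rule wreath_group)
 have "zelt G n \<otimes>\<^bsub>W n\<^esub> zelt G n = \<one>\<^bsub>W n\<^esub>"
  using zelt_zelt[OF W.one_closed] zelt_closed by simp
 then have "inv\<^bsub>W n\<^esub> zelt G n = zelt G n" using zelt_closed by (intro W.inv_equality)
 then show ?thesis using x zelt_closed zelt_central[OF W.inv_closed[OF x]] by (simp add: W.inv_mult_group)
qed

text \<open>Passing from x to zx changes the sign of both factors on the left, so their product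
  descends to \<open>pr x\<close> and may be computed at the odd-order lift. If \<open>pr x\<close>
  has no odd order, both sides vanish.\<close>

lemma pairing_summand:
 assumes g: "g \<in> R_minus G n" and f: "f \<in> R_minus G (n + p)"
  and x: "x \<in> CW n" and y: "y \<in> CW p" "pos p y"
 shows "g (inv\<^bsub>W n\<^esub> x) * young_fun n p f x y =
  til g n {1..n} (dinv G {1..n} (pr x)) * til f (n + p) {1..n + p} (djoin {1..n} (pr x) (shifted n p (pr y)))"
proof -
 let ?W = "W n"
 interpret W: group ?W by (rule wreath_group)
 have pos_case: "g (inv\<^bsub>?W\<^esub> w) * young_fun n p f w y =
   til g n {1..n} (dinv G {1..n} (pr w)) * til f (n + p) {1..n + p} (djoin {1..n} (pr w) (shifted n p (pr y)))"
  if w: "w \<in> carrier ?W" "pos n w" for w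
  using til_self[OF R_minusD(1)[OF g] W.inv_closed[OF w(1)] pos_inv[OF w]]
   til_self[OF R_minusD(1)[OF f] young_mult_closed[OF w(1) y(1)] pos_young_mult[OF w y]]
   pos_even_elts[OF w] pos_even_elts[OF y]
  by (simp add: pr_inv[OF w(1)] pr_young_mult[OF w(1) y(1)] young_fun_def)
 show ?thesis
 proof (cases "odd_order (snd (pr x))")
  case True
  then consider "pos n x" | "pos n (zelt G n \<otimes>\<^bsub>?W\<^esub> x)" using pos_or_zpos[OF x] by blast
  then show ?thesis
  proof cases
   case 1
   then show ?thesis by (rule pos_case[OF x])
  next
   case 2
   have "g (zelt G n \<otimes>\<^bsub>?W\<^esub> inv\<^bsub>?W\<^esub> x) = - g (inv\<^bsub>?W\<^esub> x)" by (rule R_minusD(2)[OF g W.inv_closed[OF x]])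
   moreover have "young_fun n p f (zelt G n \<otimes>\<^bsub>?W\<^esub> x) y = - young_fun n p f x y"
    by (rule R_minusD(2)[OF young_fun_left[OF f] x])
   ultimately show ?thesis
    using pos_case[OF wreath_closed[OF zelt_closed x] 2] by (simp add: inv_zelt_mult[OF x] pr_zelt[OF x])
  qed
 next
  case False
  note ym = young_mult_closed[OF x y(1)]
  have "{1..n} \<in> invs {1..n + p} (pr (young_mult G n p x y))"
   using young_mult_young[OF x y(1)] by (simp add: young_iff)
  then have no: "\<not> odd_order (snd (pr (young_mult G n p x y)))"
   using odd_order_dres[OF pr_closed[OF ym]] dres_young_mult(1)[OF x y(1)] False by metis
  then have "f (young_mult G n p x y) = 0" by (rule R_minus_not_odd_order[OF f ym])
  then show ?thesis using no by (simp add: young_fun_def til_zero pr_young_mult[OF x y(1)])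
 qed
qed

lemma pairing_comult_mem:
 assumes f: "f \<in> R_minus G (n + p)"
 shows "(\<lambda>y. pairing G n g (\<lambda>x. R_comult G n p f x y)) \<in> R_minus G p"
proof -
 have "(\<lambda>y. \<Sum>x\<in>CW n. (g x / of_nat (card (CW n))) *
   young_fun n p f (inv\<^bsub>W n\<^esub> x) y) \<in> R_minus G p"
  by (rule R_minus_sum[OF young_fun_right[OF f]])
 then show ?thesis by (simp add: pairing_def R_comult_eq[OF f] sum_divide_distrib)
qed

text \<open>Substituting the inverse of x moves the inversion from the coproduct to g; this is the
  origin of the dual character in \<open>fam_annih\<close>.\<close>

lemma pairing_comult_pos:
 assumes g: "g \<in> R_minus G n" and f: "f \<in> R_minus G (n + p)"
  and y: "y \<in> CW p" "pos p y"
 shows "pairing G n g (\<lambda>x. R_comult G n p f x y) =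
  avg G {1..n} (\<lambda>\<xi>. til g n {1..n} (dinv G {1..n} \<xi>) *
   til f (n + p) {1..n + p} (djoin {1..n} \<xi> (shifted n p (pr y))))"
proof -
 let ?W = "W n"
 interpret W: group ?W by (rule wreath_group)
 have "(\<Sum>x\<in>carrier ?W. g x * young_fun n p f (inv\<^bsub>?W\<^esub> x) y) =
   (\<Sum>x\<in>carrier ?W. g (inv\<^bsub>?W\<^esub> x) * young_fun n p f x y)"
  by (rule sum.reindex_bij_witness[where i = "\<lambda>x. inv\<^bsub>?W\<^esub> x" and j = "\<lambda>x. inv\<^bsub>?W\<^esub> x"]) simp_all
 also have "\<dots> = (\<Sum>x\<in>carrier ?W. til g n {1..n} (dinv G {1..n} (pr x)) *
   til f (n + p) {1..n + p} (djoin {1..n} (pr x) (shifted n p (pr y))))"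
  by (rule sum.cong[OF HOL.refl]) (rule pairing_summand[OF g f _ y])
 finally show ?thesis
  unfolding pairing_def R_comult_eq[OF f] avg_wreath[symmetric] by simp
qed

end

section \<open>Standard elements\<close>

text \<open>Used in \<open>type_exists\<close> to list the cycles of an element in the order
  prescribed by \<open>type_parts\<close>.\<close>

lemma mset_map_permute:
 assumes "mset (map f xs) = mset ys" shows "\<exists>xs'. mset xs' = mset xs \<and> map f xs' = ys"
 using assms
proof (induction ys arbitrary: xs)
 case (Cons y ys)
 have "y \<in># mset (map f xs)" unfolding Cons.prems by simp
 then obtain x where x: "x \<in> set xs" "f x = y" by auto
 then obtain us vs where xs: "xs = us @ x # vs" by (meson split_list)
 have "mset (map f (us @ vs)) = mset ys" using Cons.prems x(2) by (simp add: xs)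
 then obtain zs where "mset zs = mset (us @ vs)" "map f zs = ys" using Cons.IH by blast
 then show ?case using x(2) by (intro exI[of _ "x # zs"]) (simp add: xs)
qed simp

text \<open>The lift \<open>t\<^sub>1 \<dots> t\<^sub>k\<^sub>-\<^sub>1\<close> of a cycle of odd length \<open>k\<close> has odd order up to the sign \<open>cycle_sign k\<close>. The
 sign need not be known: only the square of \<open>cycle_weight k\<close> matters.\<close>

definition cycle_sign :: "nat => complex" where
 "cycle_sign k = (if \<exists>N::nat. odd N \<and>
  spin_class k (map lt [1..<k]) [^]\<^bsub>Sp k\<^esub> N = \<one>\<^bsub>Sp k\<^esub> then 1 else -1)"

definition cycle_weight :: "nat => complex" where
 "cycle_weight k = of_real (sqrt 2) * cycle_sign k"

lemma cycle_weight_square: "cycle_weight k ^ 2 = 2"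
 by (simp add: cycle_weight_def cycle_sign_def power_mult_distrib flip: of_real_power)

lemma map_lt_closed: "1 \<le> a ==> b \<le> k ==> map lt [a..<b] \<in> swords k"
 by (auto simp: gwords_def spin_gens_def)

lemma word_perm_interval:
 "word_perm (map lt [a..<a + m]) i = (if a \<le> i \<and> i < a + m then i + 1 else if i = a + m then a else i)"
 by (induction m arbitrary: i) (auto simp: Transposition.transpose_def)

lemma word_perm_cycle:
 assumes "k \<ge> 1"
 shows "word_perm (map lt [1..<k]) i = (if 1 \<le> i \<and> i < k then i + 1 else if i = k then 1 else i)"
 using word_perm_interval[of 1 "k - 1" i] assms by simp

definition part_sum :: "('a set \<times> nat) list => nat" where
 "part_sum ps = sum_list (map snd ps)"

lemma part_sum_simps [simp]: "part_sum [] = 0" "part_sum ((C, k) # ps) = k + part_sum ps"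
 by (simp_all add: part_sum_def)

text \<open>The word \<open>t_word\<close> for an arbitrary list of parts and an arbitrary starting
  point, which makes induction over the parts possible.\<close>

definition interval_word :: "nat => ('a set \<times> nat) list => spin_gen gword" where
 "interval_word a ps = concat (map (\<lambda>(C, a, k). map lt [a..<a + k - 1]) (intervals_from a ps))"

lemma interval_word_simps [simp]:
 "interval_word a [] = []"
 "interval_word a ((C, k) # ps) = map lt [a..<a + k - 1] @ interval_word (a + k) ps"
 by (simp_all add: interval_word_def)

lemma intervals_from_shift:
 "intervals_from (a + b) ps = map (\<lambda>(C, i, k). (C, i + b, k)) (intervals_from a ps)"
proof (induction ps arbitrary: a)
 case (Cons p ps)
 obtain C k where p: "p = (C, k)" by force
 show ?case using Cons.IH[of "a + k"] by (simp add: p ac_simps)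
qed simp

lemma intervals_from_bounds:
 "(C, i, k) \<in> set (intervals_from a ps) ==> a \<le> i \<and> i + k \<le> a + part_sum ps"
proof (induction ps arbitrary: a)
 case (Cons p ps)
 obtain D l where p: "p = (D, l)" by force
 show ?case using Cons.prems Cons.IH[of "a + l"] by (auto simp: p)
qed simp

lemma interval_word_shift: "1 \<le> a ==> interval_word (a + b) ps = shift_word b (interval_word a ps)"
proof (induction ps arbitrary: a)
 case (Cons p ps)
 obtain C k where p: "p = (C, k)" by force
 have "map lt [a + b..<a + b + k - 1] = shift_word b (map lt [a..<a + k - 1])"
  using Cons.prems by (intro nth_equalityI) (auto simp: shift_word_def)
 then show ?case using Cons.IH[of "a + k"] Cons.prems by (simp add: p ac_simps)
qed simp

lemma interval_word_closed: "interval_word 1 ps \<in> swords (part_sum ps)"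
proof (induction ps)
 case (Cons p ps)
 obtain C k where p: "p = (C, k)" by force
 have "interval_word (1 + k) ps \<in> swords (k + part_sum ps)"
  unfolding interval_word_shift[OF le_refl] by (rule shift_word_closed[OF Cons.IH le_refl])
 then show ?case using map_lt_closed[of 1 k "k + part_sum ps"] by (simp add: p del: One_nat_def)
qed simp

lemma cycle_prod_shift:
 assumes "\<And>i. a \<le> i ==> i < a + l ==> g (i + k) = h i"
 shows "cycle_prod G g (a + k) l = cycle_prod G h a l"
 using assms
proof (induction l)
 case (Suc l)
 have "g (a + l + k) = h (a + l)" by (rule Suc.prems) auto
 moreover have "cycle_prod G g (a + k) l = cycle_prod G h a l" by (rule Suc.IH) (simp add: Suc.prems)
 ultimately show ?case by (simp add: ac_simps)
qed simp

context fin_group begin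

lemma conj_class_self: "x \<in> carrier G ==> x \<in> conj_class G x"
 unfolding conj_class_def by (rule CollectI, rule exI[of _ \<one>]) simp

lemma class_value_eq:
 assumes f: "class_fun G f" and C: "C \<in> conj_classes G" "x \<in> C" shows "f x = class_value f C"
proof -
 obtain y where y: "y \<in> carrier G" "C = conj_class G y" using C(1) by (auto simp: conj_classes_def)
 have "f z = f y" if "z \<in> C" for z using that f y by (auto simp: conj_class_def class_fun_def)
 then have "f ` C = {f x}" using C(2) by auto
 then show ?thesis by (simp add: class_value_def)
qed

definition cycle_elt :: "nat => (nat => 'a) => 'a welt" where
 "cycle_elt k g = (g, spin_class k (map lt [1..<k]))"

lemma cycle_elt_closed: "g \<in> {1..k} \<rightarrow>\<^sub>E carrier G ==> cycle_elt k g \<in> CW k"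
 by (simp add: carrier_wreath cycle_elt_def map_lt_closed del: One_nat_def)

lemma snd_cycle_elt: "k \<ge> 1 ==> snd (pr (cycle_elt k g)) i =
  (if 1 \<le> i \<and> i < k then i + 1 else if i = k then 1 else i)"
 by (simp add: pr_def cycle_elt_def spin_perm_class map_lt_closed word_perm_cycle del: One_nat_def)

lemma cyc_cycle_elt:
 assumes k: "k \<ge> 1" shows "cyc {1..k} (pr (cycle_elt k g))"
 unfolding cyc_def
proof (intro conjI ballI)
 fix B assume B: "B \<in> invs {1..k} (pr (cycle_elt k g))"
 have up: "i + j \<in> B" if "i \<in> B" "i + j \<le> k" for i j
  using that(2)
 proof (induction j)
  case (Suc j)
  then have ij: "i + j \<in> B" by simp
  moreover have "1 \<le> i + j" using invsD(1)[OF B] ij by auto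
  ultimately show ?case using invsD(2)[OF B ij] Suc.prems snd_cycle_elt[OF k, of g "i + j"] by simp
 qed (use that in simp)
 show "B = {} \<or> B = {1..k}"
 proof (rule disjCI)
  assume "B \<noteq> {1..k}"
  show "B = {}"
  proof (rule ccontr)
   assume "B \<noteq> {}"
   then obtain i where i: "i \<in> B" by auto
   then have "i \<le> k" using invsD(1)[OF B] by auto
   then have "k \<in> B" using up[OF i, of "k - i"] by simp
   then have "1 \<in> B" using invsD(2)[OF B] snd_cycle_elt[OF k, of g k] by fastforce
   then have "j \<in> B" if "j \<in> {1..k}" for j using up[of 1 "j - 1"] that by simp
   then show False using \<open>B \<noteq> {1..k}\<close> invsD(1)[OF B] by blast
  qed
 qed
qed (use k in simp)

lemma cprod_cycle_elt:
 assumes k: "k \<ge> 1" shows "l \<le> k ==> cprod G (pr (cycle_elt k g)) 1 l = cycle_prod G g 1 l"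
proof (induction l)
 case (Suc l)
 have "(snd (pr (cycle_elt k g)) ^^ j) 1 = 1 + j" if "j < k" for j
  using that by (induction j) (simp_all add: snd_cycle_elt[OF k])
 then show ?case using Suc by (simp add: pr_def cycle_elt_def)
qed simp

text \<open>The condition \<open>pos\<close> looks at the spin component only, so one sign serves
  all decorations g. A single cycle of odd length has odd order, so one of its two lifts is
  \<open>pos\<close>.\<close>

lemma cycle_elt_signed:
 assumes g: "g \<in> {1..k} \<rightarrow>\<^sub>E carrier G" and k: "odd k"
 shows "cycle_sign k = 1 \<and> pos k (cycle_elt k g) \<or>
  cycle_sign k = -1 \<and> pos k (zelt G k \<otimes>\<^bsub>W k\<^esub> cycle_elt k g)"
proof (cases "pos k (cycle_elt k g)")
 case True
 then show ?thesis by (simp add: pos_def cycle_sign_def cycle_elt_def del: One_nat_def)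
next
 case False
 have k1: "k \<ge> 1" using k by (cases k) auto
 note c = cycle_elt_closed[OF g]
 have "odd_order (snd (pr (cycle_elt k g)))"
 proof (rule odd_order_if_odd_atoms[OF pr_closed[OF c]])
  fix A assume A: "A \<in> atoms {1..k} (pr (cycle_elt k g))"
  then have "A = {1..k}" using cyc_cycle_elt[OF k1, of g] unfolding atoms_iff cyc_def by blast
  then show "odd (card A)" using k by simp
 qed simp
 then have "pos k (zelt G k \<otimes>\<^bsub>W k\<^esub> cycle_elt k g)" using pos_or_zpos[OF c] False by blast
 then show ?thesis using False by (simp add: pos_def cycle_sign_def cycle_elt_def del: One_nat_def)
qed

text \<open>The elements over \<open>t_word\<close> rebuilt as iterated Young products of single
  cycles (\<open>standard_form\<close>, \<open>standardI\<close>). In this shape signs and weights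
  can be found factor by factor.\<close>

fun standard :: "('a set \<times> nat) list => 'a welt set" where
 "standard [] = {\<one>\<^bsub>W 0\<^esub>}"
| "standard ((C, k) # ps) = {young_mult G k (part_sum ps) (cycle_elt k g) y | g y.
  g \<in> {1..k} \<rightarrow>\<^sub>E carrier G \<and> cycle_prod G g 1 k \<in> C \<and> y \<in> standard ps}"

lemma standard_closed: "x \<in> standard ps ==> x \<in> CW (part_sum ps)"
proof (induction ps arbitrary: x)
 case Nil
 interpret W: group "W 0" by (rule wreath_group)
 show ?case using Nil by simp
next
 case (Cons p ps)
 obtain C k where p: "p = (C, k)" by force
 obtain g y where "g \<in> {1..k} \<rightarrow>\<^sub>E carrier G" "y \<in> standard ps" "x = young_mult G k (part_sum ps) (cycle_elt k g) y"
  using Cons.prems by (auto simp only: p standard.simps)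
 then show ?case using young_mult_closed[OF cycle_elt_closed Cons.IH] by (simp add: p)
qed

text \<open>A factor z can be taken out of either side of a Young product, so the signs of the
  single cycles multiply and two of them cancel.\<close>

lemma standard_signed:
 assumes "\<And>C k. (C, k) \<in> set ps ==> odd k" "x \<in> standard ps"
 defines "s \<equiv> prod_list (map (\<lambda>(C, k). cycle_sign k) ps)" and "n \<equiv> part_sum ps"
 shows "s = 1 \<and> pos n x \<or> s = -1 \<and> pos n (zelt G n \<otimes>\<^bsub>W n\<^esub> x)"
 using assms(1,2) unfolding s_def n_def
proof (induction ps arbitrary: x)
 case Nil
 interpret S: group "Sp 0" by (rule spin_group_group)
 have "pos 0 x" using Nil(2) unfolding pos_def by (intro exI[of _ 1]) (simp add: one_wreath)
 then show ?case by simp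
next
 case (Cons p ps)
 obtain C k where p: "p = (C, k)" by force
 let ?m = "part_sum ps"
 obtain g y where g: "g \<in> {1..k} \<rightarrow>\<^sub>E carrier G" and y: "y \<in> standard ps"
  and x: "x = young_mult G k ?m (cycle_elt k g) y"
  using Cons.prems(2) by (auto simp only: p standard.simps)
 have k: "odd k" using Cons.prems(1)[of C k] by (simp add: p)
 note cx = cycle_elt_closed[OF g] and cy = standard_closed[OF y]
 note zx = wreath_closed[OF zelt_closed cx] and zy = wreath_closed[OF zelt_closed cy]
 have IH: "prod_list (map (\<lambda>(C, k). cycle_sign k) ps) = 1 \<and> pos ?m y \<or>
   prod_list (map (\<lambda>(C, k). cycle_sign k) ps) = -1 \<and> pos ?m (zelt G ?m \<otimes>\<^bsub>W ?m\<^esub> y)"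
  by (rule Cons.IH[OF _ y]) (meson Cons.prems(1) list.set_intros(2))
 note S = cycle_elt_signed[OF g k]
 have zz: "young_mult G k ?m (zelt G k \<otimes>\<^bsub>W k\<^esub> cycle_elt k g) (zelt G ?m \<otimes>\<^bsub>W ?m\<^esub> y) = x"
  unfolding x young_mult_zelt(1)[OF cx zy] young_mult_zelt(2)[OF cx cy]
  by (rule zelt_zelt[OF young_mult_closed[OF cx cy]])
 consider "cycle_sign k = 1" "pos k (cycle_elt k g)" "prod_list (map (\<lambda>(C, k). cycle_sign k) ps) = 1" "pos ?m y"
  | "cycle_sign k = -1" "pos k (zelt G k \<otimes>\<^bsub>W k\<^esub> cycle_elt k g)"
   "prod_list (map (\<lambda>(C, k). cycle_sign k) ps) = 1" "pos ?m y"
  | "cycle_sign k = 1" "pos k (cycle_elt k g)" "prod_list (map (\<lambda>(C, k). cycle_sign k) ps) = -1"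
   "pos ?m (zelt G ?m \<otimes>\<^bsub>W ?m\<^esub> y)"
  | "cycle_sign k = -1" "pos k (zelt G k \<otimes>\<^bsub>W k\<^esub> cycle_elt k g)"
   "prod_list (map (\<lambda>(C, k). cycle_sign k) ps) = -1" "pos ?m (zelt G ?m \<otimes>\<^bsub>W ?m\<^esub> y)"
  using S IH by blast
 then show ?case
 proof cases
  case 1
  then show ?thesis using pos_young_mult[OF cx 1(2) cy 1(4)] by (simp add: p x)
 next
  case 2
  then show ?thesis using pos_young_mult[OF zx 2(2) cy 2(4)] young_mult_zelt(1)[OF cx cy] by (simp add: p x)
 next
  case 3
  then show ?thesis using pos_young_mult[OF cx 3(2) zy 3(4)] young_mult_zelt(2)[OF cx cy] by (simp add: p x)
 next
  case 4
  then show ?thesis using pos_young_mult[OF zx 4(2) zy 4(4)] zz by (simp add: p)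
 qed
qed

lemma wt_standard:
 assumes f: "class_fun G f" and ps: "\<And>C k. (C, k) \<in> set ps ==> odd k \<and> C \<in> conj_classes G"
  and x: "x \<in> standard ps"
 shows "wt G e f {1..part_sum ps} (pr x) = prod_list (map (\<lambda>(C, k). e k * class_value f C) ps)"
 using ps x
proof (induction ps arbitrary: x)
 case Nil
 have "wt G e f {} (pr x) = 1"
  using mult_weight_wt[OF f, of e] pr_closed[OF standard_closed[OF Nil(2)]] by (simp add: mult_weight_def)
 then show ?case by simp
next
 case (Cons p ps)
 obtain C k where p: "p = (C, k)" by force
 let ?m = "part_sum ps"
 obtain g y where g: "g \<in> {1..k} \<rightarrow>\<^sub>E carrier G" "cycle_prod G g 1 k \<in> C" and y: "y \<in> standard ps"
  and x: "x = young_mult G k ?m (cycle_elt k g) y"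
  using Cons.prems(2) by (auto simp only: p standard.simps)
 have k: "odd k" "C \<in> conj_classes G" using Cons.prems(1)[of C k] by (simp_all add: p)
 have k1: "k \<ge> 1" using k(1) by (cases k) auto
 note cx = cycle_elt_closed[OF g(1)] and cy = standard_closed[OF y]
 note ij = pr_closed[OF cx] and sy = drel_closed[OF shift_bij pr_closed[OF cy]]
 have "wt G e f ({1..k} \<union> {k + 1..k + ?m}) (djoin {1..k} (pr (cycle_elt k g)) (shifted k ?m (pr y))) =
   wt G e f {1..k} (pr (cycle_elt k g)) * wt G e f {k + 1..k + ?m} (shifted k ?m (pr y))"
  by (rule mult_weight_mult[OF mult_weight_wt[OF f] _ _ young_sets(1) ij sy]) simp_all
 moreover have "wt G e f {k + 1..k + ?m} (shifted k ?m (pr y)) = wt G e f {1..?m} (pr y)"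
  by (rule iso_invD[OF mult_weight_iso_inv[OF mult_weight_wt[OF f]] drel_diso[OF shift_bij pr_closed[OF cy]]
     _ pr_closed[OF cy] sy, symmetric]) simp
 moreover have "wt G e f {1..?m} (pr y) = prod_list (map (\<lambda>(C, k). e k * class_value f C) ps)"
  by (rule Cons.IH[OF _ y]) (meson Cons.prems(1) list.set_intros(2))
 moreover have "Min {1..k} = 1" using k1 by (intro Min_eqI) auto
 then have "wt G e f {1..k} (pr (cycle_elt k g)) = e k * class_value f C"
  using wt_cyc[OF ij cyc_cycle_elt[OF k1], of e f] k(1) cprod_cycle_elt[OF k1 le_refl, of g]
   class_value_eq[OF f k(2) g(2)] by (simp add: cyc_val_def del: One_nat_def)
 ultimately show ?case unfolding x part_sum_simps p young_sets(2) pr_young_mult[OF cx cy] by simp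
qed

lemma young_mult_cycle_elt:
 assumes g: "g \<in> {1..k} \<rightarrow>\<^sub>E carrier G" and h: "h \<in> {1..m} \<rightarrow>\<^sub>E carrier G" and w: "w \<in> swords m"
 shows "young_mult G k m (cycle_elt k g) (h, spin_class m w) =
  (\<lambda>i\<in>{1..k + m}. if i \<le> k then g i else h (i - k), spin_class (k + m) (map lt [1..<k] @ shift_word k w))"
  (is "?x = _")
proof -
 have cy: "(h, spin_class m w) \<in> CW m" using h w by (simp add: carrier_wreath)
 note cx = cycle_elt_closed[OF g]
 have "fst ?x = fst (pr ?x)" by (simp add: pr_def)
 also have "\<dots> = (\<lambda>i\<in>{1..k + m}. if i \<le> k then g i else h (i - k))"
 proof
  fix i
  show "fst (pr ?x) i = (\<lambda>i\<in>{1..k + m}. if i \<le> k then g i else h (i - k)) i"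
   unfolding pr_young_mult[OF cx cy]
   by (cases "i \<in> {1..k}"; cases "i \<in> {k + 1..k + m}")
    (auto simp: djoin_def drel_def pr_def cycle_elt_def inv_shifts)
 qed
 finally have 1: "fst ?x = (\<lambda>i\<in>{1..k + m}. if i \<le> k then g i else h (i - k))" .
 have "map lt [1..<k] \<in> swords (k + m)" by (rule map_lt_closed) auto
 then have "snd ?x = spin_class (k + m) (map lt [1..<k] @ shift_word k w)"
  using spin_shift_class[OF map_lt_closed[of 1 k k], of 0 "k + m"] spin_shift_class[OF w, of k "k + m"]
   shift_word_closed[OF w, of k "k + m"]
  by (simp add: snd_young_mult cycle_elt_def spin_mult del: One_nat_def)
 then show ?thesis using 1 by (simp add: prod_eq_iff)
qed

lemma standard_form:
 assumes "x \<in> standard ps"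
 shows "\<exists>g. x = (g, spin_class (part_sum ps) (interval_word 1 ps)) \<and> g \<in> {1..part_sum ps} \<rightarrow>\<^sub>E carrier G \<and>
  (\<forall>(C, a, k)\<in>set (intervals_from 1 ps). cycle_prod G g a k \<in> C)"
 using assms
proof (induction ps arbitrary: x)
 case Nil
 then show ?case by (auto simp: one_wreath spin_one)
next
 case (Cons p ps)
 obtain C k where p: "p = (C, k)" by force
 let ?m = "part_sum ps"
 obtain g y where g: "g \<in> {1..k} \<rightarrow>\<^sub>E carrier G" "cycle_prod G g 1 k \<in> C" and y: "y \<in> standard ps"
  and x: "x = young_mult G k ?m (cycle_elt k g) y"
  using Cons.prems by (auto simp only: p standard.simps)
 obtain h where h: "y = (h, spin_class ?m (interval_word 1 ps))" "h \<in> {1..?m} \<rightarrow>\<^sub>E carrier G"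
  "\<forall>(C, a, k)\<in>set (intervals_from 1 ps). cycle_prod G h a k \<in> C" using Cons.IH[OF y] by blast
 let ?g = "\<lambda>i\<in>{1..k + ?m}. if i \<le> k then g i else h (i - k)"
 have x': "x = (?g, spin_class (part_sum (p # ps)) (interval_word 1 (p # ps)))"
  unfolding x h(1) young_mult_cycle_elt[OF g(1) h(2) interval_word_closed]
  by (simp add: p interval_word_shift[OF le_refl, of k] del: One_nat_def)
 have "cycle_prod G ?g (1 + 0) k = cycle_prod G g 1 k" by (rule cycle_prod_shift) auto
 moreover have "cycle_prod G ?g (a + k) l \<in> D" if D: "(D, a, l) \<in> set (intervals_from 1 ps)" for D a l
 proof -
  have "cycle_prod G ?g (a + k) l = cycle_prod G h a l"
   using intervals_from_bounds[OF D] by (intro cycle_prod_shift) auto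
  then show ?thesis using h(3) D by auto
 qed
 ultimately have "\<forall>(D, a, l)\<in>set (intervals_from 1 (p # ps)). cycle_prod G ?g a l \<in> D"
  using g(2) by (auto simp: p intervals_from_shift[of 1 k, simplified])
 moreover have "?g \<in> {1..part_sum (p # ps)} \<rightarrow>\<^sub>E carrier G"
  using standard_closed[OF Cons.prems] unfolding x' carrier_wreath by simp
 ultimately show ?case using x' by blast
qed

lemma standardI:
 assumes "g \<in> {1..part_sum ps} \<rightarrow>\<^sub>E carrier G"
  and "\<And>C a k. (C, a, k) \<in> set (intervals_from 1 ps) ==> cycle_prod G g a k \<in> C"
 shows "(g, spin_class (part_sum ps) (interval_word 1 ps)) \<in> standard ps"
 using assms
proof (induction ps arbitrary: g)
 case Nil
 then show ?case by (auto simp: one_wreath spin_one)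
next
 case (Cons p ps)
 obtain C k where p: "p = (C, k)" by force
 let ?m = "part_sum ps"
 let ?g = "restrict g {1..k}" and ?h = "\<lambda>i\<in>{1..?m}. g (i + k)"
 have gm: "g i \<in> carrier G" if "1 \<le> i" "i \<le> k + ?m" for i
  using PiE_mem[OF Cons.prems(1), of i] that by (simp add: p)
 have g: "?g \<in> {1..k} \<rightarrow>\<^sub>E carrier G" and h: "?h \<in> {1..?m} \<rightarrow>\<^sub>E carrier G" using gm by auto
 have "(?h, spin_class ?m (interval_word 1 ps)) \<in> standard ps"
 proof (rule Cons.IH[OF h])
  fix D a l assume D: "(D, a, l) \<in> set (intervals_from 1 ps)"
  then have "(D, a + k, l) \<in> set (intervals_from 1 (p # ps))"
   using intervals_from_shift[of 1 k ps] by (force simp: p)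
  then have "cycle_prod G g (a + k) l \<in> D" by (rule Cons.prems(2))
  moreover have "cycle_prod G g (a + k) l = cycle_prod G ?h a l"
   using intervals_from_bounds[OF D] by (intro cycle_prod_shift) auto
  ultimately show "cycle_prod G ?h a l \<in> D" by simp
 qed
 moreover have "cycle_prod G ?g 1 k \<in> C"
 proof -
  have "cycle_prod G g (1 + 0) k = cycle_prod G ?g 1 k" by (rule cycle_prod_shift) auto
  moreover have "cycle_prod G g 1 k \<in> C" by (rule Cons.prems(2)) (simp add: p)
  ultimately show ?thesis by simp
 qed
 ultimately have "young_mult G k ?m (cycle_elt k ?g) (?h, spin_class ?m (interval_word 1 ps)) \<in> standard (p # ps)"
  using g unfolding p standard.simps by blast
 moreover have "(\<lambda>i\<in>{1..k + ?m}. if i \<le> k then ?g i else ?h (i - k)) = g"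
 proof
  fix i
  show "(\<lambda>i\<in>{1..k + ?m}. if i \<le> k then ?g i else ?h (i - k)) i = g i"
   using PiE_arb[OF Cons.prems(1), of i] by (auto simp: p)
 qed
 ultimately show ?case
  unfolding young_mult_cycle_elt[OF g h interval_word_closed]
  by (simp add: p interval_word_shift[OF le_refl, of k] del: One_nat_def)
qed

section \<open>Every element of odd order is isomorphic to a standard one\<close>

text \<open>The length of a cycle is the least period of its points, so it divides any exponent that
  kills the permutation.\<close>

lemma odd_atoms:
 assumes x: "\<xi> \<in> dperm G I" and I: "finite I" and o: "odd_order (snd \<xi>)" and A: "A \<in> atoms I \<xi>"
 shows "odd (card A)"
proof -
 note inv = atomsD[OF A]
 obtain N where N: "odd N" "snd \<xi> ^^ N = id" using o by (auto simp: odd_order_def)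
 have fA: "finite A" using finite_subset[OF invsD(1)[OF inv(1)] I] .
 note d = dres_closed[OF x inv(1)]
 obtain i where i: "i \<in> A" using inv(2) by (auto simp: cyc_def)
 have "(snd (dres A \<xi>) ^^ k) i = (snd \<xi> ^^ k) i \<and> (snd \<xi> ^^ k) i \<in> A" for k
  using i invsD(2)[OF inv(1)] by (induction k) (auto simp: dres_def)
 then have "(snd (dres A \<xi>) ^^ N) i = i" using N(2) by simp
 moreover have "permutation (snd (dres A \<xi>))" using dperm_snd[OF d] fA by (auto simp: permutation_permutes)
 ultimately have "card A dvd N" using least_power_dvd cyc_orbit(4)[OF d fA inv(2) i] by metis
 then show ?thesis using N(1) by auto
qed

definition cycle_class :: "'a dp => nat set => 'a set" where
 "cycle_class \<xi> A = conj_class G (cprod G (dres A \<xi>) (Min A) (card A))"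

text \<open>Numbering the points along the orbit of the minimum turns the permutation into i, i + 1,
  ... and the cycle product into \<open>cycle_prod\<close>.\<close>

lemma cyc_standard:
 assumes x: "\<eta> \<in> dperm G A" and A: "finite A" "cyc A \<eta>"
 shows "\<exists>g. g \<in> {1..card A} \<rightarrow>\<^sub>E carrier G \<and>
  cycle_prod G g 1 (card A) \<in> conj_class G (cprod G \<eta> (Min A) (card A)) \<and>
  (\<exists>s h. diso_via G s h {1..card A} (pr (cycle_elt (card A) g)) A \<eta>)"
proof -
 let ?k = "card A" and ?i = "Min A"
 have ne: "A \<noteq> {}" using A(2) by (auto simp: cyc_def)
 then have i: "?i \<in> A" and k: "?k \<ge> 1" using A(1) Min_in by (auto simp: Suc_le_eq card_gt_0_iff)
 note orb = cyc_orbit[OF x A i]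
 \<comment> \<open>The exponent is j - 1 because positions count from 1, so the minimum receives the
   number 1.\<close>
 define s where "s j = (snd \<eta> ^^ (j - 1)) ?i" for j
 have s: "bij_betw s {1..?k} A"
 proof -
  have "bij_betw (\<lambda>j. j - 1) {1..?k} {..<?k}"
   using k by (intro bij_betw_byWitness[where f' = Suc]) auto
  moreover have "bij_betw (\<lambda>j. (snd \<eta> ^^ j) ?i) {..<?k} A" using orb(2,3) by (simp add: bij_betw_def)
  ultimately have "bij_betw ((\<lambda>j. (snd \<eta> ^^ j) ?i) \<circ> (\<lambda>j. j - 1)) {1..?k} A" by (rule bij_betw_trans)
  moreover have "s = (\<lambda>j. (snd \<eta> ^^ j) ?i) \<circ> (\<lambda>j. j - 1)" by (simp add: fun_eq_iff s_def)
  ultimately show ?thesis by (simp only:)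
 qed
 define t where "t = inv_into {1..?k} s"
 have t: "bij_betw t A {1..?k}" unfolding t_def by (rule bij_betw_inv_into[OF s])
 have ts: "t (s j) = j" if "j \<in> {1..?k}" for j unfolding t_def by (rule inv_into_f_f[OF bij_betw_imp_inj_on[OF s] that])
 have sA: "s j \<in> A" if "j \<in> {1..?k}" for j using bij_betwE[OF s] that by blast
 have it: "inv_into A t j = s j" if "j \<in> {1..?k}" for j
  using inv_into_f_f[OF bij_betw_imp_inj_on[OF t] sA[OF that]] ts[OF that] by simp
 define g where "g = fst (drel t A {1..?k} \<eta>)"
 note d = drel_closed[OF t x]
 have g: "g \<in> {1..?k} \<rightarrow>\<^sub>E carrier G" unfolding g_def using d by (simp add: dperm_iff)
 have gj: "g j = fst \<eta> (s j)" if "j \<in> {1..?k}" for j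
  unfolding g_def drel_def using it[OF that] that by simp
 have step: "t (snd \<eta> (s j)) = (if j < ?k then j + 1 else 1)" if j: "j \<in> {1..?k}" for j
 proof (cases "j < ?k")
  case True
  have "snd \<eta> (s j) = s (j + 1)" using j by (cases j) (simp_all add: s_def)
  then show ?thesis using ts[of "j + 1"] True by simp
 next
  case False
  then have "j = ?k" using j by auto
  then have "snd \<eta> (s j) = (snd \<eta> ^^ ?k) ?i" using k by (cases "?k") (simp_all add: s_def)
  then have "snd \<eta> (s j) = s 1" using orb(1) by (simp add: s_def)
  then show ?thesis using ts[of 1] k False by simp
 qed
 have "snd (drel t A {1..?k} \<eta>) j = snd (pr (cycle_elt ?k g)) j" for j
 proof (cases "j \<in> {1..?k}")
  case True
  then have "snd (drel t A {1..?k} \<eta>) j = t (snd \<eta> (s j))" unfolding drel_def by (simp add: it)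
  then show ?thesis unfolding snd_cycle_elt[OF k] using step[OF True] True by auto
 next
  case False
  then show ?thesis unfolding snd_cycle_elt[OF k] using k by (auto simp: drel_def)
 qed
 then have pr: "pr (cycle_elt ?k g) = drel t A {1..?k} \<eta>"
  by (intro prod_eqI ext) (simp_all add: pr_def cycle_elt_def g_def)
 have "cycle_prod G g 1 l = cprod G \<eta> ?i l" if "l \<le> ?k" for l
  using that by (induction l) (simp_all add: gj s_def)
 then have "cycle_prod G g 1 ?k \<in> conj_class G (cprod G \<eta> ?i ?k)"
  using conj_class_self[OF cprod_closed[OF x i]] by simp
 moreover have "\<exists>s h. diso_via G s h {1..?k} (pr (cycle_elt ?k g)) A \<eta>"
  unfolding pr by (rule diso_sym[OF x d drel_diso[OF t x]])
 ultimately show ?thesis using g by blast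
qed

text \<open>The statement allows any enumeration of the cycles, so that the order can later be
  adapted to \<open>type_parts\<close>. The induction splits off the first cycle and joins the two
  isomorphisms.\<close>

lemma standard_exists:
 assumes "\<xi> \<in> dperm G I" "finite I" "distinct As" "set As = atoms I \<xi>"
 shows "\<exists>x\<in>standard (map (\<lambda>A. (cycle_class \<xi> A, card A)) As). \<exists>s h.
  diso_via G s h {1..part_sum (map (\<lambda>A. (cycle_class \<xi> A, card A)) As)} (pr x) I \<xi>"
 using assms
proof (induction As arbitrary: I \<xi>)
 case Nil
 have "I = {}" using Union_atoms[OF Nil(1,2)] Nil(4) by simp
 then show ?case by (auto simp: diso_via_def)
next
 case (Cons A As)
 note x = Cons.prems(1) and I = Cons.prems(2)
 have A: "A \<in> atoms I \<xi>" using Cons.prems(4) by auto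
 note inv = atomsD[OF A]
 have sub: "A \<subseteq> I" by (rule invsD(1)[OF inv(1)])
 have fA: "finite A" using finite_subset[OF sub I] .
 note dA = dres_closed[OF x inv(1)] and dB = dres_closed[OF x invs_compl[OF x inv(1)]]
 let ?\<xi>' = "dres (I - A) \<xi>"
 have "atoms (A \<union> (I - A)) (djoin A (dres A \<xi>) ?\<xi>') = atoms A (dres A \<xi>) \<union> atoms (I - A) ?\<xi>'"
  by (rule atoms_djoin[OF dA dB]) auto
 moreover have "A \<union> (I - A) = I" using sub by blast
 ultimately have un: "atoms I \<xi> = atoms A (dres A \<xi>) \<union> atoms (I - A) ?\<xi>'" using djoin_dres[OF x sub] by simp
 have one: "B = A" if B: "B \<in> atoms A (dres A \<xi>)" for B
 proof -
  have "B \<in> invs A (dres A \<xi>)" "B \<noteq> {}" using B by (simp_all add: atoms_iff)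
  then show ?thesis using inv(2) unfolding cyc_def by metis
 qed
 have in_sub: "B \<noteq> {} \<and> B \<subseteq> I - A" if "B \<in> atoms (I - A) ?\<xi>'" for B
  using invsD(1)[of B "I - A" ?\<xi>'] that unfolding atoms_iff by simp
 have "A \<noteq> {}" using inv(2) by (simp add: cyc_def)
 then have "A \<notin> atoms (I - A) ?\<xi>'" using in_sub[of A] by auto
 moreover have "set As = atoms I \<xi> - {A}" using Cons.prems(3) Cons.prems(4)[symmetric] by simp
 ultimately have setAs: "set As = atoms (I - A) ?\<xi>'" using un one by auto
 have "distinct As" using Cons.prems(3) by simp
 from Cons.IH[OF dB finite_Diff[OF I] this setAs]
 obtain y s h where y: "y \<in> standard (map (\<lambda>B. (cycle_class ?\<xi>' B, card B)) As)"
  "diso_via G s h {1..part_sum (map (\<lambda>B. (cycle_class ?\<xi>' B, card B)) As)} (pr y) (I - A) ?\<xi>'"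
  by blast
 have "cycle_class ?\<xi>' B = cycle_class \<xi> B" if "B \<in> set As" for B
  using in_sub[of B] setAs that by (simp add: cycle_class_def dres_dres)
 then have map: "map (\<lambda>B. (cycle_class ?\<xi>' B, card B)) As = map (\<lambda>B. (cycle_class \<xi> B, card B)) As" by simp
 let ?ps = "map (\<lambda>B. (cycle_class \<xi> B, card B)) As"
 let ?m = "part_sum ?ps"
 note y = y[unfolded map]
 obtain g s' h' where g: "g \<in> {1..card A} \<rightarrow>\<^sub>E carrier G" "cycle_prod G g 1 (card A) \<in> cycle_class \<xi> A"
  "diso_via G s' h' {1..card A} (pr (cycle_elt (card A) g)) A (dres A \<xi>)"
  using cyc_standard[OF dA fA inv(2)] unfolding cycle_class_def by blast
 note cx = cycle_elt_closed[OF g(1)] and cy = standard_closed[OF y(1)]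
 note sy = drel_closed[OF shift_bij[of "card A" ?m] pr_closed[OF cy]]
 obtain t k where tk: "diso_via G t k {card A + 1..card A + ?m} (shifted (card A) ?m (pr y)) {1..?m} (pr y)"
  using diso_sym[OF pr_closed[OF cy] sy drel_diso[OF shift_bij pr_closed[OF cy]]] by blast
 obtain u l where ul: "diso_via G u l {card A + 1..card A + ?m} (shifted (card A) ?m (pr y)) (I - A) ?\<xi>'"
  using diso_trans[OF sy pr_closed[OF cy] tk y(2)] by blast
 let ?x = "young_mult G (card A) ?m (cycle_elt (card A) g) y"
 have "\<exists>a b. diso_via G a b ({1..card A} \<union> {card A + 1..card A + ?m}) (pr ?x) (A \<union> (I - A)) (djoin A (dres A \<xi>) ?\<xi>')"
  unfolding pr_young_mult[OF cx cy]
  by (rule exI, rule exI, rule diso_djoin[OF g(3) ul pr_closed[OF cx] sy young_sets(1)]) auto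
 then have "\<exists>a b. diso_via G a b {1..card A + ?m} (pr ?x) I \<xi>"
  unfolding young_sets(2) \<open>A \<union> (I - A) = I\<close> djoin_dres[OF x sub] .
 moreover have "?x \<in> standard ((cycle_class \<xi> A, card A) # ?ps)"
  unfolding standard.simps using g y(1) by blast
 ultimately show ?case by (auto simp only: list.map part_sum_simps)
qed

end

section \<open>Orthogonality of characters\<close>

lemma is_rep_carrier: "is_rep G d \<pi> ==> x \<in> carrier G ==> \<pi> x \<in> carrier_mat d d"
 by (auto simp: is_rep_def hom_def units_of_def Units_def ring_mat_def)

lemma is_rep_mult:
 "is_rep G d \<pi> ==> x \<in> carrier G ==> y \<in> carrier G ==> \<pi> (x \<otimes>\<^bsub>G\<^esub> y) = \<pi> x * \<pi> y"
 by (auto simp: is_rep_def hom_def units_of_def ring_mat_def)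

lemma is_rep_one:
 assumes "group G" "is_rep G d \<pi>" shows "\<pi> \<one>\<^bsub>G\<^esub> = 1\<^sub>m d"
proof -
 interpret R: ring "ring_mat TYPE(complex) d ()" by (rule ring_mat)
 have "\<pi> \<one>\<^bsub>G\<^esub> = \<one>\<^bsub>units_of (ring_mat TYPE(complex) d ())\<^esub>"
  using assms by (intro hom_one[of \<pi> G]) (auto simp: is_rep_def R.units_group)
 then show ?thesis by (simp add: units_of_def ring_mat_def)
qed

lemma subspace_vecI:
 assumes "W \<subseteq> carrier_vec d" "0\<^sub>v d \<in> W" "\<And>v w. v \<in> W ==> w \<in> W ==> v + w \<in> W"
  "\<And>c v. v \<in> W ==> c \<cdot>\<^sub>v v \<in> W"
 shows "VectorSpace.subspace class_ring W (module_vec TYPE(complex) d)"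
 using vec_vs[of d] vec_module[of d] assms
 by (auto simp: VectorSpace.subspace_def submodule_def module_vec_simps class_ring_simps)

lemma irreducible_rep_subspace:
 assumes "irreducible_rep G d \<pi>" and "W \<subseteq> carrier_vec d" "0\<^sub>v d \<in> W"
  "\<And>v w. v \<in> W ==> w \<in> W ==> v + w \<in> W" "\<And>c v. v \<in> W ==> c \<cdot>\<^sub>v v \<in> W"
  "\<And>x v. x \<in> carrier G ==> v \<in> W ==> \<pi> x *\<^sub>v v \<in> W"
 shows "W = {0\<^sub>v d} \<or> W = carrier_vec d"
proof -
 have "VectorSpace.subspace class_ring W (module_vec TYPE(complex) d)"
  by (rule subspace_vecI[OF assms(2-5)])
 moreover have "\<forall>x\<in>carrier G. \<forall>w\<in>W. \<pi> x *\<^sub>v w \<in> W" using assms(6) by simp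
 moreover have "\<forall>W. VectorSpace.subspace class_ring W (module_vec TYPE(complex) d) \<and>
   (\<forall>x\<in>carrier G. \<forall>w\<in>W. \<pi> x *\<^sub>v w \<in> W) \<longrightarrow> W = {0\<^sub>v d} \<or> W = carrier_vec d"
  using assms(1) by (simp add: irreducible_rep_def)
 ultimately show ?thesis by (elim allE[of _ W]) (rule mp, assumption, rule conjI)
qed

lemma mat_eqI_mult_vec:
 assumes "A \<in> carrier_mat d e" "B \<in> carrier_mat d e"
  and "\<And>v. v \<in> carrier_vec e ==> A *\<^sub>v v = B *\<^sub>v (v :: complex vec)"
 shows "A = B"
proof (rule mat_col_eqI)
 fix j assume "j < dim_col B"
 then have j: "j < e" using assms by simp
 have "A *\<^sub>v unit_vec e j = col A j" "B *\<^sub>v unit_vec e j = col B j"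
  using assms(1,2) j by (auto intro!: eq_vecI simp: scalar_prod_right_unit)
 then show "col A j = col B j" using assms(3)[of "unit_vec e j"] by simp
qed (use assms in auto)

text \<open>Schur's lemma: kernel and image of A are invariant subspaces. As A is not zero, the
  kernel is trivial and the image is everything.\<close>

lemma schur_inverse:
 assumes \<pi>: "irreducible_rep G d \<pi>" and \<rho>: "irreducible_rep G e \<rho>"
  and A: "A \<in> carrier_mat d e" "A \<noteq> 0\<^sub>m d e"
  and comm: "\<And>x. x \<in> carrier G ==> \<pi> x * A = A * \<rho> x"
 shows "\<exists>B\<in>carrier_mat e d. A * B = 1\<^sub>m d \<and> B * A = 1\<^sub>m e"
proof -
 have rc: "\<pi> x \<in> carrier_mat d d" "\<rho> x \<in> carrier_mat e e" if "x \<in> carrier G" for x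
  using \<pi> \<rho> that is_rep_carrier by (auto simp: irreducible_rep_def)
 have eq: "\<pi> x *\<^sub>v (A *\<^sub>v v) = A *\<^sub>v (\<rho> x *\<^sub>v v)" if "x \<in> carrier G" "v \<in> carrier_vec e" for x v
  using assoc_mult_mat_vec[OF rc(1)[OF that(1)] A(1) that(2)] comm[OF that(1)]
   assoc_mult_mat_vec[OF A(1) rc(2)[OF that(1)] that(2)] by simp
 have nz: "\<exists>v\<in>carrier_vec e. A *\<^sub>v v \<noteq> 0\<^sub>v d"
 proof (rule ccontr)
  assume "\<not> ?thesis"
  then have "A = 0\<^sub>m d e" using A(1) by (intro mat_eqI_mult_vec[of _ d e]) auto
  then show False using A(2) by simp
 qed
 let ?K = "{v \<in> carrier_vec e. A *\<^sub>v v = 0\<^sub>v d}"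
 have "?K = {0\<^sub>v e} \<or> ?K = carrier_vec e"
 proof (rule irreducible_rep_subspace[OF \<rho>])
  fix x v assume "x \<in> carrier G" "v \<in> ?K"
  moreover from this have "\<pi> x *\<^sub>v 0\<^sub>v d = 0\<^sub>v d" using rc(1)[of x] by (intro eq_vecI) auto
  ultimately show "\<rho> x *\<^sub>v v \<in> ?K" using eq[of x v] rc[of x] by auto
 qed (use A(1) in \<open>auto simp: mult_add_distrib_mat_vec mult_mat_vec\<close>)
 then have ker: "v = 0\<^sub>v e" if "v \<in> carrier_vec e" "A *\<^sub>v v = 0\<^sub>v d" for v using nz that by blast
 let ?M = "(\<lambda>v. A *\<^sub>v v) ` carrier_vec e"
 have "?M = {0\<^sub>v d} \<or> ?M = carrier_vec d"
 proof (rule irreducible_rep_subspace[OF \<pi>])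
  show "?M \<subseteq> carrier_vec d" using A(1) by auto
  show "0\<^sub>v d \<in> ?M" using A(1) by (intro image_eqI[of _ _ "0\<^sub>v e"]) auto
 next
  fix v w assume "v \<in> ?M" "w \<in> ?M"
  then obtain v' w' where "v' \<in> carrier_vec e" "w' \<in> carrier_vec e" "v = A *\<^sub>v v'" "w = A *\<^sub>v w'" by auto
  then show "v + w \<in> ?M" using A(1)
   by (intro image_eqI[of _ _ "v' + w'"]) (auto simp: mult_add_distrib_mat_vec)
 next
  fix c v assume "v \<in> ?M"
  then obtain v' where "v' \<in> carrier_vec e" "v = A *\<^sub>v v'" by auto
  then show "c \<cdot>\<^sub>v v \<in> ?M" using A(1)
   by (intro image_eqI[of _ _ "c \<cdot>\<^sub>v v'"]) (auto simp: mult_mat_vec)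
 next
  fix x v assume x: "x \<in> carrier G" and "v \<in> ?M"
  then obtain v' where "v' \<in> carrier_vec e" "v = A *\<^sub>v v'" by auto
  then show "\<pi> x *\<^sub>v v \<in> ?M" using eq[OF x] rc(2)[OF x]
   by (intro image_eqI[of _ _ "\<rho> x *\<^sub>v v'"]) auto
 qed
 then have surj: "?M = carrier_vec d" using nz by auto
 have "\<forall>j\<in>{..<d}. \<exists>v. v \<in> carrier_vec e \<and> A *\<^sub>v v = unit_vec d j"
 proof
  fix j assume "j \<in> {..<d}"
  have "unit_vec d j \<in> ?M" unfolding surj by simp
  then show "\<exists>v. v \<in> carrier_vec e \<and> A *\<^sub>v v = unit_vec d j" by auto
 qed
 from bchoice[OF this] obtain b where b: "\<And>j. j < d ==> b j \<in> carrier_vec e \<and> A *\<^sub>v b j = unit_vec d j"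
  by auto
 \<comment> \<open>The columns are chosen preimages of the unit vectors. This yields a right
   inverse, and injectivity of A makes it two-sided.\<close>
 define B where "B = mat_of_cols e (map b [0..<d])"
 have B: "B \<in> carrier_mat e d" by (auto simp: B_def)
 have colB: "col B j = b j" if "j < d" for j
  unfolding B_def using b[OF that] that by (subst col_mat_of_cols) auto
 have AB: "A * B = 1\<^sub>m d"
 proof (rule mat_col_eqI)
  fix j assume "j < dim_col (1\<^sub>m d :: complex mat)"
  then have j: "j < d" by simp
  have "col (A * B) j = A *\<^sub>v b j" using col_mult2[OF A(1) B j] colB[OF j] by simp
  then show "col (A * B) j = col (1\<^sub>m d) j" using b[OF j] j by simp
 qed (use A(1) B in auto)
 have BA: "B * A = 1\<^sub>m e"
 proof (rule mat_eqI_mult_vec)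
  fix v :: "complex vec" assume v: "v \<in> carrier_vec e"
  let ?u = "(B * A) *\<^sub>v v"
  have u: "?u \<in> carrier_vec e" using A(1) B v by auto
  have "A *\<^sub>v ?u = A *\<^sub>v (B *\<^sub>v (A *\<^sub>v v))" using assoc_mult_mat_vec[OF B A(1) v] by simp
  also have "\<dots> = (A * B) *\<^sub>v (A *\<^sub>v v)" using A(1) v by (intro assoc_mult_mat_vec[OF A(1) B, symmetric]) auto
  also have "\<dots> = A *\<^sub>v v" using A(1) v by (simp add: AB)
  finally have "A *\<^sub>v (?u - v) = 0\<^sub>v d"
   using A(1) u v by (simp add: mult_minus_distrib_mat_vec)
  then have "?u - v = 0\<^sub>v e" using u v by (intro ker) auto
  then have "(?u - v) $ i = 0" if "i < e" for i using that by simp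
  then have "?u = v" using u v A(1) B by (intro eq_vecI) auto
  then show "(B * A) *\<^sub>v v = 1\<^sub>m e *\<^sub>v v" using v by simp
 qed (use A B in auto)
 show ?thesis using AB BA B by blast
qed

lemma trace_mult_comm:
 assumes "A \<in> carrier_mat d e" "B \<in> carrier_mat e d"
 shows "(\<Sum>i<d. (A * B) $$ (i, i)) = (\<Sum>i<e. (B * A) $$ (i, i) :: complex)"
proof -
 have 1: "(A * B) $$ (i, i) = (\<Sum>k<e. A $$ (i, k) * B $$ (k, i))" if "i < d" for i
  using assms that by (simp add: scalar_prod_def lessThan_atLeast0)
 have 2: "(B * A) $$ (i, i) = (\<Sum>k<d. B $$ (i, k) * A $$ (k, i))" if "i < e" for i
  using assms that by (simp add: scalar_prod_def lessThan_atLeast0)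
 have "(\<Sum>i<d. (A * B) $$ (i, i)) = (\<Sum>i<d. \<Sum>k<e. A $$ (i, k) * B $$ (k, i))" by (simp add: 1)
 also have "\<dots> = (\<Sum>k<e. \<Sum>i<d. B $$ (k, i) * A $$ (i, k))"
  by (subst sum.swap) (simp add: mult.commute)
 finally show ?thesis by (simp add: 2)
qed

lemma rep_character_conj:
 assumes "group G" "is_rep G d \<pi>" "x \<in> carrier G" "y \<in> carrier G"
 shows "rep_character G d \<pi> (y \<otimes>\<^bsub>G\<^esub> x \<otimes>\<^bsub>G\<^esub> inv\<^bsub>G\<^esub> y) = rep_character G d \<pi> x"
proof -
 interpret group G by fact
 note c = is_rep_carrier[OF assms(2)] and m = is_rep_mult[OF assms(2)]
 have "\<pi> (y \<otimes>\<^bsub>G\<^esub> x \<otimes>\<^bsub>G\<^esub> inv\<^bsub>G\<^esub> y) = \<pi> (y \<otimes>\<^bsub>G\<^esub> x) * \<pi> (inv\<^bsub>G\<^esub> y)" using assms by (simp add: m)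
 moreover have "\<pi> (inv\<^bsub>G\<^esub> y) * \<pi> (y \<otimes>\<^bsub>G\<^esub> x) = \<pi> x"
  using assms by (simp flip: m m_assoc)
 ultimately show ?thesis
  using trace_mult_comm[OF c c, of "y \<otimes>\<^bsub>G\<^esub> x" "inv\<^bsub>G\<^esub> y"] assms by (simp add: rep_character_def)
qed

text \<open>The unnormalised sum over x of \<pi>(x) E \<rho>(x)^-1, where E is the matrix unit at
  position (j, k).\<close>

definition schur_avg :: "('a, 'b) monoid_scheme => nat => ('a => complex mat) => nat =>
  ('a => complex mat) => nat => nat => complex mat" where
 "schur_avg G d \<pi> e \<rho> j k =
  mat d e (\<lambda>(i, l). \<Sum>x\<in>carrier G. \<pi> x $$ (i, j) * \<rho> (inv\<^bsub>G\<^esub> x) $$ (k, l))"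

lemma schur_avg_intertwines:
 assumes "group G" "finite (carrier G)" "is_rep G d \<pi>" "is_rep G e \<rho>" "j < d" "k < e" "y \<in> carrier G"
 shows "\<pi> y * schur_avg G d \<pi> e \<rho> j k = schur_avg G d \<pi> e \<rho> j k * \<rho> y"
proof -
 interpret group G by fact
 note c = is_rep_carrier[OF assms(3)] is_rep_carrier[OF assms(4)]
 have entry: "(\<sigma> (x \<otimes>\<^bsub>G\<^esub> z)) $$ (i, l) = (\<Sum>m<n. \<sigma> x $$ (i, m) * \<sigma> z $$ (m, l))"
  if "is_rep G n \<sigma>" "x \<in> carrier G" "z \<in> carrier G" "i < n" "l < n" for n \<sigma> x z i l
  using is_rep_mult[OF that(1-3)] is_rep_carrier[OF that(1,2)] is_rep_carrier[OF that(1,3)] that(4,5)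
  by (simp add: scalar_prod_def lessThan_atLeast0)
 show ?thesis
 proof (rule eq_matI)
  fix i l assume "i < dim_row (schur_avg G d \<pi> e \<rho> j k * \<rho> y)" "l < dim_col (schur_avg G d \<pi> e \<rho> j k * \<rho> y)"
  then have il: "i < d" "l < e" using c(2)[OF assms(7)] by (auto simp: schur_avg_def)
  have "(\<pi> y * schur_avg G d \<pi> e \<rho> j k) $$ (i, l) =
    (\<Sum>m<d. \<pi> y $$ (i, m) * (\<Sum>x\<in>carrier G. \<pi> x $$ (m, j) * \<rho> (inv\<^bsub>G\<^esub> x) $$ (k, l)))"
   using il c(1)[OF assms(7)] by (simp add: schur_avg_def scalar_prod_def lessThan_atLeast0)
  also have "\<dots> = (\<Sum>x\<in>carrier G. \<pi> (y \<otimes>\<^bsub>G\<^esub> x) $$ (i, j) * \<rho> (inv\<^bsub>G\<^esub> x) $$ (k, l))"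
   using il assms(5) by (simp add: entry[OF assms(3,7)] sum_distrib_left sum_distrib_right
     sum.swap[of _ "{..<d}"] mult.assoc)
  also have "\<dots> = (\<Sum>x\<in>carrier G. \<pi> x $$ (i, j) * \<rho> (inv\<^bsub>G\<^esub> x \<otimes>\<^bsub>G\<^esub> y) $$ (k, l))"
   by (rule sum.reindex_bij_witness[where i = "\<lambda>x. inv\<^bsub>G\<^esub> y \<otimes>\<^bsub>G\<^esub> x" and j = "\<lambda>x. y \<otimes>\<^bsub>G\<^esub> x"])
    (use assms(7) in \<open>auto simp: inv_mult_group m_assoc simp flip: m_assoc[of y] m_assoc[of "inv\<^bsub>G\<^esub> y"]\<close>)
  also have "\<dots> = (\<Sum>m<e. (\<Sum>x\<in>carrier G. \<pi> x $$ (i, j) * \<rho> (inv\<^bsub>G\<^esub> x) $$ (k, m)) * \<rho> y $$ (m, l))"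
   using il assms(6,7) by (simp add: entry[OF assms(4)] sum_distrib_left sum_distrib_right
     sum.swap[of _ "{..<e}"] mult.assoc)
  also have "\<dots> = (schur_avg G d \<pi> e \<rho> j k * \<rho> y) $$ (i, l)"
   using il c(2)[OF assms(7)] by (simp add: schur_avg_def scalar_prod_def lessThan_atLeast0)
  finally show "(\<pi> y * schur_avg G d \<pi> e \<rho> j k) $$ (i, l) = (schur_avg G d \<pi> e \<rho> j k * \<rho> y) $$ (i, l)" .
 qed (use c(1)[OF assms(7)] c(2)[OF assms(7)] in \<open>auto simp: schur_avg_def\<close>)
qed

lemma sum_characters:
 assumes "group G"
 shows "(\<Sum>x\<in>carrier G. rep_character G d \<pi> x * rep_character G e \<rho> (inv\<^bsub>G\<^esub> x)) =
  (\<Sum>i<d. \<Sum>k<e. schur_avg G d \<pi> e \<rho> i k $$ (i, k))"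
proof -
 interpret group G by fact
 have "(\<Sum>x\<in>carrier G. rep_character G d \<pi> x * rep_character G e \<rho> (inv\<^bsub>G\<^esub> x)) =
   (\<Sum>x\<in>carrier G. \<Sum>i<d. \<Sum>k<e. \<pi> x $$ (i, i) * \<rho> (inv\<^bsub>G\<^esub> x) $$ (k, k))"
  by (simp add: rep_character_def sum_product)
 also have "\<dots> = (\<Sum>i<d. \<Sum>x\<in>carrier G. \<Sum>k<e. \<pi> x $$ (i, i) * \<rho> (inv\<^bsub>G\<^esub> x) $$ (k, k))"
  by (rule sum.swap)
 also have "\<dots> = (\<Sum>i<d. \<Sum>k<e. \<Sum>x\<in>carrier G. \<pi> x $$ (i, i) * \<rho> (inv\<^bsub>G\<^esub> x) $$ (k, k))"
  by (intro sum.cong sum.swap HOL.refl)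
 finally show ?thesis by (simp add: schur_avg_def)
qed

text \<open>A nonzero \<open>schur_avg\<close> would be an invertible intertwiner, and then the two
  characters would agree. So all of them vanish, and the sum of character products is a sum of their
  entries.\<close>

lemma character_orthogonality_distinct:
 assumes G: "group G" "finite (carrier G)" and \<pi>: "irreducible_rep G d \<pi>" and \<rho>: "irreducible_rep G e \<rho>"
  and ne: "rep_character G d \<pi> \<noteq> rep_character G e \<rho>"
 shows "(\<Sum>x\<in>carrier G. rep_character G d \<pi> x * rep_character G e \<rho> (inv\<^bsub>G\<^esub> x)) = 0"
proof -
 have r: "is_rep G d \<pi>" "is_rep G e \<rho>" using \<pi> \<rho> by (auto simp: irreducible_rep_def)
 have "schur_avg G d \<pi> e \<rho> j k = 0\<^sub>m d e" if jk: "j < d" "k < e" for j k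
 proof (rule ccontr)
  let ?A = "schur_avg G d \<pi> e \<rho> j k"
  assume "?A \<noteq> 0\<^sub>m d e"
  moreover have A: "?A \<in> carrier_mat d e" by (simp add: schur_avg_def)
  moreover note comm = schur_avg_intertwines[OF G r jk]
  ultimately obtain B where B: "B \<in> carrier_mat e d" "?A * B = 1\<^sub>m d" "B * ?A = 1\<^sub>m e"
   using schur_inverse[OF \<pi> \<rho> A] by blast
  have "rep_character G d \<pi> x = rep_character G e \<rho> x" for x
  proof (cases "x \<in> carrier G")
   case x: True
   note c = is_rep_carrier[OF r(1) x] is_rep_carrier[OF r(2) x]
   have AB: "?A * \<rho> x \<in> carrier_mat d e" using A c by simp
   have "\<pi> x = \<pi> x * (?A * B)" using B c by simp
   also have "\<dots> = (?A * \<rho> x) * B" using comm[OF x] assoc_mult_mat[OF c(1) A B(1)] by simp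
   finally have 1: "\<pi> x = (?A * \<rho> x) * B" .
   have "B * (?A * \<rho> x) = \<rho> x" using B c assoc_mult_mat[OF B(1) A c(2)] by simp
   then show ?thesis using trace_mult_comm[OF AB B(1)] x 1 by (simp add: rep_character_def)
  qed (simp add: rep_character_def)
  then show False using ne by auto
 qed
 then show ?thesis unfolding sum_characters[OF G(1)] by simp
qed

text \<open>Subtract an eigenvalue c: the difference still commutes with the representation but
  kills an eigenvector, so it is not invertible and must be zero.\<close>

lemma schur_scalar:
 assumes \<pi>: "irreducible_rep G d \<pi>" and A: "A \<in> carrier_mat d d"
  and comm: "\<And>x. x \<in> carrier G ==> \<pi> x * A = A * \<pi> x"
 shows "\<exists>c. A = c \<cdot>\<^sub>m 1\<^sub>m d"
proof -
 have d: "d > 0" and r: "is_rep G d \<pi>" using \<pi> by (auto simp: irreducible_rep_def)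
 obtain c where "eigenvalue A c" using spectrum_non_empty[OF A d] by (auto simp: spectrum_def)
 then obtain v where v: "v \<in> carrier_vec d" "v \<noteq> 0\<^sub>v d" "A *\<^sub>v v = c \<cdot>\<^sub>v v"
  using A by (auto simp: eigenvalue_def eigenvector_def)
 let ?A = "A - c \<cdot>\<^sub>m 1\<^sub>m d"
 have A': "?A \<in> carrier_mat d d" using A by auto
 have comm': "\<pi> x * ?A = ?A * \<pi> x" if x: "x \<in> carrier G" for x
  using A is_rep_carrier[OF r x] comm[OF x]
  by (simp add: mult_minus_distrib_mat[of _ d d _ d] minus_mult_distrib_mat[of _ d d _ _ d]
    mult_smult_distrib[of _ d d _ d] mult_smult_assoc_mat[of _ d d _ d])
 have "?A *\<^sub>v v = A *\<^sub>v v - (c \<cdot>\<^sub>m 1\<^sub>m d) *\<^sub>v v"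
  using A v by (intro minus_mult_distrib_mat_vec[of _ d d]) auto
 also have "(c \<cdot>\<^sub>m 1\<^sub>m d) *\<^sub>v v = c \<cdot>\<^sub>v v"
 proof (rule eq_vecI)
  fix i assume "i < dim_vec (c \<cdot>\<^sub>v v)"
  then have i: "i < d" using v(1) by simp
  have "((c \<cdot>\<^sub>m 1\<^sub>m d) *\<^sub>v v) $ i = (\<Sum>k<d. c * (if k = i then 1 else 0) * v $ k)"
   using i v(1) by (auto simp: scalar_prod_def lessThan_atLeast0 intro!: sum.cong)
  also have "\<dots> = (\<Sum>k<d. if k = i then c * v $ k else 0)" by (intro sum.cong) auto
  finally show "((c \<cdot>\<^sub>m 1\<^sub>m d) *\<^sub>v v) $ i = (c \<cdot>\<^sub>v v) $ i" using i v(1) by simp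
 qed (use v(1) in simp)
 finally have Av: "?A *\<^sub>v v = 0\<^sub>v d" using v by auto
 have "?A = 0\<^sub>m d d"
 proof (rule ccontr)
  assume "?A \<noteq> 0\<^sub>m d d"
  then obtain B where B: "B \<in> carrier_mat d d" "B * ?A = 1\<^sub>m d"
   using schur_inverse[OF \<pi> \<pi> A' _ comm'] by blast
  have "v = (B * ?A) *\<^sub>v v" using v B by simp
  also have "\<dots> = B *\<^sub>v (?A *\<^sub>v v)" using assoc_mult_mat_vec[OF B(1) A' v(1)] .
  finally show False using v B Av by auto
 qed
 then have "A = c \<cdot>\<^sub>m 1\<^sub>m d"
  using A by (intro eq_matI) (auto dest!: arg_cong[of _ _ "\<lambda>M. M $$ (_, _)"] simp: mat_eq_iff)
 then show ?thesis by blast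
qed

lemma character_norm:
 assumes G: "group G" "finite (carrier G)" and \<pi>: "irreducible_rep G d \<pi>"
 shows "(\<Sum>x\<in>carrier G. rep_character G d \<pi> x * rep_character G d \<pi> (inv\<^bsub>G\<^esub> x)) = of_nat (card (carrier G))"
proof -
 interpret group G by fact
 have r: "is_rep G d \<pi>" and d: "d > 0" using \<pi> by (auto simp: irreducible_rep_def)
 let ?A = "schur_avg G d \<pi> d \<pi>"
 have "\<exists>c. ?A j k = c \<cdot>\<^sub>m 1\<^sub>m d \<and> c * of_nat d = (if j = k then of_nat (card (carrier G)) else 0)"
  if jk: "j < d" "k < d" for j k
 proof -
  obtain c where c: "?A j k = c \<cdot>\<^sub>m 1\<^sub>m d"
   using schur_scalar[OF \<pi> _ schur_avg_intertwines[OF G r r jk]] by (auto simp: schur_avg_def)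
  \<comment> \<open>The scalar is found from the trace, which for the average of the matrix unit (j,
    k) is the group order if j = k and zero otherwise.\<close>
  have "c * of_nat d = (\<Sum>i<d. ?A j k $$ (i, i))" unfolding c by simp
  also have "\<dots> = (\<Sum>i<d. \<Sum>x\<in>carrier G. \<pi> (inv\<^bsub>G\<^esub> x) $$ (k, i) * \<pi> x $$ (i, j))"
   by (simp add: schur_avg_def mult.commute)
  also have "\<dots> = (\<Sum>x\<in>carrier G. \<Sum>i<d. \<pi> (inv\<^bsub>G\<^esub> x) $$ (k, i) * \<pi> x $$ (i, j))" by (rule sum.swap)
  also have "\<dots> = (\<Sum>x\<in>carrier G. if j = k then 1 else 0)"
  proof (rule sum.cong)
   fix x assume x: "x \<in> carrier G"
   have "(\<Sum>i<d. \<pi> (inv\<^bsub>G\<^esub> x) $$ (k, i) * \<pi> x $$ (i, j)) = (\<pi> (inv\<^bsub>G\<^esub> x) * \<pi> x) $$ (k, j)"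
    using jk is_rep_carrier[OF r x] is_rep_carrier[OF r inv_closed[OF x]]
    by (simp add: scalar_prod_def lessThan_atLeast0)
   also have "\<pi> (inv\<^bsub>G\<^esub> x) * \<pi> x = 1\<^sub>m d"
    using is_rep_mult[OF r inv_closed[OF x] x] is_rep_one[OF G(1) r] x by simp
   finally show "(\<Sum>i<d. \<pi> (inv\<^bsub>G\<^esub> x) $$ (k, i) * \<pi> x $$ (i, j)) = (if j = k then 1 else 0)" using jk by auto
  qed simp
  finally show ?thesis using c by (intro exI[of _ c]) auto
 qed
 then have "\<exists>c. \<forall>j<d. \<forall>k<d. ?A j k = c j k \<cdot>\<^sub>m 1\<^sub>m d \<and>
   c j k * of_nat d = (if j = k then of_nat (card (carrier G)) else 0)" by metis
 then obtain c where c: "\<And>j k. j < d ==> k < d ==> ?A j k = c j k \<cdot>\<^sub>m 1\<^sub>m d"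
  "\<And>j k. j < d ==> k < d ==> c j k * of_nat d = (if j = k then of_nat (card (carrier G)) else 0)" by blast
 have "(\<Sum>i<d. \<Sum>k<d. ?A i k $$ (i, k)) = (\<Sum>i<d. \<Sum>k<d. if k = i then c i i else 0)"
  by (intro sum.cong) (auto simp: c(1))
 also have "\<dots> = (\<Sum>i<d. of_nat (card (carrier G)) / of_nat d)"
  using c(2) d by (intro sum.cong) (auto simp: field_simps)
 also have "\<dots> = of_nat (card (carrier G))" using d by simp
 finally show ?thesis unfolding sum_characters[OF G(1)] .
qed

section \<open>Vertex operators from creation and annihilation operators\<close>

text \<open>The sign (-1)^k in an abelian group without scalars. The exponent is an integer because
  mode indices may be negative.\<close>

definition sg :: "int => 'v::ab_group_add => 'v" where
 "sg k v = (if even k then v else - v)"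

lemma sg_add: "sg k (u + v) = sg k u + sg k v"
 by (simp add: sg_def)

lemma sg_zero [simp]: "sg k 0 = 0"
 by (simp add: sg_def)

lemma sg_sum: "sg k (\<Sum>i\<in>A. f i) = (\<Sum>i\<in>A. sg k (f i))"
 by (simp add: sg_def sum_negf)

lemma sg_sg: "sg k (sg l v) = sg (k + l) v"
 by (simp add: sg_def)

text \<open>Multiplication by the coefficient of t^a in (1 + t)/(1 - t).\<close>

definition dbl :: "nat => 'v::ab_group_add => 'v" where
 "dbl a v = (if a = 0 then v else v + v)"

lemma dbl_sg: "dbl a (sg k v) = sg k (dbl a v)"
 by (simp add: dbl_def sg_def)

lemma dbl_zero [simp]: "dbl a 0 = 0"
 by (simp add: dbl_def)

text \<open>The operators \<open>X_coeff\<close> in abstract form, with P in the role of creation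
  and Q of annihilation (\<open>X_coeff_vop\<close>).\<close>

definition vop :: "(nat => 'v => 'v) => (nat => 'v => 'v) => int => 'v::ab_group_add => 'v" where
 "vop P Q n v = (\<Sum>k | n \<le> int k \<and> Q k v \<noteq> 0. sg (int k) (P (nat (int k - n)) (Q k v)))"

text \<open>The operators act on all families of functions but are additive only on
  \<open>R_Gamma\<close>; so every rule is relative to a subgroup R.\<close>

locale subgroup_add =
 fixes R :: "'v::ab_group_add set"
 assumes zero_mem: "0 \<in> R" and add_mem: "u \<in> R ==> v \<in> R ==> u + v \<in> R"
  and neg_mem: "v \<in> R ==> - v \<in> R"
begin

lemma sum_mem: "(\<And>i. i \<in> A ==> f i \<in> R) ==> (\<Sum>i\<in>A. f i) \<in> R"
 by (induction A rule: infinite_finite_induct) (auto intro: zero_mem add_mem)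

lemma sg_mem: "v \<in> R ==> sg k v \<in> R"
 by (simp add: sg_def neg_mem)

lemma additive_zero:
 assumes "\<And>u v. u \<in> R ==> v \<in> R ==> f (u + v) = f u + f v" shows "f 0 = (0 :: 'v)"
 using assms[OF zero_mem zero_mem] by simp

lemma additive_neg:
 assumes "\<And>u v. u \<in> R ==> v \<in> R ==> f (u + v) = f u + f v" "v \<in> R" shows "f (- v) = - (f v :: 'v)"
 using assms(1)[OF assms(2) neg_mem[OF assms(2)]] additive_zero[OF assms(1)]
 by (simp add: eq_neg_iff_add_eq_0 add.commute)

lemma additive_sg:
 assumes "\<And>u v. u \<in> R ==> v \<in> R ==> f (u + v) = f u + f v" "v \<in> R" shows "f (sg k v) = (sg k (f v) :: 'v)"
 using additive_neg[of f, OF assms] by (simp add: sg_def)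

lemma additive_sum:
 assumes "\<And>u v. u \<in> R ==> v \<in> R ==> f (u + v) = f u + f v" "\<And>i. i \<in> A ==> g i \<in> R"
 shows "f (\<Sum>i\<in>A. g i) = (\<Sum>i\<in>A. f (g i) :: 'v)"
 using assms(2)
proof (induction A rule: infinite_finite_induct)
 case (insert x F)
 then show ?case by (simp add: assms(1) sum_mem)
qed (simp_all add: additive_zero[of f, OF assms(1)])

end

locale creation_annihilation = subgroup_add R for R :: "'v::ab_group_add set" +
 fixes P Q :: "nat => 'v => 'v"
 assumes P_mem: "v \<in> R ==> P n v \<in> R" and Q_mem: "v \<in> R ==> Q n v \<in> R"
  and P_add: "u \<in> R ==> v \<in> R ==> P n (u + v) = P n u + P n v"
  and Q_add: "u \<in> R ==> v \<in> R ==> Q n (u + v) = Q n u + Q n v"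
  and Q_finite: "v \<in> R ==> \<exists>N. \<forall>k>N. Q k v = 0"
begin

lemmas P_zero = additive_zero[OF P_add] and Q_zero = additive_zero[OF Q_add]
lemmas P_sg = additive_sg[OF P_add] and Q_sg = additive_sg[OF Q_add]
lemmas Q_sum = additive_sum[OF Q_add]

text \<open>With zero for negative indices, the constraint n \<le> k in \<open>vop\<close> takes
  care of itself and index shifts need no side conditions.\<close>

definition Pz :: "int => 'v => 'v" where
 "Pz k v = (if 0 \<le> k then P (nat k) v else 0)"

lemma Pz_mem: "v \<in> R ==> Pz k v \<in> R"
 by (simp add: Pz_def P_mem zero_mem)

lemma Pz_add: "u \<in> R ==> v \<in> R ==> Pz k (u + v) = Pz k u + Pz k v"
 by (simp add: Pz_def P_add)

lemmas Pz_zero = additive_zero[OF Pz_add]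
lemmas Pz_sg = additive_sg[OF Pz_add]
lemmas Pz_sum = additive_sum[OF Pz_add]

lemma vop_eq:
 assumes "v \<in> R" "\<And>k. k > N ==> Q k v = 0"
 shows "vop P Q n v = (\<Sum>k\<le>N. sg (int k) (Pz (int k - n) (Q k v)))"
 unfolding vop_def
proof (rule sum.mono_neutral_cong_left)
 show "{k. n \<le> int k \<and> Q k v \<noteq> 0} \<subseteq> {..N}" using assms(2) by (force simp: not_le[symmetric])
 show "\<forall>i\<in>{..N} - {k. n \<le> int k \<and> Q k v \<noteq> 0}. sg (int i) (Pz (int i - n) (Q i v)) = 0"
  by (auto simp: Pz_def P_zero)
qed (auto simp: Pz_def)

lemma vop_mem: "v \<in> R ==> vop P Q n v \<in> R"
 unfolding vop_def by (intro sum_mem sg_mem P_mem Q_mem)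

lemma vop_add:
 assumes "u \<in> R" "v \<in> R" shows "vop P Q n (u + v) = vop P Q n u + vop P Q n v"
proof -
 obtain M N where M: "\<forall>k>M. Q k u = 0" and N: "\<forall>k>N. Q k v = 0" using Q_finite assms by blast
 let ?K = "max M N"
 have "vop P Q n (u + v) = (\<Sum>k\<le>?K. sg (int k) (Pz (int k - n) (Q k (u + v))))"
  using M N assms by (intro vop_eq) (auto simp: add_mem Q_add)
 also have "\<dots> = (\<Sum>k\<le>?K. sg (int k) (Pz (int k - n) (Q k u))) + (\<Sum>k\<le>?K. sg (int k) (Pz (int k - n) (Q k v)))"
  by (simp add: assms Q_add Q_mem Pz_add sg_add sum.distrib)
 also have "(\<Sum>k\<le>?K. sg (int k) (Pz (int k - n) (Q k u))) = vop P Q n u"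
  using M assms by (intro vop_eq[symmetric]) auto
 also have "(\<Sum>k\<le>?K. sg (int k) (Pz (int k - n) (Q k v))) = vop P Q n v"
  using N assms by (intro vop_eq[symmetric]) auto
 finally show ?thesis .
qed

end

text \<open>When all modes commute, both compositions expand to the same finite double sum; the
  cutoffs M and N serve for either order.\<close>

lemma vop_commute:
 fixes R :: "'v::ab_group_add set"
 assumes "creation_annihilation R P Q" "creation_annihilation R P' Q'"
  and PP: "\<And>m n v. v \<in> R ==> P m (P' n v) = P' n (P m v)"
  and QQ: "\<And>m n v. v \<in> R ==> Q m (Q' n v) = Q' n (Q m v)"
  and QP: "\<And>m n v. v \<in> R ==> Q m (P' n v) = P' n (Q m v)"
  and QP': "\<And>m n v. v \<in> R ==> Q' m (P n v) = P n (Q' m v)"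
  and v: "v \<in> R"
 shows "vop P Q m (vop P' Q' n v) = vop P' Q' n (vop P Q m v)"
proof -
 interpret A: creation_annihilation R P Q by fact
 interpret B: creation_annihilation R P' Q' by fact
 obtain M N where M: "\<forall>k>M. Q k v = 0" and N: "\<forall>k>N. Q' k v = 0" using A.Q_finite B.Q_finite v by blast
 have Pcomm: "A.Pz i (B.Pz j u) = B.Pz j (A.Pz i u)" if "u \<in> R" for i j u
  using that by (simp add: A.Pz_def B.Pz_def PP A.P_zero B.P_zero)
 have QPz: "Q k (B.Pz i u) = B.Pz i (Q k u)" "Q' k (A.Pz i u) = A.Pz i (Q' k u)" if "u \<in> R" for k i u
  using that by (simp_all add: A.Pz_def B.Pz_def QP QP' A.Q_zero B.Q_zero)
 note mem = A.sg_mem A.Pz_mem B.Pz_mem A.Q_mem B.Q_mem v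
 have 1: "Q k (vop P' Q' n v) = (\<Sum>l\<le>N. sg (int l) (B.Pz (int l - n) (Q k (Q' l v))))" for k
 proof -
  have "vop P' Q' n v = (\<Sum>l\<le>N. sg (int l) (B.Pz (int l - n) (Q' l v)))"
   using N by (intro B.vop_eq v) auto
  then show ?thesis by (simp add: A.Q_sum A.Q_sg QPz mem)
 qed
 have 2: "Q' l (vop P Q m v) = (\<Sum>k\<le>M. sg (int k) (A.Pz (int k - m) (Q' l (Q k v))))" for l
 proof -
  have "vop P Q m v = (\<Sum>k\<le>M. sg (int k) (A.Pz (int k - m) (Q k v)))"
   using M by (intro A.vop_eq v) auto
  then show ?thesis by (simp add: B.Q_sum B.Q_sg QPz mem)
 qed
 have "vop P Q m (vop P' Q' n v) = (\<Sum>k\<le>M. sg (int k) (A.Pz (int k - m) (Q k (vop P' Q' n v))))"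
 proof (rule A.vop_eq[OF B.vop_mem[OF v]])
  fix k assume "k > M"
  then show "Q k (vop P' Q' n v) = 0" using M v by (simp add: 1 QQ B.Q_zero B.Pz_zero)
 qed
 also have "\<dots> = (\<Sum>k\<le>M. \<Sum>l\<le>N. sg (int k + int l) (A.Pz (int k - m) (B.Pz (int l - n) (Q k (Q' l v)))))"
  unfolding 1 by (simp add: v A.Pz_sum A.Pz_sg A.sg_mem B.Pz_mem A.Q_mem B.Q_mem sg_sum sg_sg)
 also have "\<dots> = (\<Sum>l\<le>N. \<Sum>k\<le>M. sg (int l + int k) (B.Pz (int l - n) (A.Pz (int k - m) (Q' l (Q k v)))))"
  by (subst sum.swap) (simp add: v Pcomm QQ A.Q_mem B.Q_mem add.commute)
 also have "\<dots> = (\<Sum>l\<le>N. sg (int l) (B.Pz (int l - n) (Q' l (vop P Q m v))))"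
  unfolding 2 by (simp add: v B.Pz_sum B.Pz_sg A.sg_mem A.Pz_mem A.Q_mem B.Q_mem sg_sum sg_sg)
 also have "\<dots> = vop P' Q' n (vop P Q m v)"
 proof (rule B.vop_eq[OF A.vop_mem[OF v], symmetric])
  fix l assume "l > N"
  then show "Q' l (vop P Q m v) = 0" using N v by (simp add: 2 QQ[symmetric] A.Q_zero A.Pz_zero)
 qed
 finally show ?thesis .
qed

text \<open>In generating functions: Q(z) P(w) = c(w/z) P(w) Q(z) with c(t) = (1 + t)/(1 - t), and
  P(z) P(-z) = Q(z) Q(-z) = 1.\<close>

locale clifford_pair = creation_annihilation R P Q
 for R :: "'v::ab_group_add set" and P Q +
 assumes PP: "v \<in> R ==> P m (P n v) = P n (P m v)"
  and QQ: "v \<in> R ==> Q m (Q n v) = Q n (Q m v)"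
  and QP: "v \<in> R ==> Q n (P m v) = (\<Sum>a\<le>n. if a \<le> m then dbl a (P (m - a) (Q (n - a) v)) else 0)"
  and P_alt: "v \<in> R ==> (\<Sum>a\<le>n. sg (int a) (P a (P (n - a) v))) = (if n = 0 then v else 0)"
  and Q_alt: "v \<in> R ==> (\<Sum>a\<le>n. sg (int a) (Q a (Q (n - a) v))) = (if n = 0 then v else 0)"
begin

lemma Pz_commute: "v \<in> R ==> Pz i (Pz j v) = Pz j (Pz i v)"
 by (simp add: Pz_def PP P_zero)

lemma Pz_dbl: "v \<in> R ==> Pz k (dbl a v) = dbl a (Pz k v)"
 by (simp add: dbl_def Pz_add)

lemma dbl_mem: "v \<in> R ==> dbl a v \<in> R"
 by (simp add: dbl_def add_mem)

text \<open>A single bound J replaces the bounds n and m of the commutation rule, as the terms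
  beyond i vanish. Common summation ranges are needed to interchange sums later.\<close>

lemma Q_Pz:
 assumes "v \<in> R" "i \<le> int J"
 shows "Q n (Pz i v) = (\<Sum>a\<le>J. if a \<le> n then dbl a (Pz (i - int a) (Q (n - a) v)) else 0)"
proof (cases "0 \<le> i")
 case True
 then have i: "i = int (nat i)" by simp
 have "Q n (Pz i v) = (\<Sum>a\<le>n. if a \<le> nat i then dbl a (P (nat i - a) (Q (n - a) v)) else 0)"
  using True assms by (simp add: Pz_def QP)
 also have "\<dots> = (\<Sum>a\<le>n. if a \<le> J then dbl a (Pz (i - int a) (Q (n - a) v)) else 0)"
  using True assms by (intro sum.cong) (auto simp: Pz_def nat_diff_distrib)
 also have "\<dots> = (\<Sum>a\<in>{..n} \<inter> {..J}. dbl a (Pz (i - int a) (Q (n - a) v)))"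
  by (simp add: sum.inter_restrict del: Int_atMost)
 also have "\<dots> = (\<Sum>a\<le>J. if a \<le> n then dbl a (Pz (i - int a) (Q (n - a) v)) else 0)"
  by (subst Int_commute) (simp add: sum.inter_restrict del: Int_atMost)
 finally show ?thesis .
next
 case False
 have "(\<Sum>a\<le>J. if a \<le> n then dbl a (Pz (i - int a) (Q (n - a) v)) else 0) = 0"
  using False by (intro sum.neutral) (auto simp: Pz_def)
 then show ?thesis using False by (simp add: Pz_def Q_zero)
qed

text \<open>Shifting the index by A turns the two-sided sum into the alternating sum for n = A + B,
  which is nonzero only for n = 0. The shift leaves the sign (-1)^A.\<close>

lemma Pz_alternating:
 assumes "v \<in> R" "\<bar>A\<bar> \<le> int J" "\<bar>B\<bar> \<le> int J"
 shows "(\<Sum>j\<in>{- int J..int J}. sg j (Pz (A + j) (Pz (B - j) v))) = (if A + B = 0 then sg A v else 0)"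
proof -
 have "(\<Sum>j\<in>{- int J..int J}. sg j (Pz (A + j) (Pz (B - j) v))) =
   (\<Sum>j\<in>{- A..B}. sg j (Pz (A + j) (Pz (B - j) v)))"
  by (rule sum.mono_neutral_right) (use assms in \<open>auto simp: Pz_def P_zero\<close>)
 also have "\<dots> = (if A + B = 0 then sg A v else 0)"
 proof (cases "A + B < 0")
  case False
  define n where "n = nat (A + B)"
  have n: "int n = A + B" using False by (simp add: n_def)
  have "(\<Sum>j\<in>{- A..B}. sg j (Pz (A + j) (Pz (B - j) v))) =
    (\<Sum>a\<le>n. sg (int a - A) (Pz (int a) (Pz (int (n - a)) v)))"
   by (rule sum.reindex_bij_witness[where i = "\<lambda>a. int a - A" and j = "\<lambda>j. nat (A + j)"])
    (use n in \<open>auto simp: of_nat_diff algebra_simps\<close>)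
  also have "\<dots> = sg (- A) (\<Sum>a\<le>n. sg (int a) (P a (P (n - a) v)))"
   by (simp add: sg_sum sg_sg Pz_def add.commute nat_diff_distrib)
  also have "\<dots> = (if A + B = 0 then sg A v else 0)"
   using n by (simp add: P_alt[OF assms(1)]) (auto simp: sg_def)
  finally show ?thesis .
 qed auto
 finally show ?thesis .
qed

text \<open>Normal ordering: the inner P is moved to the left of the outer Q_k at the cost of the
  coefficients \<open>dbl j\<close>, and a = k - j is the new annihilation index. Terms with a > N
  vanish because the Q's commute.\<close>

lemma vop_vop:
 assumes v: "v \<in> R" and N: "\<And>k. k > N ==> Q k v = 0" and J: "int N - n \<le> int J"
 shows "vop P Q m (vop P Q n v) = (\<Sum>a\<le>N. \<Sum>b\<le>N. sg (int a + int b)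
  (\<Sum>j\<le>J. sg (int j) (dbl j (Pz (int a - m + int j) (Pz (int b - n - int j) (Q a (Q b v)))))))"
proof -
 let ?u = "vop P Q n v"
 have u: "?u \<in> R" by (rule vop_mem[OF v])
 have big: "Q a (Q b v) = 0" if "a > N" for a b
  using QQ[OF v, of a b] N[OF that] by (simp add: Q_zero)
 have Qu: "Q k ?u = (\<Sum>b\<le>N. \<Sum>j\<le>J. if j \<le> k then sg (int b) (dbl j (Pz (int b - n - int j) (Q (k - j) (Q b v)))) else 0)" for k
 proof -
  have "Q k ?u = (\<Sum>b\<le>N. sg (int b) (Q k (Pz (int b - n) (Q b v))))"
  proof -
   have "?u = (\<Sum>b\<le>N. sg (int b) (Pz (int b - n) (Q b v)))" using N by (intro vop_eq v) auto
   then show ?thesis by (simp add: Q_sum Q_sg v Pz_mem Q_mem sg_mem)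
  qed
  also have "\<dots> = (\<Sum>b\<le>N. sg (int b) (\<Sum>j\<le>J. if j \<le> k then dbl j (Pz (int b - n - int j) (Q (k - j) (Q b v))) else 0))"
   using J by (intro sum.cong arg_cong[where f = "sg _"] Q_Pz Q_mem v) auto
  finally show ?thesis unfolding sg_sum by (simp add: if_distrib[of "sg _"] cong: if_cong)
 qed
 have "vop P Q m ?u = (\<Sum>k\<le>N + J. sg (int k) (Pz (int k - m) (Q k ?u)))"
 proof (rule vop_eq[OF u])
  fix k assume "k > N + J"
  then show "Q k ?u = 0" unfolding Qu by (intro sum.neutral ballI) (auto simp: big Pz_zero)
 qed
 also have "\<dots> = (\<Sum>k\<le>N + J. \<Sum>b\<le>N. \<Sum>j\<le>J. if j \<le> k then
   sg (int k + int b) (dbl j (Pz (int k - m) (Pz (int b - n - int j) (Q (k - j) (Q b v))))) else 0)"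
 proof (rule sum.cong)
  fix k
  have mem: "(if j \<le> k then sg (int b) (dbl j (Pz (int b - n - int j) (Q (k - j) (Q b v)))) else 0) \<in> R" for b j
   by (simp add: zero_mem sg_mem dbl_mem Pz_mem Q_mem v)
  have "Pz (int k - m) (Q k ?u) = (\<Sum>b\<le>N. \<Sum>j\<le>J. Pz (int k - m) (if j \<le> k then
    sg (int b) (dbl j (Pz (int b - n - int j) (Q (k - j) (Q b v)))) else 0))"
   unfolding Qu by (simp only: Pz_sum sum_mem mem)
  also have "\<dots> = (\<Sum>b\<le>N. \<Sum>j\<le>J. if j \<le> k then
    sg (int b) (dbl j (Pz (int k - m) (Pz (int b - n - int j) (Q (k - j) (Q b v))))) else 0)"
   by (intro sum.cong) (auto simp: Pz_zero Pz_sg Pz_dbl dbl_mem Pz_mem Q_mem v)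
  finally show "sg (int k) (Pz (int k - m) (Q k ?u)) = (\<Sum>b\<le>N. \<Sum>j\<le>J. if j \<le> k then
    sg (int k + int b) (dbl j (Pz (int k - m) (Pz (int b - n - int j) (Q (k - j) (Q b v))))) else 0)"
   by (auto simp: sg_sum sg_sg intro!: sum.cong)
 qed simp
 also have "\<dots> = (\<Sum>b\<le>N. \<Sum>j\<le>J. \<Sum>k\<le>N + J. if j \<le> k then
   sg (int k + int b) (dbl j (Pz (int k - m) (Pz (int b - n - int j) (Q (k - j) (Q b v))))) else 0)"
  by (rule HOL.trans[OF sum.swap], rule sum.cong[OF HOL.refl], rule sum.swap)
 also have "\<dots> = (\<Sum>b\<le>N. \<Sum>j\<le>J. \<Sum>a\<le>N. sg (int a + int b) (sg (int j) (dbl j (Pz (int a - m + int j) (Pz (int b - n - int j) (Q a (Q b v)))))))"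
 proof (rule sum.cong[OF HOL.refl], rule sum.cong[OF HOL.refl])
  fix b j assume j: "j \<in> {..J}"
  let ?f = "\<lambda>k. sg (int k + int b) (dbl j (Pz (int k - m) (Pz (int b - n - int j) (Q (k - j) (Q b v)))))"
  have "(\<Sum>k\<le>N + J. if j \<le> k then ?f k else 0) = (\<Sum>k\<in>{j..N + j}. ?f k)"
   by (rule sum.mono_neutral_cong_right) (use j in \<open>auto simp: big Pz_zero\<close>)
  also have "\<dots> = (\<Sum>a\<le>N. ?f (a + j))"
   by (rule sum.reindex_bij_witness[where i = "\<lambda>a. a + j" and j = "\<lambda>k. k - j"]) auto
  also have "\<dots> = (\<Sum>a\<le>N. sg (int a + int b) (sg (int j) (dbl j (Pz (int a - m + int j) (Pz (int b - n - int j) (Q a (Q b v)))))))"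
   by (intro sum.cong) (auto simp: sg_sg algebra_simps)
  finally show "(\<Sum>k\<le>N + J. if j \<le> k then ?f k else 0) = (\<Sum>a\<le>N. sg (int a + int b) (sg (int j) (dbl j (Pz (int a - m + int j) (Pz (int b - n - int j) (Q a (Q b v)))))))" .
 qed
 also have "\<dots> = (\<Sum>b\<le>N. \<Sum>a\<le>N. \<Sum>j\<le>J. sg (int a + int b) (sg (int j) (dbl j (Pz (int a - m + int j) (Pz (int b - n - int j) (Q a (Q b v)))))))"
  by (rule sum.cong[OF HOL.refl], rule sum.swap)
 also have "\<dots> = (\<Sum>a\<le>N. \<Sum>b\<le>N. \<Sum>j\<le>J. sg (int a + int b) (sg (int j) (dbl j (Pz (int a - m + int j) (Pz (int b - n - int j) (Q a (Q b v)))))))"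
  by (rule sum.swap)
 finally show ?thesis by (simp only: sg_sum)
qed

text \<open>The coefficients 1, 2, 2, ... of (1 + t)/(1 - t), taken in t and in 1/t, add up to twice
  the formal delta function, the sum of all integral powers of t.\<close>

lemma sum_int_symmetric:
 fixes f :: "int => 'v"
 shows "(\<Sum>j\<le>J. dbl j (f (int j))) + (\<Sum>j\<le>J. dbl j (f (- int j))) =
  (\<Sum>j\<in>{- int J..int J}. f j) + (\<Sum>j\<in>{- int J..int J}. f j)"
proof (induction J)
 case 0
 then show ?case by (simp add: dbl_def)
next
 case (Suc J)
 have "{- int (Suc J)..int (Suc J)} = insert (- int (Suc J)) (insert (int (Suc J)) {- int J..int J})"
  by auto
 then have "(\<Sum>j\<in>{- int (Suc J)..int (Suc J)}. f j) = f (- int (Suc J)) + (f (int (Suc J)) + (\<Sum>j\<in>{- int J..int J}. f j))"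
  by simp
 then show ?case using Suc by (simp add: dbl_def algebra_simps del: of_nat_Suc)
qed

text \<open>After normal ordering, the two compositions differ only in the direction in which the
  coefficient series is expanded, so their sum contains twice a delta function. This collapses the
  creation part by \<open>Pz_alternating\<close> to the condition a + b = m + n; the sum of (-1)^a
  Q_a Q_b under that condition vanishes unless m + n = 0.\<close>

theorem vop_anticommutator:
 assumes v: "v \<in> R"
 shows "vop P Q m (vop P Q n v) + vop P Q n (vop P Q m v) = (if m = - n then sg m (v + v) else 0)"
proof -
 obtain N0 where N0: "\<forall>k>N0. Q k v = 0" using Q_finite v by blast
 \<comment> \<open>The summand |m + n| ensures that no pair (a, b) with a + b = m + n is cut
   off.\<close>
 define N where "N = N0 + nat \<bar>m + n\<bar>"
 \<comment> \<open>Large enough to bound all indices a - m and b - n that occur in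
   \<open>Pz_alternating\<close>.\<close>
 define J where "J = N + nat \<bar>m\<bar> + nat \<bar>n\<bar>"
 have N: "Q k v = 0" if "k > N" for k using N0 that by (simp add: N_def)
 let ?W = "\<lambda>a b. Q a (Q b v)"
 have W: "?W a b \<in> R" for a b by (intro Q_mem v)
 let ?g = "\<lambda>a b j. sg j (Pz (int a - m + j) (Pz (int b - n - j) (?W a b)))"
 have 1: "vop P Q m (vop P Q n v) = (\<Sum>a\<le>N. \<Sum>b\<le>N. sg (int a + int b) (\<Sum>j\<le>J. dbl j (?g a b (int j))))"
  by (subst vop_vop[OF v N, where J = J]) (auto simp: J_def dbl_sg)
 have "vop P Q n (vop P Q m v) = (\<Sum>b\<le>N. \<Sum>a\<le>N. sg (int b + int a)
  (\<Sum>j\<le>J. sg (int j) (dbl j (Pz (int b - n + int j) (Pz (int a - m - int j) (?W b a))))))"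
  by (subst vop_vop[OF v N, where J = J]) (auto simp: J_def)
 also have "\<dots> = (\<Sum>a\<le>N. \<Sum>b\<le>N. sg (int b + int a)
  (\<Sum>j\<le>J. sg (int j) (dbl j (Pz (int b - n + int j) (Pz (int a - m - int j) (?W b a))))))"
  by (rule sum.swap)
 also have "\<dots> = (\<Sum>a\<le>N. \<Sum>b\<le>N. sg (int a + int b) (\<Sum>j\<le>J. dbl j (?g a b (- int j))))"
 proof (intro sum.cong HOL.refl arg_cong2[where f = sg])
  \<comment> \<open>Commuting the P's and the Q's replaces j by -j in the summand, without changing
    the sign.\<close>
  fix a b j
  have "Pz (int b - n + int j) (Pz (int a - m - int j) (?W b a)) =
    Pz (int a - m - int j) (Pz (int b - n + int j) (?W a b))"
   using Pz_commute[OF W] QQ[OF v] by simp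
  then show "sg (int j) (dbl j (Pz (int b - n + int j) (Pz (int a - m - int j) (?W b a)))) = dbl j (?g a b (- int j))"
   by (simp add: dbl_sg) (simp add: sg_def)
 qed simp
 finally have 2: "vop P Q n (vop P Q m v) = (\<Sum>a\<le>N. \<Sum>b\<le>N. sg (int a + int b) (\<Sum>j\<le>J. dbl j (?g a b (- int j))))" .
 have "vop P Q m (vop P Q n v) + vop P Q n (vop P Q m v) =
   (\<Sum>a\<le>N. \<Sum>b\<le>N. sg (int a + int b) ((\<Sum>j\<in>{- int J..int J}. ?g a b j) + (\<Sum>j\<in>{- int J..int J}. ?g a b j)))"
  unfolding 1 2 sum_int_symmetric[of "?g a b" J for a b, symmetric] by (simp only: sum.distrib sg_add)
 also have "\<dots> = (\<Sum>a\<le>N. \<Sum>b\<le>N. if int a + int b = m + n then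
   sg (m + n + (int a - m)) (?W a b + ?W a b) else 0)"
 proof (intro sum.cong HOL.refl)
  fix a b assume "a \<in> {..N}" "b \<in> {..N}"
  then have "(\<Sum>j\<in>{- int J..int J}. ?g a b j) = (if int a - m + (int b - n) = 0 then sg (int a - m) (?W a b) else 0)"
   by (intro Pz_alternating W) (auto simp: J_def)
  then show "sg (int a + int b) ((\<Sum>j\<in>{- int J..int J}. ?g a b j) + (\<Sum>j\<in>{- int J..int J}. ?g a b j)) =
   (if int a + int b = m + n then sg (m + n + (int a - m)) (?W a b + ?W a b) else 0)"
   by (auto simp: sg_add[symmetric] sg_sg)
 qed
 also have "\<dots> = (if m = - n then sg m (v + v) else 0)"
 proof (cases "m + n < 0")
  case False
  define s where "s = nat (m + n)"
  have s: "int s = m + n" "s \<le> N" using False by (auto simp: s_def N_def)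
  have "(\<Sum>b\<le>N. if int a + int b = m + n then sg (m + n + (int a - m)) (?W a b + ?W a b) else 0) =
    (if a \<le> s then sg n (sg (int a) (?W a (s - a)) + sg (int a) (?W a (s - a))) else 0)" for a
  proof -
   have "(\<Sum>b\<le>N. if int a + int b = m + n then sg (m + n + (int a - m)) (?W a b + ?W a b) else 0) =
     (\<Sum>b\<le>N. if b = s - a then (if a \<le> s then sg (n + int a) (?W a b + ?W a b) else 0) else 0)"
    using s by (intro sum.cong) auto
   then show ?thesis using s by (auto simp: sg_sg sg_add[symmetric])
  qed
  then have "(\<Sum>a\<le>N. \<Sum>b\<le>N. if int a + int b = m + n then sg (m + n + (int a - m)) (?W a b + ?W a b) else 0) =
    (\<Sum>a\<le>N. if a \<le> s then sg n (sg (int a) (?W a (s - a)) + sg (int a) (?W a (s - a))) else 0)" by simp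
  also have "\<dots> = (\<Sum>a\<le>s. sg n (sg (int a) (?W a (s - a)) + sg (int a) (?W a (s - a))))"
   using s(2) by (intro sum.mono_neutral_cong_right) auto
  also have "\<dots> = sg n ((\<Sum>a\<le>s. sg (int a) (?W a (s - a))) + (\<Sum>a\<le>s. sg (int a) (?W a (s - a))))"
   by (simp only: sg_sum[symmetric] sum.distrib)
  also have "\<dots> = (if m = - n then sg m (v + v) else 0)"
   unfolding Q_alt[OF v] using s(1) by (auto simp: sg_def)
  finally show ?thesis .
 qed (auto intro!: sum.neutral)
 finally show ?thesis .
qed

end

section \<open>Transfer to species\<close>

lemma prod_mset_image_sum:
 "finite S ==> prod_mset (image_mset h (\<Sum>C\<in>S. M C)) = (\<Prod>C\<in>S. prod_mset (image_mset h (M C)))"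
 by (induction rule: finite_induct) auto

lemma sum_mset_image_sum:
 "finite S ==> sum_mset (image_mset h (\<Sum>C\<in>S. M C)) = (\<Sum>C\<in>S. sum_mset (image_mset h (M C)))"
 by (induction rule: finite_induct) auto

section \<open>Cycle types and the evaluation of chi\<close>

lemma mset_type_parts:
 assumes "class_order G c r"
 shows "mset (type_parts c r \<rho>) = (\<Sum>C\<in>conj_classes G. image_mset (Pair C) (\<rho> C))"
proof -
 have c: "bij_betw c {0..<r + 1} (conj_classes G)" using assms by (simp add: class_order_def atLeastLessThanSuc_atLeastAtMost)
 have "mset (type_parts c r \<rho>) = (\<Sum>i\<leftarrow>[0..<r + 1]. image_mset (Pair (c i)) (\<rho> (c i)))"
  unfolding type_parts_def mset_concat by (simp add: comp_def del: upt_Suc)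
 also have "\<dots> = (\<Sum>i\<in>{0..<r + 1}. image_mset (Pair (c i)) (\<rho> (c i)))"
  by (simp only: sum_set_upt_conv_sum_list_nat[symmetric] set_upt)
 also have "\<dots> = (\<Sum>C\<in>conj_classes G. image_mset (Pair C) (\<rho> C))" by (rule sum.reindex_bij_betw[OF c])
 finally show ?thesis .
qed

context fin_group begin

lemma finite_conj_classes: "finite (conj_classes G)"
 using finite_carrier by (simp add: conj_classes_def)

lemma type_parts_mem:
 assumes "class_order G c r" "(C, k) \<in> set (type_parts c r \<rho>)"
 shows "C \<in> conj_classes G \<and> k \<in># \<rho> C"
proof -
 have "(C, k) \<in># (\<Sum>C\<in>conj_classes G. image_mset (Pair C) (\<rho> C))"
  using assms(2) unfolding mset_type_parts[OF assms(1), symmetric] by simp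
 then show ?thesis using finite_conj_classes by (auto simp: set_mset_sum)
qed

lemma part_sum_type_parts:
 assumes "class_order G c r" "\<rho> \<in> odd_partitions G n"
 shows "part_sum (type_parts c r \<rho>) = n"
proof -
 have "part_sum (type_parts c r \<rho>) = sum_mset (image_mset snd (mset (type_parts c r \<rho>)))"
  by (simp add: part_sum_def sum_mset_sum_list flip: mset_map)
 also have "\<dots> = n" using assms(2)
  by (simp add: mset_type_parts[OF assms(1)] sum_mset_image_sum finite_conj_classes odd_partitions_def
    image_mset.compositionality comp_def)
 finally show ?thesis .
qed

lemma type_value:
 fixes b :: complex
 assumes "class_order G c r"
 shows "prod_list (map (\<lambda>(C, k). b * class_value f C) (type_parts c r \<rho>)) =
  b ^ total_length G \<rho> * (\<Prod>C\<in>conj_classes G. class_value f C ^ size (\<rho> C))"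
proof -
 have "prod_list (map (\<lambda>(C, k). b * class_value f C) (type_parts c r \<rho>)) =
   prod_mset (image_mset (\<lambda>(C, k). b * class_value f C) (mset (type_parts c r \<rho>)))"
  by (simp add: prod_mset_prod_list flip: mset_map)
 also have "\<dots> = (\<Prod>C\<in>conj_classes G. (b * class_value f C) ^ size (\<rho> C))"
  by (simp add: mset_type_parts[OF assms(1)] prod_mset_image_sum finite_conj_classes
    image_mset.compositionality comp_def image_mset_const_eq)
 also have "\<dots> = b ^ total_length G \<rho> * (\<Prod>C\<in>conj_classes G. class_value f C ^ size (\<rho> C))"
  by (simp add: power_mult_distrib prod.distrib total_length_def power_sum)
 finally show ?thesis .
qed

lemma cycle_weight_prod:
 "prod_list (map (\<lambda>(C, k). cycle_weight k * class_value f C) ps) =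
  prod_list (map (\<lambda>(C, k). cycle_sign k) ps) * prod_list (map (\<lambda>(C, k). of_real (sqrt 2) * class_value f C) ps)"
 by (induction ps) (auto simp: cycle_weight_def ac_simps)

text \<open>The member of \<open>R_minus\<close> that belongs to the weight: prescribed at odd-order
  lifts and continued by the sign under z. It turns out to be \<open>scaled_chi\<close>
  (\<open>scaled_chi_eq\<close>).\<close>

definition wt_lift :: "nat => ('a => complex) => 'a welt => complex" where
 "wt_lift n f x = (if x \<notin> CW n then 0
  else if pos n x then wt G cycle_weight f {1..n} (pr x)
  else if pos n (zelt G n \<otimes>\<^bsub>W n\<^esub> x) then - wt G cycle_weight f {1..n} (pr x) else 0)"

lemma wt_lift_mem:
 assumes f: "class_fun G f" shows "wt_lift n f \<in> R_minus G n"
proof (rule R_minusI)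
 interpret W: group "W n" by (rule wreath_group)
 fix x u assume x: "x \<in> CW n" and u: "u \<in> CW n"
 let ?c = "\<lambda>x. u \<otimes>\<^bsub>W n\<^esub> x \<otimes>\<^bsub>W n\<^esub> inv\<^bsub>W n\<^esub> u"
 have c: "?c x \<in> CW n" using x u by simp
 have wt: "wt G cycle_weight f {1..n} (pr (?c x)) = wt G cycle_weight f {1..n} (pr x)"
  by (rule iso_invD[OF mult_weight_iso_inv[OF mult_weight_wt[OF f]] conj_diso[OF x u] _ pr_closed[OF x] pr_closed[OF c], symmetric]) simp
 have pos_iff: "pos n (?c w) \<longleftrightarrow> pos n w" if w: "w \<in> CW n" for w
 proof
  assume p: "pos n (?c w)"
  have cw: "?c w \<in> CW n" using w u by simp
  have "inv\<^bsub>W n\<^esub> u \<otimes>\<^bsub>W n\<^esub> ?c w \<otimes>\<^bsub>W n\<^esub> u = w"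
  proof -
   have "inv\<^bsub>W n\<^esub> u \<otimes>\<^bsub>W n\<^esub> (u \<otimes>\<^bsub>W n\<^esub> a) = a" if "a \<in> CW n" for a
    using that u by (simp flip: W.m_assoc)
   then show ?thesis using w u by (simp add: W.m_assoc)
  qed
  then show "pos n w" using pos_conj_inv[OF cw p u] by simp
 qed (rule pos_conj[OF w _ u])
 have "zelt G n \<otimes>\<^bsub>W n\<^esub> ?c x = ?c (zelt G n \<otimes>\<^bsub>W n\<^esub> x)"
 proof -
  have "zelt G n \<otimes>\<^bsub>W n\<^esub> ?c x = (zelt G n \<otimes>\<^bsub>W n\<^esub> u) \<otimes>\<^bsub>W n\<^esub> x \<otimes>\<^bsub>W n\<^esub> inv\<^bsub>W n\<^esub> u"
   using x u zelt_closed by (simp add: W.m_assoc)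
  also have "\<dots> = ?c (zelt G n \<otimes>\<^bsub>W n\<^esub> x)"
   unfolding zelt_central[OF u] using x u zelt_closed by (simp add: W.m_assoc)
  finally show ?thesis .
 qed
 then show "wt_lift n f (?c x) = wt_lift n f x"
  using pos_iff[OF x] pos_iff[OF wreath_closed[OF zelt_closed x]] x c wt by (simp add: wt_lift_def)
next
 fix x assume x: "x \<in> CW n"
 note zx = wreath_closed[OF zelt_closed x]
 show "wt_lift n f (zelt G n \<otimes>\<^bsub>W n\<^esub> x) = - wt_lift n f x"
  using x zx pos_zelt[OF x] by (simp add: wt_lift_def zelt_zelt[OF x] pr_zelt[OF x])
next
 fix x assume no: "x \<notin> even_elts G n"
 show "wt_lift n f x = 0"
 proof (cases "x \<in> CW n")
  case True
  have "\<not> pos n x" using pos_even_elts[OF True] no by blast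
  moreover have "\<not> pos n (zelt G n \<otimes>\<^bsub>W n\<^esub> x)"
   using pos_even_elts[OF wreath_closed[OF zelt_closed True]] even_zelt[OF True] no by blast
  ultimately show ?thesis by (simp add: wt_lift_def)
 qed (simp add: wt_lift_def)
qed

lemma til_wt_lift:
 assumes f: "class_fun G f" and \<xi>: "\<xi> \<in> dperm G I" and I: "finite I" "card I = n"
 shows "til (wt_lift n f) n I \<xi> = wt G cycle_weight f I \<xi>"
proof (cases "odd_order (snd \<xi>)")
 case True
 obtain x s h where x: "x \<in> CW n" "pos n x" "diso_via G s h {1..n} (pr x) I \<xi>"
  using pos_representative[OF \<xi> I True] by blast
 have "til (wt_lift n f) n I \<xi> = wt_lift n f x"
  by (rule til_eq[OF R_minusD(1)[OF wt_lift_mem[OF f]] x(1,2) \<xi> x(3)])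
 also have "\<dots> = wt G cycle_weight f {1..n} (pr x)" using x by (simp add: wt_lift_def)
 also have "\<dots> = wt G cycle_weight f I \<xi>"
  by (rule iso_invD[OF mult_weight_iso_inv[OF mult_weight_wt[OF f]] x(3) _ pr_closed[OF x(1)] \<xi>]) simp
 finally show ?thesis .
next
 case False
 obtain A where "A \<in> atoms I \<xi>" "even (card A)" using odd_order_if_odd_atoms[OF \<xi> I(1)] False by blast
 then have "wt G cycle_weight f I \<xi> = 0"
  unfolding wt_def by (intro prod_zero[OF finite_atoms[OF I(1)]] bexI[of _ A]) simp_all
 then show ?thesis using til_zero[OF False] by simp
qed

text \<open>The sign by which a standard element differs from an odd-order lift is the product of
  the \<open>cycle_sign\<close>s, and the weight contains that product too. They cancel and leave
  sqrt 2 per part.\<close>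

lemma wt_lift_standard:
 assumes f: "class_fun G f" and ps: "\<And>C k. (C, k) \<in> set ps ==> odd k \<and> C \<in> conj_classes G"
  and x: "x \<in> standard ps"
 shows "wt_lift (part_sum ps) f x = prod_list (map (\<lambda>(C, k). of_real (sqrt 2) * class_value f C) ps)"
proof -
 note c = standard_closed[OF x]
 have odd: "\<And>C k. (C, k) \<in> set ps ==> odd k" using ps by blast
 note w = wt_standard[OF f ps x, of cycle_weight, unfolded cycle_weight_prod]
 have "prod_list (map (\<lambda>(C, k). cycle_sign k) ps) = 1 \<and> pos (part_sum ps) x \<or>
   prod_list (map (\<lambda>(C, k). cycle_sign k) ps) = -1 \<and>
   pos (part_sum ps) (zelt G (part_sum ps) \<otimes>\<^bsub>W (part_sum ps)\<^esub> x)"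
  by (rule standard_signed[OF _ x]) (meson odd)
 then show ?thesis
 proof (elim disjE conjE)
  assume "prod_list (map (\<lambda>(C, k). cycle_sign k) ps) = 1" "pos (part_sum ps) x"
  then show ?thesis using c w by (simp add: wt_lift_def)
 next
  assume s: "prod_list (map (\<lambda>(C, k). cycle_sign k) ps) = -1"
   and p: "pos (part_sum ps) (zelt G (part_sum ps) \<otimes>\<^bsub>W (part_sum ps)\<^esub> x)"
  then have "\<not> pos (part_sum ps) x" using pos_zelt[OF c] by blast
  then show ?thesis using c w s p by (simp add: wt_lift_def)
 qed
qed

lemma D_plus_standard:
 assumes co: "class_order G c r" and \<rho>: "\<rho> \<in> odd_partitions G n"
 shows "D_plus G c r n \<rho> = (\<Union>x\<in>standard (type_parts c r \<rho>). conj_class (W n) x)"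
proof -
 note n = part_sum_type_parts[OF co \<rho>]
 have t: "t_word c r \<rho> = interval_word 1 (type_parts c r \<rho>)"
  by (simp add: t_word_def interval_word_def type_intervals_def)
 have b: "carrier (base_group G n) = {1..n} \<rightarrow>\<^sub>E carrier G" by (simp add: base_group_def)
 show ?thesis
 proof (intro equalityI subsetI)
  fix y assume "y \<in> D_plus G c r n \<rho>"
  then obtain g where g: "g \<in> {1..n} \<rightarrow>\<^sub>E carrier G"
   "\<forall>(C, a, k)\<in>set (type_intervals c r \<rho>). cycle_prod G g a k \<in> C"
   "y \<in> conj_class (W n) (g, spin_class n (t_word c r \<rho>))" unfolding D_plus_def b by blast
  have "(g, spin_class n (t_word c r \<rho>)) \<in> standard (type_parts c r \<rho>)"
   using standardI[of g "type_parts c r \<rho>"] g(1,2) unfolding n t type_intervals_def by blast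
  then show "y \<in> (\<Union>x\<in>standard (type_parts c r \<rho>). conj_class (W n) x)" using g(3) by blast
 next
  fix y assume "y \<in> (\<Union>x\<in>standard (type_parts c r \<rho>). conj_class (W n) x)"
  then obtain x where x: "x \<in> standard (type_parts c r \<rho>)" "y \<in> conj_class (W n) x" by blast
  obtain g where g: "x = (g, spin_class n (t_word c r \<rho>))" "g \<in> {1..n} \<rightarrow>\<^sub>E carrier G"
   "\<forall>(C, a, k)\<in>set (type_intervals c r \<rho>). cycle_prod G g a k \<in> C"
   using standard_form[OF x(1)] unfolding n t type_intervals_def by blast
  then show "y \<in> D_plus G c r n \<rho>" using x(2) unfolding D_plus_def b by blast
 qed
qed

lemma type_exists:
 assumes co: "class_order G c r" and x: "x \<in> CW n" "pos n x"
 shows "\<exists>\<rho>\<in>odd_partitions G n. \<exists>y\<in>standard (type_parts c r \<rho>). \<exists>s h. diso_via G s h {1..n} (pr y) {1..n} (pr x)"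
proof -
 let ?I = "{1..n}" and ?\<xi> = "pr x"
 note px = pr_closed[OF x(1)]
 let ?At = "atoms ?I ?\<xi>" and ?cl = "cycle_class ?\<xi>"
 have fin: "finite ?At" by (rule finite_atoms) simp
 obtain As where As: "set As = ?At" "distinct As" using finite_distinct_list[OF fin] by blast
 have odd: "odd (card A)" if "A \<in> ?At" for A by (rule odd_atoms[OF px _ pos_odd_order[OF x] that]) simp
 have cl: "?cl A \<in> conj_classes G" if A: "A \<in> ?At" for A
 proof -
  note inv = atomsD[OF A]
  have "A \<noteq> {}" using inv(2) by (simp add: cyc_def)
  moreover have "finite A" using finite_subset[OF invsD(1)[OF inv(1)]] by simp
  ultimately have "Min A \<in> A" by simp
  then have "cprod G (dres A ?\<xi>) (Min A) (card A) \<in> carrier G" by (rule cprod_closed[OF dres_closed[OF px inv(1)]])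
  then show ?thesis by (simp add: cycle_class_def conj_classes_def)
 qed
 \<comment> \<open>The type of x: for every conjugacy class, the lengths of the cycles whose product
   lies in it.\<close>
 define \<rho> where "\<rho> C = image_mset card (mset_set {A \<in> ?At. ?cl A = C})" for C
 have "\<rho> \<in> odd_partitions G n"
 proof -
  have "(\<Sum>C\<in>conj_classes G. sum_mset (\<rho> C)) = (\<Sum>C\<in>conj_classes G. \<Sum>A | A \<in> ?At \<and> ?cl A = C. card A)"
   by (simp add: \<rho>_def sum_unfold_sum_mset)
  also have "\<dots> = (\<Sum>A\<in>?At. card A)"
   by (rule sum.group[OF fin finite_conj_classes]) (use cl in auto)
  also have "\<dots> = n" using sum_card_atoms[OF px] by simp
  finally have "(\<Sum>C\<in>conj_classes G. sum_mset (\<rho> C)) = n" .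
  moreover have "\<rho> C = {#}" if "C \<notin> conj_classes G" for C
  proof -
   have "{A \<in> ?At. ?cl A = C} = {}" using cl that by auto
   then show ?thesis by (simp only: \<rho>_def mset_set.empty image_mset_empty)
  qed
  moreover have "odd k" if "k \<in># \<rho> C" for k C using that odd fin by (auto simp: \<rho>_def)
  ultimately show ?thesis by (simp add: odd_partitions_def)
 qed
 moreover have "mset (map (\<lambda>A. (?cl A, card A)) As) = mset (type_parts c r \<rho>)"
 proof -
  let ?l = "\<lambda>A. (?cl A, card A)"
  have sub: "image_mset (Pair C) (\<rho> C) = image_mset ?l (mset_set {A \<in> ?At. ?cl A = C})" for C
   unfolding \<rho>_def image_mset.compositionality using fin by (intro image_mset_cong) auto
  have "mset (map ?l As) = image_mset ?l (mset_set ?At)"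
   using As mset_set_set[OF As(2)] by simp
  also have "mset_set ?At = (\<Sum>C\<in>conj_classes G. mset_set {A \<in> ?At. ?cl A = C})"
  proof (rule multiset_eqI)
   fix A
   have "(\<Sum>C\<in>conj_classes G. count (mset_set {A \<in> ?At. ?cl A = C}) A) =
     (\<Sum>C\<in>conj_classes G. if ?cl A = C then of_bool (A \<in> ?At) else 0)"
    by (rule sum.cong[OF HOL.refl]) (use fin in \<open>simp add: count_mset_set'\<close>)
   then show "count (mset_set ?At) A = count (\<Sum>C\<in>conj_classes G. mset_set {A \<in> ?At. ?cl A = C}) A"
    using fin cl finite_conj_classes by (simp add: count_sum count_mset_set')
  qed
  also have "image_mset ?l \<dots> = (\<Sum>C\<in>conj_classes G. image_mset ?l (mset_set {A \<in> ?At. ?cl A = C}))"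
   using finite_conj_classes by (induction rule: finite_induct) simp_all
  also have "\<dots> = mset (type_parts c r \<rho>)" unfolding mset_type_parts[OF co] sub by (rule HOL.refl)
  finally show ?thesis .
 qed
 then obtain Bs where Bs: "mset Bs = mset As" "map (\<lambda>A. (?cl A, card A)) Bs = type_parts c r \<rho>"
  using mset_map_permute by blast
 have "distinct Bs" "set Bs = ?At" using Bs(1) As mset_eq_imp_distinct_iff[OF Bs(1)] mset_eq_setD[OF Bs(1)] by auto
 then obtain y s h where y: "y \<in> standard (type_parts c r \<rho>)"
  "diso_via G s h {1..part_sum (type_parts c r \<rho>)} (pr y) ?I ?\<xi>"
  using standard_exists[OF px] unfolding Bs(2)[symmetric] by blast
 moreover note part_sum_type_parts[OF co \<open>\<rho> \<in> odd_partitions G n\<close>]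
 ultimately show ?thesis by auto
qed

text \<open>Needed for the uniqueness in the definition of \<open>chi\<close>. Every odd-order
  element is isomorphic to a standard y of its type, and y or zy has odd order, so the values at y
  determine the function.\<close>

lemma R_minus_D_plus_eqI:
 assumes co: "class_order G c r" and f: "f \<in> R_minus G n" and g: "g \<in> R_minus G n"
  and eq: "\<And>\<rho> x. \<rho> \<in> odd_partitions G n ==> x \<in> D_plus G c r n \<rho> ==> f x = g x"
 shows "f = g"
proof (rule R_minus_eqI[OF f g])
 fix x assume x: "x \<in> CW n" "pos n x"
 obtain \<rho> y s h where \<rho>: "\<rho> \<in> odd_partitions G n" and y: "y \<in> standard (type_parts c r \<rho>)"
  and iso: "diso_via G s h {1..n} (pr y) {1..n} (pr x)" using type_exists[OF co x] by blast
 have cy: "y \<in> CW n" using standard_closed[OF y] part_sum_type_parts[OF co \<rho>] by simp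
 interpret W: group "W n" by (rule wreath_group)
 have "y \<in> conj_class (W n) y" unfolding conj_class_def
  by (rule CollectI, rule exI[of _ "\<one>\<^bsub>W n\<^esub>"]) (use cy in simp)
 then have "y \<in> D_plus G c r n \<rho>" unfolding D_plus_standard[OF co \<rho>] using y by blast
 then have fg: "f y = g y" by (rule eq[OF \<rho>])
 have odd: "\<And>C k. (C, k) \<in> set (type_parts c r \<rho>) ==> odd k"
  using type_parts_mem[OF co] \<rho> unfolding odd_partitions_def by blast
 have "prod_list (map (\<lambda>(C, k). cycle_sign k) (type_parts c r \<rho>)) = 1 \<and> pos (part_sum (type_parts c r \<rho>)) y \<or>
   prod_list (map (\<lambda>(C, k). cycle_sign k) (type_parts c r \<rho>)) = -1 \<and> pos (part_sum (type_parts c r \<rho>))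
    (zelt G (part_sum (type_parts c r \<rho>)) \<otimes>\<^bsub>W (part_sum (type_parts c r \<rho>))\<^esub> y)"
  by (rule standard_signed[OF _ y]) (meson odd)
 then have "pos n y \<or> pos n (zelt G n \<otimes>\<^bsub>W n\<^esub> y)"
  unfolding part_sum_type_parts[OF co \<rho>] by blast
 then show "f x = g x"
 proof
  assume p: "pos n y"
  show ?thesis using pos_class_eq[OF R_minusD(1)[OF f] cy p x iso] pos_class_eq[OF R_minusD(1)[OF g] cy p x iso] fg by simp
 next
  assume p: "pos n (zelt G n \<otimes>\<^bsub>W n\<^esub> y)"
  note zy = wreath_closed[OF zelt_closed cy]
  note iso' = iso[folded pr_zelt[OF cy]]
  show ?thesis using pos_class_eq[OF R_minusD(1)[OF f] zy p x iso'] pos_class_eq[OF R_minusD(1)[OF g] zy p x iso']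
    R_minusD(2)[OF f cy] R_minusD(2)[OF g cy] fg by simp
 qed
qed

lemma wt_lift_D_plus:
 assumes co: "class_order G c r" and f: "class_fun G f" and \<rho>: "\<rho> \<in> odd_partitions G n" and x: "x \<in> D_plus G c r n \<rho>"
 shows "wt_lift n f x = of_real (sqrt 2) ^ total_length G \<rho> * (\<Prod>C\<in>conj_classes G. class_value f C ^ size (\<rho> C))"
proof -
 obtain y where y: "y \<in> standard (type_parts c r \<rho>)" "x \<in> conj_class (W n) y"
  using x unfolding D_plus_standard[OF co \<rho>] by blast
 have cy: "y \<in> CW n" using standard_closed[OF y(1)] part_sum_type_parts[OF co \<rho>] by simp
 obtain u where u: "u \<in> CW n" "x = u \<otimes>\<^bsub>W n\<^esub> y \<otimes>\<^bsub>W n\<^esub> inv\<^bsub>W n\<^esub> u"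
  using y(2) unfolding conj_class_def by blast
 have "wt_lift n f x = wt_lift n f y" unfolding u(2) by (rule class_functionD[OF R_minusD(1)[OF wt_lift_mem[OF f]] cy u(1)])
 moreover have "\<And>C k. (C, k) \<in> set (type_parts c r \<rho>) ==> odd k \<and> C \<in> conj_classes G"
  using type_parts_mem[OF co] \<rho> unfolding odd_partitions_def by blast
 from wt_lift_standard[OF f this y(1)]
 have "wt_lift n f y = prod_list (map (\<lambda>(C, k). of_real (sqrt 2) * class_value f C) (type_parts c r \<rho>))"
  unfolding part_sum_type_parts[OF co \<rho>] .
 ultimately show ?thesis unfolding type_value[OF co] by simp
qed

text \<open>The prefactor 2^(n mod 2 / 2) compensates the same quantity in the exponent of
  \<open>chi\<close>; what remains is sqrt 2 to the number of parts, a multiplicative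
  weight.\<close>

lemma scaled_chi_eq:
 assumes co: "class_order G c r" and f: "class_fun G f"
 shows "scaled_chi G c r n f = wt_lift n f"
proof -
 define K where "K = (2::real) powr (real (n mod 2) / 2)"
 have K: "K \<noteq> 0" by (simp add: K_def)
 let ?v = "\<lambda>\<rho>. of_real (2 powr ((real (total_length G \<rho>) - real (n mod 2)) / 2)) *
       (\<Prod>C\<in>conj_classes G. class_value f C ^ size (\<rho> C)) :: complex"
 let ?f = "\<lambda>x. of_real (1 / K) * wt_lift n f x"
 have "(\<lambda>x. \<Sum>k\<in>{0::nat}. of_real (1 / K) * wt_lift n f x) \<in> R_minus G n"
  by (rule R_minus_sum) (rule wt_lift_mem[OF f])
 then have mem: "?f \<in> R_minus G n" by simp
 have val: "?f x = ?v \<rho>" if \<rho>: "\<rho> \<in> odd_partitions G n" and x: "x \<in> D_plus G c r n \<rho>" for \<rho> x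
 proof -
  have "sqrt 2 ^ l = 2 powr (real l / 2)" for l
   by (simp add: powr_half_sqrt[symmetric] powr_powr flip: powr_realpow)
  then have "2 powr ((real l - real (n mod 2)) / 2) = sqrt 2 ^ l / K" for l
   by (simp add: K_def diff_divide_distrib powr_diff)
  then show ?thesis unfolding wt_lift_D_plus[OF co f \<rho> x] by simp
 qed
 have "chi G c r n f = ?f" unfolding chi_def
 proof (rule the_equality)
  show "?f \<in> R_minus G n \<and> (\<forall>\<rho>\<in>odd_partitions G n. \<forall>x\<in>D_plus G c r n \<rho>. ?f x = ?v \<rho>)" using mem val by blast
  fix g assume g: "g \<in> R_minus G n \<and> (\<forall>\<rho>\<in>odd_partitions G n. \<forall>x\<in>D_plus G c r n \<rho>. g x = ?v \<rho>)"
  show "g = ?f"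
  proof (rule R_minus_D_plus_eqI[OF co _ mem])
   show "g \<in> R_minus G n" using g by blast
   show "g x = ?f x" if "\<rho> \<in> odd_partitions G n" "x \<in> D_plus G c r n \<rho>" for \<rho> x
    unfolding val[OF that] using g that by blast
  qed
 qed
 then show ?thesis using K by (simp add: scaled_chi_def fun_eq_iff flip: K_def)
qed

text \<open>Each cycle contributes one sign, and for a cycle of odd length -1 = (-1)^length; the
  lengths sum to the number of points. Terms of even cycles are zero on both sides.\<close>

lemma wt_minus:
 assumes x: "\<xi> \<in> dperm G I" and I: "finite I"
 shows "wt G e (\<lambda>g. - f g) I \<xi> = (-1) ^ card I * wt G e f I \<xi>"
proof -
 let ?t = "\<lambda>f A. if odd (card A) then e (card A) * cyc_val G f A (dres A \<xi>) else 0"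
 have "wt G e (\<lambda>g. - f g) I \<xi> = (\<Prod>A\<in>atoms I \<xi>. (-1) ^ card A * ?t f A)"
  unfolding wt_def by (rule prod.cong[OF HOL.refl]) (simp add: cyc_val_def)
 also have "\<dots> = (-1) ^ (\<Sum>A\<in>atoms I \<xi>. card A) * wt G e f I \<xi>"
  by (simp add: prod.distrib wt_def power_sum)
 finally show ?thesis using sum_card_atoms[OF x I] by simp
qed

lemma R_minus_comb:
 assumes f: "f \<in> R_minus G n" and g: "g \<in> R_minus G n"
 shows "(\<lambda>x. a * f x + b * g x) \<in> R_minus G n"
proof (rule R_minusI)
 fix x u assume "x \<in> CW n" "u \<in> CW n"
 then show "a * f (u \<otimes>\<^bsub>W n\<^esub> x \<otimes>\<^bsub>W n\<^esub> inv\<^bsub>W n\<^esub> u) +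
   b * g (u \<otimes>\<^bsub>W n\<^esub> x \<otimes>\<^bsub>W n\<^esub> inv\<^bsub>W n\<^esub> u) = a * f x + b * g x"
  using class_functionD[OF R_minusD(1)[OF f], of x u] class_functionD[OF R_minusD(1)[OF g], of x u] by simp
next
 fix x assume "x \<in> CW n"
 then show "a * f (zelt G n \<otimes>\<^bsub>W n\<^esub> x) + b * g (zelt G n \<otimes>\<^bsub>W n\<^esub> x) = - (a * f x + b * g x)"
  using R_minusD(2)[OF f, of x] R_minusD(2)[OF g, of x] by simp
next
 fix x assume "x \<notin> even_elts G n"
 then show "a * f x + b * g x = 0" using R_minusD(3)[OF f, of x] R_minusD(3)[OF g, of x] by simp
qed

lemma R_minus_zero: "(\<lambda>_. 0) \<in> R_minus G n"
 by (rule R_minusI) simp_all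

lemma R_GammaD: "F \<in> R_Gamma G ==> F n \<in> R_minus G n" "F \<in> R_Gamma G ==> finite {n. F n \<noteq> (\<lambda>_. 0)}"
 by (simp_all add: R_Gamma_def)

section \<open>The operators on families and their relations\<close>

text \<open>The number of points selects the degree, so a whole family becomes a single
  species.\<close>

definition fam :: "'a wfam => 'a species" where
 "fam F I \<xi> = til (F (card I)) (card I) I \<xi>"

lemma fam_iso_inv:
 assumes F: "F \<in> R_Gamma G" shows "iso_inv G (fam F)"
 unfolding iso_inv_def
proof (intro allI impI)
 fix I J x y s h
 assume I: "finite I" and x: "x \<in> dperm G I" and y: "y \<in> dperm G J" and iso: "diso_via G s h I x J y"
 have "card J = card I" using iso bij_betw_same_card[of s I J] by (simp add: diso_via_def)
 then show "fam F I x = fam F J y"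
  unfolding fam_def using til_diso[OF R_minusD(1)[OF R_GammaD(1)[OF F]] I HOL.refl x y iso] by simp
qed

text \<open>All operator identities are proved through this: elements of \<open>R_Gamma\<close> are
  compared by their species, where the operators are \<open>Pop\<close> and
  \<open>Qop\<close>.\<close>

lemma fam_eqI:
 assumes F: "F \<in> R_Gamma G" "F' \<in> R_Gamma G"
  and eq: "\<And>I \<xi>. finite I ==> \<xi> \<in> dperm G I ==> fam F I \<xi> = fam F' I \<xi>"
 shows "F = F'"
proof (rule ext, rule R_minus_eqI[OF R_GammaD(1)[OF F(1)] R_GammaD(1)[OF F(2)]])
 fix n x assume x: "x \<in> CW n" "pos n x"
 show "F n x = F' n x"
  using eq[OF finite_atLeastAtMost pr_closed[OF x(1)]] til_self[OF R_minusD(1)[OF R_GammaD(1)[OF F(1)]] x]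
   til_self[OF R_minusD(1)[OF R_GammaD(1)[OF F(2)]] x] by (simp add: fam_def)
qed

lemma fam_comb:
 "fam (\<lambda>p x. a * F p x + b * E p x) = (\<lambda>I \<xi>. a * fam F I \<xi> + b * fam E I \<xi>)"
 by (intro ext) (simp add: fam_def til_def)

lemma odd_order_join:
 assumes x: "\<xi> \<in> dperm G I" and I: "finite I" and A: "A \<in> invs I \<xi>"
  and odd: "odd_order (snd (dres A \<xi>))" "odd_order (snd (dres (I - A) \<xi>))"
 shows "odd_order (snd \<xi>)"
proof (rule odd_order_if_odd_atoms[OF x I])
 note dA = dres_closed[OF x A] and dB = dres_closed[OF x invs_compl[OF x A]]
 have sub: "A \<subseteq> I" by (rule invsD(1)[OF A])
 have "atoms (A \<union> (I - A)) (djoin A (dres A \<xi>) (dres (I - A) \<xi>)) = atoms A (dres A \<xi>) \<union> atoms (I - A) (dres (I - A) \<xi>)"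
  by (rule atoms_djoin[OF dA dB]) auto
 moreover have "A \<union> (I - A) = I" using sub by blast
 ultimately have un: "atoms I \<xi> = atoms A (dres A \<xi>) \<union> atoms (I - A) (dres (I - A) \<xi>)" using djoin_dres[OF x sub] by simp
 fix B assume "B \<in> atoms I \<xi>"
 then consider "B \<in> atoms A (dres A \<xi>)" | "B \<in> atoms (I - A) (dres (I - A) \<xi>)" unfolding un by blast
 then show "odd (card B)"
  using odd_atoms[OF dA finite_subset[OF sub I] odd(1)] odd_atoms[OF dB finite_Diff[OF I] odd(2)] by cases blast+
qed

lemma R_mult_zero:
 assumes f: "f \<in> R_minus G n" shows "R_mult G n m f (\<lambda>_. 0) = (\<lambda>_. 0)"
proof (rule R_minus_eqI[OF R_mult_mem[OF f R_minus_zero] R_minus_zero])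
 fix x assume x: "x \<in> CW (n + m)" "pos (n + m) x"
 show "R_mult G n m f (\<lambda>_. 0) x = 0" using R_mult_pos[OF f R_minus_zero x] by (simp add: til_def)
qed

lemma pairing_comult_zero: "pairing G n g (\<lambda>x. R_comult G n p (\<lambda>_. 0) x y) = 0"
 by (simp add: pairing_def R_comult_eq[OF R_minus_zero] young_fun_def)

abbreviation weight :: "('a => complex) => 'a species" where
 "weight f \<equiv> wt G cycle_weight f"

abbreviation dual :: "('a => complex) => 'a => complex" where
 "dual f \<equiv> \<lambda>g. f (inv g)"

lemma weight_iso_inv: "class_fun G f ==> iso_inv G (weight f)"
 by (rule mult_weight_iso_inv[OF mult_weight_wt])

lemma Pop_cong:
 assumes "\<And>J \<eta>. finite J ==> \<eta> \<in> dperm G J ==> F J \<eta> = F' J \<eta>" "finite I" "\<xi> \<in> dperm G I"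
 shows "Pop w n F I \<xi> = Pop w n F' I \<xi>"
 unfolding Pop_def
proof (rule sum.cong[OF HOL.refl])
 fix A assume "A \<in> {A. A \<in> invs I \<xi> \<and> card A = n}"
 then have "dres (I - A) \<xi> \<in> dperm G (I - A)" using dres_closed[OF assms(3) invs_compl[OF assms(3)]] by blast
 then show "w A (dres A \<xi>) * F (I - A) (dres (I - A) \<xi>) = w A (dres A \<xi>) * F' (I - A) (dres (I - A) \<xi>)"
  using assms(1)[of "I - A"] assms(2) by simp
qed

lemma Qop_cong:
 assumes "\<And>J \<eta>. finite J ==> \<eta> \<in> dperm G J ==> F J \<eta> = F' J \<eta>" "finite J" "\<eta> \<in> dperm G J"
 shows "Qop G v n F J \<eta> = Qop G v n F' J \<eta>"
 unfolding Qop_def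
proof (rule avg_cong)
 fix x assume "x \<in> dperm G (fresh n J)"
 then have "djoin (fresh n J) x \<eta> \<in> dperm G (fresh n J \<union> J)"
  by (rule djoin_closed[OF _ assms(3) fresh_disjoint[OF assms(2)]])
 then show "v (fresh n J) x * F (fresh n J \<union> J) (djoin (fresh n J) x \<eta>) =
   v (fresh n J) x * F' (fresh n J \<union> J) (djoin (fresh n J) x \<eta>)"
  using assms(1)[of "fresh n J \<union> J"] assms(2) by simp
qed

lemma Pop_comb:
 "Pop w n (\<lambda>I \<xi>. a * F I \<xi> + b * E I \<xi>) I \<xi> = a * Pop w n F I \<xi> + b * Pop w n E I \<xi>"
 by (simp add: Pop_def sum.distrib sum_distrib_left algebra_simps)

lemma Qop_comb:
 "Qop G v n (\<lambda>I \<xi>. a * F I \<xi> + b * E I \<xi>) I \<xi> = a * Qop G v n F I \<xi> + b * Qop G v n E I \<xi>"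
 by (simp add: Qop_def avg_def sum.distrib sum_distrib_left algebra_simps add_divide_distrib)

lemma R_Gamma_comb:
 assumes "F \<in> R_Gamma G" "E \<in> R_Gamma G" shows "(\<lambda>p x. a * F p x + b * E p x) \<in> R_Gamma G"
proof -
 have "{p. (\<lambda>x. a * F p x + b * E p x) \<noteq> (\<lambda>_. 0)} \<subseteq> {p. F p \<noteq> (\<lambda>_. 0)} \<union> {p. E p \<noteq> (\<lambda>_. 0)}"
 proof
  fix p assume p: "p \<in> {p. (\<lambda>x. a * F p x + b * E p x) \<noteq> (\<lambda>_. 0)}"
  show "p \<in> {p. F p \<noteq> (\<lambda>_. 0)} \<union> {p. E p \<noteq> (\<lambda>_. 0)}"
  proof (rule ccontr)
   assume "p \<notin> {p. F p \<noteq> (\<lambda>_. 0)} \<union> {p. E p \<noteq> (\<lambda>_. 0)}"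
   then have "F p = (\<lambda>_. 0)" "E p = (\<lambda>_. 0)" by blast+
   then show False using p by simp
  qed
 qed
 then have "finite {p. (\<lambda>x. a * F p x + b * E p x) \<noteq> (\<lambda>_. 0)}"
  using R_GammaD(2)[OF assms(1)] R_GammaD(2)[OF assms(2)] finite_subset by blast
 then show ?thesis using R_minus_comb[OF R_GammaD(1)[OF assms(1)] R_GammaD(1)[OF assms(2)]]
  by (simp add: R_Gamma_def)
qed

lemma zero_fam: "(0 :: 'a wfam) = (\<lambda>_ _. 0)"
 by (simp add: fun_eq_iff)

lemma subgroup_add_R_Gamma: "subgroup_add (R_Gamma G)"
proof
 show "0 \<in> R_Gamma G" using R_minus_zero by (simp add: zero_fam R_Gamma_def)
 fix u v assume u: "u \<in> R_Gamma G" and v: "v \<in> R_Gamma G"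
 have "u + v = (\<lambda>p x. 1 * u p x + 1 * v p x)" by (simp add: fun_eq_iff)
 then show "u + v \<in> R_Gamma G" using R_Gamma_comb[OF u v, of 1 1] by simp
next
 fix v assume v: "v \<in> R_Gamma G"
 have "- v = (\<lambda>p x. (-1) * v p x + 0 * v p x)" by (simp add: fun_eq_iff)
 then show "- v \<in> R_Gamma G" using R_Gamma_comb[OF v v, of "-1" 0] by simp
qed

lemma add_fam: "(u :: 'a wfam) + v = (\<lambda>p x. 1 * u p x + 1 * v p x)"
 by (simp add: fun_eq_iff)

lemma fam_add: "fam (u + v) I \<xi> = fam u I \<xi> + fam v I \<xi>"
 using fam_comb[of 1 u 1 v] unfolding add_fam by simp

lemma fam_zero: "fam 0 I \<xi> = 0"
 by (simp add: fam_def til_def)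

lemma fam_sum: "fam (\<Sum>k\<in>S. F k) I \<xi> = (\<Sum>k\<in>S. fam (F k) I \<xi>)"
 by (induction S rule: infinite_finite_induct) (simp_all only: sum.infinite sum.empty sum.insert fam_add fam_zero not_False_eq_True)

lemma fam_sg: "fam (sg (int k) v) I \<xi> = (-1) ^ k * fam v I \<xi>"
 by (cases "even k") (simp_all add: sg_def fam_def til_def)

lemma fam_dbl: "fam (dbl a v) I \<xi> = (if a = 0 then 1 else 2) * fam v I \<xi>"
proof (cases "a = 0")
 case False
 then have "dbl a v = v + v" by (simp only: dbl_def if_False)
 then have "fam (dbl a v) I \<xi> = fam v I \<xi> + fam v I \<xi>" by (simp only: fam_add)
 then show ?thesis using False by simp
qed (simp add: dbl_def)

lemma fam_sum_apply: "(\<Sum>k\<in>S. F k) p x = (\<Sum>k\<in>S. (F k :: 'a wfam) p x)"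
 by (induction S rule: infinite_finite_induct) simp_all

lemma fam_sg_apply: "sg k (v :: 'a wfam) p x = (-1) powi k * v p x"
 using power_int_minus_left[of "1::complex" k] by (simp add: sg_def)

context
 fixes c :: "nat => 'a set" and r :: nat
 assumes co: "class_order G c r"
begin

abbreviation "HP \<equiv> H_create G c r"
abbreviation "HQ \<equiv> H_annih G c r"

lemma H_create_eq:
 assumes "class_fun G f"
 shows "HP f n F p = (if n \<le> p then R_mult G n (p - n) (wt_lift n f) (F (p - n)) else (\<lambda>_. 0))"
 by (simp add: H_create_def scaled_chi_eq[OF co assms])

lemma H_create_mem:
 assumes f: "class_fun G f" and F: "F \<in> R_Gamma G" shows "HP f n F \<in> R_Gamma G"
proof -
 have "HP f n F p \<in> R_minus G p" for p
  using R_mult_mem[OF wt_lift_mem[OF f] R_GammaD(1)[OF F], of n "p - n"] R_minus_zero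
  by (cases "n \<le> p") (simp_all add: H_create_eq[OF f])
 moreover have "{p. HP f n F p \<noteq> (\<lambda>_. 0)} \<subseteq> (\<lambda>q. n + q) ` {q. F q \<noteq> (\<lambda>_. 0)}"
 proof
  fix p assume "p \<in> {p. HP f n F p \<noteq> (\<lambda>_. 0)}"
  then have "n \<le> p" "F (p - n) \<noteq> (\<lambda>_. 0)"
   using R_mult_zero[OF wt_lift_mem[OF f], of n "p - n"] by (auto simp: H_create_eq[OF f] split: if_splits)
  then show "p \<in> (\<lambda>q. n + q) ` {q. F q \<noteq> (\<lambda>_. 0)}" by (intro image_eqI[of _ _ "p - n"]) auto
 qed
 ultimately show ?thesis using finite_subset[OF _ finite_imageI[OF R_GammaD(2)[OF F]]] by (simp add: R_Gamma_def)
qed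

lemma H_annih_eq:
 assumes "class_fun G f"
 shows "HQ f n F p = (\<lambda>y. pairing G n (wt_lift n f) (\<lambda>x. R_comult G n p (F (n + p)) x y))"
 by (simp add: H_annih_def scaled_chi_eq[OF co assms])

lemma H_annih_zero:
 assumes "class_fun G f" "F (n + p) = (\<lambda>_. 0)" shows "HQ f n F p = (\<lambda>_. 0)"
 using pairing_comult_zero by (simp add: H_annih_eq[OF assms(1)] assms(2))

lemma H_annih_mem:
 assumes f: "class_fun G f" and F: "F \<in> R_Gamma G" shows "HQ f n F \<in> R_Gamma G"
proof -
 have "HQ f n F p \<in> R_minus G p" for p
  unfolding H_annih_eq[OF f] by (rule pairing_comult_mem[OF R_GammaD(1)[OF F]])
 moreover have "{p. HQ f n F p \<noteq> (\<lambda>_. 0)} \<subseteq> (\<lambda>p. n + p) -` {q. F q \<noteq> (\<lambda>_. 0)}"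
  using H_annih_zero[OF f] by blast
 ultimately show ?thesis
  using finite_subset[OF _ finite_vimageI[OF R_GammaD(2)[OF F], of "\<lambda>p. n + p"]] by (simp add: R_Gamma_def)
qed

lemma H_annih_finite:
 assumes f: "class_fun G f" and F: "F \<in> R_Gamma G" shows "\<exists>N. \<forall>k>N. HQ f k F = (\<lambda>_ _. 0)"
proof -
 obtain N where N: "n \<le> N" if "F n \<noteq> (\<lambda>_. 0)" for n
  using R_GammaD(2)[OF F] unfolding finite_nat_set_iff_bounded_le by blast
 have "HQ f k F p = (\<lambda>_. 0)" if "k > N" for k p
  by (rule H_annih_zero[OF f]) (use N[of "k + p"] that in force)
 then show ?thesis by (intro exI[of _ N]) (simp add: fun_eq_iff)
qed

text \<open>At odd order this is the product formula at a lift, transported along an isomorphism.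
  Otherwise, for every invariant subset one of the two pieces fails to have odd order, so both sides
  are zero.\<close>

lemma fam_create:
 assumes f: "class_fun G f" and F: "F \<in> R_Gamma G" and I: "finite I" and \<xi>: "\<xi> \<in> dperm G I"
 shows "fam (HP f n F) I \<xi> = Pop (weight f) n (fam F) I \<xi>"
proof (cases "n \<le> card I")
 case False
 have "{A. A \<in> invs I \<xi> \<and> card A = n} = {}"
  using False card_mono[OF I] invsD(1)[of _ I \<xi>] by auto
 then have "Pop (weight f) n (fam F) I \<xi> = 0" unfolding Pop_def by (simp only: sum.empty)
 then show ?thesis using False by (simp add: fam_def H_create_eq[OF f] til_def)
next
 case True
 define m where "m = card I - n"
 have cI: "card I = n + m" using True by (simp add: m_def)
 note g = R_GammaD(1)[OF F, of m] and l = wt_lift_mem[OF f, of n]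
 have T: "fam (HP f n F) I \<xi> = til (R_mult G n m (wt_lift n f) (F m)) (n + m) I \<xi>"
  by (simp add: fam_def H_create_eq[OF f] cI)
 show ?thesis
 proof (cases "odd_order (snd \<xi>)")
  case True
  obtain x s h where x: "x \<in> CW (n + m)" "pos (n + m) x" "diso_via G s h {1..n + m} (pr x) I \<xi>"
   using pos_representative[OF \<xi> I cI True] by blast
  note px = pr_closed[OF x(1)]
  have "til (R_mult G n m (wt_lift n f) (F m)) (n + m) I \<xi> = R_mult G n m (wt_lift n f) (F m) x"
   by (rule til_eq[OF R_minusD(1)[OF R_mult_mem[OF l g]] x(1,2) \<xi> x(3)])
  also have "\<dots> = Pop (weight f) n (fam F) {1..n + m} (pr x)"
   unfolding R_mult_pos[OF l g x(1,2)] Pop_def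
  proof (rule sum.cong[OF HOL.refl])
   fix A assume "A \<in> {A. A \<in> invs {1..n + m} (pr x) \<and> card A = n}"
   then have A: "A \<in> invs {1..n + m} (pr x)" "card A = n" by auto
   have fA: "finite A" using finite_subset[OF invsD(1)[OF A(1)]] by simp
   have "card ({1..n + m} - A) = m" using card_Diff_subset[OF fA invsD(1)[OF A(1)]] A(2) by simp
   then show "til (wt_lift n f) n A (dres A (pr x)) * til (F m) m ({1..n + m} - A) (dres ({1..n + m} - A) (pr x)) =
     weight f A (dres A (pr x)) * fam F ({1..n + m} - A) (dres ({1..n + m} - A) (pr x))"
    using til_wt_lift[OF f dres_closed[OF px A(1)] fA A(2)] by (simp add: fam_def)
  qed
  also have "\<dots> = Pop (weight f) n (fam F) I \<xi>"
   by (rule iso_invD[OF iso_inv_Pop[OF weight_iso_inv[OF f] fam_iso_inv[OF F]] x(3) _ px \<xi>]) simp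
  finally show ?thesis unfolding T .
 next
  case False
  have "Pop (weight f) n (fam F) I \<xi> = 0" unfolding Pop_def
  proof (rule sum.neutral, rule ballI)
   fix A assume "A \<in> {A. A \<in> invs I \<xi> \<and> card A = n}"
   then have A: "A \<in> invs I \<xi>" "card A = n" by auto
   have fA: "finite A" using finite_subset[OF invsD(1)[OF A(1)] I] .
   have "\<not> odd_order (snd (dres A \<xi>)) \<or> \<not> odd_order (snd (dres (I - A) \<xi>))"
    using odd_order_join[OF \<xi> I A(1)] False by blast
   then show "weight f A (dres A \<xi>) * fam F (I - A) (dres (I - A) \<xi>) = 0"
    using til_zero[of "dres A \<xi>" "wt_lift n f" n A] til_wt_lift[OF f dres_closed[OF \<xi> A(1)] fA A(2)]
     til_zero[of "dres (I - A) \<xi>" "F (card (I - A))" "card (I - A)" "I - A"]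
    by (elim disjE) (simp_all add: fam_def)
  qed
  then show ?thesis unfolding T by (simp add: til_zero[OF False])
 qed
qed

text \<open>The Young subgroup places the n additional points before a shifted copy of J; by
  \<open>Qop_eq\<close> they may be any fresh points. The inversion in the pairing accounts for the
  dual weight.\<close>

lemma fam_annih:
 assumes f: "class_fun G f" and F: "F \<in> R_Gamma G" and J: "finite J" and \<eta>: "\<eta> \<in> dperm G J"
 shows "fam (HQ f n F) J \<eta> = Qop G (weight (dual f)) n (fam F) J \<eta>"
proof (cases "odd_order (snd \<eta>)")
 case True
 let ?p = "card J"
 have K: "{1..n} \<union> {n + 1..n + ?p} = {1..n + ?p}" by auto
 obtain y s h where y: "y \<in> CW ?p" "pos ?p y" "diso_via G s h {1..?p} (pr y) J \<eta>"
  using pos_representative[OF \<eta> J HOL.refl True] by blast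
 note py = pr_closed[OF y(1)]
 note sy = drel_closed[OF shift_bij[of n ?p] py]
 obtain t k where tk: "diso_via G t k {n + 1..n + ?p} (shifted n ?p (pr y)) {1..?p} (pr y)"
  using diso_sym[OF py sy drel_diso[OF shift_bij py]] by blast
 obtain u l where ul: "diso_via G u l {n + 1..n + ?p} (shifted n ?p (pr y)) J \<eta>"
  using diso_trans[OF sy py tk y(3)] by blast
 note v = weight_iso_inv[OF class_fun_inv[OF f]]
 have "fam (HQ f n F) J \<eta> = pairing G n (wt_lift n f) (\<lambda>x. R_comult G n ?p (F (n + ?p)) x y)"
  unfolding fam_def H_annih_eq[OF f]
  by (rule til_eq[OF R_minusD(1)[OF pairing_comult_mem[OF R_GammaD(1)[OF F]]] y(1,2) \<eta> y(3)])
 also have "\<dots> = avg G {1..n} (\<lambda>\<xi>. til (wt_lift n f) n {1..n} (dinv G {1..n} \<xi>) *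
   til (F (n + ?p)) (n + ?p) {1..n + ?p} (djoin {1..n} \<xi> (shifted n ?p (pr y))))"
  by (rule pairing_comult_pos[OF wt_lift_mem[OF f] R_GammaD(1)[OF F] y(1,2)])
 also have "\<dots> = avg G {1..n} (\<lambda>\<xi>. weight (dual f) {1..n} \<xi> *
   fam F ({1..n} \<union> {n + 1..n + ?p}) (djoin {1..n} \<xi> (shifted n ?p (pr y))))"
 proof (rule avg_cong)
  fix \<xi> assume \<xi>: "\<xi> \<in> dperm G {1..n}"
  have "til (wt_lift n f) n {1..n} (dinv G {1..n} \<xi>) = weight (dual f) {1..n} \<xi>"
   using til_wt_lift[OF f dinv_closed[OF \<xi>]] wt_dinv[OF f \<xi>, of cycle_weight] by simp
  then show "til (wt_lift n f) n {1..n} (dinv G {1..n} \<xi>) *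
    til (F (n + ?p)) (n + ?p) {1..n + ?p} (djoin {1..n} \<xi> (shifted n ?p (pr y))) =
   weight (dual f) {1..n} \<xi> * fam F ({1..n} \<union> {n + 1..n + ?p}) (djoin {1..n} \<xi> (shifted n ?p (pr y)))"
   unfolding K fam_def by simp
 qed
 also have "\<dots> = Qop G (weight (dual f)) n (fam F) {n + 1..n + ?p} (shifted n ?p (pr y))"
  by (rule Qop_eq[OF v fam_iso_inv[OF F] _ sy, symmetric]) auto
 also have "\<dots> = Qop G (weight (dual f)) n (fam F) J \<eta>"
  by (rule iso_invD[OF iso_inv_Qop[OF v fam_iso_inv[OF F]] ul _ sy \<eta>]) simp
 finally show ?thesis .
next
 case False
 let ?N = "fresh n J"
 have "Qop G (weight (dual f)) n (fam F) J \<eta> = avg G ?N (\<lambda>_. 0)"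
  unfolding Qop_def
 proof (rule avg_cong)
  fix x assume x: "x \<in> dperm G ?N"
  note d = fresh_disjoint[OF J, of n]
  have "\<not> odd_order (snd (djoin ?N x \<eta>))"
   using odd_order_dres[OF djoin_closed[OF x \<eta> d] djoin_invs(2)[OF x \<eta> d]] dres_djoin_right[OF \<eta> d, of x] False
   by auto
  then show "weight (dual f) ?N x * fam F (?N \<union> J) (djoin ?N x \<eta>) = 0"
   by (simp add: fam_def til_zero)
 qed
 then show ?thesis by (simp add: fam_def til_zero[OF False] avg_def)
qed


lemma create_create:
 assumes f: "class_fun G f" "class_fun G f'" and F: "F \<in> R_Gamma G"
 shows "HP f m (HP f' n F) = HP f' n (HP f m F)"
proof (rule fam_eqI)
 fix I \<xi> assume I: "finite I" and \<xi>: "\<xi> \<in> dperm G I"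
 have "fam (HP f m (HP f' n F)) I \<xi> =
   Pop (weight f) m (Pop (weight f') n (fam F)) I \<xi>"
  unfolding fam_create[OF f(1) H_create_mem[OF f(2) F] I \<xi>]
  by (rule Pop_cong[OF fam_create[OF f(2) F] I \<xi>])
 moreover have "fam (HP f' n (HP f m F)) I \<xi> =
   Pop (weight f') n (Pop (weight f) m (fam F)) I \<xi>"
  unfolding fam_create[OF f(2) H_create_mem[OF f(1) F] I \<xi>]
  by (rule Pop_cong[OF fam_create[OF f(1) F] I \<xi>])
 ultimately show "fam (HP f m (HP f' n F)) I \<xi> =
   fam (HP f' n (HP f m F)) I \<xi>"
  using Pop_commute[OF \<xi> I] by metis
qed (intro H_create_mem f F)+

lemma annih_annih:
 assumes f: "class_fun G f" "class_fun G f'" and F: "F \<in> R_Gamma G"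
 shows "HQ f m (HQ f' n F) = HQ f' n (HQ f m F)"
proof (rule fam_eqI)
 fix I \<xi> assume I: "finite I" and \<xi>: "\<xi> \<in> dperm G I"
 note v = weight_iso_inv[OF class_fun_inv[OF f(1)]] weight_iso_inv[OF class_fun_inv[OF f(2)]]
 have "fam (HQ f m (HQ f' n F)) I \<xi> =
   Qop G (weight (dual f)) m (Qop G (weight (dual f')) n (fam F)) I \<xi>"
  unfolding fam_annih[OF f(1) H_annih_mem[OF f(2) F] I \<xi>]
  by (rule Qop_cong[OF fam_annih[OF f(2) F] I \<xi>])
 moreover have "fam (HQ f' n (HQ f m F)) I \<xi> =
   Qop G (weight (dual f')) n (Qop G (weight (dual f)) m (fam F)) I \<xi>"
  unfolding fam_annih[OF f(2) H_annih_mem[OF f(1) F] I \<xi>]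
  by (rule Qop_cong[OF fam_annih[OF f(1) F] I \<xi>])
 ultimately show "fam (HQ f m (HQ f' n F)) I \<xi> =
   fam (HQ f' n (HQ f m F)) I \<xi>"
  using Qop_commute[OF v fam_iso_inv[OF F] I \<xi>, of m n] by simp
qed (intro H_annih_mem f F)+

lemma fam_annih_create:
 assumes f: "class_fun G f" "class_fun G f'" and F: "F \<in> R_Gamma G" and I: "finite I" and \<xi>: "\<xi> \<in> dperm G I"
 shows "fam (HQ f n (HP f' m F)) I \<xi> =
  (\<Sum>a\<le>n. if a \<le> m then wpair (weight (dual f)) (weight f') a *
   fam (HP f' (m - a) (HQ f (n - a) F)) I \<xi> else 0)"
proof -
 have "fam (HQ f n (HP f' m F)) I \<xi> =
   Qop G (weight (dual f)) n (Pop (weight f') m (fam F)) I \<xi>"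
  unfolding fam_annih[OF f(1) H_create_mem[OF f(2) F] I \<xi>]
  by (rule Qop_cong[OF fam_create[OF f(2) F] I \<xi>])
 also have "\<dots> = (\<Sum>a\<le>n. if a \<le> m then wpair (weight (dual f)) (weight f') a *
   Pop (weight f') (m - a) (Qop G (weight (dual f)) (n - a) (fam F)) I \<xi> else 0)"
  by (rule Qop_Pop[OF mult_weight_wt[OF class_fun_inv[OF f(1)]] mult_weight_wt[OF f(2)] fam_iso_inv[OF F] I \<xi>])
 also have "\<dots> = (\<Sum>a\<le>n. if a \<le> m then wpair (weight (dual f)) (weight f') a *
   fam (HP f' (m - a) (HQ f (n - a) F)) I \<xi> else 0)"
 proof (rule sum.cong[OF HOL.refl])
  fix a
  have "fam (HP f' (m - a) (HQ f (n - a) F)) I \<xi> =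
    Pop (weight f') (m - a) (Qop G (weight (dual f)) (n - a) (fam F)) I \<xi>"
   unfolding fam_create[OF f(2) H_annih_mem[OF f(1) F] I \<xi>]
   by (rule Pop_cong[OF fam_annih[OF f(1) F] I \<xi>])
  then show "(if a \<le> m then wpair (weight (dual f)) (weight f') a *
    Pop (weight f') (m - a) (Qop G (weight (dual f)) (n - a) (fam F)) I \<xi> else 0) =
   (if a \<le> m then wpair (weight (dual f)) (weight f') a *
   fam (HP f' (m - a) (HQ f (n - a) F)) I \<xi> else 0)" by simp
 qed
 finally show ?thesis .
qed

lemma create_comb:
 assumes f: "class_fun G f" and F: "F \<in> R_Gamma G" and E: "E \<in> R_Gamma G"
 shows "HP f n (\<lambda>p x. a * F p x + b * E p x) =
  (\<lambda>p x. a * HP f n F p x + b * HP f n E p x)"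
proof (rule fam_eqI)
 show "HP f n (\<lambda>p x. a * F p x + b * E p x) \<in> R_Gamma G"
  by (rule H_create_mem[OF f R_Gamma_comb[OF F E]])
 show "(\<lambda>p x. a * HP f n F p x + b * HP f n E p x) \<in> R_Gamma G"
  by (rule R_Gamma_comb[OF H_create_mem[OF f F] H_create_mem[OF f E]])
qed (simp add: fam_create[OF f R_Gamma_comb[OF F E]] fam_create[OF f F] fam_create[OF f E]
   fam_comb Pop_comb)

lemma annih_comb:
 assumes f: "class_fun G f" and F: "F \<in> R_Gamma G" and E: "E \<in> R_Gamma G"
 shows "HQ f n (\<lambda>p x. a * F p x + b * E p x) =
  (\<lambda>p x. a * HQ f n F p x + b * HQ f n E p x)"
proof (rule fam_eqI)
 show "HQ f n (\<lambda>p x. a * F p x + b * E p x) \<in> R_Gamma G"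
  by (rule H_annih_mem[OF f R_Gamma_comb[OF F E]])
 show "(\<lambda>p x. a * HQ f n F p x + b * HQ f n E p x) \<in> R_Gamma G"
  by (rule R_Gamma_comb[OF H_annih_mem[OF f F] H_annih_mem[OF f E]])
qed (simp add: fam_annih[OF f R_Gamma_comb[OF F E]] fam_annih[OF f F] fam_annih[OF f E]
   fam_comb Qop_comb)

lemma creation_annihilation_H:
 assumes f: "class_fun G f"
 shows "creation_annihilation (R_Gamma G) (HP f) (HQ f)"
proof -
 interpret subgroup_add "R_Gamma G" by (rule subgroup_add_R_Gamma)
 show ?thesis
 proof
  fix u v :: "'a wfam" and n assume u: "u \<in> R_Gamma G" and v: "v \<in> R_Gamma G"
  show "HP f n (u + v) = HP f n u + HP f n v"
   unfolding add_fam by (rule create_comb[OF f u v])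
  show "HQ f n (u + v) = HQ f n u + HQ f n v"
   unfolding add_fam by (rule annih_comb[OF f u v])
 next
  fix v :: "'a wfam" and n assume v: "v \<in> R_Gamma G"
  show "HP f n v \<in> R_Gamma G" by (rule H_create_mem[OF f v])
  show "HQ f n v \<in> R_Gamma G" by (rule H_annih_mem[OF f v])
  show "\<exists>N. \<forall>k>N. HQ f k v = 0" unfolding zero_fam by (rule H_annih_finite[OF f v])
 qed
qed

lemma clifford_pair_H:
 assumes f: "class_fun G f" and norm: "inner (dual f) f = 1"
 shows "clifford_pair (R_Gamma G) (HP f) (HQ f)"
proof -
 interpret creation_annihilation "R_Gamma G" "HP f" "HQ f"
  by (rule creation_annihilation_H[OF f])
 note fd = class_fun_inv[OF f]
 show ?thesis
 proof
  fix v :: "'a wfam" and m n assume v: "v \<in> R_Gamma G"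
  show "HP f m (HP f n v) = HP f n (HP f m v)"
   by (rule create_create[OF f f v])
  show "HQ f m (HQ f n v) = HQ f n (HQ f m v)"
   by (rule annih_annih[OF f f v])
  show "HQ f n (HP f m v) =
    (\<Sum>a\<le>n. if a \<le> m then dbl a (HP f (m - a) (HQ f (n - a) v)) else 0)"
  proof (rule fam_eqI)
   show "HQ f n (HP f m v) \<in> R_Gamma G" by (intro P_mem Q_mem v)
   show "(\<Sum>a\<le>n. if a \<le> m then dbl a (HP f (m - a) (HQ f (n - a) v)) else 0) \<in> R_Gamma G"
   proof (rule sum_mem)
    fix a
    let ?w = "HP f (m - a) (HQ f (n - a) v)"
    have w: "?w \<in> R_Gamma G" by (intro P_mem Q_mem v)
    consider "\<not> a \<le> m" | "a \<le> m" "a = 0" | "a \<le> m" "a \<noteq> 0" by blast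
    then have "(if a \<le> m then dbl a ?w else 0) = 0 \<or> (if a \<le> m then dbl a ?w else 0) = ?w \<or>
      (if a \<le> m then dbl a ?w else 0) = ?w + ?w"
     by cases (simp_all only: dbl_def if_True if_False simp_thms)
    then show "(if a \<le> m then dbl a ?w else 0) \<in> R_Gamma G"
     using w add_mem[OF w w] zero_mem by metis
   qed
   fix I \<xi> assume I: "finite I" and \<xi>: "\<xi> \<in> dperm G I"
   show "fam (HQ f n (HP f m v)) I \<xi> =
     fam (\<Sum>a\<le>n. if a \<le> m then dbl a (HP f (m - a) (HQ f (n - a) v)) else 0) I \<xi>"
    unfolding fam_annih_create[OF f f v I \<xi>] fam_sum
    by (rule sum.cong[OF HOL.refl])
     (simp add: fam_dbl fam_zero wpair_wt(2)[OF fd f cycle_weight_square norm])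
  qed
  show "(\<Sum>a\<le>n. sg (int a) (HP f a (HP f (n - a) v))) = (if n = 0 then v else 0)"
  proof (rule fam_eqI)
   show "(\<Sum>a\<le>n. sg (int a) (HP f a (HP f (n - a) v))) \<in> R_Gamma G"
    by (intro sum_mem sg_mem P_mem v)
   show "(if n = 0 then v else 0) \<in> R_Gamma G" using v zero_mem by simp
   fix I \<xi> assume I: "finite I" and \<xi>: "\<xi> \<in> dperm G I"
   have "fam (HP f a (HP f b v)) I \<xi> = Pop (weight f) a (Pop (weight f) b (fam v)) I \<xi>" for a b
    unfolding fam_create[OF f P_mem[OF v] I \<xi>] by (rule Pop_cong[OF fam_create[OF f v] I \<xi>])
   then show "fam (\<Sum>a\<le>n. sg (int a) (HP f a (HP f (n - a) v))) I \<xi> =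
     fam (if n = 0 then v else 0) I \<xi>"
    using Pop_alternating[OF mult_weight_wt[OF f] alternating_wt \<xi> I, of cycle_weight n "fam v"]
    by (simp add: fam_sum fam_sg fam_zero)
  qed
  show "(\<Sum>a\<le>n. sg (int a) (HQ f a (HQ f (n - a) v))) = (if n = 0 then v else 0)"
  proof (rule fam_eqI)
   show "(\<Sum>a\<le>n. sg (int a) (HQ f a (HQ f (n - a) v))) \<in> R_Gamma G"
    by (intro sum_mem sg_mem Q_mem v)
   show "(if n = 0 then v else 0) \<in> R_Gamma G" using v zero_mem by simp
   fix I \<xi> assume I: "finite I" and \<xi>: "\<xi> \<in> dperm G I"
   have "fam (HQ f a (HQ f b v)) I \<xi> =
     Qop G (weight (dual f)) a (Qop G (weight (dual f)) b (fam v)) I \<xi>" for a b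
    unfolding fam_annih[OF f Q_mem[OF v] I \<xi>] by (rule Qop_cong[OF fam_annih[OF f v] I \<xi>])
   then show "fam (\<Sum>a\<le>n. sg (int a) (HQ f a (HQ f (n - a) v))) I \<xi> =
     fam (if n = 0 then v else 0) I \<xi>"
    using Qop_alternating[OF mult_weight_wt[OF fd] alternating_wt fam_iso_inv[OF v] I \<xi>, of cycle_weight n]
    by (simp add: fam_sum fam_sg fam_zero)
  qed
 qed
qed

text \<open>Orthogonality leaves only the term a = 0 of the general commutation formula.\<close>

lemma annih_create_commute:
 assumes f: "class_fun G f" "class_fun G f'" and orth: "inner (dual f) f' = 0" and v: "v \<in> R_Gamma G"
 shows "HQ f n (HP f' m v) = HP f' m (HQ f n v)"
proof (rule fam_eqI)
 fix I \<xi> assume I: "finite I" and \<xi>: "\<xi> \<in> dperm G I"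
 let ?T = "fam (HP f' m (HQ f n v)) I \<xi>"
 have "fam (HQ f n (HP f' m v)) I \<xi> = (\<Sum>a\<le>n. if a = 0 then ?T else 0)"
  unfolding fam_annih_create[OF f v I \<xi>]
  by (rule sum.cong[OF HOL.refl])
   (simp add: wpair_wt(1)[OF class_fun_inv[OF f(1)] f(2) cycle_weight_square orth])
 then show "fam (HQ f n (HP f' m v)) I \<xi> = ?T" by simp
qed (intro H_create_mem H_annih_mem f v)+

lemma vop_orthogonal:
 assumes f: "class_fun G f" "class_fun G f'" and orth: "inner (dual f) f' = 0" "inner (dual f') f = 0"
  and v: "v \<in> R_Gamma G"
 shows "vop (HP f) (HQ f) m (vop (HP f') (HQ f') n v) =
  vop (HP f') (HQ f') n (vop (HP f) (HQ f) m v)"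
proof (rule vop_commute[OF creation_annihilation_H[OF f(1)] creation_annihilation_H[OF f(2)] _ _ _ _ v])
 fix m n v assume u: "v \<in> R_Gamma G"
 show "HP f m (HP f' n v) = HP f' n (HP f m v)"
  by (rule create_create[OF f u])
 show "HQ f m (HQ f' n v) = HQ f' n (HQ f m v)"
  by (rule annih_annih[OF f u])
 show "HQ f m (HP f' n v) = HP f' n (HQ f m v)"
  by (rule annih_create_commute[OF f orth(1) u])
 show "HQ f' m (HP f n v) = HP f n (HQ f' m v)"
  by (rule annih_create_commute[OF f(2,1) orth(2) u])
qed

lemma X_coeff_vop: "X_coeff G c r f n F = vop (HP f) (HQ f) n F"
 by (intro ext) (simp only: X_coeff_def vop_def fam_sum_apply fam_sg_apply zero_fam power_int_of_nat)

lemma create_minus: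
 assumes f: "class_fun G f" and v: "v \<in> R_Gamma G"
 shows "HP (\<lambda>g. - f g) n v = sg (int n) (HP f n v)"
proof (rule fam_eqI)
 interpret creation_annihilation "R_Gamma G" "HP f" "HQ f" by (rule creation_annihilation_H[OF f])
 have f': "class_fun G (\<lambda>g. - f g)" using f by (simp add: class_fun_def)
 show "HP (\<lambda>g. - f g) n v \<in> R_Gamma G" by (rule H_create_mem[OF f' v])
 show "sg (int n) (HP f n v) \<in> R_Gamma G" by (intro sg_mem P_mem v)
 fix I \<xi> assume I: "finite I" and \<xi>: "\<xi> \<in> dperm G I"
 have "Pop (weight (\<lambda>g. - f g)) n (fam v) I \<xi> = (-1) ^ n * Pop (weight f) n (fam v) I \<xi>"
  unfolding Pop_def sum_distrib_left
 proof (rule sum.cong[OF HOL.refl])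
  fix A assume "A \<in> {A. A \<in> invs I \<xi> \<and> card A = n}"
  then have A: "A \<in> invs I \<xi>" "card A = n" by auto
  show "weight (\<lambda>g. - f g) A (dres A \<xi>) * fam v (I - A) (dres (I - A) \<xi>) =
    (-1) ^ n * (weight f A (dres A \<xi>) * fam v (I - A) (dres (I - A) \<xi>))"
   using wt_minus[OF dres_closed[OF \<xi> A(1)] finite_subset[OF invsD(1)[OF A(1)] I], of cycle_weight f] A(2)
   by (simp add: mult.assoc)
 qed
 then show "fam (HP (\<lambda>g. - f g) n v) I \<xi> = fam (sg (int n) (HP f n v)) I \<xi>"
  by (simp add: fam_sg fam_create[OF f' v I \<xi>] fam_create[OF f v I \<xi>])
qed

lemma annih_minus:
 assumes f: "class_fun G f" and v: "v \<in> R_Gamma G"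
 shows "HQ (\<lambda>g. - f g) n v = sg (int n) (HQ f n v)"
proof (rule fam_eqI)
 interpret creation_annihilation "R_Gamma G" "HP f" "HQ f" by (rule creation_annihilation_H[OF f])
 have f': "class_fun G (\<lambda>g. - f g)" using f by (simp add: class_fun_def)
 show "HQ (\<lambda>g. - f g) n v \<in> R_Gamma G" by (rule H_annih_mem[OF f' v])
 show "sg (int n) (HQ f n v) \<in> R_Gamma G" by (intro sg_mem Q_mem v)
 fix I \<xi> assume I: "finite I" and \<xi>: "\<xi> \<in> dperm G I"
 have "Qop G (weight (dual (\<lambda>g. - f g))) n (fam v) I \<xi> = (-1) ^ n * Qop G (weight (dual f)) n (fam v) I \<xi>"
  unfolding Qop_def avg_cmult[symmetric]
 proof (rule avg_cong)
  fix x assume "x \<in> dperm G (fresh n I)"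
  then show "weight (dual (\<lambda>g. - f g)) (fresh n I) x * fam v (fresh n I \<union> I) (djoin (fresh n I) x \<xi>) =
    (-1) ^ n * (weight (dual f) (fresh n I) x * fam v (fresh n I \<union> I) (djoin (fresh n I) x \<xi>))"
   using wt_minus[of x "fresh n I" cycle_weight "dual f"] by (simp add: mult.assoc)
 qed
 then show "fam (HQ (\<lambda>g. - f g) n v) I \<xi> = fam (sg (int n) (HQ f n v)) I \<xi>"
  by (simp add: fam_sg fam_annih[OF f' v I \<xi>] fam_annih[OF f v I \<xi>])
qed

text \<open>Creation of k - n points and annihilation of k points acquire the signs (-1)^(k - n) and
  (-1)^k; their product (-1)^n does not depend on k.\<close>

lemma vop_minus:
 assumes f: "class_fun G f" and v: "v \<in> R_Gamma G"
 shows "vop (HP (\<lambda>g. - f g)) (HQ (\<lambda>g. - f g)) n v =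
  sg n (vop (HP f) (HQ f) n v)"
proof -
 interpret creation_annihilation "R_Gamma G" "HP f" "HQ f" by (rule creation_annihilation_H[OF f])
 let ?g = "\<lambda>g. - f g"
 have nz: "sg k w \<noteq> 0 \<longleftrightarrow> w \<noteq> 0" for k and w :: "'a wfam" by (simp add: sg_def)
 have step: "sg (int k) (HP ?g (nat (int k - n)) (HQ ?g k v)) =
   sg n (sg (int k) (HP f (nat (int k - n)) (HQ f k v)))" if k: "n \<le> int k" for k
 proof -
  have par: "even (int k + (int k - n) + int k) \<longleftrightarrow> even (n + int k)" by presburger
  have PS: "HP f m (sg j w) = sg j (HP f m w)" if "w \<in> R_Gamma G" for m j w
   by (rule P_sg[OF _ _ that])
  have "HP ?g (nat (int k - n)) (HQ ?g k v) =
    sg (int (nat (int k - n))) (sg (int k) (HP f (nat (int k - n)) (HQ f k v)))"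
   by (simp only: annih_minus[OF f v] create_minus[OF f sg_mem[OF Q_mem[OF v]]] PS[OF Q_mem[OF v]])
  moreover have "int (nat (int k - n)) = int k - n" using k by simp
  ultimately show ?thesis using par by (simp add: sg_def)
 qed
 have set: "{k. n \<le> int k \<and> HQ ?g k v \<noteq> 0} = {k. n \<le> int k \<and> HQ f k v \<noteq> 0}"
  by (simp only: annih_minus[OF f v] nz)
 show ?thesis unfolding vop_def sg_sum set
 proof (rule sum.cong[OF HOL.refl])
  fix k assume "k \<in> {k. n \<le> int k \<and> HQ f k v \<noteq> 0}"
  then have "n \<le> int k" by blast
  then show "sg (int k) (HP ?g (nat (int k - n)) (HQ ?g k v)) =
    sg n (sg (int k) (HP f (nat (int k - n)) (HQ f k v)))" by (rule step)
 qed
qed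

lemma vop_comb:
 assumes f: "class_fun G f" and F: "F \<in> R_Gamma G" and E: "E \<in> R_Gamma G"
 defines "V \<equiv> vop (HP f) (HQ f)"
 shows "V n (\<lambda>p x. a * F p x + b * E p x) = (\<lambda>p x. a * V n F p x + b * V n E p x)"
proof -
 interpret creation_annihilation "R_Gamma G" "HP f" "HQ f" by (rule creation_annihilation_H[OF f])
 obtain M N where MN: "\<forall>k>M. HQ f k F = 0" "\<forall>k>N. HQ f k E = 0" using Q_finite F E by blast
 let ?K = "max M N" and ?C = "\<lambda>p x. a * F p x + b * E p x"
 have Q: "HQ f k ?C = (\<lambda>p x. a * HQ f k F p x + b * HQ f k E p x)" for k
  by (rule annih_comb[OF f F E])
 have Pz: "Pz k (\<lambda>p x. a * u p x + b * v p x) = (\<lambda>p x. a * Pz k u p x + b * Pz k v p x)"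
  if "u \<in> R_Gamma G" "v \<in> R_Gamma G" for k u v
  using create_comb[OF f that] by (simp add: Pz_def zero_fam)
 have z: "HQ f k ?C = 0" "HQ f k F = 0" "HQ f k E = 0" if "k > ?K" for k
  unfolding Q using MN that by (simp_all add: zero_fam)
 have V: "V n ?C = (\<Sum>k\<le>?K. sg (int k) (Pz (int k - n) (HQ f k ?C)))"
  "V n F = (\<Sum>k\<le>?K. sg (int k) (Pz (int k - n) (HQ f k F)))"
  "V n E = (\<Sum>k\<le>?K. sg (int k) (Pz (int k - n) (HQ f k E)))"
  unfolding V_def by (rule vop_eq[OF R_Gamma_comb[OF F E] z(1)] vop_eq[OF F z(2)] vop_eq[OF E z(3)]; assumption)+
 show ?thesis
  unfolding V Q Pz[OF Q_mem[OF F] Q_mem[OF E]]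
  by (intro ext) (simp add: fam_sum_apply fam_sg_apply sum.distrib sum_distrib_left algebra_simps)
qed

lemma linear_operator_X:
 assumes f: "class_fun G f"
 shows "linear_operator G (X_plus G c r f n)"
proof -
 interpret creation_annihilation "R_Gamma G" "HP f" "HQ f" by (rule creation_annihilation_H[OF f])
 show ?thesis unfolding linear_operator_def X_plus_def X_coeff_vop
  by (intro conjI funcsetI ballI allI) (simp_all only: X_coeff_vop vop_mem vop_comb[OF f])
qed

end

lemma class_fun_irr:
 assumes "f \<in> irr_chars G" shows "class_fun G f"
 using assms rep_character_conj[OF is_group] by (auto simp: irr_chars_def irreducible_rep_def class_fun_def)

lemma inner_irr:
 assumes f: "f \<in> irr_chars G" and f': "f' \<in> irr_chars G"
 shows "inner (dual f) f' = (if f = f' then 1 else 0)"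
proof -
 obtain d \<pi> where \<pi>: "irreducible_rep G d \<pi>" "f = rep_character G d \<pi>" using f by (auto simp: irr_chars_def)
 obtain e \<rho> where \<rho>: "irreducible_rep G e \<rho>" "f' = rep_character G e \<rho>" using f' by (auto simp: irr_chars_def)
 have "card (carrier G) \<noteq> 0" using finite_carrier one_closed by auto
 then show ?thesis
  using character_norm[OF is_group finite_carrier \<rho>(1)]
   character_orthogonality_distinct[OF is_group finite_carrier \<rho>(1) \<pi>(1)] \<pi>(2) \<rho>(2)
  by (simp add: inner_def mult.commute)
qed

end

theorem theorem9p1:
 fixes G :: "('a, 'b) monoid_scheme"
  and c :: "nat \<Rightarrow> 'a set" and \<gamma> :: "nat \<Rightarrow> 'a \<Rightarrow> complex" and r :: nat
 assumes "group G" and "finite (carrier G)"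
  and "class_order G c r"
  and "bij_betw \<gamma> {0..r} (irr_chars G)"
  and "\<gamma> 0 = trivial_char G"
 defines "Xp \<equiv> \<lambda>i. X_plus G c r (\<gamma> i)"
  and "Xm \<equiv> \<lambda>i. X_minus G c r (\<gamma> i)"
 shows
  "(\<forall>n. \<forall>i\<le>r. linear_operator G (Xp i n) \<and> linear_operator G (Xm i n)) \<and>
  (\<forall>n n'. \<forall>i\<le>r. \<forall>j\<le>r. i \<noteq> j \<longrightarrow>
    is_scalar_on G (commutator (Xp i n) (Xp j n')) 0 \<and>
    is_scalar_on G (commutator (Xm i n) (Xm j n')) 0 \<and>
    is_scalar_on G (commutator (Xp i n) (Xm j n')) 0) \<and>
  (\<forall>n n'. \<forall>i\<le>r.
    is_scalar_on G (anticommutator (Xp i n) (Xp i n'))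
     (if n = - n' then 2 * (-1) powi n else 0) \<and>
    is_scalar_on G (anticommutator (Xm i n) (Xm i n'))
     (if n = - n' then 2 * (-1) powi n else 0) \<and>
    is_scalar_on G (anticommutator (Xp i n) (Xm i n'))
     (if n = - n' then 2 else 0))"
proof -
 interpret group G by fact
 interpret fin_group G by unfold_locales fact
 note co = assms(3)
 have irr: "\<gamma> i \<in> irr_chars G" if "i \<le> r" for i using bij_betwE[OF assms(4)] that by simp
 note cf = class_fun_irr[OF irr]
 have inj: "\<gamma> i \<noteq> \<gamma> j" if "i \<le> r" "j \<le> r" "i \<noteq> j" for i j
  using bij_betw_imp_inj_on[OF assms(4)] that by (auto dest: inj_onD)
 define V where "V i = vop (H_create G c r (\<gamma> i)) (H_annih G c r (\<gamma> i))" for i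
 have Xp: "Xp i n F = V i n F" for i n F
  by (simp add: Xp_def V_def X_plus_def X_coeff_vop[OF co])
 \<comment> \<open>So X^- is (-1)^n X^+, and all relations reduce to those for the single family
   V.\<close>
 have Xm: "Xm i n F = sg n (V i n F)" if "i \<le> r" "F \<in> R_Gamma G" for i n F
  by (simp add: Xm_def V_def X_minus_def X_coeff_vop[OF co] vop_minus[OF co cf[OF that(1)] that(2)])
 interpret S: subgroup_add "R_Gamma G" by (rule subgroup_add_R_Gamma)
 have mem: "V i n F \<in> R_Gamma G" if "i \<le> r" "F \<in> R_Gamma G" for i n F
  unfolding V_def by (rule creation_annihilation.vop_mem[OF creation_annihilation_H[OF co cf[OF that(1)]] that(2)])
 have Vadd: "V i n (u + v) = V i n u + V i n v" if "i \<le> r" "u \<in> R_Gamma G" "v \<in> R_Gamma G" for i n u v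
  unfolding V_def by (rule creation_annihilation.vop_add[OF creation_annihilation_H[OF co cf[OF that(1)]] that(2,3)])
 have Vsg: "V i n (sg k u) = sg k (V i n u)" if "i \<le> r" "u \<in> R_Gamma G" for i n k u
  by (rule S.additive_sg[of "V i n", OF Vadd[OF that(1)] that(2)])
 have lin: "linear_operator G (Xp i n) \<and> linear_operator G (Xm i n)" if "i \<le> r" for i n
  using linear_operator_X[OF co cf[OF that]] linear_operator_X[OF co, of "\<lambda>x. - \<gamma> i x"] cf[OF that]
  by (simp add: Xp_def Xm_def X_minus_def X_plus_def class_fun_def)
 have comm: "V i n (V j n' F) = V j n' (V i n F)" if "i \<le> r" "j \<le> r" "i \<noteq> j" "F \<in> R_Gamma G" for i j n n' F
  unfolding V_def using inj[OF that(1-3)] inj[OF that(2,1)] that(3)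
  by (intro vop_orthogonal[OF co] cf that(1,2,4)) (simp_all add: inner_irr irr that(1,2))
 have anti: "V i m (V i n F) + V i n (V i m F) = (if m = - n then sg m (F + F) else 0)"
  if "i \<le> r" "F \<in> R_Gamma G" for i m n F
  unfolding V_def
  by (rule clifford_pair.vop_anticommutator[OF clifford_pair_H[OF co cf[OF that(1)]] that(2)])
   (simp add: inner_irr irr that(1))
 have sgadd: "sg k u + sg k v = sg k (u + v)" for k and u v :: "'a wfam" by (simp add: sg_add)
 have "is_scalar_on G (commutator (Xp i n) (Xp j n')) 0 \<and> is_scalar_on G (commutator (Xm i n) (Xm j n')) 0 \<and>
   is_scalar_on G (commutator (Xp i n) (Xm j n')) 0" if ij: "i \<le> r" "j \<le> r" "i \<noteq> j" for i j n n'
  unfolding is_scalar_on_def commutator_def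
  by (intro conjI ballI; simp add: Xp Xm mem S.sg_mem Vsg ij comm[OF ij] sg_sg add.commute)
 moreover have "is_scalar_on G (anticommutator (Xp i n) (Xp i n')) (if n = - n' then 2 * (-1) powi n else 0) \<and>
   is_scalar_on G (anticommutator (Xm i n) (Xm i n')) (if n = - n' then 2 * (-1) powi n else 0) \<and>
   is_scalar_on G (anticommutator (Xp i n) (Xm i n')) (if n = - n' then 2 else 0)" if i: "i \<le> r" for i n n'
  unfolding is_scalar_on_def
 proof (intro conjI ballI)
  fix F assume F: "F \<in> R_Gamma G"
  have ac: "anticommutator A B F = A (B F) + B (A F)" for A B by (simp add: anticommutator_def fun_eq_iff)
  have pp: "anticommutator (Xp i n) (Xp i n') F = (if n = - n' then sg n (F + F) else 0)"
   unfolding ac Xp by (rule anti[OF i F])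
  \<comment> \<open>The sign (-1)^(n + n') is harmless, as the right-hand side is nonzero only for n
    + n' = 0.\<close>
  have "anticommutator (Xm i n) (Xm i n') F = sg (n + n') (V i n (V i n' F) + V i n' (V i n F))"
   unfolding ac sg_add using i F by (simp add: Xm mem S.sg_mem Vsg sg_sg add.commute)
  then have mm: "anticommutator (Xm i n) (Xm i n') F = (if n = - n' then sg n (F + F) else 0)"
   unfolding anti[OF i F] by (simp add: sg_def)
  \<comment> \<open>Only one sign (-1)^n' appears here; for n' = -n it cancels the factor (-1)^n of
    the anticommutator, which explains the plain 2.\<close>
  have "anticommutator (Xp i n) (Xm i n') F = sg n' (V i n (V i n' F) + V i n' (V i n F))"
   unfolding ac sg_add using i F by (simp add: Xp Xm mem S.sg_mem Vsg)
  then have pm: "anticommutator (Xp i n) (Xm i n') F = (if n = - n' then F + F else 0)"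
   unfolding anti[OF i F] by (simp add: sg_def)
  show "anticommutator (Xp i n) (Xp i n') F = (\<lambda>p x. (if n = - n' then 2 * (-1) powi n else 0) * F p x)"
   unfolding pp by (simp add: fun_eq_iff fam_sg_apply)
  show "anticommutator (Xm i n) (Xm i n') F = (\<lambda>p x. (if n = - n' then 2 * (-1) powi n else 0) * F p x)"
   unfolding mm by (simp add: fun_eq_iff fam_sg_apply)
  show "anticommutator (Xp i n) (Xm i n') F = (\<lambda>p x. (if n = - n' then 2 else 0) * F p x)"
   unfolding pm by (simp add: fun_eq_iff)
 qed
 ultimately show ?thesis using lin by blast
qed

end
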